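(* Let $W$ be one of the Weyl groups $W_{A_{n-1}}$, $W_{D_n}$ or $W_{B_n}$, let $\ddot{\mathfrak H}^{\mathfrak c}_W$ be its rational double affine Hecke-Clifford algebra and $\ddot{\mathfrak H}^-_W$ its rational spin double affine Hecke algebra (with the same parameters). Then: (1) there exists an isomorphism of superalgebras $\Phi:\ddot{\mathfrak H}^{\mathfrak c}_W\longrightarrow \mathcal C_n\otimes\ddot{\mathfrak H}^-_W$ which extends the isomorphism $\Phi:\mathcal C_n\rtimes\mathbb CW\to\mathcal C_n\otimes\mathbb CW^-$ and sends $$y_i\mapsto y_i,\quad x_i\mapsto \sqrt{-2}\,c_i\xi_i,\quad s_i\mapsto -\sqrt{-1}\,\beta_it_i,\quad c_i\mapsto c_i,\qquad\text{for all } i;$$ (2) the inverse $\Psi:\mathcal C_n\otimes\ddot{\mathfrak H}^-_W\longrightarrow \ddot{\mathfrak H}^{\mathfrak c}_W$ extends $\Psi:\mathcal C_n\otimes\mathbb CW^-\to\mathcal C_n\rtimes\mathbb CW$ and sends $$y_i\mapsto y_i,\quad \xi_i\mapsto \tfrac{1}{\sqrt{-2}}\,c_ix_i,\quad t_i\mapsto \sqrt{-1}\,\beta_is_i,\quad c_i\mapsto c_i,\qquad\text{for all } i.$$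
   Context: Ground field $\mathbb C$; a square root $\sqrt{-1}$ is fixed and $\sqrt{-2}=\sqrt2\sqrt{-1}$. $[a,b]=ab-ba$. Weyl groups. $W_{A_{n-1}}=S_n$ acts on $\mathbb C^n$ by permuting the standard basis $e_1,\dots,e_n$; $W_{B_n}$ ($n\ge 2$) is the group of all signed permutations of the $e_i$; $W_{D_n}$ ($n\ge 4$) is the subgroup with an even number of sign changes. For $i\ne j$: $s_{ij}$ swaps $e_i,e_j$; $\overline{s}_{ij}$ sends $e_i\mapsto -e_j$, $e_j\mapsto -e_i$; $\tau_i$ sends $e_i\mapsto -e_i$ (all other basis vectors fixed). Generators: $s_i=s_{i,i+1}$ ($1\le i\le n-1$), and additionally $s_n=\overline{s}_{n-1,n}$ in type $D_n$, $s_n=\tau_n$ in type $B_n$. Clifford algebra. $\mathcal C_n$ is generated by $c_1,\dots,c_n$ with $c_i^2=1$, $c_ic_j=-c_jc_i$ ($i\ne j$); $W$ acts by automorphisms, acting on the $c_i$ as on the $e_i$. Put $\beta_i=\frac1{\sqrt2}(c_i-c_{i+1})$ for $1\le i\le n-1$; $\beta_n=c_n$ in type $B_n$; $\beta_n=\frac1{\sqrt2}(c_{n-1}+c_n)$ in type $D_n$. The algebra $\ddot{\mathfrak H}^{\mathfrak c}_W$. Let $u\in\mathbb C$ (and $v\in\mathbb C$ in type $B_n$). Let $\mathfrak h^*=\bigoplus\mathbb Cx_i$, $\mathfrak h=\bigoplus\mathbb Cy_i$ with $W$ acting on the $x_i$ and $y_i$ as on the $e_i$. $\ddot{\mathfrak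 H}^{\mathfrak c}_W$ is generated by $x_i,y_i,c_i$ ($1\le i\le n$) and $W$, subject to the relations of $W$, of $\mathcal C_n$, and: $x_ix_j=x_jx_i$, $y_iy_j=y_jy_i$, $y_ic_j=c_jy_i$ (all $i,j$); $x_ic_i=-c_ix_i$, $x_ic_j=c_jx_i$ ($i\ne j$); $wxw^{-1}=w(x)$, $wyw^{-1}=w(y)$, $wcw^{-1}=w(c)$ ($w\in W$, $x\in\mathfrak h^*$, $y\in\mathfrak h$, $c\in\mathcal C_n$); and type $A_{n-1}$: $[y_j,x_i]=u(1+c_jc_i)s_{ji}$ ($i\neq j$), $[y_i,x_i]=-u\sum_{k\ne i}(1+c_kc_i)s_{ki}$; type $D_n$: $[y_j,x_i]=u((1+c_jc_i)s_{ij}-(1-c_jc_i)\overline{s}_{ij})$ ($i\ne j$), $[y_i,x_i]=-u\sum_{k\ne i}((1+c_kc_i)s_{ki}+(1-c_kc_i)\overline{s}_{ki})$; type $B_n$: $[y_j,x_i]$ ($i\neq j$) as displayed for type $D_n$, and $[y_i,x_i]=-u\sum_{k\ne i}((1+c_kc_i)s_{ki}+(1-c_kc_i)\overline{s}_{ki})-\sqrt2\,v\tau_i$. It is a superalgebra with $x_i,y_i$ and $W$ even, $c_i$ odd. Spin Weyl group algebra $\mathbb CW^-$. Type $A_{n-1}$: generated by $t_1,\dots,t_{n-1}$ with $t_i^2=1$, $t_it_{i+1}t_i=t_{i+1}t_it_{i+1}$, $(t_it_j)^2=-1$ if $|i-j|>1$. Type $B_n$: add $t_n$ with $t_n^2=1$,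 $(t_it_n)^2=-1$ for $i\ne n-1,n$, $(t_{n-1}t_n)^4=-1$. Type $D_n$: add $t_n$ with $t_n^2=1$, $(t_it_n)^2=-1$ for $i\neq n-2,n$, $t_{n-2}t_nt_{n-2}=t_nt_{n-2}t_n$. All $t_i$ are odd. Put $t_{i\uparrow j}=t_it_{i+1}\cdots t_j$ if $i\le j$ and $1$ otherwise; $t_{i\downarrow j}=t_it_{i-1}\cdots t_j$ if $i\ge j$ and $1$ otherwise. For $1\le i<j\le n$ put $[i,j]=(-1)^{j-i-1}t_{j-1}\cdots t_{i+1}t_it_{i+1}\cdots t_{j-1}$, $[j,i]=-[i,j]$; $\overline{[i,j]}=\overline{[j,i]}=(-1)^{j-i-1}t_{j\uparrow n-1}t_{i\uparrow n-2}\,t_n\,t_{n-2\downarrow i}t_{n-1\downarrow j}$ in type $D_n$, and $=(-1)^{j-i}t_{j\uparrow n-1}t_{i\uparrow n-2}\,t_nt_{n-1}t_n\,t_{n-2\downarrow i}t_{n-1\downarrow j}$ in type $B_n$; $\overline{[i]}=(-1)^{n-i}t_i\cdots t_{n-1}t_nt_{n-1}\cdots t_i$ ($1\le i\le n$) in type $B_n$. The algebra $\ddot{\mathfrak H}^-_W$. Generated by $\xi_i,y_i$ ($1\le i\le n$) and $\mathbb CW^-$, subject to: $y_iy_j=y_jy_i$; $\xi_i\xi_j=-\xi_j\xi_i$ ($i\ne j$); for $1\le i\le n-1$: $t_iy_i=y_{i+1}t_i$, $t_i\xi_i=-\xi_{i+1}t_i$, and $t_iy_j=y_jt_i$, $t_i\xi_j=-\xi_jt_i$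 for $j\ne i,i+1$; and type $A_{n-1}$: $[y_j,\xi_i]=-u[i,j]$ ($i\ne j$), $[y_i,\xi_i]=u\sum_{k\ne i}[i,k]$; type $D_n$: $t_ny_n=-y_{n-1}t_n$, $t_n\xi_n=-\xi_{n-1}t_n$, $t_ny_j=y_jt_n$ and $t_n\xi_j=-\xi_jt_n$ ($j\ne n-1,n$), $[y_j,\xi_i]=-u[i,j]+u\overline{[i,j]}$ ($i\ne j$), $[y_i,\xi_i]=u\sum_{k\ne i}([i,k]+\overline{[i,k]})$; type $B_n$: $t_ny_n=-y_nt_n$, $t_n\xi_n=-\xi_nt_n$, $t_ny_j=y_jt_n$ and $t_n\xi_j=-\xi_jt_n$ ($j\ne n$), $[y_j,\xi_i]=-u[i,j]+u\overline{[i,j]}$ ($i\ne j$), $[y_i,\xi_i]=u\sum_{k\ne i}([i,k]+\overline{[i,k]})+v\overline{[i]}$. (On the left-hand sides $[y_j,\xi_i]$ is a commutator; $[i,j]$ with integer entries is the element of $\mathbb CW^-$ above.) It is a superalgebra with $y_i$ even and $\xi_i,t_i$ odd. Tensor products of superalgebras have multiplication $(a\otimes b)(a'\otimes b')=(-1)^{|b||a'|}aa'\otimes bb'$; one writes $ab$ for $a\otimes b$. It is known that there is a superalgebra isomorphism $\Phi:\mathcal C_n\rtimes\mathbb CW\to\mathcal C_n\otimes\mathbb CW^-$ which is the identity on $\mathcal C_n$ and sends $s_i\mapsto-\sqrt{-1}\beta_it_i$; its inverse $\Psi$ is the identity on $\mathcal C_n$ and sends $t_i\mapsto\sqrt{-1}\beta_is_i$.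 *)

theory Defs
  imports
    Complex_Main
    "HOL-Library.Poly_Mapping"
    "HOL-Combinatorics.Permutations"
    "HOL-Algebra.QuotRing"
    "HOL-Algebra.Module"
    "HOL-Algebra.Algebraic_Closure_Type"
begin

section \<open>Complex superalgebras\<close>

abbreviation complex_ring :: "complex ring" where
  "complex_ring \<equiv> ring_of_type_algebra"

text \<open>The homogeneous parts are indexed by the parity: \<^term>\<open>False\<close> is even, \<^term>\<open>True\<close> is odd.\<close>

record 'a salg = "(complex, 'a) module" +
  part :: "bool \<Rightarrow> 'a set"

definition superalgebra :: "('a, 'm) salg_scheme \<Rightarrow> bool" where
  "superalgebra A \<longleftrightarrow>
     ring A \<and> module complex_ring A \<and>
     (\<forall>z. \<forall>a\<in>carrier A. \<forall>b\<in>carrier A.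
        (z \<odot>\<^bsub>A\<^esub> a) \<otimes>\<^bsub>A\<^esub> b = z \<odot>\<^bsub>A\<^esub> (a \<otimes>\<^bsub>A\<^esub> b) \<and>
        a \<otimes>\<^bsub>A\<^esub> (z \<odot>\<^bsub>A\<^esub> b) = z \<odot>\<^bsub>A\<^esub> (a \<otimes>\<^bsub>A\<^esub> b)) \<and>
     (\<forall>i. submodule (part A i) complex_ring A) \<and>
     (\<forall>a\<in>carrier A. \<exists>!b. b \<in> part A False \<and> a \<ominus>\<^bsub>A\<^esub> b \<in> part A True) \<and>
     (\<forall>i j. \<forall>a\<in>part A i. \<forall>b\<in>part A j. a \<otimes>\<^bsub>A\<^esub> b \<in> part A (i \<noteq> j))"

definition superalgebra_iso ::
    "('a, 'm) salg_scheme \<Rightarrow> ('b, 'k) salg_scheme \<Rightarrow> ('a \<Rightarrow> 'b) \<Rightarrow> bool" where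
  "superalgebra_iso A B f \<longleftrightarrow>
     superalgebra A \<and> superalgebra B \<and> f \<in> ring_iso A B \<and>
     (\<forall>z. \<forall>a\<in>carrier A. f (z \<odot>\<^bsub>A\<^esub> a) = z \<odot>\<^bsub>B\<^esub> f a) \<and>
     (\<forall>i. f ` part A i \<subseteq> part B i)"

definition inverse_maps ::
    "('a, 'm) salg_scheme \<Rightarrow> ('b, 'k) salg_scheme \<Rightarrow> ('a \<Rightarrow> 'b) \<Rightarrow> ('b \<Rightarrow> 'a) \<Rightarrow> bool" where
  "inverse_maps A B f g \<longleftrightarrow>
     (\<forall>a\<in>carrier A. g (f a) = a) \<and> (\<forall>b\<in>carrier B. f (g b) = b)"

text \<open>
  Quotient of a superalgebra (or of a not yet associative precursor of one, see the tensor
  product below): \<^const>\<open>FactRing\<close> together with the induced scalar action and grading.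
\<close>

definition salg_quot :: "('a, 'm) salg_scheme \<Rightarrow> 'a set \<Rightarrow> 'a set salg" where
  "salg_quot A I =
     \<lparr>carrier = carrier (A Quot I), monoid.mult = monoid.mult (A Quot I),
      monoid.one = monoid.one (A Quot I),
      ring.zero = ring.zero (A Quot I), ring.add = ring.add (A Quot I),
      module.smult = (\<lambda>z K. \<Union>a\<in>K. I +>\<^bsub>A\<^esub> (z \<odot>\<^bsub>A\<^esub> a)),
      part = (\<lambda>i. (\<lambda>a. I +>\<^bsub>A\<^esub> a) ` part A i)\<rparr>"


section \<open>Free superalgebras and presentations\<close>

text \<open>Words form the free monoid, so \<open>'g list \<Rightarrow>\<^sub>0 complex\<close> is the free algebra.\<close>

instantiation list :: (type) monoid_add
begin
definition zero_list :: "'a list" where "zero_list = []"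
definition plus_list :: "'a list \<Rightarrow> 'a list \<Rightarrow> 'a list" where "plus_list = (@)"
instance by standard (simp_all add: zero_list_def plus_list_def)
end

type_synonym 'g free = "'g list \<Rightarrow>\<^sub>0 complex"

definition gen :: "'g \<Rightarrow> 'g free" where
  "gen g = Poly_Mapping.single [g] 1"

definition cst :: "complex \<Rightarrow> 'g free" where
  "cst z = Poly_Mapping.single [] z"

definition scale :: "complex \<Rightarrow> ('k \<Rightarrow>\<^sub>0 complex) \<Rightarrow> ('k \<Rightarrow>\<^sub>0 complex)" where
  "scale z p = Poly_Mapping.map ((*) z) p"

definition free_carrier :: "'g set \<Rightarrow> 'g free set" where
  "free_carrier G = {p. \<forall>w\<in>Poly_Mapping.keys p. set w \<subseteq> G}"

definition free_superalgebra :: "('g \<Rightarrow> bool) \<Rightarrow> 'g set \<Rightarrow> 'g free salg" where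
  "free_superalgebra is_odd G =
     \<lparr>carrier = free_carrier G, monoid.mult = (*), one = 1, zero = 0, add = (+), module.smult = scale,
      part = (\<lambda>i. {p \<in> free_carrier G.
                \<forall>w\<in>Poly_Mapping.keys p. odd (length (filter is_odd w)) = i})\<rparr>"


section \<open>Tensor product of superalgebras\<close>

definition hcomp :: "('a, 'm) salg_scheme \<Rightarrow> bool \<Rightarrow> 'a \<Rightarrow> 'a" where
  "hcomp A i a = (THE b. b \<in> part A i \<and> a \<ominus>\<^bsub>A\<^esub> b \<in> part A (\<not> i))"

text \<open>
  The free vector space on \<open>A \<times> B\<close>, with the multiplication rule
  \<open>(a \<otimes> b) (a' \<otimes> b') = (-1) ^ (|b| |a'|) aa' \<otimes> bb'\<close>
  applied to the homogeneous components of \<open>b\<close> and \<open>a'\<close> and extended bilinearly.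
  This multiplication is an associative one only modulo the bilinearity relations.
\<close>

definition pre_tensor ::
    "('a, 'm) salg_scheme \<Rightarrow> ('b, 'k) salg_scheme \<Rightarrow> ('a \<times> 'b \<Rightarrow>\<^sub>0 complex) salg" where
  "pre_tensor A B =
     \<lparr>carrier = {p. Poly_Mapping.keys p \<subseteq> carrier A \<times> carrier B},
      monoid.mult = (\<lambda>p q.
        \<Sum>(a, b)\<in>Poly_Mapping.keys p. \<Sum>(a', b')\<in>Poly_Mapping.keys q. \<Sum>i\<in>UNIV. \<Sum>j\<in>UNIV.
          Poly_Mapping.single (a \<otimes>\<^bsub>A\<^esub> hcomp A j a', hcomp B i b \<otimes>\<^bsub>B\<^esub> b')
            ((if i \<and> j then -1 else 1) * Poly_Mapping.lookup p (a, b) * Poly_Mapping.lookup q (a', b'))),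
      one = Poly_Mapping.single (\<one>\<^bsub>A\<^esub>, \<one>\<^bsub>B\<^esub>) 1,
      zero = 0,
      add = (+),
      module.smult = scale,
      part = (\<lambda>k. {p. \<forall>(a, b)\<in>Poly_Mapping.keys p.
                      \<exists>i j. a \<in> part A i \<and> b \<in> part B j \<and> k = (i \<noteq> j)})\<rparr>"

definition bilinear_span ::
    "('a, 'm) salg_scheme \<Rightarrow> ('b, 'k) salg_scheme \<Rightarrow> ('a \<times> 'b \<Rightarrow>\<^sub>0 complex) set" where
  "bilinear_span A B = module.span scale
     (let \<delta> = (\<lambda>a b. Poly_Mapping.single (a, b) (1 :: complex)) in
       {\<delta> (a \<oplus>\<^bsub>A\<^esub> a') b - \<delta> a b - \<delta> a' b | a a' b.
          a \<in> carrier A \<and> a' \<in> carrier A \<and> b \<in> carrier B} \<union>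
       {\<delta> a (b \<oplus>\<^bsub>B\<^esub> b') - \<delta> a b - \<delta> a b' | a b b'.
          a \<in> carrier A \<and> b \<in> carrier B \<and> b' \<in> carrier B} \<union>
       {\<delta> (z \<odot>\<^bsub>A\<^esub> a) b - scale z (\<delta> a b) | z a b. a \<in> carrier A \<and> b \<in> carrier B} \<union>
       {\<delta> a (z \<odot>\<^bsub>B\<^esub> b) - scale z (\<delta> a b) | z a b. a \<in> carrier A \<and> b \<in> carrier B})"

definition tensor ::
    "('a, 'm) salg_scheme \<Rightarrow> ('b, 'k) salg_scheme \<Rightarrow> ('a \<times> 'b \<Rightarrow>\<^sub>0 complex) set salg" where
  "tensor A B = salg_quot (pre_tensor A B) (bilinear_span A B)"

definition pure_tensor ::
    "('a, 'm) salg_scheme \<Rightarrow> ('b, 'k) salg_scheme \<Rightarrow> 'a \<Rightarrow> 'b \<Rightarrow> ('a \<times> 'b \<Rightarrow>\<^sub>0 complex) set" where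
  "pure_tensor A B a b = bilinear_span A B +>\<^bsub>pre_tensor A B\<^esub> Poly_Mapping.single (a, b) 1"

text \<open>The map \<open>id \<otimes> f : A \<otimes> B \<rightarrow> A \<otimes> B'\<close> induced by a linear map \<open>f : B \<rightarrow> B'\<close>.\<close>

definition id_tensor ::
    "('a, 'm) salg_scheme \<Rightarrow> ('b, 'k) salg_scheme \<Rightarrow> ('b \<Rightarrow> 'b) \<Rightarrow>
     ('a \<times> 'b \<Rightarrow>\<^sub>0 complex) set \<Rightarrow> ('a \<times> 'b \<Rightarrow>\<^sub>0 complex) set" where
  "id_tensor A B' f K =
     (\<Union>p\<in>K. bilinear_span A B' +>\<^bsub>pre_tensor A B'\<^esub>
        (\<Sum>(a, b)\<in>Poly_Mapping.keys p.
           Poly_Mapping.single (a, f b) (Poly_Mapping.lookup p (a, b))))"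


section \<open>Weyl groups of types A, B and D\<close>

datatype weyl_type = TypeA | TypeB | TypeD

text \<open>
  The groups are \<open>W_{A_{n-1}}\<close>, \<open>W_{B_n}\<close> and \<open>W_{D_n}\<close>; in all three cases \<open>n\<close> is the dimension
  of the space on which the group acts.
\<close>

fun admissible :: "weyl_type \<Rightarrow> nat \<Rightarrow> bool" where
  "admissible TypeA n \<longleftrightarrow> n \<ge> 1"
| "admissible TypeB n \<longleftrightarrow> n \<ge> 2"
| "admissible TypeD n \<longleftrightarrow> n \<ge> 4"

text \<open>
  A signed permutation is an odd bijection \<open>w\<close> of \<open>{-n..n}\<close>, standing for the linear map
  sending \<open>e_i\<close> to \<open>e_{w(i)}\<close>, where \<open>e_{-k} = - e_k\<close>. Composition of functions is composition of
  linear maps.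
\<close>

definition signed_perms :: "nat \<Rightarrow> (int \<Rightarrow> int) set" where
  "signed_perms n = {w. w permutes {- int n..int n} \<and> (\<forall>k. w (- k) = - w k)}"

definition weyl :: "weyl_type \<Rightarrow> nat \<Rightarrow> (int \<Rightarrow> int) set" where
  "weyl ty n = (case ty of
     TypeA \<Rightarrow> {w \<in> signed_perms n. \<forall>i\<in>{1..int n}. w i > 0}
   | TypeB \<Rightarrow> signed_perms n
   | TypeD \<Rightarrow> {w \<in> signed_perms n. even (card {i \<in> {1..int n}. w i < 0})})"

definition s_ref :: "nat \<Rightarrow> nat \<Rightarrow> int \<Rightarrow> int" where
  "s_ref i j = transpose (int i) (int j) \<circ> transpose (- int i) (- int j)"

definition sbar_ref :: "nat \<Rightarrow> nat \<Rightarrow> int \<Rightarrow> int" where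
  "sbar_ref i j = transpose (int i) (- int j) \<circ> transpose (int j) (- int i)"

definition tau_ref :: "nat \<Rightarrow> int \<Rightarrow> int" where
  "tau_ref i = transpose (int i) (- int i)"

definition simple_index :: "weyl_type \<Rightarrow> nat \<Rightarrow> nat set" where
  "simple_index ty n = (case ty of TypeA \<Rightarrow> {1..<n} | _ \<Rightarrow> {1..n})"

definition simple_ref :: "weyl_type \<Rightarrow> nat \<Rightarrow> nat \<Rightarrow> int \<Rightarrow> int" where
  "simple_ref ty n i =
     (if i < n then s_ref i (i + 1)
      else case ty of TypeB \<Rightarrow> tau_ref n | _ \<Rightarrow> sbar_ref (n - 1) n)"


section \<open>The algebras\<close>

text \<open>One type of generators serves all algebras; each presentation selects those it uses.\<close>

datatype gens = Gx nat | Gy nat | Gc nat | Gw "int \<Rightarrow> int" | Gxi nat | Gt nat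

fun odd_gen :: "gens \<Rightarrow> bool" where
  "odd_gen (Gc i) = True"
| "odd_gen (Gxi i) = True"
| "odd_gen (Gt i) = True"
| "odd_gen _ = False"

abbreviation "gx i \<equiv> gen (Gx i)"
abbreviation "gy i \<equiv> gen (Gy i)"
abbreviation "gc i \<equiv> gen (Gc i)"
abbreviation "gw w \<equiv> gen (Gw w)"
abbreviation "gxi i \<equiv> gen (Gxi i)"
abbreviation "gt i \<equiv> gen (Gt i)"

text \<open>Generators and relators; a relation \<open>p = q\<close> is encoded by the relator \<open>p - q\<close>.\<close>

type_synonym pres = "gens set \<times> gens free set"

definition rel_ideal :: "pres \<Rightarrow> gens free set" where
  "rel_ideal P = genideal (free_superalgebra odd_gen (fst P)) (snd P)"

definition alg :: "pres \<Rightarrow> gens free set salg" where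
  "alg P = salg_quot (free_superalgebra odd_gen (fst P)) (rel_ideal P)"

definition cls :: "pres \<Rightarrow> gens free \<Rightarrow> gens free set" where
  "cls P p = rel_ideal P +>\<^bsub>free_superalgebra odd_gen (fst P)\<^esub> p"

text \<open>
  The canonical homomorphism into \<open>alg Q\<close> from an algebra given by some of the generators and
  some of the relations of \<open>Q\<close>.
\<close>

definition canon :: "pres \<Rightarrow> gens free set \<Rightarrow> gens free set" where
  "canon Q K = (\<Union>p\<in>K. cls Q p)"

definition commutator :: "'a::ring \<Rightarrow> 'a \<Rightarrow> 'a" where
  "commutator a b = a * b - b * a"

text \<open>\<open>signed f k\<close> is the extension of \<open>f\<close> to negative indices by \<open>f (- k) = - f k\<close>.\<close>

definition signed :: "(nat \<Rightarrow> gens free) \<Rightarrow> int \<Rightarrow> gens free" where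
  "signed f k = (if k > 0 then f (nat k) else - f (nat (- k)))"


subsection \<open>Clifford algebra and its semidirect product with the Weyl group\<close>

definition clifford_rels :: "nat \<Rightarrow> gens free set" where
  "clifford_rels n =
     {gc i * gc i - 1 | i. i \<in> {1..n}} \<union>
     {gc i * gc j + gc j * gc i | i j. i \<in> {1..n} \<and> j \<in> {1..n} \<and> i \<noteq> j}"

definition clifford :: "nat \<Rightarrow> pres" where
  "clifford n = (Gc ` {1..n}, clifford_rels n)"

definition beta :: "weyl_type \<Rightarrow> nat \<Rightarrow> nat \<Rightarrow> gens free" where
  "beta ty n i =
     (if i < n then cst (1 / complex_of_real (sqrt 2)) * (gc i - gc (i + 1))
      else case ty of
        TypeB \<Rightarrow> gc n
      | _ \<Rightarrow> cst (1 / complex_of_real (sqrt 2)) * (gc (n - 1) + gc n))"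

definition weyl_rels :: "weyl_type \<Rightarrow> nat \<Rightarrow> gens free set" where
  "weyl_rels ty n =
     {gw id - 1} \<union> {gw w * gw w' - gw (w \<circ> w') | w w'. w \<in> weyl ty n \<and> w' \<in> weyl ty n}"

text \<open>The relations \<open>w f_i w\<inverse> = w(f_i)\<close>; plain \<open>inv\<close> is the inverse in a group of HOL-Algebra here.\<close>

definition conj_rels :: "weyl_type \<Rightarrow> nat \<Rightarrow> (nat \<Rightarrow> gens free) \<Rightarrow> gens free set" where
  "conj_rels ty n f =
     {gw w * f i * gw (inv_into UNIV w) - signed f (w (int i)) | w i. w \<in> weyl ty n \<and> i \<in> {1..n}}"

definition clifford_weyl :: "weyl_type \<Rightarrow> nat \<Rightarrow> pres" where
  "clifford_weyl ty n =
     (Gc ` {1..n} \<union> Gw ` weyl ty n,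
      clifford_rels n \<union> weyl_rels ty n \<union> conj_rels ty n gc)"


subsection \<open>Rational double affine Hecke-Clifford algebra\<close>

definition hc_offdiag :: "weyl_type \<Rightarrow> complex \<Rightarrow> nat \<Rightarrow> nat \<Rightarrow> gens free" where
  "hc_offdiag ty u j i = (case ty of
     TypeA \<Rightarrow> cst u * ((1 + gc j * gc i) * gw (s_ref j i))
   | _ \<Rightarrow> cst u * ((1 + gc j * gc i) * gw (s_ref i j) - (1 - gc j * gc i) * gw (sbar_ref i j)))"

definition hc_diag :: "weyl_type \<Rightarrow> nat \<Rightarrow> complex \<Rightarrow> complex \<Rightarrow> nat \<Rightarrow> gens free" where
  "hc_diag ty n u v i = (case ty of
     TypeA \<Rightarrow>
       - cst u * (\<Sum>k\<in>{1..n} - {i}. (1 + gc k * gc i) * gw (s_ref k i))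
   | TypeD \<Rightarrow>
       - cst u * (\<Sum>k\<in>{1..n} - {i}. (1 + gc k * gc i) * gw (s_ref k i)
                                    + (1 - gc k * gc i) * gw (sbar_ref k i))
   | TypeB \<Rightarrow>
       - cst u * (\<Sum>k\<in>{1..n} - {i}. (1 + gc k * gc i) * gw (s_ref k i)
                                    + (1 - gc k * gc i) * gw (sbar_ref k i))
       - cst (complex_of_real (sqrt 2) * v) * gw (tau_ref i))"

definition hecke_clifford :: "weyl_type \<Rightarrow> nat \<Rightarrow> complex \<Rightarrow> complex \<Rightarrow> pres" where
  "hecke_clifford ty n u v =
     (Gx ` {1..n} \<union> Gy ` {1..n} \<union> Gc ` {1..n} \<union> Gw ` weyl ty n,
      clifford_rels n \<union> weyl_rels ty n \<union>
      conj_rels ty n gx \<union> conj_rels ty n gy \<union> conj_rels ty n gc \<union>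
      {gx i * gx j - gx j * gx i | i j. i \<in> {1..n} \<and> j \<in> {1..n}} \<union>
      {gy i * gy j - gy j * gy i | i j. i \<in> {1..n} \<and> j \<in> {1..n}} \<union>
      {gy i * gc j - gc j * gy i | i j. i \<in> {1..n} \<and> j \<in> {1..n}} \<union>
      {gx i * gc i + gc i * gx i | i. i \<in> {1..n}} \<union>
      {gx i * gc j - gc j * gx i | i j. i \<in> {1..n} \<and> j \<in> {1..n} \<and> i \<noteq> j} \<union>
      {commutator (gy j) (gx i) - hc_offdiag ty u j i | i j. i \<in> {1..n} \<and> j \<in> {1..n} \<and> i \<noteq> j} \<union>
      {commutator (gy i) (gx i) - hc_diag ty n u v i | i. i \<in> {1..n}})"


subsection \<open>Spin Weyl group algebra\<close>

definition spin_rels :: "weyl_type \<Rightarrow> nat \<Rightarrow> gens free set" where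
  "spin_rels ty n =
     {gt i * gt i - 1 | i. i \<in> simple_index ty n} \<union>
     {gt i * gt (i + 1) * gt i - gt (i + 1) * gt i * gt (i + 1) | i. 1 \<le> i \<and> i + 1 < n} \<union>
     {(gt i * gt j) ^ 2 + 1 | i j.
        i \<in> {1..<n} \<and> j \<in> {1..<n} \<and> \<bar>int i - int j\<bar> > 1} \<union>
     (case ty of
        TypeA \<Rightarrow> {}
      | TypeB \<Rightarrow>
          {(gt i * gt n) ^ 2 + 1 | i. i \<in> {1..n} - {n - 1, n}} \<union>
          {(gt (n - 1) * gt n) ^ 4 + 1}
      | TypeD \<Rightarrow>
          {(gt i * gt n) ^ 2 + 1 | i. i \<in> {1..n} - {n - 2, n}} \<union>
          {gt (n - 2) * gt n * gt (n - 2) - gt n * gt (n - 2) * gt n})"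

definition spin_weyl :: "weyl_type \<Rightarrow> nat \<Rightarrow> pres" where
  "spin_weyl ty n = (Gt ` simple_index ty n, spin_rels ty n)"

text \<open>\<open>t_i t_{i+1} \<cdots> t_j\<close> and \<open>t_i t_{i-1} \<cdots> t_j\<close>, both being \<open>1\<close> for an empty range.\<close>

definition t_up :: "nat \<Rightarrow> nat \<Rightarrow> gens free" where
  "t_up i j = prod_list (map gt [i..<Suc j])"

definition t_down :: "nat \<Rightarrow> nat \<Rightarrow> gens free" where
  "t_down i j = prod_list (map gt (rev [j..<Suc i]))"

definition bracket_lt :: "nat \<Rightarrow> nat \<Rightarrow> gens free" where
  "bracket_lt i j = (-1) ^ (j - i - 1) * t_down (j - 1) (i + 1) * gt i * t_up (i + 1) (j - 1)"

definition bracket :: "nat \<Rightarrow> nat \<Rightarrow> gens free" where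
  "bracket i j = (if i < j then bracket_lt i j else - bracket_lt j i)"

definition bar_bracket_lt :: "weyl_type \<Rightarrow> nat \<Rightarrow> nat \<Rightarrow> nat \<Rightarrow> gens free" where
  "bar_bracket_lt ty n i j = (case ty of
     TypeB \<Rightarrow> (-1) ^ (j - i) * t_up j (n - 1) * t_up i (n - 2) * (gt n * gt (n - 1) * gt n)
                * t_down (n - 2) i * t_down (n - 1) j
   | _ \<Rightarrow> (-1) ^ (j - i - 1) * t_up j (n - 1) * t_up i (n - 2) * gt n
                * t_down (n - 2) i * t_down (n - 1) j)"

definition bar_bracket :: "weyl_type \<Rightarrow> nat \<Rightarrow> nat \<Rightarrow> nat \<Rightarrow> gens free" where
  "bar_bracket ty n i j = bar_bracket_lt ty n (min i j) (max i j)"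

definition bar_single :: "nat \<Rightarrow> nat \<Rightarrow> gens free" where
  "bar_single n i = (-1) ^ (n - i) * t_up i (n - 1) * gt n * t_down (n - 1) i"


subsection \<open>Rational spin double affine Hecke algebra\<close>

definition hm_offdiag :: "weyl_type \<Rightarrow> nat \<Rightarrow> complex \<Rightarrow> nat \<Rightarrow> nat \<Rightarrow> gens free" where
  "hm_offdiag ty n u i j = (case ty of
     TypeA \<Rightarrow> - cst u * bracket i j
   | _ \<Rightarrow> - cst u * bracket i j + cst u * bar_bracket ty n i j)"

definition hm_diag :: "weyl_type \<Rightarrow> nat \<Rightarrow> complex \<Rightarrow> complex \<Rightarrow> nat \<Rightarrow> gens free" where
  "hm_diag ty n u v i = (case ty of
     TypeA \<Rightarrow> cst u * (\<Sum>k\<in>{1..n} - {i}. bracket i k)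
   | TypeD \<Rightarrow> cst u * (\<Sum>k\<in>{1..n} - {i}. bracket i k + bar_bracket ty n i k)
   | TypeB \<Rightarrow> cst u * (\<Sum>k\<in>{1..n} - {i}. bracket i k + bar_bracket ty n i k)
               + cst v * bar_single n i)"

definition spin_hecke :: "weyl_type \<Rightarrow> nat \<Rightarrow> complex \<Rightarrow> complex \<Rightarrow> pres" where
  "spin_hecke ty n u v =
     (Gxi ` {1..n} \<union> Gy ` {1..n} \<union> Gt ` simple_index ty n,
      spin_rels ty n \<union>
      {gy i * gy j - gy j * gy i | i j. i \<in> {1..n} \<and> j \<in> {1..n}} \<union>
      {gxi i * gxi j + gxi j * gxi i | i j. i \<in> {1..n} \<and> j \<in> {1..n} \<and> i \<noteq> j} \<union>
      {gt i * gy i - gy (i + 1) * gt i | i. i \<in> {1..<n}} \<union>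
      {gt i * gxi i + gxi (i + 1) * gt i | i. i \<in> {1..<n}} \<union>
      {gt i * gy j - gy j * gt i | i j. i \<in> {1..<n} \<and> j \<in> {1..n} - {i, i + 1}} \<union>
      {gt i * gxi j + gxi j * gt i | i j. i \<in> {1..<n} \<and> j \<in> {1..n} - {i, i + 1}} \<union>
      (case ty of
         TypeA \<Rightarrow> {}
       | TypeB \<Rightarrow>
           {gt n * gy n + gy n * gt n, gt n * gxi n + gxi n * gt n} \<union>
           {gt n * gy j - gy j * gt n | j. j \<in> {1..n} - {n}} \<union>
           {gt n * gxi j + gxi j * gt n | j. j \<in> {1..n} - {n}}
       | TypeD \<Rightarrow>
           {gt n * gy n + gy (n - 1) * gt n, gt n * gxi n + gxi (n - 1) * gt n} \<union>
           {gt n * gy j - gy j * gt n | j. j \<in> {1..n} - {n - 1, n}} \<union>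
           {gt n * gxi j + gxi j * gt n | j. j \<in> {1..n} - {n - 1, n}}) \<union>
      {commutator (gy j) (gxi i) - hm_offdiag ty n u i j | i j.
         i \<in> {1..n} \<and> j \<in> {1..n} \<and> i \<noteq> j} \<union>
      {commutator (gy i) (gxi i) - hm_diag ty n u v i | i. i \<in> {1..n}})"


subsection \<open>Tensoring with the Clifford algebra\<close>

text \<open>
  For a presentation \<open>P\<close>: the superalgebra \<open>C_n \<otimes> alg P\<close>, the element \<open>a \<otimes> b\<close> of it given by
  representatives \<open>a\<close>, \<open>b\<close>, and \<open>id \<otimes> canon\<close> for the canonical map into \<open>alg Q\<close>.
\<close>

abbreviation Cn_tensor where
  "Cn_tensor n P \<equiv> tensor (alg (clifford n)) (alg P)"

abbreviation Cn_elt where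
  "Cn_elt n P a b \<equiv> pure_tensor (alg (clifford n)) (alg P) (cls (clifford n) a) (cls P b)"

abbreviation Cn_canon where
  "Cn_canon n Q \<equiv> id_tensor (alg (clifford n)) (alg Q) (canon Q)"

text \<open>
  The mutually inverse isomorphisms between \<open>C_n \<rtimes> \<complex>W\<close> and \<open>C_n \<otimes> \<complex>W\<^sup>-\<close>;
  \<open>\<iota>\<close> is the chosen square root of \<open>-1\<close>.
\<close>

definition finite_isos where
  "finite_isos ty n \<iota> \<Phi> \<Psi> \<longleftrightarrow>
     (let H = clifford_weyl ty n; S = spin_weyl ty n; T = Cn_tensor n S in
       superalgebra_iso (alg H) T \<Phi> \<and> superalgebra_iso T (alg H) \<Psi> \<and>
       inverse_maps (alg H) T \<Phi> \<Psi> \<and>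
       (\<forall>a\<in>carrier (alg (clifford n)).
          \<Phi> (canon H a) = pure_tensor (alg (clifford n)) (alg S) a \<one>\<^bsub>alg S\<^esub> \<and>
          \<Psi> (pure_tensor (alg (clifford n)) (alg S) a \<one>\<^bsub>alg S\<^esub>) = canon H a) \<and>
       (\<forall>i\<in>simple_index ty n.
          \<Phi> (cls H (gw (simple_ref ty n i))) = (- \<iota>) \<odot>\<^bsub>T\<^esub> Cn_elt n S (beta ty n i) (gt i) \<and>
          \<Psi> (Cn_elt n S 1 (gt i)) = cls H (cst \<iota> * beta ty n i * gw (simple_ref ty n i))))"

end

(*
  The isomorphism is a change of generators.  In any algebra containing the c_i, put
  T_s = -sqrt(-1) beta_s t_s and x_i = sqrt(-2) c_i xi_i.  Since the beta_s satisfy the Coxeter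
  relations of W up to signs, which are exactly the signs that distinguish the relations of the t_s
  from those of the reflections, the defining relations of the spin algebra hold for (t, y, xi) if
  and only if those of the Hecke-Clifford algebra hold for (T, y, x).  For the commutator relations
  one needs that each reflection of W equals, up to a scalar, a unit vector of the Clifford algebra
  times the corresponding element [i,j], its barred version, or the barred [i]; this follows by
  conjugating with simple reflections.  A family T_s satisfying the braid relations and T_s^2 = 1
  extends to W by Matsumoto's argument, as W is presented here by its multiplication table.
  Universal properties of presentations and of the super tensor product turn the substitutions into
  homomorphisms, which are mutually inverse because they are so on generators.
*)
theory Submission
  imports Defs
begin

section \<open>Complex algebras as a type class\<close>

text \<open>Both sides are algebras with explicit carriers depending on \<open>n\<close>,
  \<open>u\<close> and \<open>v\<close>, whereas long sign calculations want a type class ring.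
  Every superalgebra over a type is therefore placed, by extension by zero, inside the product of
  all of them; its unit becomes an idempotent \<open>e\<close>, and calculations take place in such
  a corner. One assignment \<open>a\<close> gives values to the generators of both presentations at
  once, subject to the change of generators. The central statement is that under \<open>a\<close>
  the relators of one side all vanish exactly if those of the other side do. In the tensor product
  the spin relators are known and the others follow; in the Hecke-Clifford algebra it is the other
  way round. The constant sqrt(-2) comes from (1 + c_j c_i)(c_i - c_j) = 2 c_i against the
  normalisation 1/sqrt 2 of the root vectors. All relators are homogeneous, which lets the parity of
  words descend to the quotients. The finite isomorphisms come from the same argument with the
  generators x, y and xi left out.\<close>

class calg = ring +
  fixes cscale :: "complex \<Rightarrow> 'a \<Rightarrow> 'a" (infixr "*\<^sub>c" 75)
  assumes cscale_add_right: "z *\<^sub>c (x + y) = z *\<^sub>c x + z *\<^sub>c y"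
    and cscale_add_left: "(z + w) *\<^sub>c x = z *\<^sub>c x + w *\<^sub>c x"
    and cscale_cscale [simp]: "z *\<^sub>c (w *\<^sub>c x) = (z * w) *\<^sub>c x"
    and cscale_one [simp]: "1 *\<^sub>c x = x"
    and mult_cscale_left [simp]: "(z *\<^sub>c x) * y = z *\<^sub>c (x * y)"
    and mult_cscale_right [simp]: "x * (z *\<^sub>c y) = z *\<^sub>c (x * y)"
begin

lemma cscale_zero_left [simp]: "0 *\<^sub>c x = 0"
  using cscale_add_left[of 0 0 x] by simp

lemma cscale_zero_right [simp]: "z *\<^sub>c 0 = 0"
  using cscale_add_right[of z 0 0] by simp

lemma cscale_minus_right [simp]: "z *\<^sub>c (- x) = - (z *\<^sub>c x)"
  using cscale_add_right[of z x "- x"] by (simp add: eq_neg_iff_add_eq_0 add.commute)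

lemma cscale_minus_left [simp]: "(- z) *\<^sub>c x = - (z *\<^sub>c x)"
  using cscale_add_left[of z "- z" x] by (simp add: eq_neg_iff_add_eq_0 add.commute)

lemma cscale_diff_right: "z *\<^sub>c (x - y) = z *\<^sub>c x - z *\<^sub>c y"
  using cscale_add_right[of z x "- y"] by simp

lemma cscale_sum_right: "z *\<^sub>c (\<Sum>i\<in>A. f i) = (\<Sum>i\<in>A. z *\<^sub>c f i)"
  by (induction A rule: infinite_finite_induct) (simp_all add: cscale_add_right)

lemma cscale_cancel: "z \<noteq> 0 \<Longrightarrow> z *\<^sub>c x = z *\<^sub>c y \<longleftrightarrow> x = y"
  by (metis cscale_cscale cscale_one left_inverse)

end

section \<open>Superalgebras\<close>

lemma superalgebraD:
  assumes "superalgebra A"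
  shows "ring A" "Module.module complex_ring A" "abelian_group A" "monoid A"
    "\<And>z a b. a \<in> carrier A \<Longrightarrow> b \<in> carrier A \<Longrightarrow> (z \<odot>\<^bsub>A\<^esub> a) \<otimes>\<^bsub>A\<^esub> b = z \<odot>\<^bsub>A\<^esub> (a \<otimes>\<^bsub>A\<^esub> b)"
    "\<And>z a b. a \<in> carrier A \<Longrightarrow> b \<in> carrier A \<Longrightarrow> a \<otimes>\<^bsub>A\<^esub> (z \<odot>\<^bsub>A\<^esub> b) = z \<odot>\<^bsub>A\<^esub> (a \<otimes>\<^bsub>A\<^esub> b)"
    "\<And>i. submodule (part A i) complex_ring A"
    "\<And>a. a \<in> carrier A \<Longrightarrow> \<exists>!b. b \<in> part A False \<and> a \<ominus>\<^bsub>A\<^esub> b \<in> part A True"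
    "\<And>i j a b. a \<in> part A i \<Longrightarrow> b \<in> part A j \<Longrightarrow> a \<otimes>\<^bsub>A\<^esub> b \<in> part A (i \<noteq> j)"
  using assms unfolding superalgebra_def ring_def by (auto simp: abelian_group_def)

lemma carrier_complex_ring [simp]: "z \<in> carrier complex_ring"
  by (simp add: ring_of_type_algebra_def)

context
  fixes A :: "'a salg"
  assumes A: "superalgebra A"
begin

interpretation ring A using superalgebraD(1)[OF A] .
interpretation module complex_ring A using superalgebraD(2)[OF A] .

lemma salg_closed [simp, intro]:
  "a \<in> carrier A \<Longrightarrow> b \<in> carrier A \<Longrightarrow> a \<oplus>\<^bsub>A\<^esub> b \<in> carrier A"
  "a \<in> carrier A \<Longrightarrow> b \<in> carrier A \<Longrightarrow> a \<otimes>\<^bsub>A\<^esub> b \<in> carrier A"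
  "a \<in> carrier A \<Longrightarrow> b \<in> carrier A \<Longrightarrow> a \<ominus>\<^bsub>A\<^esub> b \<in> carrier A"
  "a \<in> carrier A \<Longrightarrow> z \<odot>\<^bsub>A\<^esub> a \<in> carrier A"
  "a \<in> carrier A \<Longrightarrow> \<ominus>\<^bsub>A\<^esub> a \<in> carrier A"
  "\<zero>\<^bsub>A\<^esub> \<in> carrier A" "\<one>\<^bsub>A\<^esub> \<in> carrier A"
  by auto

lemma salg_smult:
  "a \<in> carrier A \<Longrightarrow> b \<in> carrier A \<Longrightarrow> z \<odot>\<^bsub>A\<^esub> (a \<oplus>\<^bsub>A\<^esub> b) = z \<odot>\<^bsub>A\<^esub> a \<oplus>\<^bsub>A\<^esub> z \<odot>\<^bsub>A\<^esub> b"
  "a \<in> carrier A \<Longrightarrow> (z + w) \<odot>\<^bsub>A\<^esub> a = z \<odot>\<^bsub>A\<^esub> a \<oplus>\<^bsub>A\<^esub> w \<odot>\<^bsub>A\<^esub> a"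
  "a \<in> carrier A \<Longrightarrow> (z * w) \<odot>\<^bsub>A\<^esub> a = z \<odot>\<^bsub>A\<^esub> (w \<odot>\<^bsub>A\<^esub> a)"
  "a \<in> carrier A \<Longrightarrow> 1 \<odot>\<^bsub>A\<^esub> a = a"
  "z \<odot>\<^bsub>A\<^esub> \<zero>\<^bsub>A\<^esub> = \<zero>\<^bsub>A\<^esub>"
  "a \<in> carrier A \<Longrightarrow> 0 \<odot>\<^bsub>A\<^esub> a = \<zero>\<^bsub>A\<^esub>"
  using smult_r_distr[of z a b] smult_l_distr[of z w a] smult_assoc1[of z w a] smult_one[of a]
    smult_r_null[of z] smult_l_null[of a]
  by (simp_all add: ring_of_type_algebra_def)

end

section \<open>All superalgebras on a type inside one ring\<close>

text \<open>The product of all superalgebras with elements in a given type is an instance of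
  \<^class>\<open>calg\<close>, and contains each of them as a corner. This makes the simplifier for
  type class rings available for calculations in a superalgebra depending on parameters.\<close>

typedef 'c prodalg =
  "{f :: 'c salg \<Rightarrow> 'c. \<forall>R. if superalgebra R then f R \<in> carrier R else f R = undefined}"
  by (rule exI[of _ "\<lambda>R. if superalgebra R then \<zero>\<^bsub>R\<^esub> else undefined"]) simp

setup_lifting type_definition_prodalg

text \<open>Off superalgebras every element of the type takes the value \<open>undefined\<close>, so
  agreement on superalgebras is equality.\<close>

lemma prodalg_eqI:
  assumes "\<And>R. superalgebra R \<Longrightarrow> Rep_prodalg x R = Rep_prodalg y R"
  shows "x = y"
proof -
  have "Rep_prodalg x R = Rep_prodalg y R" for R
    using assms[of R] Rep_prodalg[of x] Rep_prodalg[of y] by (cases "superalgebra R") (auto split: if_splits)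
  then show ?thesis by (simp add: Rep_prodalg_inject[symmetric] fun_eq_iff)
qed

lemma Rep_prodalg_carrier [simp]: "superalgebra R \<Longrightarrow> Rep_prodalg x R \<in> carrier R"
  using Rep_prodalg[of x] by auto

instantiation prodalg :: (type) calg
begin

lift_definition plus_prodalg :: "'a prodalg \<Rightarrow> 'a prodalg \<Rightarrow> 'a prodalg" is
  "\<lambda>f g R. if superalgebra R then f R \<oplus>\<^bsub>R\<^esub> g R else undefined" by simp
lift_definition minus_prodalg :: "'a prodalg \<Rightarrow> 'a prodalg \<Rightarrow> 'a prodalg" is
  "\<lambda>f g R. if superalgebra R then f R \<ominus>\<^bsub>R\<^esub> g R else undefined" by simp
lift_definition uminus_prodalg :: "'a prodalg \<Rightarrow> 'a prodalg" is
  "\<lambda>f R. if superalgebra R then \<ominus>\<^bsub>R\<^esub> f R else undefined" by simp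
lift_definition zero_prodalg :: "'a prodalg" is
  "\<lambda>R. if superalgebra R then \<zero>\<^bsub>R\<^esub> else undefined" by simp
lift_definition times_prodalg :: "'a prodalg \<Rightarrow> 'a prodalg \<Rightarrow> 'a prodalg" is
  "\<lambda>f g R. if superalgebra R then f R \<otimes>\<^bsub>R\<^esub> g R else undefined" by simp
lift_definition cscale_prodalg :: "complex \<Rightarrow> 'a prodalg \<Rightarrow> 'a prodalg" is
  "\<lambda>z f R. if superalgebra R then z \<odot>\<^bsub>R\<^esub> f R else undefined" by simp

lemmas Rep_prodalg_ops = plus_prodalg.rep_eq minus_prodalg.rep_eq uminus_prodalg.rep_eq
  zero_prodalg.rep_eq times_prodalg.rep_eq cscale_prodalg.rep_eq

instance
proof
  fix a b c :: "'a prodalg" and z w :: complex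
  note ab = superalgebraD(3) and rg = superalgebraD(1)
  have mon: "abelian_monoid R" if "superalgebra R" for R :: "'a salg"
    using ab[OF that] by (simp add: abelian_group_def)
  show "a + b + c = a + (b + c)"
    by (rule prodalg_eqI) (simp add: Rep_prodalg_ops mon abelian_monoid.a_assoc)
  show "a + b = b + a"
    by (rule prodalg_eqI) (simp add: Rep_prodalg_ops mon abelian_monoid.a_comm)
  show "0 + a = a" "- a + a = 0" "a - b = a + - b"
    by (rule prodalg_eqI; simp add: Rep_prodalg_ops mon ab abelian_monoid.l_zero abelian_group.l_neg
      a_minus_def)+
  show "a * b * c = a * (b * c)"
    by (rule prodalg_eqI) (simp add: Rep_prodalg_ops superalgebraD(4) monoid.m_assoc)
  show "(a + b) * c = a * c + b * c" "a * (b + c) = a * b + a * c"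
    by (rule prodalg_eqI; simp add: Rep_prodalg_ops rg ring.ring_simprules(13) ring.ring_simprules(23))+
  show "z *\<^sub>c (a + b) = z *\<^sub>c a + z *\<^sub>c b" "(z + w) *\<^sub>c a = z *\<^sub>c a + w *\<^sub>c a"
    "z *\<^sub>c (w *\<^sub>c a) = (z * w) *\<^sub>c a" "1 *\<^sub>c a = a"
    "(z *\<^sub>c a) * b = z *\<^sub>c (a * b)" "a * (z *\<^sub>c b) = z *\<^sub>c (a * b)"
    by (rule prodalg_eqI; simp add: Rep_prodalg_ops salg_smult superalgebraD(5,6))+
qed

end

text \<open>Extension by zero to the other factors. It respects sums, products and scalars, but the
  image of a unit is only an idempotent; this is why the later locales carry a local unit
  \<open>e\<close>.\<close>

definition emb :: "'c salg \<Rightarrow> 'c \<Rightarrow> 'c prodalg" where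
  "emb R x = Abs_prodalg (\<lambda>R'. if superalgebra R' then (if R' = R then x else \<zero>\<^bsub>R'\<^esub>) else undefined)"

lemma Rep_emb:
  "x \<in> carrier R \<Longrightarrow>
    Rep_prodalg (emb R x) = (\<lambda>R'. if superalgebra R' then (if R' = R then x else \<zero>\<^bsub>R'\<^esub>) else undefined)"
  unfolding emb_def by (rule Abs_prodalg_inverse) auto

context
  fixes R :: "'c salg"
  assumes R: "superalgebra R"
begin

lemma Rep_emb_same [simp]: "x \<in> carrier R \<Longrightarrow> Rep_prodalg (emb R x) R = x"
  using R by (simp add: Rep_emb)

lemma emb_inject: "x \<in> carrier R \<Longrightarrow> y \<in> carrier R \<Longrightarrow> emb R x = emb R y \<longleftrightarrow> x = y"
  by (metis Rep_emb_same)

lemma emb_simps: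
  "x \<in> carrier R \<Longrightarrow> y \<in> carrier R \<Longrightarrow> emb R (x \<oplus>\<^bsub>R\<^esub> y) = emb R x + emb R y"
  "x \<in> carrier R \<Longrightarrow> y \<in> carrier R \<Longrightarrow> emb R (x \<otimes>\<^bsub>R\<^esub> y) = emb R x * emb R y"
  "x \<in> carrier R \<Longrightarrow> emb R (z \<odot>\<^bsub>R\<^esub> x) = z *\<^sub>c emb R x"
  "emb R \<zero>\<^bsub>R\<^esub> = 0"
  "x \<in> carrier R \<Longrightarrow> y \<in> carrier R \<Longrightarrow> emb R (x \<ominus>\<^bsub>R\<^esub> y) = emb R x - emb R y"
proof -
  \<comment> \<open>Away from the factor \<open>R\<close> all images are zero, so there the laws
    reduce to sums, differences and products of zero with itself.\<close>
  have mon: "R' \<oplus>\<^bsub>S\<^esub> R' = R'" "R' \<ominus>\<^bsub>S\<^esub> R' = R'" "R' \<otimes>\<^bsub>S\<^esub> R' = R'"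
    if "superalgebra S" "R' = \<zero>\<^bsub>S\<^esub>" for R' and S :: "'c salg"
  proof -
    interpret ring S using superalgebraD(1)[OF that(1)] .
    show "R' \<oplus>\<^bsub>S\<^esub> R' = R'" "R' \<ominus>\<^bsub>S\<^esub> R' = R'" "R' \<otimes>\<^bsub>S\<^esub> R' = R'" using that(2) by (simp_all add: a_minus_def)
  qed
  show "x \<in> carrier R \<Longrightarrow> y \<in> carrier R \<Longrightarrow> emb R (x \<oplus>\<^bsub>R\<^esub> y) = emb R x + emb R y"
  "x \<in> carrier R \<Longrightarrow> y \<in> carrier R \<Longrightarrow> emb R (x \<otimes>\<^bsub>R\<^esub> y) = emb R x * emb R y"
  "x \<in> carrier R \<Longrightarrow> emb R (z \<odot>\<^bsub>R\<^esub> x) = z *\<^sub>c emb R x"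
  "emb R \<zero>\<^bsub>R\<^esub> = 0"
  "x \<in> carrier R \<Longrightarrow> y \<in> carrier R \<Longrightarrow> emb R (x \<ominus>\<^bsub>R\<^esub> y) = emb R x - emb R y"
    using R by (intro prodalg_eqI; simp add: Rep_emb Rep_prodalg_ops salg_smult mon)+
qed

end

section \<open>Homogeneous components in a superalgebra\<close>

context
  fixes A :: "'a salg"
  assumes A: "superalgebra A"
begin

interpretation ring A using superalgebraD(1)[OF A] .
interpretation module complex_ring A using superalgebraD(2)[OF A] .

text \<open>Identities in a superalgebra are proved by applying the injective map \<open>emb\<close>
  and simplifying in the type class.\<close>

lemmas emb_eq = emb_inject[OF A, symmetric] emb_simps[OF A]

lemma part_subset: "part A i \<subseteq> carrier A"
  using submoduleE(1)[OF superalgebraD(7)[OF A]] .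

lemma part_closed [intro]:
  "a \<in> part A i \<Longrightarrow> a \<in> carrier A"
  "a \<in> part A i \<Longrightarrow> b \<in> part A i \<Longrightarrow> a \<oplus>\<^bsub>A\<^esub> b \<in> part A i"
  "a \<in> part A i \<Longrightarrow> b \<in> part A i \<Longrightarrow> a \<ominus>\<^bsub>A\<^esub> b \<in> part A i"
  "a \<in> part A i \<Longrightarrow> z \<odot>\<^bsub>A\<^esub> a \<in> part A i"
  "\<zero>\<^bsub>A\<^esub> \<in> part A i"
proof -
  note sub = superalgebraD(7)[OF A, of i]
  show "a \<in> part A i \<Longrightarrow> a \<in> carrier A" using part_subset by auto
  show "a \<in> part A i \<Longrightarrow> b \<in> part A i \<Longrightarrow> a \<oplus>\<^bsub>A\<^esub> b \<in> part A i"
    using submoduleE(5)[OF sub] by auto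
  show "a \<in> part A i \<Longrightarrow> b \<in> part A i \<Longrightarrow> a \<ominus>\<^bsub>A\<^esub> b \<in> part A i"
    using submoduleE(5,3)[OF sub] by (auto simp: a_minus_def)
  show "a \<in> part A i \<Longrightarrow> z \<odot>\<^bsub>A\<^esub> a \<in> part A i"
    using submoduleE(4)[OF sub] by auto
  show "\<zero>\<^bsub>A\<^esub> \<in> part A i"
    using subgroup.one_closed[OF submodule.axioms(1)[OF sub]] by simp
qed

text \<open>Both the element itself and zero would qualify as its even component, and that component
  is unique.\<close>

lemma part_disjoint:
  assumes "a \<in> part A i" "a \<in> part A (\<not> i)" shows "a = \<zero>\<^bsub>A\<^esub>"
proof -
  have a: "a \<in> part A False" "a \<in> part A True" using assms by (cases i; simp)+
  then have "a \<in> carrier A" by auto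
  then have "a \<ominus>\<^bsub>A\<^esub> a \<in> part A True" "a \<ominus>\<^bsub>A\<^esub> \<zero>\<^bsub>A\<^esub> \<in> part A True"
    using a part_closed by (auto simp: a_minus_def r_neg)
  then show ?thesis
    using superalgebraD(8)[OF A \<open>a \<in> carrier A\<close>] a part_closed(5) by blast
qed

text \<open>The definition of a superalgebra postulates the even component only. The odd one is the
  remainder, and \<open>part_disjoint\<close> makes either of them unique.\<close>

lemma hcomp_ex: 
  assumes "a \<in> carrier A"
  shows "\<exists>!b. b \<in> part A i \<and> a \<ominus>\<^bsub>A\<^esub> b \<in> part A (\<not> i)"
proof -
  obtain b where b: "b \<in> part A False" "a \<ominus>\<^bsub>A\<^esub> b \<in> part A True"
    using superalgebraD(8)[OF A assms] by blast
  have eq: "a \<ominus>\<^bsub>A\<^esub> (a \<ominus>\<^bsub>A\<^esub> b) = b"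
    using assms part_closed(1)[OF b(1)] by (simp add: emb_eq)
  have ex: "\<exists>b. b \<in> part A i \<and> a \<ominus>\<^bsub>A\<^esub> b \<in> part A (\<not> i)"
    using b eq by (cases i) (auto intro: exI[of _ b] exI[of _ "a \<ominus>\<^bsub>A\<^esub> b"])
  show ?thesis
  proof (rule ex_ex1I[OF ex], elim conjE)
    fix x y assume x: "x \<in> part A i" "a \<ominus>\<^bsub>A\<^esub> x \<in> part A (\<not> i)" and y: "y \<in> part A i" "a \<ominus>\<^bsub>A\<^esub> y \<in> part A (\<not> i)"
    then have c: "x \<in> carrier A" "y \<in> carrier A" by auto
    have "(a \<ominus>\<^bsub>A\<^esub> y) \<ominus>\<^bsub>A\<^esub> (a \<ominus>\<^bsub>A\<^esub> x) \<in> part A (\<not> i)" using x y by auto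
    moreover have "(a \<ominus>\<^bsub>A\<^esub> y) \<ominus>\<^bsub>A\<^esub> (a \<ominus>\<^bsub>A\<^esub> x) = x \<ominus>\<^bsub>A\<^esub> y"
      using c assms by (simp add: emb_eq)
    ultimately have "x \<ominus>\<^bsub>A\<^esub> y = \<zero>\<^bsub>A\<^esub>"
      using part_disjoint[of "x \<ominus>\<^bsub>A\<^esub> y" i] x y by auto
    then show "x = y" using c by (simp add: r_right_minus_eq)
  qed
qed

lemma hcomp_part [intro, simp]: "a \<in> carrier A \<Longrightarrow> hcomp A i a \<in> part A i"
  unfolding hcomp_def using theI'[OF hcomp_ex[of a i]] by blast

lemma hcomp_diff: "a \<in> carrier A \<Longrightarrow> a \<ominus>\<^bsub>A\<^esub> hcomp A i a \<in> part A (\<not> i)"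
  unfolding hcomp_def using theI'[OF hcomp_ex[of a i]] by blast

lemma hcomp_carrier [intro, simp]: "a \<in> carrier A \<Longrightarrow> hcomp A i a \<in> carrier A"
  using part_closed(1) by blast

lemma hcomp_unique:
  "a \<in> carrier A \<Longrightarrow> b \<in> part A i \<Longrightarrow> a \<ominus>\<^bsub>A\<^esub> b \<in> part A (\<not> i) \<Longrightarrow> hcomp A i a = b"
  using hcomp_ex[of a i] hcomp_part hcomp_diff by blast

lemma hcomp_of_part: "a \<in> part A i \<Longrightarrow> hcomp A j a = (if i = j then a else \<zero>\<^bsub>A\<^esub>)"
  proof (rule hcomp_unique)
  assume a: "a \<in> part A i"
  then show c: "a \<in> carrier A" by auto
  show "(if i = j then a else \<zero>\<^bsub>A\<^esub>) \<in> part A j" using a by auto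
  have "a \<ominus>\<^bsub>A\<^esub> a = \<zero>\<^bsub>A\<^esub>" "a \<ominus>\<^bsub>A\<^esub> \<zero>\<^bsub>A\<^esub> = a" using c by (simp_all add: emb_eq)
  then show "a \<ominus>\<^bsub>A\<^esub> (if i = j then a else \<zero>\<^bsub>A\<^esub>) \<in> part A (\<not> j)"
    using a by (cases i; cases j) auto
qed

lemma hcomp_decompose: "a \<in> carrier A \<Longrightarrow> hcomp A i a \<oplus>\<^bsub>A\<^esub> hcomp A (\<not> i) a = a"
proof -
  assume a: "a \<in> carrier A"
  have "hcomp A (\<not> i) a = a \<ominus>\<^bsub>A\<^esub> hcomp A i a"
  proof (rule hcomp_unique)
    have "a \<ominus>\<^bsub>A\<^esub> (a \<ominus>\<^bsub>A\<^esub> hcomp A i a) = hcomp A i a" using a by (simp add: emb_eq)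
    then show "a \<ominus>\<^bsub>A\<^esub> (a \<ominus>\<^bsub>A\<^esub> hcomp A i a) \<in> part A (\<not> \<not> i)" using a by simp
  qed (use a hcomp_diff in auto)
  then show ?thesis using a by (simp add: emb_eq)
qed

lemma hcomp_add: 
  assumes "a \<in> carrier A" "b \<in> carrier A"
  shows "hcomp A i (a \<oplus>\<^bsub>A\<^esub> b) = hcomp A i a \<oplus>\<^bsub>A\<^esub> hcomp A i b"
proof (rule hcomp_unique)
  have "a \<oplus>\<^bsub>A\<^esub> b \<ominus>\<^bsub>A\<^esub> (hcomp A i a \<oplus>\<^bsub>A\<^esub> hcomp A i b) = (a \<ominus>\<^bsub>A\<^esub> hcomp A i a) \<oplus>\<^bsub>A\<^esub> (b \<ominus>\<^bsub>A\<^esub> hcomp A i b)"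
    using assms by (simp add: emb_eq algebra_simps)
  then show "a \<oplus>\<^bsub>A\<^esub> b \<ominus>\<^bsub>A\<^esub> (hcomp A i a \<oplus>\<^bsub>A\<^esub> hcomp A i b) \<in> part A (\<not> i)"
    using assms hcomp_diff part_closed(2) by simp
qed (use assms part_closed(2) in auto)

lemma hcomp_smult:
  assumes "a \<in> carrier A"
  shows "hcomp A i (z \<odot>\<^bsub>A\<^esub> a) = z \<odot>\<^bsub>A\<^esub> hcomp A i a"
proof (rule hcomp_unique)
  have "z \<odot>\<^bsub>A\<^esub> a \<ominus>\<^bsub>A\<^esub> z \<odot>\<^bsub>A\<^esub> hcomp A i a = z \<odot>\<^bsub>A\<^esub> (a \<ominus>\<^bsub>A\<^esub> hcomp A i a)"
    using assms by (simp add: emb_eq cscale_diff_right)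
  then show "z \<odot>\<^bsub>A\<^esub> a \<ominus>\<^bsub>A\<^esub> z \<odot>\<^bsub>A\<^esub> hcomp A i a \<in> part A (\<not> i)"
    using assms hcomp_diff part_closed(4) by simp
qed (use assms part_closed(4) in auto)

text \<open>Evenness of the unit is a consequence of the axioms. For \<open>1 = p + q\<close> with
  \<open>p\<close> even and \<open>q\<close> odd, \<open>qp = p - pp\<close> is both odd and even,
  hence zero; then \<open>qq = q - qp\<close> is both even and odd, hence zero; so
  \<open>q = qp + qq = 0\<close>.\<close>

lemma part_one: "\<one>\<^bsub>A\<^esub> \<in> part A False"
proof -
  define p q where "p = hcomp A False \<one>\<^bsub>A\<^esub>" and "q = hcomp A True \<one>\<^bsub>A\<^esub>"
  have pq: "p \<in> part A False" "q \<in> part A True" "p \<oplus>\<^bsub>A\<^esub> q = \<one>\<^bsub>A\<^esub>"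
    using hcomp_decompose[of "\<one>\<^bsub>A\<^esub>" False] by (auto simp: p_def q_def)
  then have c: "p \<in> carrier A" "q \<in> carrier A" by auto
  have parts: "q \<otimes>\<^bsub>A\<^esub> p \<in> part A True" "q \<otimes>\<^bsub>A\<^esub> q \<in> part A False" "p \<otimes>\<^bsub>A\<^esub> p \<in> part A False"
    using superalgebraD(9)[OF A pq(2,1)] superalgebraD(9)[OF A pq(2,2)] superalgebraD(9)[OF A pq(1,1)]
    by auto
  have "emb A (p \<otimes>\<^bsub>A\<^esub> p \<oplus>\<^bsub>A\<^esub> q \<otimes>\<^bsub>A\<^esub> p) = emb A p" "emb A (p \<otimes>\<^bsub>A\<^esub> q \<oplus>\<^bsub>A\<^esub> q \<otimes>\<^bsub>A\<^esub> q) = emb A q"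
    using ring.ring_simprules(13)[OF superalgebraD(1)[OF A], of p q p]
      ring.ring_simprules(13)[OF superalgebraD(1)[OF A], of p q q] pq(3) c by simp_all
  moreover have "emb A (q \<otimes>\<^bsub>A\<^esub> p \<oplus>\<^bsub>A\<^esub> q \<otimes>\<^bsub>A\<^esub> q) = emb A q"
    using ring.ring_simprules(23)[OF superalgebraD(1)[OF A], of p q q] pq(3) c by simp
  ultimately have eqs: "q \<otimes>\<^bsub>A\<^esub> p = p \<ominus>\<^bsub>A\<^esub> p \<otimes>\<^bsub>A\<^esub> p" "q \<otimes>\<^bsub>A\<^esub> q = q \<ominus>\<^bsub>A\<^esub> q \<otimes>\<^bsub>A\<^esub> p"
    using c by (simp_all add: emb_eq algebra_simps)
  have "q \<otimes>\<^bsub>A\<^esub> p \<in> part A False" unfolding eqs(1) using parts(3) pq(1) by (rule part_closed(3)[rotated])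
  with parts(1) have qp: "q \<otimes>\<^bsub>A\<^esub> p = \<zero>\<^bsub>A\<^esub>" using part_disjoint[of _ False] by simp
  have "q \<otimes>\<^bsub>A\<^esub> q \<in> part A True" unfolding eqs(2) using parts(1) pq(2) by (rule part_closed(3)[rotated])
  with parts(2) have "q \<otimes>\<^bsub>A\<^esub> q = \<zero>\<^bsub>A\<^esub>" using part_disjoint[of _ False] by simp
  with qp eqs(2) have "q = \<zero>\<^bsub>A\<^esub>" using c by (simp add: emb_eq)
  then show ?thesis using pq c by simp
qed

end

declare part_closed [rule del] salg_closed [rule del] hcomp_part [rule del] hcomp_carrier [rule del]

section \<open>Homomorphisms of superalgebras\<close>

definition salg_hom :: "('a, 'm) salg_scheme \<Rightarrow> ('b, 'k) salg_scheme \<Rightarrow> ('a \<Rightarrow> 'b) \<Rightarrow> bool" where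
  "salg_hom A B f \<longleftrightarrow> f \<in> ring_hom A B \<and>
     (\<forall>z. \<forall>a\<in>carrier A. f (z \<odot>\<^bsub>A\<^esub> a) = z \<odot>\<^bsub>B\<^esub> f a) \<and>
     (\<forall>i. f ` part A i \<subseteq> part B i)"

lemma salg_homD:
  assumes "salg_hom A B f"
  shows "a \<in> carrier A \<Longrightarrow> f a \<in> carrier B"
    "a \<in> carrier A \<Longrightarrow> b \<in> carrier A \<Longrightarrow> f (a \<oplus>\<^bsub>A\<^esub> b) = f a \<oplus>\<^bsub>B\<^esub> f b"
    "a \<in> carrier A \<Longrightarrow> b \<in> carrier A \<Longrightarrow> f (a \<otimes>\<^bsub>A\<^esub> b) = f a \<otimes>\<^bsub>B\<^esub> f b"
    "f \<one>\<^bsub>A\<^esub> = \<one>\<^bsub>B\<^esub>"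
    "a \<in> carrier A \<Longrightarrow> f (z \<odot>\<^bsub>A\<^esub> a) = z \<odot>\<^bsub>B\<^esub> f a"
    "a \<in> part A i \<Longrightarrow> f a \<in> part B i"
  using assms unfolding salg_hom_def ring_hom_def by (auto simp: image_subset_iff)

lemma salg_hom_id: "salg_hom A A (\<lambda>x. x)"
  by (auto simp: salg_hom_def ring_hom_def)

lemma salg_hom_comp: "salg_hom A B f \<Longrightarrow> salg_hom B C g \<Longrightarrow> salg_hom A C (\<lambda>x. g (f x))"
  unfolding salg_hom_def ring_hom_def by (auto simp: image_subset_iff Pi_def)

lemma superalgebra_iso_of_inverse:
  assumes "superalgebra A" "superalgebra B" "salg_hom A B f" "salg_hom B A g" "inverse_maps A B f g"
  shows "superalgebra_iso A B f" "superalgebra_iso B A g"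
proof -
  have "bij_betw f (carrier A) (carrier B)" "bij_betw g (carrier B) (carrier A)"
    using assms(5) salg_homD(1)[OF assms(3)] salg_homD(1)[OF assms(4)]
    unfolding inverse_maps_def by (auto intro: bij_betw_byWitness)
  then show "superalgebra_iso A B f" "superalgebra_iso B A g"
    using assms unfolding superalgebra_iso_def salg_hom_def ring_iso_def by auto
qed

section \<open>Quotients\<close>

lemma lookup_scale [simp]: "Poly_Mapping.lookup (scale z p) k = z * Poly_Mapping.lookup p k"
  by (simp add: scale_def Poly_Mapping.map.rep_eq when_def)

interpretation sc: vector_space scale
  by standard (auto intro!: poly_mapping_eqI simp: lookup_add algebra_simps)

lemma scale_single [simp]: "scale z (Poly_Mapping.single k w) = Poly_Mapping.single k (z * w)"
  by (rule poly_mapping_eqI) (simp add: lookup_single when_def)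

lemma keys_scale_subset: "Poly_Mapping.keys (scale z p) \<subseteq> Poly_Mapping.keys p"
  by (auto simp: in_keys_iff)

text \<open>Carriers and homogeneous parts, of free algebras and of the precursors of tensor
  products alike, consist of the polynomials supported in a fixed set of keys.\<close>

lemma subspace_keys: "sc.subspace {p. Poly_Mapping.keys p \<subseteq> S}"
proof (rule sc.subspaceI)
  fix p q :: "'a \<Rightarrow>\<^sub>0 complex" and z
  assume pq: "p \<in> {p. Poly_Mapping.keys p \<subseteq> S}" "q \<in> {p. Poly_Mapping.keys p \<subseteq> S}"
  show "p + q \<in> {p. Poly_Mapping.keys p \<subseteq> S}" using pq Poly_Mapping.keys_add[of p q] by auto
  show "scale z p \<in> {p. Poly_Mapping.keys p \<subseteq> S}" using pq keys_scale_subset[of z p] by auto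
qed simp

text \<open>The map \<open>P\<close> represents the projection onto the even part.\<close>

locale prequot =
  fixes A :: "('k \<Rightarrow>\<^sub>0 complex) salg" (structure) and I and P
  assumes ops: "add A = (+)" "zero A = 0" "module.smult A = scale"
    and subspaceC: "sc.subspace (carrier A)"
    and subspaceI: "sc.subspace I" and I_subset: "I \<subseteq> carrier A"
    and one_in: "\<one> \<in> carrier A"
    and mult_in: "\<And>a b. a \<in> carrier A \<Longrightarrow> b \<in> carrier A \<Longrightarrow> a \<otimes> b \<in> carrier A"
    and mult_add: "\<And>a b c. a \<in> carrier A \<Longrightarrow> b \<in> carrier A \<Longrightarrow> c \<in> carrier A \<Longrightarrow>
          (a + b) \<otimes> c = a \<otimes> c + b \<otimes> c \<and> c \<otimes> (a + b) = c \<otimes> a + c \<otimes> b"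
    and mult_scale: "\<And>z a b. a \<in> carrier A \<Longrightarrow> b \<in> carrier A \<Longrightarrow>
          scale z a \<otimes> b = scale z (a \<otimes> b) \<and> a \<otimes> scale z b = scale z (a \<otimes> b)"
    and absorb: "\<And>a x. a \<in> carrier A \<Longrightarrow> x \<in> I \<Longrightarrow> a \<otimes> x \<in> I \<and> x \<otimes> a \<in> I"
    and one_mult: "\<And>a. a \<in> carrier A \<Longrightarrow> \<one> \<otimes> a - a \<in> I \<and> a \<otimes> \<one> - a \<in> I"
    and assoc: "\<And>a b c. a \<in> carrier A \<Longrightarrow> b \<in> carrier A \<Longrightarrow> c \<in> carrier A \<Longrightarrow>
          (a \<otimes> b) \<otimes> c - a \<otimes> (b \<otimes> c) \<in> I"
    and subspace_part: "\<And>i. sc.subspace (part A i)" and part_sub: "\<And>i. part A i \<subseteq> carrier A"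
    and part_mult: "\<And>i j a b. a \<in> part A i \<Longrightarrow> b \<in> part A j \<Longrightarrow> a \<otimes> b \<in> part A (i \<noteq> j)"
    and P_part: "\<And>a. a \<in> carrier A \<Longrightarrow> P a \<in> part A False \<and> (\<exists>c\<in>part A True. a - P a - c \<in> I)"
    and P_diff: "\<And>a b. a \<in> carrier A \<Longrightarrow> b \<in> carrier A \<Longrightarrow> P (a - b) = P a - P b"
    and P_I: "\<And>x. x \<in> I \<Longrightarrow> P x \<in> I"
    and P_even: "\<And>a. a \<in> part A False \<Longrightarrow> P a - a \<in> I"
    and P_odd: "\<And>a. a \<in> part A True \<Longrightarrow> P a \<in> I"
begin

definition coset where "coset a = I +>\<^bsub>A\<^esub> a"

lemma coset_def': "coset a = (\<lambda>i. i + a) ` I"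
  by (auto simp: coset_def a_r_coset_def' ops)

lemma subspace_ops:
  "sc.subspace S \<Longrightarrow> 0 \<in> S" "sc.subspace S \<Longrightarrow> x \<in> S \<Longrightarrow> y \<in> S \<Longrightarrow> x + y \<in> S"
  "sc.subspace S \<Longrightarrow> x \<in> S \<Longrightarrow> y \<in> S \<Longrightarrow> x - y \<in> S" "sc.subspace S \<Longrightarrow> x \<in> S \<Longrightarrow> - x \<in> S"
  "sc.subspace S \<Longrightarrow> x \<in> S \<Longrightarrow> scale z x \<in> S"
  by (auto simp: sc.subspace_0 sc.subspace_add sc.subspace_diff sc.subspace_neg sc.subspace_scale)

lemmas C_ops = subspace_ops[OF subspaceC] and I_ops = subspace_ops[OF subspaceI]
  and part_ops = subspace_ops[OF subspace_part]

lemma coset_eq_iff: "coset a = coset b \<longleftrightarrow> a - b \<in> I"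
proof
  assume "coset a = coset b"
  then have "0 + a \<in> coset b" using I_ops(1) unfolding coset_def' by blast
  then show "a - b \<in> I" by (auto simp: coset_def')
next
  assume d: "a - b \<in> I"
  show "coset a = coset b"
  proof (intro equalityI subsetI)
    fix x assume "x \<in> coset a"
    then obtain i where "i \<in> I" "x = (i + (a - b)) + b" by (auto simp: coset_def')
    then show "x \<in> coset b" unfolding coset_def' using d I_ops(2) by blast
  next
    fix x assume "x \<in> coset b"
    then obtain i where "i \<in> I" "x = (i - (a - b)) + a" by (auto simp: coset_def')
    then show "x \<in> coset a" unfolding coset_def' using d I_ops(3) by blast
  qed
qed

lemma coset_eqI: "a - b \<in> I \<Longrightarrow> coset a = coset b"
  by (simp add: coset_eq_iff)

lemma in_coset_iff: "x \<in> coset a \<longleftrightarrow> x - a \<in> I"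
proof
  show "x \<in> coset a \<Longrightarrow> x - a \<in> I" by (auto simp: coset_def')
  assume "x - a \<in> I"
  then have "x - a + a \<in> coset a" unfolding coset_def' by blast
  then show "x \<in> coset a" by simp
qed

lemma coset_carrier: "a \<in> carrier A \<Longrightarrow> x \<in> coset a \<Longrightarrow> x \<in> carrier A"
  using I_subset C_ops(2) by (auto simp: coset_def')

abbreviation "Q \<equiv> salg_quot A I"

lemma Q_carrier: "carrier Q = coset ` carrier A"
  unfolding salg_quot_def FactRing_def by (auto simp: A_RCOSETS_def' coset_def)

lemma Q_part: "part Q i = coset ` part A i"
  unfolding salg_quot_def by (simp add: coset_def)

lemma Q_one: "\<one>\<^bsub>Q\<^esub> = coset \<one>"
  unfolding salg_quot_def FactRing_def by (simp add: coset_def)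

lemma Q_zero: "\<zero>\<^bsub>Q\<^esub> = coset 0"
  unfolding salg_quot_def FactRing_def by (simp add: coset_def')

lemma Q_add: "coset a \<oplus>\<^bsub>Q\<^esub> coset b = coset (a + b)"
proof -
  have "coset a \<oplus>\<^bsub>Q\<^esub> coset b = (\<Union>x\<in>coset a. \<Union>y\<in>coset b. {x + y})"
    unfolding salg_quot_def FactRing_def by (auto simp: set_add_def set_mult_def ops)
  also have "\<dots> = coset (a + b)"
  proof (intro equalityI subsetI)
    fix z assume "z \<in> (\<Union>x\<in>coset a. \<Union>y\<in>coset b. {x + y})"
    then obtain i j where "i \<in> I" "j \<in> I" "z = (i + j) + (a + b)"
      by (auto simp: coset_def' algebra_simps)
    then show "z \<in> coset (a + b)" unfolding coset_def' using I_ops(2) by blast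
  next
    fix z assume "z \<in> coset (a + b)"
    then obtain i where "i \<in> I" "z = (i + a) + (0 + b)" by (auto simp: coset_def' algebra_simps)
    then show "z \<in> (\<Union>x\<in>coset a. \<Union>y\<in>coset b. {x + y})" unfolding coset_def' using I_ops(1) by blast
  qed
  finally show ?thesis .
qed

text \<open>\<open>FactRing\<close> multiplies two cosets by a union over all pairs of
  representatives. Two-sided absorption makes that union constant.\<close>

lemma Q_mult: 
  assumes a: "a \<in> carrier A" and b: "b \<in> carrier A"
  shows "coset a \<otimes>\<^bsub>Q\<^esub> coset b = coset (a \<otimes> b)"
proof -
  have eq: "coset a \<otimes>\<^bsub>Q\<^esub> coset b = (\<Union>x\<in>coset a. \<Union>y\<in>coset b. coset (x \<otimes> y))"
    unfolding salg_quot_def FactRing_def by (simp add: rcoset_mult_def coset_def)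
  have const: "coset (x \<otimes> y) = coset (a \<otimes> b)" if x: "x \<in> coset a" and y: "y \<in> coset b" for x y
  proof -
    have c: "x \<in> carrier A" "y \<in> carrier A" using x y a b coset_carrier by auto
    obtain i j where ij: "i \<in> I" "j \<in> I" "x = i + a" "y = j + b" using x y by (auto simp: coset_def')
    then have ic: "i \<in> carrier A" "j \<in> carrier A" using I_subset by auto
    have "x \<otimes> y = i \<otimes> y + a \<otimes> j + a \<otimes> b"
      using mult_add ic a b c ij by (simp add: algebra_simps)
    then have "x \<otimes> y - a \<otimes> b = i \<otimes> y + a \<otimes> j" by simp
    then show ?thesis using absorb ij a c I_ops(2) by (simp add: coset_eq_iff)
  qed
  have "a \<in> coset a" "b \<in> coset b" using I_ops(1) by (simp_all add: in_coset_iff)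
  then show ?thesis unfolding eq using const by blast
qed

lemma Q_smult:
  assumes a: "a \<in> carrier A"
  shows "z \<odot>\<^bsub>Q\<^esub> coset a = coset (scale z a)"
proof -
  have eq: "z \<odot>\<^bsub>Q\<^esub> coset a = (\<Union>x\<in>coset a. coset (scale z x))"
    unfolding salg_quot_def by (simp add: coset_def ops)
  have "coset (scale z x) = coset (scale z a)" if "x \<in> coset a" for x
    using that I_ops(5)[of "x - a" z] by (simp add: coset_eq_iff in_coset_iff sc.scale_right_diff_distrib)
  moreover have "a \<in> coset a" using I_ops(1) by (simp add: in_coset_iff)
  ultimately show ?thesis unfolding eq by blast
qed

lemmas Q_simps = Q_one Q_zero Q_add Q_mult Q_smult

lemma coset_closed [simp]: "a \<in> carrier A \<Longrightarrow> coset a \<in> carrier Q"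
  by (simp add: Q_carrier)

lemma Q_cases:
  assumes "x \<in> carrier Q" obtains a where "a \<in> carrier A" "x = coset a"
  using assms by (auto simp: Q_carrier)

lemma Q_abelian: "abelian_group Q"
proof (rule abelian_groupI)
  fix x assume "x \<in> carrier Q"
  then obtain a where "a \<in> carrier A" "x = coset a" by (rule Q_cases)
  then show "\<exists>y\<in>carrier Q. y \<oplus>\<^bsub>Q\<^esub> x = \<zero>\<^bsub>Q\<^esub>" "\<zero>\<^bsub>Q\<^esub> \<oplus>\<^bsub>Q\<^esub> x = x"
    by (auto simp: Q_add Q_zero C_ops intro!: bexI[of _ "coset (- a)"])
next
  fix x y assume "x \<in> carrier Q" "y \<in> carrier Q"
  then obtain a b where "a \<in> carrier A" "x = coset a" "b \<in> carrier A" "y = coset b"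
    by (elim Q_cases)
  then show "x \<oplus>\<^bsub>Q\<^esub> y \<in> carrier Q" "x \<oplus>\<^bsub>Q\<^esub> y = y \<oplus>\<^bsub>Q\<^esub> x"
    by (simp_all add: Q_add C_ops add.commute)
next
  fix x y z assume "x \<in> carrier Q" "y \<in> carrier Q" "z \<in> carrier Q"
  then obtain a b c where "x = coset a" "y = coset b" "z = coset c" by (elim Q_cases)
  then show "x \<oplus>\<^bsub>Q\<^esub> y \<oplus>\<^bsub>Q\<^esub> z = x \<oplus>\<^bsub>Q\<^esub> (y \<oplus>\<^bsub>Q\<^esub> z)" by (simp add: Q_add add.assoc)
qed (simp add: Q_zero C_ops)

text \<open>\<open>A\<close> need not be a ring: the unit and associative laws are available modulo
  \<open>I\<close> only, which is all that the precursor of a tensor product satisfies.\<close>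

lemma Q_ring: "ring Q"
proof (rule ringI[OF Q_abelian])
  show "Group.monoid Q"
  proof (rule monoidI)
    fix x y z assume "x \<in> carrier Q" "y \<in> carrier Q" "z \<in> carrier Q"
    then obtain a b c where "a \<in> carrier A" "x = coset a" "b \<in> carrier A" "y = coset b"
      "c \<in> carrier A" "z = coset c"
      by (elim Q_cases)
    then show "x \<otimes>\<^bsub>Q\<^esub> y \<otimes>\<^bsub>Q\<^esub> z = x \<otimes>\<^bsub>Q\<^esub> (y \<otimes>\<^bsub>Q\<^esub> z)" "x \<otimes>\<^bsub>Q\<^esub> y \<in> carrier Q"
      using assoc by (simp_all add: Q_mult mult_in coset_eq_iff)
  next
    fix x assume "x \<in> carrier Q"
    then obtain a where "a \<in> carrier A" "x = coset a" by (rule Q_cases)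
    then show "\<one>\<^bsub>Q\<^esub> \<otimes>\<^bsub>Q\<^esub> x = x" "x \<otimes>\<^bsub>Q\<^esub> \<one>\<^bsub>Q\<^esub> = x"
      using one_mult by (simp_all add: Q_one Q_mult one_in coset_eq_iff)
  qed (simp add: Q_one one_in)
next
  fix x y z assume "x \<in> carrier Q" "y \<in> carrier Q" "z \<in> carrier Q"
  then obtain a b c where "a \<in> carrier A" "x = coset a" "b \<in> carrier A" "y = coset b"
      "c \<in> carrier A" "z = coset c"
    by (elim Q_cases)
  then show "(x \<oplus>\<^bsub>Q\<^esub> y) \<otimes>\<^bsub>Q\<^esub> z = x \<otimes>\<^bsub>Q\<^esub> z \<oplus>\<^bsub>Q\<^esub> y \<otimes>\<^bsub>Q\<^esub> z"
    "z \<otimes>\<^bsub>Q\<^esub> (x \<oplus>\<^bsub>Q\<^esub> y) = z \<otimes>\<^bsub>Q\<^esub> x \<oplus>\<^bsub>Q\<^esub> z \<otimes>\<^bsub>Q\<^esub> y"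
    using mult_add by (simp_all add: Q_mult Q_add C_ops)
qed

lemma Q_module: "Module.module complex_ring Q"
proof (rule moduleI[OF _ Q_abelian])
  show "cring complex_ring" by (rule cring_from_type_algebra)
  fix x y z w assume "x \<in> carrier Q" "y \<in> carrier Q"
  then obtain a b where "a \<in> carrier A" "x = coset a" "b \<in> carrier A" "y = coset b"
    by (elim Q_cases)
  then show "z \<odot>\<^bsub>Q\<^esub> x \<in> carrier Q" "(z \<oplus>\<^bsub>complex_ring\<^esub> w) \<odot>\<^bsub>Q\<^esub> x = z \<odot>\<^bsub>Q\<^esub> x \<oplus>\<^bsub>Q\<^esub> w \<odot>\<^bsub>Q\<^esub> x"
    "z \<odot>\<^bsub>Q\<^esub> (x \<oplus>\<^bsub>Q\<^esub> y) = z \<odot>\<^bsub>Q\<^esub> x \<oplus>\<^bsub>Q\<^esub> z \<odot>\<^bsub>Q\<^esub> y"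
    "(z \<otimes>\<^bsub>complex_ring\<^esub> w) \<odot>\<^bsub>Q\<^esub> x = z \<odot>\<^bsub>Q\<^esub> (w \<odot>\<^bsub>Q\<^esub> x)" "\<one>\<^bsub>complex_ring\<^esub> \<odot>\<^bsub>Q\<^esub> x = x"
    by (simp_all add: Q_smult Q_add C_ops ring_of_type_algebra_def sc.scale_right_distrib
      sc.scale_left_distrib)
qed

lemma Q_uminus: "a \<in> carrier A \<Longrightarrow> \<ominus>\<^bsub>Q\<^esub> coset a = coset (- a)"
  by (rule abelian_group.minus_equality[OF Q_abelian])
    (auto simp: Q_carrier Q_simps C_ops)

lemma Q_diff: "a \<in> carrier A \<Longrightarrow> b \<in> carrier A \<Longrightarrow> coset a \<ominus>\<^bsub>Q\<^esub> coset b = coset (a - b)"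
  by (simp add: a_minus_def Q_uminus Q_simps)

text \<open>Even components exist and are unique because \<open>P\<close> descends to the quotient:
  it preserves \<open>I\<close>, fixes even elements modulo \<open>I\<close> and sends odd ones into
  \<open>I\<close>. Thus \<open>a = b + c\<close> modulo \<open>I\<close>, with \<open>b\<close>
  even and \<open>c\<close> odd, forces the class of \<open>b\<close> to be that of
  \<open>P a\<close>.\<close>

theorem superalgebra_Q: "superalgebra Q"
  unfolding superalgebra_def
proof (intro conjI allI ballI)
  show "ring Q" "Module.module complex_ring Q" by (rule Q_ring Q_module)+
  fix z x y assume "x \<in> carrier Q" "y \<in> carrier Q"
  then obtain a b where "a \<in> carrier A" "x = coset a" "b \<in> carrier A" "y = coset b"
    by (elim Q_cases)
  then show "z \<odot>\<^bsub>Q\<^esub> x \<otimes>\<^bsub>Q\<^esub> y = z \<odot>\<^bsub>Q\<^esub> (x \<otimes>\<^bsub>Q\<^esub> y)" "x \<otimes>\<^bsub>Q\<^esub> (z \<odot>\<^bsub>Q\<^esub> y) = z \<odot>\<^bsub>Q\<^esub> (x \<otimes>\<^bsub>Q\<^esub> y)"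
    using mult_scale by (simp_all add: Q_mult Q_smult C_ops mult_in)
next
  fix i
  have sub: "a \<in> carrier A" if "a \<in> part A i" for a using that part_sub by blast
  show "submodule (part Q i) complex_ring Q"
  proof (rule module.submoduleI[OF Q_module])
    show "part Q i \<subseteq> carrier Q" using part_sub[of i] by (auto simp: Q_part Q_carrier)
    show "\<zero>\<^bsub>Q\<^esub> \<in> part Q i" by (simp add: Q_part Q_zero part_ops)
  next
    fix x assume "x \<in> part Q i"
    then obtain a where a: "a \<in> part A i" "x = coset a" by (auto simp: Q_part)
    then show "\<ominus>\<^bsub>Q\<^esub> x \<in> part Q i" "z \<odot>\<^bsub>Q\<^esub> x \<in> part Q i" for z
      using sub by (simp_all add: Q_part Q_uminus Q_smult part_ops)
  next
    fix x y assume "x \<in> part Q i" "y \<in> part Q i"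
    then obtain a b where "a \<in> part A i" "x = coset a" "b \<in> part A i" "y = coset b"
      by (auto simp: Q_part)
    then show "x \<oplus>\<^bsub>Q\<^esub> y \<in> part Q i" by (simp add: Q_part Q_add part_ops)
  qed
next
  fix i j x y assume "x \<in> part Q i" "y \<in> part Q j"
  then obtain a b where ab: "a \<in> part A i" "x = coset a" "b \<in> part A j" "y = coset b"
    by (auto simp: Q_part)
  then have "a \<in> carrier A" "b \<in> carrier A" using part_sub by blast+
  with ab have "x \<otimes>\<^bsub>Q\<^esub> y = coset (a \<otimes> b)" by (simp add: Q_mult)
  then show "x \<otimes>\<^bsub>Q\<^esub> y \<in> part Q (i \<noteq> j)"
    using part_mult[OF ab(1,3)] by (simp add: Q_part)
next
  fix x assume "x \<in> carrier Q"
  then obtain a where a: "x = coset a" "a \<in> carrier A" by (auto simp: Q_carrier)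
  have PC: "P b \<in> carrier A" if "b \<in> carrier A" for b using P_part[OF that] part_sub by auto
  show "\<exists>!b. b \<in> part Q False \<and> x \<ominus>\<^bsub>Q\<^esub> b \<in> part Q True"
  proof (rule ex1I[of _ "coset (P a)"], intro conjI)
    show "coset (P a) \<in> part Q False" using P_part[OF a(2)] by (auto simp: Q_part)
    obtain c where "c \<in> part A True" "a - P a - c \<in> I" using P_part[OF a(2)] by auto
    then have "coset (a - P a) = coset c" "coset c \<in> part Q True" by (auto simp: Q_part coset_eq_iff)
    then show "x \<ominus>\<^bsub>Q\<^esub> coset (P a) \<in> part Q True" using a PC by (simp add: Q_diff)
  next
    fix y assume "y \<in> part Q False \<and> x \<ominus>\<^bsub>Q\<^esub> y \<in> part Q True"
    then obtain b c where b: "b \<in> part A False" "y = coset b" and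
      c: "c \<in> part A True" "x \<ominus>\<^bsub>Q\<^esub> y = coset c"
      by (elim conjE) (unfold Q_part, elim imageE, rule that)
    then have bc: "b \<in> carrier A" "c \<in> carrier A" using part_sub by auto
    have diff: "a - b - c \<in> I" using c(2) a b(2) bc by (simp add: Q_diff coset_eq_iff)
    have "P (a - b) - P c = P (a - b - c)" using P_diff[of "a - b" c] a bc C_ops by simp
    then have "P a - P b - P c \<in> I"
      using P_I[OF diff] P_diff[of a b] a bc by simp
    then have "P a - P b - P c + P c + (P b - b) \<in> I"
      using P_odd[OF c(1)] P_even[OF b(1)] I_ops(2) by blast
    then have "P a - b \<in> I" by simp
    then have "coset (P a) = coset b" by (rule coset_eqI)
    then show "y = coset (P a)" using b(2) by simp
  qed
qed

end

section \<open>Linear extension\<close>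

text \<open>The scalar action is an argument because linear extensions are taken both into free
  vector spaces (\<open>scale\<close>) and into types of class \<open>calg\<close>
  (\<open>cscale\<close>).\<close>

definition lin :: "(complex \<Rightarrow> 'b \<Rightarrow> 'b) \<Rightarrow> ('k \<Rightarrow> 'b) \<Rightarrow> ('k \<Rightarrow>\<^sub>0 complex) \<Rightarrow> 'b::ab_group_add" where
  "lin s f p = (\<Sum>k\<in>Poly_Mapping.keys p. s (Poly_Mapping.lookup p k) (f k))"

context
  fixes s :: "complex \<Rightarrow> 'b \<Rightarrow> 'b::ab_group_add"
  assumes s: "vector_space s"
begin

interpretation s: vector_space s by (fact s)

lemma lin_superset:
  "finite K \<Longrightarrow> Poly_Mapping.keys p \<subseteq> K \<Longrightarrow> lin s f p = (\<Sum>k\<in>K. s (Poly_Mapping.lookup p k) (f k))"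
  unfolding lin_def by (rule sum.mono_neutral_left) (auto simp: in_keys_iff)

lemma lin_add: "lin s f (p + q) = lin s f p + lin s f q"
proof -
  let ?K = "Poly_Mapping.keys p \<union> Poly_Mapping.keys q"
  have "lin s f r = (\<Sum>k\<in>?K. s (Poly_Mapping.lookup r k) (f k))" if "r \<in> {p, q, p + q}" for r
    using that Poly_Mapping.keys_add[of p q] by (intro lin_superset) auto
  then show ?thesis by (simp add: lookup_add s.scale_left_distrib sum.distrib)
qed

lemma lin_scale: "lin s f (scale z p) = s z (lin s f p)"
  using keys_scale_subset[of z p]
  by (simp add: lin_superset[of "Poly_Mapping.keys p"] s.scale_sum_right)

lemma lin_single [simp]: "lin s f (Poly_Mapping.single k z) = s z (f k)"
  by (simp add: lin_superset[of "{k}"])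

lemma lin_zero [simp]: "lin s f 0 = 0"
  by (simp add: lin_def)

lemma lin_uminus: "lin s f (- p) = - lin s f p"
  using lin_scale[of f "-1" p] by simp

lemma lin_diff: "lin s f (p - q) = lin s f p - lin s f q"
  using lin_add[of f p "- q"] by (simp add: lin_uminus)

lemma lin_sum: "lin s f (\<Sum>i\<in>I. g i) = (\<Sum>i\<in>I. lin s f (g i))"
  by (induction I rule: infinite_finite_induct) (simp_all add: lin_add)

lemma lin_in_subspace:
  assumes "s.subspace S" "\<And>k. k \<in> Poly_Mapping.keys p \<Longrightarrow> f k \<in> S"
  shows "lin s f p \<in> S"
  unfolding lin_def using assms by (auto intro!: s.subspace_sum s.subspace_scale)

end

lemma vector_space_cscale: "vector_space (cscale :: complex \<Rightarrow> 'a \<Rightarrow> 'a :: calg)"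
  by standard (simp_all add: cscale_add_left cscale_add_right)

interpretation cs: vector_space "cscale :: complex \<Rightarrow> 'a \<Rightarrow> 'a :: calg"
  by (rule vector_space_cscale)

lemmas clin = lin_add[OF vector_space_cscale] lin_scale[OF vector_space_cscale]
  lin_single[OF vector_space_cscale] lin_zero[OF vector_space_cscale]
  lin_uminus[OF vector_space_cscale] lin_diff[OF vector_space_cscale] lin_sum[OF vector_space_cscale]

lemmas slin = lin_add[OF sc.vector_space_axioms] lin_scale[OF sc.vector_space_axioms]
  lin_single[OF sc.vector_space_axioms] lin_zero[OF sc.vector_space_axioms]
  lin_uminus[OF sc.vector_space_axioms] lin_diff[OF sc.vector_space_axioms]
  lin_sum[OF sc.vector_space_axioms]

lemma sum_single_keys: "(\<Sum>k\<in>Poly_Mapping.keys p. Poly_Mapping.single k (Poly_Mapping.lookup p k)) = p"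
proof (rule poly_mapping_eqI)
  fix k
  have "Poly_Mapping.lookup (\<Sum>k\<in>Poly_Mapping.keys p. Poly_Mapping.single k (Poly_Mapping.lookup p k)) k
      = (\<Sum>k'\<in>Poly_Mapping.keys p. if k' = k then Poly_Mapping.lookup p k' else 0)"
    by (auto simp: lookup_sum lookup_single when_def intro!: sum.cong)
  also have "\<dots> = Poly_Mapping.lookup p k" by (simp add: in_keys_iff)
  finally show "Poly_Mapping.lookup (\<Sum>k\<in>Poly_Mapping.keys p.
    Poly_Mapping.single k (Poly_Mapping.lookup p k)) k = Poly_Mapping.lookup p k" .
qed

text \<open>The summands keep their keys in \<open>S\<close>, so membership in the carrier is
  available in every case of the induction.\<close>

lemma poly_mapping_keys_induct [consumes 1, case_names single add zero]:
  assumes "Poly_Mapping.keys p \<subseteq> S"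
    and single: "\<And>k z. k \<in> S \<Longrightarrow> Q (Poly_Mapping.single k (z :: 'z :: comm_monoid_add))"
    and add: "\<And>p q. Poly_Mapping.keys p \<subseteq> S \<Longrightarrow> Poly_Mapping.keys q \<subseteq> S \<Longrightarrow> Q p \<Longrightarrow> Q q \<Longrightarrow> Q (p + q)"
    and zero: "Q 0"
  shows "Q p"
proof -
  have "Poly_Mapping.keys (\<Sum>k\<in>K. Poly_Mapping.single k (Poly_Mapping.lookup p k)) \<subseteq> S
      \<and> Q (\<Sum>k\<in>K. Poly_Mapping.single k (Poly_Mapping.lookup p k))"
    if "finite K" "K \<subseteq> Poly_Mapping.keys p" for K
    using that
  proof (induction K)
    case empty
    then show ?case using zero by simp
  next
    case (insert k K)
    have "Poly_Mapping.keys (Poly_Mapping.single k (Poly_Mapping.lookup p k)) \<subseteq> S"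
      using insert.prems assms(1) by auto
    moreover have "Q (Poly_Mapping.single k (Poly_Mapping.lookup p k))"
      using insert.prems assms(1) by (intro single) auto
    ultimately show ?case
      using insert add Poly_Mapping.keys_add by (fastforce simp: subset_iff)
  qed
  from this[OF finite_keys subset_refl] show ?thesis by (simp add: sum_single_keys)
qed

section \<open>Algebras given by generators and relations\<close>

lemma single_append: "Poly_Mapping.single (v @ w) (y * z) = Poly_Mapping.single v y * Poly_Mapping.single w (z :: complex)"
  by (simp add: mult_single plus_list_def)

lemma one_list: "(1 :: 'g free) = Poly_Mapping.single [] 1"
  by (simp add: zero_list_def[symmetric])

lemma free_carrier_eq: "free_carrier G = {p. Poly_Mapping.keys p \<subseteq> {w. set w \<subseteq> G}}"
  by (auto simp: free_carrier_def)

lemma subspace_free: "sc.subspace (free_carrier G)"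
  unfolding free_carrier_eq by (rule subspace_keys)

lemma scale_eq_cst: "scale z p = cst z * p"
proof -
  have "scale z p = (\<Sum>k\<in>Poly_Mapping.keys p. scale z (Poly_Mapping.single k (Poly_Mapping.lookup p k)))"
    by (subst sum_single_keys[of p, symmetric]) (simp only: sc.scale_sum_right)
  also have "\<dots> = cst z * p"
    by (subst (3) sum_single_keys[of p, symmetric])
      (simp add: sum_distrib_left cst_def single_append[of "[]", simplified])
  finally show ?thesis .
qed

lemma free_scale:
  "scale z p * q = scale z (p * q)" "p * scale z q = scale z (p * q :: 'g free)"
proof -
  show "scale z p * q = scale z (p * q)" by (simp add: scale_eq_cst mult.assoc)
  have "p * cst z = cst z * p" for p :: "'g free"
  proof -
    have "p * cst z = (\<Sum>k\<in>Poly_Mapping.keys p. Poly_Mapping.single k (Poly_Mapping.lookup p k) * cst z)"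
      by (simp add: sum_distrib_right[symmetric] sum_single_keys)
    also have "\<dots> = (\<Sum>k\<in>Poly_Mapping.keys p. cst z * Poly_Mapping.single k (Poly_Mapping.lookup p k))"
      by (simp add: cst_def single_append[of "[]", simplified, symmetric]
        single_append[of _ "[]", simplified, symmetric] mult.commute)
    also have "\<dots> = cst z * p" by (simp add: sum_distrib_left[symmetric] sum_single_keys)
    finally show ?thesis .
  qed
  then show "p * scale z q = scale z (p * q)" by (simp add: scale_eq_cst mult.assoc[symmetric])
qed

lemma free_carrier_closed [simp]:
  "0 \<in> free_carrier G" "1 \<in> free_carrier G"
  "p \<in> free_carrier G \<Longrightarrow> q \<in> free_carrier G \<Longrightarrow> p + q \<in> free_carrier G"
  "p \<in> free_carrier G \<Longrightarrow> q \<in> free_carrier G \<Longrightarrow> p - q \<in> free_carrier G"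
  "p \<in> free_carrier G \<Longrightarrow> - p \<in> free_carrier G"
  "p \<in> free_carrier G \<Longrightarrow> scale z p \<in> free_carrier G"
  "p \<in> free_carrier G \<Longrightarrow> q \<in> free_carrier G \<Longrightarrow> p * q \<in> free_carrier G"
  "gen g \<in> free_carrier G \<longleftrightarrow> g \<in> G"
  "cst z \<in> free_carrier G"
  "(\<And>i. i \<in> I \<Longrightarrow> f i \<in> free_carrier G) \<Longrightarrow> (\<Sum>i\<in>I. f i) \<in> free_carrier G"
proof -
  note sub = subspace_free[of G]
  show "0 \<in> free_carrier G" "p \<in> free_carrier G \<Longrightarrow> q \<in> free_carrier G \<Longrightarrow> p + q \<in> free_carrier G"
    "p \<in> free_carrier G \<Longrightarrow> q \<in> free_carrier G \<Longrightarrow> p - q \<in> free_carrier G"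
    "p \<in> free_carrier G \<Longrightarrow> - p \<in> free_carrier G" "p \<in> free_carrier G \<Longrightarrow> scale z p \<in> free_carrier G"
    "(\<And>i. i \<in> I \<Longrightarrow> f i \<in> free_carrier G) \<Longrightarrow> (\<Sum>i\<in>I. f i) \<in> free_carrier G"
    using sub by (simp_all add: sc.subspace_0 sc.subspace_add sc.subspace_diff sc.subspace_neg
      sc.subspace_scale sc.subspace_sum)
  show "p \<in> free_carrier G \<Longrightarrow> q \<in> free_carrier G \<Longrightarrow> p * q \<in> free_carrier G"
    using keys_mult[of p q] by (fastforce simp: free_carrier_eq plus_list_def)
qed (auto simp: free_carrier_def gen_def cst_def one_list)

lemma free_carrier_mono: "G \<subseteq> G' \<Longrightarrow> free_carrier G \<subseteq> free_carrier G'"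
  by (auto simp: free_carrier_def)

lemma free_carrier_induct [consumes 1, case_names cst gen add mult]:
  assumes p: "p \<in> free_carrier G"
    and cst: "\<And>z. Q (cst z)" and gen: "\<And>g. g \<in> G \<Longrightarrow> Q (gen g)"
    and add: "\<And>p q. p \<in> free_carrier G \<Longrightarrow> q \<in> free_carrier G \<Longrightarrow> Q p \<Longrightarrow> Q q \<Longrightarrow> Q (p + q)"
    and mult: "\<And>p q. p \<in> free_carrier G \<Longrightarrow> q \<in> free_carrier G \<Longrightarrow> Q p \<Longrightarrow> Q q \<Longrightarrow> Q (p * q)"
  shows "Q p"
proof -
  have word: "Poly_Mapping.single w z \<in> free_carrier G \<and> Q (Poly_Mapping.single w z)"
    if "set w \<subseteq> G" for w z
    using that
  proof (induction w)
    case Nil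
    then show ?case using cst[of z] free_carrier_closed(9)[of z] by (simp add: cst_def)
  next
    case (Cons g w)
    have "Poly_Mapping.single (g # w) z = gen g * Poly_Mapping.single w z"
      using single_append[of "[g]" w 1 z] by (simp add: gen_def)
    then show ?case using Cons mult gen by simp
  qed
  from p have "Poly_Mapping.keys p \<subseteq> {w. set w \<subseteq> G}" by (simp add: free_carrier_eq)
  then show ?thesis
  proof (induction rule: poly_mapping_keys_induct)
    case (single k z)
    then show ?case using word by blast
  next
    case (add p q)
    then show ?case using assms(4) by (simp add: free_carrier_eq)
  next
    case zero
    show ?case using cst[of 0] by (simp add: cst_def)
  qed
qed

abbreviation "F G \<equiv> free_superalgebra odd_gen G"

lemma free_simps [simp]:
  "carrier (F G) = free_carrier G" "monoid.mult (F G) = (*)" "one (F G) = 1" "zero (F G) = 0"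
  "add (F G) = (+)" "module.smult (F G) = scale"
  by (simp_all add: free_superalgebra_def)

definition wpar :: "gens list \<Rightarrow> bool" where "wpar w = odd (length (filter odd_gen w))"

lemma wpar_append [simp]: "wpar (v @ w) = (wpar v \<noteq> wpar w)"
  by (auto simp: wpar_def)

lemma free_part: "part (F G) i = {p. Poly_Mapping.keys p \<subseteq> {w. set w \<subseteq> G \<and> wpar w = i}}"
  by (auto simp: free_superalgebra_def free_carrier_def wpar_def)

lemma free_part_sub: "part (F G) i \<subseteq> free_carrier G"
  by (auto simp: free_part free_carrier_eq)

lemma subspace_free_part: "sc.subspace (part (F G) i)"
  unfolding free_part by (rule subspace_keys)

lemma free_part_mult: "p \<in> part (F G) i \<Longrightarrow> q \<in> part (F G) j \<Longrightarrow> p * q \<in> part (F G) (i \<noteq> j)"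
  using keys_mult[of p q] by (fastforce simp: free_part plus_list_def)

lemma free_part_closed:
  "0 \<in> part (F G) i"
  "p \<in> part (F G) i \<Longrightarrow> q \<in> part (F G) i \<Longrightarrow> p + q \<in> part (F G) i"
  "p \<in> part (F G) i \<Longrightarrow> q \<in> part (F G) i \<Longrightarrow> p - q \<in> part (F G) i"
  "p \<in> part (F G) i \<Longrightarrow> - p \<in> part (F G) i"
  "p \<in> part (F G) i \<Longrightarrow> scale z p \<in> part (F G) i"
  "(\<And>k. k \<in> K \<Longrightarrow> f k \<in> part (F G) i) \<Longrightarrow> (\<Sum>k\<in>K. f k) \<in> part (F G) i"
  "1 \<in> part (F G) False" "cst z \<in> part (F G) False"
  "g \<in> G \<Longrightarrow> gen g \<in> part (F G) (odd_gen g)"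
  using subspace_free_part[of G i]
  by (simp_all add: sc.subspace_0 sc.subspace_add sc.subspace_diff sc.subspace_neg
      sc.subspace_scale sc.subspace_sum)
    (auto simp: free_part one_list wpar_def cst_def gen_def split: if_splits)

text \<open>The projection \<open>P\<close> of \<open>prequot\<close> for presented algebras. Words
  are homogeneous, so dropping the odd ones projects onto the even part.\<close>

definition evp :: "gens free \<Rightarrow> gens free" where
  "evp = lin scale (\<lambda>w. if wpar w then 0 else Poly_Mapping.single w 1)"

lemma evp_even: "p \<in> part (F G) False \<Longrightarrow> evp p = p"
proof -
  assume "p \<in> part (F G) False"
  then have "evp p = (\<Sum>k\<in>Poly_Mapping.keys p. Poly_Mapping.single k (Poly_Mapping.lookup p k))"
    unfolding evp_def lin_def by (intro sum.cong) (auto simp: free_part)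
  then show ?thesis by (simp add: sum_single_keys)
qed

lemma evp_odd: "p \<in> part (F G) True \<Longrightarrow> evp p = 0"
  unfolding evp_def lin_def by (intro sum.neutral) (auto simp: free_part)

lemma evp_part: "p \<in> free_carrier G \<Longrightarrow> evp p \<in> part (F G) False"
  unfolding evp_def
  by (rule lin_in_subspace[OF sc.vector_space_axioms subspace_free_part])
    (auto simp: free_part free_carrier_def)

lemma evp_diff_part: 
  assumes "p \<in> free_carrier G" shows "p - evp p \<in> part (F G) True"
proof -
  have "p - evp p = lin scale (\<lambda>w. if wpar w then Poly_Mapping.single w 1 else 0) p"
    unfolding evp_def lin_def
    by (subst (1) sum_single_keys[of p, symmetric])
      (auto simp: sum_subtractf[symmetric] intro!: sum.cong)
  also have "\<dots> \<in> part (F G) True"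
    by (rule lin_in_subspace[OF sc.vector_space_axioms subspace_free_part])
      (use assms in \<open>auto simp: free_part free_carrier_def\<close>)
  finally show ?thesis .
qed

text \<open>The mixed products are odd and drop out. What remains lies in an ideal as soon as one
  factor does together with its even part.\<close>

lemma evp_mult:
  assumes "p \<in> free_carrier G" "q \<in> free_carrier G"
  shows "evp (p * q) = evp p * evp q + (p - evp p) * (q - evp q)"
proof -
  define p0 p1 q0 q1 where "p0 = evp p" "p1 = p - evp p" "q0 = evp q" "q1 = q - evp q"
  have parts: "p0 \<in> part (F G) False" "q0 \<in> part (F G) False" "p1 \<in> part (F G) True" "q1 \<in> part (F G) True"
    using assms evp_part evp_diff_part by (auto simp: p0_p1_q0_q1_def)
  have eq: "p * q = p0 * q0 + p1 * q1 + (p0 * q1 + p1 * q0)"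
    by (simp add: p0_p1_q0_q1_def algebra_simps)
  have "p0 * q0 + p1 * q1 \<in> part (F G) False" "p0 * q1 + p1 * q0 \<in> part (F G) True"
    using free_part_mult[OF parts(1,2)] free_part_mult[OF parts(3,4)]
      free_part_mult[OF parts(1,4)] free_part_mult[OF parts(3,2)]
    by (auto intro!: free_part_closed)
  then have "evp (p * q) = p0 * q0 + p1 * q1"
    unfolding eq by (subst evp_def, subst slin(1), fold evp_def) (simp add: evp_even evp_odd)
  then show ?thesis by (simp add: p0_p1_q0_q1_def)
qed

lemma ring_free: "ring (F G)"
proof (rule ringI)
  show "abelian_group (F G)"
    by (rule abelian_groupI) (auto simp: add.assoc add.commute intro!: bexI[of _ "- x" for x])
  show "Group.monoid (F G)"
    by (rule monoidI) (auto simp: mult.assoc)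
qed (auto simp: algebra_simps)

text \<open>Homogeneity of the relators is what makes the parity of words well defined on the
  quotient.\<close>

definition homogeneous_pres :: "pres \<Rightarrow> bool" where
  "homogeneous_pres P \<longleftrightarrow> (\<forall>r\<in>snd P. \<exists>i. r \<in> part (F (fst P)) i)"

context
  fixes P :: pres
  assumes P: "homogeneous_pres P"
begin

lemma rels_carrier: "snd P \<subseteq> free_carrier (fst P)"
  using P free_part_sub by (fastforce simp: homogeneous_pres_def)

lemma rels_subset: "snd P \<subseteq> rel_ideal P"
  unfolding rel_ideal_def by (rule ring.genideal_self[OF ring_free]) (simp add: rels_carrier)

lemma ideal_rel: "ideal (rel_ideal P) (F (fst P))"
  unfolding rel_ideal_def by (rule ring.genideal_ideal[OF ring_free]) (simp add: rels_carrier)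

lemma rel_ideal_closed:
  "rel_ideal P \<subseteq> free_carrier (fst P)" "0 \<in> rel_ideal P"
  "x \<in> rel_ideal P \<Longrightarrow> y \<in> rel_ideal P \<Longrightarrow> x + y \<in> rel_ideal P"
  "x \<in> rel_ideal P \<Longrightarrow> a \<in> free_carrier (fst P) \<Longrightarrow> a * x \<in> rel_ideal P"
  "x \<in> rel_ideal P \<Longrightarrow> a \<in> free_carrier (fst P) \<Longrightarrow> x * a \<in> rel_ideal P"
  "x \<in> rel_ideal P \<Longrightarrow> scale z x \<in> rel_ideal P"
  using additive_subgroup.a_subset[OF ideal.axioms(1)[OF ideal_rel]]
    ideal.axioms(1)[OF ideal_rel] ideal.I_l_closed[OF ideal_rel] ideal.I_r_closed[OF ideal_rel]
  by (auto simp: scale_eq_cst dest: additive_subgroup.zero_closed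
      additive_subgroup.a_closed)

lemma subspace_rel_ideal: "sc.subspace (rel_ideal P)"
  using rel_ideal_closed by (intro sc.subspaceI) auto

text \<open>Minimality of the generated ideal, to be used as an induction principle. Additive
  inverses in \<open>J\<close> come from multiplication by \<open>cst (-1)\<close>.\<close>

lemma rel_ideal_least:
  assumes "J \<subseteq> free_carrier (fst P)" "0 \<in> J" "\<And>x y. x \<in> J \<Longrightarrow> y \<in> J \<Longrightarrow> x + y \<in> J"
    and l: "\<And>a x. a \<in> free_carrier (fst P) \<Longrightarrow> x \<in> J \<Longrightarrow> a * x \<in> J"
    and r: "\<And>a x. a \<in> free_carrier (fst P) \<Longrightarrow> x \<in> J \<Longrightarrow> x * a \<in> J"
    and "snd P \<subseteq> J"
  shows "rel_ideal P \<subseteq> J"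
  unfolding rel_ideal_def
proof (rule ring.genideal_minimal[OF ring_free _ \<open>snd P \<subseteq> J\<close>])
  interpret F: ring "F (fst P)" by (rule ring_free)
  have neg: "- x \<in> J" if "x \<in> J" for x
    using l[OF _ that, of "cst (-1)"] by (simp add: scale_eq_cst[symmetric])
  have inv: "\<ominus>\<^bsub>F (fst P)\<^esub> x = - x" if "x \<in> J" for x
    using that assms(1) by (intro F.minus_equality) auto
  show "ideal J (F (fst P))"
  proof (rule idealI[OF ring_free])
    show "subgroup J (add_monoid (F (fst P)))"
      by (rule subgroup.intro) (use assms neg inv in \<open>auto simp: a_inv_def\<close>)
  qed (use l r in auto)
qed

text \<open>The point is that \<open>evp\<close> maps the ideal into itself. The elements of the
  ideal whose even part lies in it again form an ideal by \<open>evp_mult\<close>, and this contains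
  the relators, since the even part of a homogeneous element is the element itself or zero.\<close>

lemma prequot_alg: "prequot (F (fst P)) (rel_ideal P) evp"
proof -
  have "rel_ideal P \<subseteq> {x \<in> rel_ideal P. evp x \<in> rel_ideal P}"
  proof (rule rel_ideal_least)
    have *: "evp (a * x) \<in> rel_ideal P" "evp (x * a) \<in> rel_ideal P"
      if "a \<in> free_carrier (fst P)" "x \<in> rel_ideal P" "evp x \<in> rel_ideal P" for a x
    proof -
      have c: "x \<in> free_carrier (fst P)" using that rel_ideal_closed(1) by auto
      have d: "x - evp x \<in> rel_ideal P" using that(2,3) by (rule sc.subspace_diff[OF subspace_rel_ideal])
      have a: "evp a \<in> free_carrier (fst P)" using evp_part[OF that(1)] free_part_sub by blast
      then have a': "a - evp a \<in> free_carrier (fst P)" using that by simp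
      show "evp (a * x) \<in> rel_ideal P"
        unfolding evp_mult[OF that(1) c] using d a a' that by (intro rel_ideal_closed(3,4))
      show "evp (x * a) \<in> rel_ideal P"
        unfolding evp_mult[OF c that(1)] using d a a' that by (intro rel_ideal_closed(3,5))
    qed
    show "\<And>a x. a \<in> free_carrier (fst P) \<Longrightarrow> x \<in> {x \<in> rel_ideal P. evp x \<in> rel_ideal P} \<Longrightarrow>
        a * x \<in> {x \<in> rel_ideal P. evp x \<in> rel_ideal P}"
      "\<And>a x. a \<in> free_carrier (fst P) \<Longrightarrow> x \<in> {x \<in> rel_ideal P. evp x \<in> rel_ideal P} \<Longrightarrow>
        x * a \<in> {x \<in> rel_ideal P. evp x \<in> rel_ideal P}"
      using * rel_ideal_closed by auto
    show "snd P \<subseteq> {x \<in> rel_ideal P. evp x \<in> rel_ideal P}"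
    proof
      fix r assume r: "r \<in> snd P"
      then obtain i where "r \<in> part (F (fst P)) i" using P by (auto simp: homogeneous_pres_def)
      then have "evp r = r \<or> evp r = 0" using evp_even evp_odd by (cases i) auto
      then show "r \<in> {x \<in> rel_ideal P. evp x \<in> rel_ideal P}"
        using r rels_subset rel_ideal_closed(2) by auto
    qed
  qed (use rel_ideal_closed in \<open>auto simp: evp_def slin\<close>)
  then have PI: "evp x \<in> rel_ideal P" if "x \<in> rel_ideal P" for x using that by auto
  have diff: "\<exists>c\<in>part (F (fst P)) True. p - evp p - c \<in> rel_ideal P" if "p \<in> free_carrier (fst P)" for p
    using evp_diff_part[OF that] rel_ideal_closed(2) by (intro bexI[of _ "p - evp p"]) auto
  show ?thesis
  proof unfold_locales
    fix i j a b assume "a \<in> part (F (fst P)) i" "b \<in> part (F (fst P)) j"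
    then show "a \<otimes>\<^bsub>F (fst P)\<^esub> b \<in> part (F (fst P)) (i \<noteq> j)"
      using free_part_mult by simp
  next
    fix a b assume "a \<in> carrier (F (fst P))" "b \<in> carrier (F (fst P))"
    then show "evp a \<in> part (F (fst P)) False \<and> (\<exists>c\<in>part (F (fst P)) True. a - evp a - c \<in> rel_ideal P)"
      "evp (a - b) = evp a - evp b"
      using evp_part diff by (simp_all add: evp_def slin)
  next
    fix a assume "a \<in> part (F (fst P)) False"
    then show "evp a - a \<in> rel_ideal P" by (simp add: evp_even rel_ideal_closed)
  next
    fix a assume "a \<in> part (F (fst P)) True"
    then show "evp a \<in> rel_ideal P" by (simp add: evp_odd rel_ideal_closed)
  qed (auto simp: subspace_free subspace_rel_ideal rel_ideal_closed algebra_simps free_scale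
    subspace_free_part PI
    intro: rel_ideal_closed(1)[THEN subsetD] free_part_sub[THEN subsetD])
qed

end

context
  fixes P :: pres
  assumes P: "homogeneous_pres P"
begin

interpretation prequot "F (fst P)" "rel_ideal P" evp
  by (rule prequot_alg[OF P])

lemma coset_cls: "coset p = cls P p"
  by (simp add: cls_def coset_def)

lemma alg_Q: "alg P = Q" by (simp add: alg_def)

lemma superalgebra_alg: "superalgebra (alg P)"
  unfolding alg_Q by (rule superalgebra_Q)

lemma alg_carrier: "carrier (alg P) = cls P ` free_carrier (fst P)"
  using Q_carrier by (simp add: alg_Q coset_cls)

lemma alg_part: "part (alg P) i = cls P ` part (F (fst P)) i"
  using Q_part by (simp add: alg_Q coset_cls)

lemma cls_in [simp]: "p \<in> free_carrier (fst P) \<Longrightarrow> cls P p \<in> carrier (alg P)"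
  by (simp add: alg_carrier)

lemma cls_ops:
  "\<one>\<^bsub>alg P\<^esub> = cls P 1" "\<zero>\<^bsub>alg P\<^esub> = cls P 0"
  "cls P p \<oplus>\<^bsub>alg P\<^esub> cls P q = cls P (p + q)"
  "p \<in> free_carrier (fst P) \<Longrightarrow> q \<in> free_carrier (fst P) \<Longrightarrow> cls P p \<otimes>\<^bsub>alg P\<^esub> cls P q = cls P (p * q)"
  "p \<in> free_carrier (fst P) \<Longrightarrow> z \<odot>\<^bsub>alg P\<^esub> cls P p = cls P (scale z p)"
  using Q_one Q_zero Q_add[of p q] Q_mult[of p q] Q_smult[of p z] by (simp_all add: alg_Q coset_cls)

lemma cls_eq_iff: "cls P p = cls P q \<longleftrightarrow> p - q \<in> rel_ideal P"
  using coset_eq_iff by (simp add: coset_cls)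

lemma in_cls_iff: "q \<in> cls P p \<longleftrightarrow> q - p \<in> rel_ideal P"
  using in_coset_iff by (simp add: coset_cls)

lemma cls_rel: "r \<in> snd P \<Longrightarrow> cls P r = \<zero>\<^bsub>alg P\<^esub>"
  using rels_subset[OF P] by (auto simp: cls_ops cls_eq_iff)

end

section \<open>Evaluation of noncommutative polynomials\<close>

text \<open>The empty word goes to \<open>e\<close>, which in the applications is the image of the
  unit of one factor of \<open>prodalg\<close>, not a unit of the whole type.\<close>

definition ev :: "'a \<Rightarrow> ('g \<Rightarrow> 'a) \<Rightarrow> 'g free \<Rightarrow> 'a::calg" where
  "ev e a = lin cscale (\<lambda>w. foldr (\<lambda>g x. a g * x) w e)"

locale corner =
  fixes e :: "'a :: calg" and a :: "'g \<Rightarrow> 'a"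
  assumes e_idem: "e * e = e" and unit_left: "e * a g = a g" and unit_right: "a g * e = a g"
begin

abbreviation "E \<equiv> ev e a"

lemma word_unit: "e * foldr (\<lambda>g x. a g * x) w e = foldr (\<lambda>g x. a g * x) w e"
  by (induction w) (simp_all add: e_idem unit_left mult.assoc[symmetric])

lemma word_append:
  "foldr (\<lambda>g x. a g * x) (v @ w) e = foldr (\<lambda>g x. a g * x) v e * foldr (\<lambda>g x. a g * x) w e"
  by (induction v) (simp_all add: word_unit mult.assoc)

lemma E_add [simp]: "E (p + q) = E p + E q"
  and E_diff [simp]: "E (p - q) = E p - E q"
  and E_uminus [simp]: "E (- p) = - E p"
  and E_scale [simp]: "E (scale z p) = z *\<^sub>c E p"
  and E_zero [simp]: "E 0 = 0"
  and E_sum [simp]: "E (\<Sum>i\<in>I. f i) = (\<Sum>i\<in>I. E (f i))"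
  by (simp_all add: ev_def clin)

lemma E_single: "E (Poly_Mapping.single w z) = z *\<^sub>c foldr (\<lambda>g x. a g * x) w e"
  by (simp add: ev_def clin)

lemma E_cst [simp]: "E (cst z) = z *\<^sub>c e"
  by (simp add: cst_def E_single)

lemma E_one [simp]: "E 1 = e"
  by (simp add: one_list E_single)

lemma E_gen [simp]: "E (gen g) = a g"
  by (simp add: gen_def E_single unit_right)

lemma E_mult [simp]: "E (p * q) = E p * E q"
proof -
  have single: "E (Poly_Mapping.single v y * Poly_Mapping.single w z) =
      E (Poly_Mapping.single v y) * E (Poly_Mapping.single w z)" for v w y z
    by (simp add: single_append[symmetric] E_single word_append del: foldr_append)
  have "p * q = (\<Sum>v\<in>Poly_Mapping.keys p. \<Sum>w\<in>Poly_Mapping.keys q.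
      Poly_Mapping.single v (Poly_Mapping.lookup p v) * Poly_Mapping.single w (Poly_Mapping.lookup q w))"
    by (simp add: sum_product[symmetric] sum_single_keys)
  then have "E (p * q) = (\<Sum>v\<in>Poly_Mapping.keys p. E (Poly_Mapping.single v (Poly_Mapping.lookup p v))) *
     (\<Sum>w\<in>Poly_Mapping.keys q. E (Poly_Mapping.single w (Poly_Mapping.lookup q w)))"
    by (simp add: single sum_product)
  then show ?thesis by (simp add: E_sum[symmetric] sum_single_keys del: E_sum)
qed

lemma E_unit [simp]: "e * E p = E p" "E p * e = E p"
  using E_mult[of 1 p] E_mult[of p 1] by simp_all

end

text \<open>\<open>h\<close> applies \<open>f\<close> to a chosen representative; the choice is
  immaterial because \<open>f\<close> vanishes on \<open>I\<close>.\<close>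

lemma (in prequot) Q_hom_ex:
  assumes R: "superalgebra R"
    and closed: "\<And>p. p \<in> carrier A \<Longrightarrow> f p \<in> carrier R"
    and add: "\<And>p q. p \<in> carrier A \<Longrightarrow> q \<in> carrier A \<Longrightarrow> f (p + q) = f p \<oplus>\<^bsub>R\<^esub> f q"
    and scale: "\<And>p z. p \<in> carrier A \<Longrightarrow> f (scale z p) = z \<odot>\<^bsub>R\<^esub> f p"
    and mult: "\<And>p q. p \<in> carrier A \<Longrightarrow> q \<in> carrier A \<Longrightarrow> f (p \<otimes> q) = f p \<otimes>\<^bsub>R\<^esub> f q"
    and one: "f \<one> = \<one>\<^bsub>R\<^esub>"
    and kill: "\<And>x. x \<in> I \<Longrightarrow> f x = \<zero>\<^bsub>R\<^esub>"
    and parts: "\<And>p i. p \<in> part A i \<Longrightarrow> f p \<in> part R i"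
  shows "\<exists>h. salg_hom Q R h \<and> (\<forall>p\<in>carrier A. h (coset p) = f p)"
proof -
  define h where "h K = f (SOME p. p \<in> carrier A \<and> K = coset p)" for K
  have h: "h (coset p) = f p" if p: "p \<in> carrier A" for p
  proof -
    define q where "q = (SOME q. q \<in> carrier A \<and> coset p = coset q)"
    have "q \<in> carrier A \<and> coset p = coset q"
      unfolding q_def by (rule someI[of _ p]) (simp add: p)
    then have q: "q \<in> carrier A" "p - q \<in> I" by (simp_all add: coset_eq_iff)
    have "f p = f (q + (p - q))" by simp
    also have "\<dots> = f q \<oplus>\<^bsub>R\<^esub> f (p - q)" using q I_subset by (intro add) auto
    also have "\<dots> = f q"
      using kill[OF q(2)] closed[OF q(1)] superalgebraD(3)[OF R] by (simp add: abelian_group_def abelian_monoid.r_zero)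
    finally show ?thesis by (simp add: h_def q_def)
  qed
  have "salg_hom Q R h"
    unfolding salg_hom_def ring_hom_def
  proof (intro conjI allI ballI CollectI impI)
    show "h \<in> carrier Q \<rightarrow> carrier R" using h closed by (auto simp: Q_carrier)
    show "h \<one>\<^bsub>Q\<^esub> = \<one>\<^bsub>R\<^esub>" using h one by (simp add: Q_one one_in)
  next
    fix x y assume "x \<in> carrier Q \<and> y \<in> carrier Q"
    then obtain a b where "a \<in> carrier A" "x = coset a" "b \<in> carrier A" "y = coset b"
      by (auto simp: Q_carrier)
    then show "h (x \<otimes>\<^bsub>Q\<^esub> y) = h x \<otimes>\<^bsub>R\<^esub> h y" "h (x \<oplus>\<^bsub>Q\<^esub> y) = h x \<oplus>\<^bsub>R\<^esub> h y"
      using h mult add by (simp_all add: Q_simps mult_in C_ops)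
  next
    fix z x assume "x \<in> carrier Q"
    then obtain a where "a \<in> carrier A" "x = coset a" by (rule Q_cases)
    then show "h (z \<odot>\<^bsub>Q\<^esub> x) = z \<odot>\<^bsub>R\<^esub> h x" using h scale by (simp add: Q_smult C_ops)
  next
    fix i
    show "h ` part Q i \<subseteq> part R i" using h parts part_sub by (fastforce simp: Q_part)
  qed
  with h show ?thesis by blast
qed

section \<open>Homomorphisms from algebras given by generators and relations\<close>

lemma emb_one: 
  assumes "superalgebra R" 
  shows "x \<in> carrier R \<Longrightarrow> emb R \<one>\<^bsub>R\<^esub> * emb R x = emb R x" 
    "x \<in> carrier R \<Longrightarrow> emb R x * emb R \<one>\<^bsub>R\<^esub> = emb R x"
  using monoid.l_one[OF superalgebraD(4)[OF assms]] monoid.r_one[OF superalgebraD(4)[OF assms]]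
  by (simp_all add: emb_simps(2)[symmetric] assms)

text \<open>Zero outside \<open>G\<close> makes the unit laws of \<open>corner\<close> hold for
  every generator, whatever \<open>a\<close> does there.\<close>

definition hat :: "'c salg \<Rightarrow> 'g set \<Rightarrow> ('g \<Rightarrow> 'c) \<Rightarrow> 'g \<Rightarrow> 'c prodalg" where
  "hat R G a g = (if g \<in> G then emb R (a g) else 0)"

lemma corner_hat:
  assumes "superalgebra R" "\<And>g. g \<in> G \<Longrightarrow> a g \<in> carrier R"
  shows "corner (emb R \<one>\<^bsub>R\<^esub>) (hat R G a)"
  using assms by unfold_locales (auto simp: hat_def emb_one)

text \<open>Universal property of a presentation. Polynomials are evaluated in
  \<open>prodalg\<close> and read off at the factor \<open>R\<close>; the evaluation kills the
  relators, hence the ideal they generate.\<close>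

theorem alg_hom_ex:
  assumes P: "homogeneous_pres P" and R: "superalgebra R"
    and a: "\<And>g. g \<in> fst P \<Longrightarrow> a g \<in> part R (odd_gen g)"
    and rels: "\<And>r. r \<in> snd P \<Longrightarrow> ev (emb R \<one>\<^bsub>R\<^esub>) (hat R (fst P) a) r = 0"
  shows "\<exists>h. salg_hom (alg P) R h \<and> (\<forall>g\<in>fst P. h (cls P (gen g)) = a g)"
proof -
  interpret prequot "F (fst P)" "rel_ideal P" evp by (rule prequot_alg[OF P])
  let ?e = "emb R \<one>\<^bsub>R\<^esub>" and ?a = "hat R (fst P) a"
  have ac: "a g \<in> carrier R" if "g \<in> fst P" for g using part_closed(1)[OF R a[OF that]] .
  interpret corner ?e ?a using R ac by (rule corner_hat)
  define f where "f p = Rep_prodalg (E p) R" for p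
  have kill: "E x = 0" if "x \<in> rel_ideal P" for x
  proof -
    have "rel_ideal P \<subseteq> {p \<in> free_carrier (fst P). E p = 0}"
      using rels rels_carrier[OF P] by (intro rel_ideal_least[OF P]) auto
    then show ?thesis using that by auto
  qed
  have one: "\<one>\<^bsub>R\<^esub> \<in> carrier R" using R by simp
  \<comment> \<open>The parity of an evaluated word; the empty word relies on the unit of
    \<open>R\<close> being even.\<close>
  have word: "Rep_prodalg (foldr (\<lambda>g x. ?a g * x) w ?e) R \<in> part R (wpar w)" if "set w \<subseteq> fst P" for w
    using that
  proof (induction w)
    case Nil
    show ?case using R one by (simp add: wpar_def part_one)
  next
    case (Cons g w)
    have "a g \<otimes>\<^bsub>R\<^esub> Rep_prodalg (foldr (\<lambda>g x. ?a g * x) w ?e) R \<in> part R (odd_gen g \<noteq> wpar w)"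
      using Cons a by (intro superalgebraD(9)[OF R]) auto
    moreover have "wpar (g # w) = (odd_gen g \<noteq> wpar w)" by (auto simp: wpar_def)
    ultimately show ?case using Cons.prems ac R by (simp add: Rep_prodalg_ops hat_def)
  qed
  have parts: "f p \<in> part R i" if "p \<in> part (F (fst P)) i" for p i
  proof -
    have "Poly_Mapping.keys p \<subseteq> {w. set w \<subseteq> fst P \<and> wpar w = i}" using that by (simp add: free_part)
    then show ?thesis
    proof (induction rule: poly_mapping_keys_induct)
      case (single k z)
      then show ?case using word[of k] part_closed(4)[OF R] R
        by (auto simp: f_def E_single Rep_prodalg_ops)
    qed (use R part_closed(2,5)[OF R] in \<open>auto simp: f_def Rep_prodalg_ops\<close>)
  qed
  have "\<exists>h. salg_hom Q R h \<and> (\<forall>p\<in>carrier (F (fst P)). h (coset p) = f p)"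
    by (rule Q_hom_ex[OF R]) (use R one kill parts in \<open>auto simp: f_def Rep_prodalg_ops\<close>)
  then obtain h where h: "salg_hom Q R h" "\<And>p. p \<in> free_carrier (fst P) \<Longrightarrow> h (coset p) = f p" by auto
  have "h (cls P (gen g)) = a g" if "g \<in> fst P" for g
    using that h(2)[of "gen g"] R ac by (simp add: coset_cls[OF P] f_def hat_def)
  then show ?thesis using h(1) by (auto simp: alg_Q[OF P])
qed

text \<open>Conversely, every homomorphism is an evaluation at the images of the generators. So it
  is determined by them, and each relation of \<open>P\<close> becomes an identity between these
  images.\<close>

theorem alg_hom_ev:
  assumes P: "homogeneous_pres P" and R: "superalgebra R" and h: "salg_hom (alg P) R h"
    and p: "p \<in> free_carrier (fst P)"
  shows "emb R (h (cls P p)) = ev (emb R \<one>\<^bsub>R\<^esub>) (hat R (fst P) (\<lambda>g. h (cls P (gen g)))) p"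
proof -
  have hc: "h (cls P q) \<in> carrier R" if "q \<in> free_carrier (fst P)" for q
    using that cls_in[OF P] salg_homD(1)[OF h] by blast
  interpret corner "emb R \<one>\<^bsub>R\<^esub>" "hat R (fst P) (\<lambda>g. h (cls P (gen g)))"
    using R hc by (intro corner_hat) auto
  from p show ?thesis
  proof (induction rule: free_carrier_induct)
    case (cst z)
    have "cls P (cst z) = z \<odot>\<^bsub>alg P\<^esub> \<one>\<^bsub>alg P\<^esub>" by (simp add: cls_ops[OF P] scale_eq_cst)
    then show ?case
      using salg_homD(4)[OF h] salg_homD(5)[OF h, of "\<one>\<^bsub>alg P\<^esub>" z] superalgebra_alg[OF P] R
      by (simp add: emb_simps)
  next
    case (gen g)
    then show ?case unfolding E_gen by (simp add: hat_def)
  next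
    case (add p q)
    have "h (cls P (p + q)) = h (cls P p) \<oplus>\<^bsub>R\<^esub> h (cls P q)"
      using salg_homD(2)[OF h cls_in[OF P add(1)] cls_in[OF P add(2)]] by (simp add: cls_ops[OF P])
    then show ?case using add hc R by (simp add: emb_simps)
  next
    case (mult p q)
    have "h (cls P (p * q)) = h (cls P p) \<otimes>\<^bsub>R\<^esub> h (cls P q)"
      using salg_homD(3)[OF h cls_in[OF P mult(1)] cls_in[OF P mult(2)]] mult(1,2) by (simp add: cls_ops[OF P])
    then show ?case using mult hc R by (simp add: emb_simps)
  qed
qed

lemma alg_hom_unique:
  fixes R :: "'c salg"
  assumes P: "homogeneous_pres P" and R: "superalgebra R" and h: "salg_hom (alg P) R h" "salg_hom (alg P) R h'"
    and eq: "\<And>g. g \<in> fst P \<Longrightarrow> h (cls P (gen g)) = h' (cls P (gen g))" and x: "x \<in> carrier (alg P)"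
  shows "h x = h' x"
proof -
  obtain p where p: "p \<in> free_carrier (fst P)" "x = cls P p" using x by (auto simp: alg_carrier[OF P])
  have "hat R (fst P) (\<lambda>g. h (cls P (gen g))) = hat R (fst P) (\<lambda>g. h' (cls P (gen g)))"
    using eq by (auto simp: hat_def)
  then have "emb R (h x) = emb R (h' x)"
    using alg_hom_ev[OF P R h(1) p(1)] alg_hom_ev[OF P R h(2) p(1)] p(2) by simp
  then show ?thesis using salg_homD(1)[OF h(1) x] salg_homD(1)[OF h(2) x] emb_inject[OF R] by simp
qed

lemma rel_ideal_mono:
  assumes P: "homogeneous_pres P" and P0: "homogeneous_pres P0"
    and "fst P0 \<subseteq> fst P" "snd P0 \<subseteq> snd P"
  shows "rel_ideal P0 \<subseteq> rel_ideal P"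
proof -
  have "free_carrier (fst P0) \<subseteq> free_carrier (fst P)" using assms(3) by (rule free_carrier_mono)
  \<comment> \<open>The candidate ideal is cut down to the smaller free algebra, inside which
    \<open>rel_ideal_least\<close> works.\<close>
  then have "rel_ideal P0 \<subseteq> {x \<in> free_carrier (fst P0). x \<in> rel_ideal P}"
    using rel_ideal_closed[OF P] rels_subset[OF P] rels_carrier[OF P0] assms(4)
    by (intro rel_ideal_least[OF P0]) auto
  then show ?thesis by auto
qed

text \<open>\<open>canon\<close> is a union over all representatives; it collapses to one class
  because the relations of \<open>P0\<close> are among those of \<open>P\<close>.\<close>

lemma canon_cls:
  assumes P: "homogeneous_pres P" and P0: "homogeneous_pres P0"
    and "fst P0 \<subseteq> fst P" "snd P0 \<subseteq> snd P"
  shows "canon P (cls P0 p) = cls P p"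
proof -
  have "cls P q = cls P p" if "q \<in> cls P0 p" for q
    using that rel_ideal_mono[OF assms] by (auto simp: cls_eq_iff[OF P] in_cls_iff[OF P0])
  moreover have "p \<in> cls P0 p" using rel_ideal_closed(2)[OF P0] by (simp add: in_cls_iff[OF P0])
  ultimately show ?thesis unfolding canon_def by blast
qed

lemma canon_hom:
  assumes P: "homogeneous_pres P" and P0: "homogeneous_pres P0"
    and sub: "fst P0 \<subseteq> fst P" "snd P0 \<subseteq> snd P"
  shows "salg_hom (alg P0) (alg P) (canon P)"
proof -
  note c = canon_cls[OF assms]
  have fc: "free_carrier (fst P0) \<subseteq> free_carrier (fst P)" using sub(1) by (rule free_carrier_mono)
  have fp: "part (F (fst P0)) i \<subseteq> part (F (fst P)) i" for i using sub(1) by (auto simp: free_part)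
  show ?thesis
    unfolding salg_hom_def ring_hom_def
  proof (intro conjI allI ballI CollectI impI)
    show "canon P \<in> carrier (alg P0) \<rightarrow> carrier (alg P)"
      using fc by (auto simp: alg_carrier[OF P0] c cls_in[OF P])
    show "canon P \<one>\<^bsub>alg P0\<^esub> = \<one>\<^bsub>alg P\<^esub>" by (simp add: cls_ops[OF P0] cls_ops[OF P] c)
  next
    fix x y assume "x \<in> carrier (alg P0) \<and> y \<in> carrier (alg P0)"
    then obtain p q where pq: "p \<in> free_carrier (fst P0)" "x = cls P0 p" "q \<in> free_carrier (fst P0)" "y = cls P0 q"
      by (auto simp: alg_carrier[OF P0])
    then have "p \<in> free_carrier (fst P)" "q \<in> free_carrier (fst P)" using fc by auto
    then show "canon P (x \<otimes>\<^bsub>alg P0\<^esub> y) = canon P x \<otimes>\<^bsub>alg P\<^esub> canon P y"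
      "canon P (x \<oplus>\<^bsub>alg P0\<^esub> y) = canon P x \<oplus>\<^bsub>alg P\<^esub> canon P y"
      using pq by (simp_all add: cls_ops[OF P0] cls_ops[OF P] c)
  next
    fix z x assume "x \<in> carrier (alg P0)"
    then obtain p where p: "p \<in> free_carrier (fst P0)" "x = cls P0 p"
      by (auto simp: alg_carrier[OF P0])
    then have "p \<in> free_carrier (fst P)" using fc by auto
    then show "canon P (z \<odot>\<^bsub>alg P0\<^esub> x) = z \<odot>\<^bsub>alg P\<^esub> canon P x"
      using p by (simp add: cls_ops[OF P0] cls_ops[OF P] c)
  next
    fix i
    show "canon P ` part (alg P0) i \<subseteq> part (alg P) i"
      using fp[of i] by (auto simp: alg_part[OF P0] alg_part[OF P] c intro!: imageI)
  qed
qed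

section \<open>Tensor products of superalgebras\<close>

lemma salg_distrib:
  assumes "superalgebra R" "x \<in> carrier R" "y \<in> carrier R" "z \<in> carrier R"
  shows "(x \<oplus>\<^bsub>R\<^esub> y) \<otimes>\<^bsub>R\<^esub> z = x \<otimes>\<^bsub>R\<^esub> z \<oplus>\<^bsub>R\<^esub> y \<otimes>\<^bsub>R\<^esub> z" "z \<otimes>\<^bsub>R\<^esub> (x \<oplus>\<^bsub>R\<^esub> y) = z \<otimes>\<^bsub>R\<^esub> x \<oplus>\<^bsub>R\<^esub> z \<otimes>\<^bsub>R\<^esub> y"
  using ring.ring_simprules(13,23)[OF superalgebraD(1)[OF assms(1)]] assms(2-) by auto

lemma salg_null:
  fixes R :: "'c salg"
  assumes "superalgebra R" "x \<in> carrier R"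
  shows "\<zero>\<^bsub>R\<^esub> \<otimes>\<^bsub>R\<^esub> x = \<zero>\<^bsub>R\<^esub>" "x \<otimes>\<^bsub>R\<^esub> \<zero>\<^bsub>R\<^esub> = \<zero>\<^bsub>R\<^esub>"
  using assms by (simp_all add: emb_inject[OF assms(1), symmetric] emb_simps)

lemma lin_fun_diff:
  assumes "vector_space s" shows "lin s f p - lin s g p = lin s (\<lambda>k. f k - g k) p"
proof -
  interpret vector_space s by fact
  show ?thesis by (simp add: lin_def sum_subtractf scale_right_diff_distrib)
qed

lemma lin_fun_scale: 
  assumes "vector_space s" shows "s z (lin s f p) = lin s (\<lambda>k. s z (f k)) p"
proof -
  interpret vector_space s by fact
  show ?thesis by (simp add: lin_def scale_sum_right mult.commute)
qed

locale tensor_pair =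
  fixes A :: "'a salg" and B :: "'b salg"
  assumes A: "superalgebra A" and B: "superalgebra B"
begin

text \<open>Bilinearity modulo a subspace: \<open>S = {0}\<close> is used for maps out of the tensor
  product, \<open>S = N\<close> for operations on representatives.\<close>

definition bil :: "(complex \<Rightarrow> 'v \<Rightarrow> 'v) \<Rightarrow> 'v set \<Rightarrow> ('a \<times> 'b \<Rightarrow> 'v::ab_group_add) \<Rightarrow> bool" where
  "bil s S f \<longleftrightarrow> (\<forall>a\<in>carrier A. \<forall>b\<in>carrier B.
     (\<forall>a'\<in>carrier A. f (a \<oplus>\<^bsub>A\<^esub> a', b) - f (a, b) - f (a', b) \<in> S) \<and>
     (\<forall>b'\<in>carrier B. f (a, b \<oplus>\<^bsub>B\<^esub> b') - f (a, b) - f (a, b') \<in> S) \<and>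
     (\<forall>z. f (z \<odot>\<^bsub>A\<^esub> a, b) - s z (f (a, b)) \<in> S \<and> f (a, z \<odot>\<^bsub>B\<^esub> b) - s z (f (a, b)) \<in> S))"

abbreviation "N \<equiv> bilinear_span A B"
abbreviation "dl a b \<equiv> Poly_Mapping.single (a, b) (1 :: complex)"
abbreviation "C \<equiv> {p :: 'a \<times> 'b \<Rightarrow>\<^sub>0 complex. Poly_Mapping.keys p \<subseteq> carrier A \<times> carrier B}"

text \<open>The preimage of \<open>S\<close> under the linear extension is a subspace, and
  bilinearity modulo \<open>S\<close> puts the spanning elements of \<open>N\<close> into
  it.\<close>

lemma lin_bil:
  assumes s: "vector_space s" and S: "module.subspace s S" and f: "bil s S f" and x: "x \<in> N"
  shows "lin s f x \<in> S"
proof -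
  interpret s: vector_space s by fact
  note L = lin_add[OF s] lin_diff[OF s] lin_scale[OF s] lin_single[OF s] lin_zero[OF s]
  have sub: "sc.subspace {x. lin s f x \<in> S}"
    using S s.subspace_0[OF S] s.subspace_add[OF S] s.subspace_scale[OF S]
    by (intro sc.subspaceI) (auto simp: L)
  have "N \<subseteq> {x. lin s f x \<in> S}"
    unfolding bilinear_span_def Let_def
    by (rule sc.span_minimal[OF _ sub]) (use f in \<open>auto simp: L bil_def simp del: scale_single\<close>)
  then show ?thesis using x by auto
qed

lemma subspace_N: "sc.subspace N"
  unfolding bilinear_span_def by (rule sc.subspace_span)

lemma N_single_one: "bil scale N (\<lambda>(a, b). dl a b)"
  unfolding bil_def bilinear_span_def Let_def case_prod_conv
  by (intro ballI conjI allI sc.span_base) auto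

lemma N_single: "bil scale N (\<lambda>(a, b). Poly_Mapping.single (a, b) z)"
proof -
  note one = N_single_one[unfolded bil_def case_prod_conv, rule_format]
  have eq: "Poly_Mapping.single (a, b) z = scale z (dl a b)" for a and b by simp
  have sw: "scale z (scale w p) = scale w (scale z p)" for w and p :: "'a \<times> 'b \<Rightarrow>\<^sub>0 complex"
    by (simp add: mult.commute)
  have sub1: "scale z p - scale z q \<in> N" if "p - q \<in> N" for p q
    using sc.subspace_scale[OF subspace_N that, of z] by (simp add: sc.scale_right_diff_distrib)
  have sub2: "scale z p - scale z q - scale z r \<in> N" if "p - q - r \<in> N" for p q r
    using sc.subspace_scale[OF subspace_N that, of z] by (simp add: sc.scale_right_diff_distrib)
  show ?thesis
    unfolding bil_def case_prod_conv
  proof (intro ballI conjI allI)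
    fix a b w assume ab: "a \<in> carrier A" "b \<in> carrier B"
    show "Poly_Mapping.single (a \<oplus>\<^bsub>A\<^esub> a', b) z - Poly_Mapping.single (a, b) z - Poly_Mapping.single (a', b) z \<in> N"
      if "a' \<in> carrier A" for a' unfolding eq by (rule sub2) (use one ab that in blast)
    show "Poly_Mapping.single (a, b \<oplus>\<^bsub>B\<^esub> b') z - Poly_Mapping.single (a, b) z - Poly_Mapping.single (a, b') z \<in> N"
      if "b' \<in> carrier B" for b' unfolding eq by (rule sub2) (use one ab that in blast)
    show "Poly_Mapping.single (w \<odot>\<^bsub>A\<^esub> a, b) z - scale w (Poly_Mapping.single (a, b) z) \<in> N"
      unfolding eq sw[of w, symmetric] by (rule sub1) (use one ab in blast)
    show "Poly_Mapping.single (a, w \<odot>\<^bsub>B\<^esub> b) z - scale w (Poly_Mapping.single (a, b) z) \<in> N"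
      unfolding eq sw[of w, symmetric] by (rule sub1) (use one ab in blast)
  qed
qed

definition cong (infix "\<approx>" 50) where "p \<approx> q \<longleftrightarrow> p - q \<in> N"

lemma cong_refl [simp]: "p \<approx> p" by (simp add: cong_def sc.subspace_0[OF subspace_N])

lemma cong_sym: "p \<approx> q \<Longrightarrow> q \<approx> p"
  using sc.subspace_neg[OF subspace_N, of "p - q"] by (simp add: cong_def)

lemma cong_trans [trans]: "p \<approx> q \<Longrightarrow> q \<approx> r \<Longrightarrow> p \<approx> r"
  using sc.subspace_add[OF subspace_N, of "p - q" "q - r"] by (simp add: cong_def)

lemma cong_eq_trans [trans]: "p \<approx> q \<Longrightarrow> q = r \<Longrightarrow> p \<approx> r" "p = q \<Longrightarrow> q \<approx> r \<Longrightarrow> p \<approx> r"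
  by simp_all

lemma cong_add: "p \<approx> q \<Longrightarrow> p' \<approx> q' \<Longrightarrow> p + p' \<approx> q + q'"
  using sc.subspace_add[OF subspace_N, of "p - q" "p' - q'"] by (simp add: cong_def algebra_simps)

lemma cong_scale: "p \<approx> q \<Longrightarrow> scale z p \<approx> scale z q"
  using sc.subspace_scale[OF subspace_N, of "p - q" z] by (simp add: cong_def sc.scale_right_diff_distrib)

lemma cong_sum: "(\<And>i. i \<in> I \<Longrightarrow> f i \<approx> g i) \<Longrightarrow> sum f I \<approx> sum g I"
  using sc.subspace_sum[OF subspace_N, of I "\<lambda>i. f i - g i"] by (simp add: cong_def sum_subtractf)

lemma single_add_left: "a \<in> carrier A \<Longrightarrow> a' \<in> carrier A \<Longrightarrow> b \<in> carrier B \<Longrightarrow>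
    Poly_Mapping.single (a \<oplus>\<^bsub>A\<^esub> a', b) z \<approx> Poly_Mapping.single (a, b) z + Poly_Mapping.single (a', b) z"
  and single_add_right: "a \<in> carrier A \<Longrightarrow> b \<in> carrier B \<Longrightarrow> b' \<in> carrier B \<Longrightarrow>
    Poly_Mapping.single (a, b \<oplus>\<^bsub>B\<^esub> b') z \<approx> Poly_Mapping.single (a, b) z + Poly_Mapping.single (a, b') z"
  and single_scale_left: "a \<in> carrier A \<Longrightarrow> b \<in> carrier B \<Longrightarrow>
    Poly_Mapping.single (w \<odot>\<^bsub>A\<^esub> a, b) z \<approx> Poly_Mapping.single (a, b) (w * z)"
  and single_scale_right: "a \<in> carrier A \<Longrightarrow> b \<in> carrier B \<Longrightarrow>
    Poly_Mapping.single (a, w \<odot>\<^bsub>B\<^esub> b) z \<approx> Poly_Mapping.single (a, b) (w * z)"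
  using N_single[of z] by (auto simp: bil_def cong_def diff_diff_eq)

lemma single_zero_left: "b \<in> carrier B \<Longrightarrow> Poly_Mapping.single (\<zero>\<^bsub>A\<^esub>, b) z \<approx> 0"
  using single_scale_left[of "\<zero>\<^bsub>A\<^esub>" b 0 z] A by (simp add: salg_smult)

lemma single_zero_right: "a \<in> carrier A \<Longrightarrow> Poly_Mapping.single (a, \<zero>\<^bsub>B\<^esub>) z \<approx> 0"
  using single_scale_right[of a "\<zero>\<^bsub>B\<^esub>" 0 z] B by (simp add: salg_smult)

lemma single_decompose:
  assumes "a \<in> carrier A" "b \<in> carrier B"
  shows "Poly_Mapping.single (a, b) z \<approx>
    (\<Sum>i\<in>UNIV. \<Sum>j\<in>UNIV. Poly_Mapping.single (hcomp A i a, hcomp B j b) z)"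
proof -
  note h = hcomp_carrier[OF A] hcomp_carrier[OF B]
  have b: "Poly_Mapping.single (a', b) z \<approx>
      Poly_Mapping.single (a', hcomp B False b) z + Poly_Mapping.single (a', hcomp B True b) z"
    if "a' \<in> carrier A" for a'
    using single_add_right[of a' "hcomp B False b" "hcomp B True b" z] that assms h
      hcomp_decompose[OF B assms(2), of False] by simp
  have "Poly_Mapping.single (a, b) z \<approx>
      Poly_Mapping.single (hcomp A False a, b) z + Poly_Mapping.single (hcomp A True a, b) z"
    using single_add_left[of "hcomp A False a" "hcomp A True a" b z] assms h
      hcomp_decompose[OF A assms(1), of False] by simp
  also have "\<dots> \<approx> (\<Sum>i\<in>UNIV. \<Sum>j\<in>UNIV. Poly_Mapping.single (hcomp A i a, hcomp B j b) z)"
    using cong_add[OF b[of "hcomp A False a"] b[of "hcomp A True a"]] assms h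
    by (simp add: UNIV_bool ac_simps)
  finally show ?thesis .
qed

text \<open>Only the inner factors, the second one of \<open>x\<close> and the first one of
  \<open>y\<close>, are split by parity, as only they enter the sign rule.\<close>

definition tm :: "'a \<times> 'b \<Rightarrow> 'a \<times> 'b \<Rightarrow> ('a \<times> 'b \<Rightarrow>\<^sub>0 complex)" where
  "tm x y = (\<Sum>i\<in>UNIV. \<Sum>j\<in>UNIV.
     Poly_Mapping.single (fst x \<otimes>\<^bsub>A\<^esub> hcomp A j (fst y), hcomp B i (snd x) \<otimes>\<^bsub>B\<^esub> snd y) (if i \<and> j then -1 else 1))"

definition mul where "mul p q = lin scale (\<lambda>x. lin scale (tm x) q) p"

lemma tensor_mult: "p \<otimes>\<^bsub>pre_tensor A B\<^esub> q = mul p q"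
  unfolding pre_tensor_def mul_def lin_def tm_def sc.scale_sum_right case_prod_beta scale_single
  by (simp, intro sum.cong refl) simp

lemma pre_simps [simp]:
  "carrier (pre_tensor A B) = C" "add (pre_tensor A B) = (+)" "zero (pre_tensor A B) = 0"
  "module.smult (pre_tensor A B) = scale" "one (pre_tensor A B) = dl \<one>\<^bsub>A\<^esub> \<one>\<^bsub>B\<^esub>"
  by (simp_all add: pre_tensor_def)

lemma mul_add: "mul (p + p') q = mul p q + mul p' q" "mul q (p + p') = mul q p + mul q p'"
proof -
  show "mul (p + p') q = mul p q + mul p' q" by (simp add: mul_def slin)
  have "mul q (p + p') - mul q p = mul q p'"
    unfolding mul_def lin_fun_diff[OF sc.vector_space_axioms] by (simp add: slin)
  then show "mul q (p + p') = mul q p + mul q p'" by (simp add: algebra_simps)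
qed

lemma mul_scale: "mul (scale z p) q = scale z (mul p q)" "mul p (scale z q) = scale z (mul p q)"
  unfolding mul_def lin_fun_scale[OF sc.vector_space_axioms] by (simp_all add: slin lin_fun_scale[OF sc.vector_space_axioms])

lemma mul_diff: "mul (p - p') q = mul p q - mul p' q" "mul q (p - p') = mul q p - mul q p'"
  using mul_add(1)[of p "- p'" q] mul_add(2)[of q p "- p'"]
    mul_scale(1)[of "-1" p' q] mul_scale(2)[of q "-1" p'] by simp_all

lemma mul_zero [simp]: "mul 0 p = 0" "mul p 0 = 0"
  using mul_diff[of p p p] mul_diff(2)[of p p p] mul_diff(1)[of 0 0 p] mul_diff(2)[of p 0 0] by simp_all

lemma mul_single: "mul (Poly_Mapping.single x y) (Poly_Mapping.single x' y') = scale (y * y') (tm x x')"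
  by (simp add: mul_def slin mult.commute)

lemma subspace_C: "sc.subspace C" by (rule subspace_keys)

lemma tm_C:
  assumes "x \<in> carrier A \<times> carrier B" "y \<in> carrier A \<times> carrier B"
  shows "tm x y \<in> C"
  unfolding tm_def using assms A B
  by (intro sc.subspace_sum[OF subspace_C]) (auto simp: hcomp_carrier)

lemma mul_C: "p \<in> C \<Longrightarrow> q \<in> C \<Longrightarrow> mul p q \<in> C"
  unfolding mul_def
  by (intro lin_in_subspace[OF sc.vector_space_axioms subspace_C] tm_C) auto

lemma sum_diff2: "(\<Sum>i\<in>I. \<Sum>j\<in>J. f i j) - (\<Sum>i\<in>I. \<Sum>j\<in>J. g i j) =
   (\<Sum>i\<in>I. \<Sum>j\<in>J. f i j - g i j :: 'z :: ab_group_add)"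
  by (simp add: sum_subtractf)

lemma tm_bil_left:
  assumes y: "y \<in> carrier A \<times> carrier B"
  shows "bil scale N (\<lambda>x. tm x y)"
proof -
  have h: "hcomp A j (fst y) \<in> carrier A" "snd y \<in> carrier B" for j using y A hcomp_carrier by auto
  note hB = hcomp_carrier[OF B]
  note simps = tm_def sum_diff2 sc.scale_sum_right salg_distrib[OF A] salg_distrib[OF B] hcomp_add[OF B]
    hcomp_smult[OF B] superalgebraD(5)[OF A] superalgebraD(5)[OF B] h hB A B
  show ?thesis
    unfolding bil_def
    by (intro ballI conjI allI; simp add: simps diff_diff_eq)
      (intro sc.subspace_sum[OF subspace_N];
        use single_add_left single_add_right single_scale_left single_scale_right in
          \<open>simp add: cong_def h hB A B diff_diff_eq mult.commute\<close>)+
qed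

lemma tm_bil_right:
  assumes y: "y \<in> carrier A \<times> carrier B"
  shows "bil scale N (tm y)"
proof -
  have h: "hcomp B j (snd y) \<in> carrier B" "fst y \<in> carrier A" for j using y B hcomp_carrier by auto
  note hA = hcomp_carrier[OF A]
  note simps = tm_def sum_diff2 sc.scale_sum_right salg_distrib[OF A] salg_distrib[OF B] hcomp_add[OF A]
    hcomp_smult[OF A] superalgebraD(6)[OF A] superalgebraD(6)[OF B] h hA A B
  show ?thesis
    unfolding bil_def
    by (intro ballI conjI allI; simp add: simps diff_diff_eq)
      (intro sc.subspace_sum[OF subspace_N];
        use single_add_left single_add_right single_scale_left single_scale_right in
          \<open>simp add: cong_def h hA A B diff_diff_eq mult.commute\<close>)+
qed

end

context tensor_pair
begin

lemma C_single [simp]: "a \<in> carrier A \<Longrightarrow> b \<in> carrier B \<Longrightarrow> Poly_Mapping.single (a, b) z \<in> C"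
  by auto

lemma N_C: "N \<subseteq> C"
proof -
  define D where "D = C"
  have sub: "sc.subspace D" unfolding D_def by (rule subspace_C)
  have d: "p - q \<in> D" if "p \<in> D" "q \<in> D" for p q using sc.subspace_diff[OF sub that] .
  have s: "scale z p \<in> D" if "p \<in> D" for p z using sc.subspace_scale[OF sub that] .
  have c: "dl a b \<in> D" if "a \<in> carrier A" "b \<in> carrier B" for a b
    using that by (simp add: D_def)
  have "N \<subseteq> D"
    unfolding bilinear_span_def Let_def
    by (rule sc.span_minimal[OF _ sub])
      (use A B in \<open>auto simp del: scale_single intro!: d s c\<close>)
  then show ?thesis by (simp add: D_def)
qed

text \<open>With one argument fixed, \<open>tm\<close> is bilinear modulo \<open>N\<close> in the
  other, since products and homogeneous components are linear. Hence a relation times anything is a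
  combination of relations.\<close>

lemma mul_absorb:
  assumes "x \<in> N" "q \<in> C"
  shows "mul x q \<in> N" "mul q x \<in> N"
proof -
  have q: "y \<in> carrier A \<times> carrier B" if "y \<in> Poly_Mapping.keys q" for y using that assms(2) by auto
  have "bil scale N (\<lambda>x. lin scale (tm x) q)"
    unfolding bil_def lin_fun_diff[OF sc.vector_space_axioms] lin_fun_scale[OF sc.vector_space_axioms]
    using tm_bil_left[OF q]
    by (intro ballI conjI allI; intro lin_in_subspace[OF sc.vector_space_axioms subspace_N])
      (auto simp: bil_def)
  then show "mul x q \<in> N"
    unfolding mul_def using lin_bil[OF sc.vector_space_axioms subspace_N _ assms(1)] by blast
  show "mul q x \<in> N"
    unfolding mul_def using lin_bil[OF sc.vector_space_axioms subspace_N tm_bil_right[OF q] assms(1)]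
    by (rule lin_in_subspace[OF sc.vector_space_axioms subspace_N])
qed

lemma mul_cong:
  assumes "p \<approx> p'" "q \<approx> q'" "p \<in> C" "q' \<in> C"
  shows "mul p q \<approx> mul p' q'"
proof -
  have "mul p (q - q') + mul (p - p') q' \<in> N"
    using assms mul_absorb by (intro sc.subspace_add[OF subspace_N]) (auto simp: cong_def)
  then show ?thesis by (simp add: cong_def mul_diff)
qed

text \<open>Of the four summands of \<open>tm\<close> one survives. The others have a vanishing
  tensor factor, which makes them zero modulo \<open>N\<close> though not in the free vector
  space.\<close>

lemma tm_inner_homogeneous:
  assumes "a \<in> carrier A" "b \<in> part B j" "a' \<in> part A i'" "b' \<in> carrier B"
  shows "tm (a, b) (a', b') \<approx>
    Poly_Mapping.single (a \<otimes>\<^bsub>A\<^esub> a', b \<otimes>\<^bsub>B\<^esub> b') (if j \<and> i' then -1 else 1)"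
proof -
  have c: "a' \<in> carrier A" "b \<in> carrier B" using assms part_closed(1)[OF A] part_closed(1)[OF B] by auto
  note z = single_zero_left single_zero_right A B c assms(1,4)
  have "tm (a, b) (a', b') \<approx> (\<Sum>k\<in>UNIV. \<Sum>l\<in>UNIV. if k = j \<and> l = i' then
      Poly_Mapping.single (a \<otimes>\<^bsub>A\<^esub> a', b \<otimes>\<^bsub>B\<^esub> b') (if j \<and> i' then -1 else 1) else 0)"
    unfolding tm_def
    by (intro cong_sum)
      (use z in \<open>auto simp: hcomp_of_part[OF A assms(3)] hcomp_of_part[OF B assms(2)] salg_null\<close>)
  also have "\<dots> = Poly_Mapping.single (a \<otimes>\<^bsub>A\<^esub> a', b \<otimes>\<^bsub>B\<^esub> b') (if j \<and> i' then -1 else 1)"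
    by (cases j; cases i') (simp_all add: UNIV_bool)
  finally show ?thesis .
qed

lemma mul_homogeneous:
  assumes "a \<in> part A i" "b \<in> part B j" "a' \<in> part A i'" "b' \<in> part B j'"
  shows "mul (Poly_Mapping.single (a, b) z) (Poly_Mapping.single (a', b') z') \<approx>
    Poly_Mapping.single (a \<otimes>\<^bsub>A\<^esub> a', b \<otimes>\<^bsub>B\<^esub> b') (if j \<and> i' then - (z * z') else z * z')"
  using cong_scale[OF tm_inner_homogeneous[OF part_closed(1)[OF A assms(1)] assms(2,3)
      part_closed(1)[OF B assms(4)]], of "z * z'"] by (auto simp: mul_single split: if_splits)

text \<open>Modulo \<open>N\<close> every element is a sum of homogeneous pure tensors, so a
  property that respects the congruence is checked on these, where the sign rule is
  explicit.\<close>

lemma C_induct [consumes 1, case_names single add cong]: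
  assumes p: "p \<in> C"
    and single: "\<And>a b i j z. a \<in> part A i \<Longrightarrow> b \<in> part B j \<Longrightarrow> Q (Poly_Mapping.single (a, b) z)"
    and add: "\<And>p q. p \<in> C \<Longrightarrow> q \<in> C \<Longrightarrow> Q p \<Longrightarrow> Q q \<Longrightarrow> Q (p + q)"
    and cong: "\<And>p q. p \<in> C \<Longrightarrow> q \<in> C \<Longrightarrow> p \<approx> q \<Longrightarrow> Q q \<Longrightarrow> Q p"
  shows "Q p"
proof -
  note Qs = single
  have "Q (Poly_Mapping.single (\<zero>\<^bsub>A\<^esub>, \<zero>\<^bsub>B\<^esub>) 0)"
    by (rule single[OF part_closed(5)[OF A, of False] part_closed(5)[OF B, of False]])
  then have Q0: "Q 0" by simp
  have "Poly_Mapping.keys p \<subseteq> carrier A \<times> carrier B" using p by simp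
  then show ?thesis
  proof (induction rule: poly_mapping_keys_induct)
    case (single k z)
    then obtain a b where k: "k = (a, b)" "a \<in> carrier A" "b \<in> carrier B" by auto
    note h = hcomp_carrier[OF A k(2)] hcomp_carrier[OF B k(3)] hcomp_part[OF A k(2)] hcomp_part[OF B k(3)]
    let ?s = "\<lambda>i j. Poly_Mapping.single (hcomp A i a, hcomp B j b) z"
    have s: "?s i j \<in> C \<and> Q (?s i j)" for i j using C_single[OF h(1,2)] Qs[OF h(3,4)] by blast
    have c: "p + q \<in> C \<and> Q (p + q)" if "p \<in> C \<and> Q p" "q \<in> C \<and> Q q" for p q
      using that add sc.subspace_add[OF subspace_C] by blast
    have "(?s False False + ?s False True) + (?s True False + ?s True True) \<in> C
      \<and> Q ((?s False False + ?s False True) + (?s True False + ?s True True))"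
      by (intro c s)
    then have "(\<Sum>i\<in>UNIV. \<Sum>j\<in>UNIV. ?s i j) \<in> C \<and> Q (\<Sum>i\<in>UNIV. \<Sum>j\<in>UNIV. ?s i j)"
      by (simp add: UNIV_bool ac_simps)
    then show ?case using cong[OF C_single[OF k(2,3)] _ single_decompose[OF k(2,3)]] k by simp
  next
    case (add p q)
    then show ?case using assms(3) by simp
  qed (rule Q0)
qed

text \<open>On homogeneous pure tensors the exponent of the sign is
  \<open>j i' + (j + j') i''\<close> on the left and \<open>j' i'' + j (i' + i'')\<close> on the
  right, where \<open>j\<close>, \<open>j'\<close> are parities of second and \<open>i'\<close>,
  \<open>i''\<close> of first tensor factors; these agree.\<close>

lemma mul_assoc:
  assumes "p \<in> C" "q \<in> C" "r \<in> C"
  shows "mul (mul p q) r \<approx> mul p (mul q r)"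
  using assms(1)
proof (induction rule: C_induct)
  case p: (single a b i j z)
  have pc: "Poly_Mapping.single (a, b) z \<in> C"
    using p part_closed(1)[OF A] part_closed(1)[OF B] by simp
  show ?case
    using assms(2)
  proof (induction rule: C_induct)
    case q: (single a' b' i' j' z')
    have qc: "Poly_Mapping.single (a', b') z' \<in> C"
      using q part_closed(1)[OF A] part_closed(1)[OF B] by simp
    show ?case
      using assms(3)
    proof (induction rule: C_induct)
      case r: (single a'' b'' i'' j'' z'')
      have rc: "Poly_Mapping.single (a'', b'') z'' \<in> C"
        using r part_closed(1)[OF A] part_closed(1)[OF B] by simp
      note c = part_closed(1)[OF A p(1)] part_closed(1)[OF B p(2)] part_closed(1)[OF A q(1)]
        part_closed(1)[OF B q(2)] part_closed(1)[OF A r(1)] part_closed(1)[OF B r(2)]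
      let ?p = "Poly_Mapping.single (a, b) z" and ?q = "Poly_Mapping.single (a', b') z'"
        and ?r = "Poly_Mapping.single (a'', b'') z''"
      have "mul (mul ?p ?q) ?r \<approx>
        mul (Poly_Mapping.single (a \<otimes>\<^bsub>A\<^esub> a', b \<otimes>\<^bsub>B\<^esub> b') (if j \<and> i' then - (z * z') else z * z')) ?r"
        by (rule mul_cong[OF mul_homogeneous[OF p q] cong_refl mul_C[OF pc qc] rc])
      also have "\<dots> \<approx> Poly_Mapping.single (a \<otimes>\<^bsub>A\<^esub> a' \<otimes>\<^bsub>A\<^esub> a'', b \<otimes>\<^bsub>B\<^esub> b' \<otimes>\<^bsub>B\<^esub> b'')
        (if (j \<noteq> j') \<and> i'' then - ((if j \<and> i' then - (z * z') else z * z') * z'')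
         else (if j \<and> i' then - (z * z') else z * z') * z'')"
        by (rule mul_homogeneous[OF superalgebraD(9)[OF A p(1) q(1)] superalgebraD(9)[OF B p(2) q(2)] r])
      also have "\<dots> = Poly_Mapping.single (a \<otimes>\<^bsub>A\<^esub> (a' \<otimes>\<^bsub>A\<^esub> a''), b \<otimes>\<^bsub>B\<^esub> (b' \<otimes>\<^bsub>B\<^esub> b''))
        (if j \<and> (i' \<noteq> i'') then - (z * (if j' \<and> i'' then - (z' * z'') else z' * z''))
         else z * (if j' \<and> i'' then - (z' * z'') else z' * z''))"
        using c monoid.m_assoc[OF superalgebraD(4)[OF A]] monoid.m_assoc[OF superalgebraD(4)[OF B]]
        by (auto simp: mult.assoc)
      also have "\<dots> \<approx> mul ?p (Poly_Mapping.single (a' \<otimes>\<^bsub>A\<^esub> a'', b' \<otimes>\<^bsub>B\<^esub> b'')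
         (if j' \<and> i'' then - (z' * z'') else z' * z''))"
        by (rule cong_sym[OF mul_homogeneous[OF p superalgebraD(9)[OF A q(1) r(1)] superalgebraD(9)[OF B q(2) r(2)]]])
      also have "\<dots> \<approx> mul ?p (mul ?q ?r)"
        by (rule mul_cong[OF cong_refl cong_sym[OF mul_homogeneous[OF q r]] pc mul_C[OF qc rc]])
      finally show ?case .
    next
      case (add r r')
      then show ?case by (simp add: mul_add cong_add)
    next
      case (cong r r')
      have "mul (mul (Poly_Mapping.single (a, b) z) (Poly_Mapping.single (a', b') z')) r
        \<approx> mul (mul (Poly_Mapping.single (a, b) z) (Poly_Mapping.single (a', b') z')) r'"
        using cong pc qc by (intro mul_cong cong_refl mul_C)
      also note cong(4)
      also have "mul (Poly_Mapping.single (a, b) z) (mul (Poly_Mapping.single (a', b') z') r')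
         \<approx> mul (Poly_Mapping.single (a, b) z) (mul (Poly_Mapping.single (a', b') z') r)"
        using cong pc qc by (intro mul_cong cong_refl mul_C cong_sym[OF cong(3)])
      finally show ?case .
    qed
  next
    case (add q q')
    then show ?case by (simp add: mul_add cong_add)
  next
    case (cong q q')
    have "mul (mul (Poly_Mapping.single (a, b) z) q) r \<approx> mul (mul (Poly_Mapping.single (a, b) z) q') r"
      using cong pc assms(3) by (intro mul_cong cong_refl mul_C)
    also note cong(4)
    also have "mul (Poly_Mapping.single (a, b) z) (mul q' r) \<approx> mul (Poly_Mapping.single (a, b) z) (mul q r)"
      using cong pc assms(3) by (intro mul_cong cong_refl mul_C cong_sym[OF cong(3)])
    finally show ?case .
  qed
next
  case (add p p')
  then show ?case by (simp add: mul_add cong_add)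
next
  case (cong p p')
  have "mul (mul p q) r \<approx> mul (mul p' q) r"
    using cong assms(2,3) by (intro mul_cong cong_refl mul_C)
  also note cong(4)
  also have "mul p' (mul q r) \<approx> mul p (mul q r)"
    using cong assms(2,3) by (intro mul_cong cong_refl mul_C cong_sym[OF cong(3)])
  finally show ?case .
qed

lemma unit_C: "dl \<one>\<^bsub>A\<^esub> \<one>\<^bsub>B\<^esub> \<in> C" using A B by (intro C_single) auto

lemma mul_unit:
  assumes "p \<in> C" shows "mul (dl \<one>\<^bsub>A\<^esub> \<one>\<^bsub>B\<^esub>) p \<approx> p" "mul p (dl \<one>\<^bsub>A\<^esub> \<one>\<^bsub>B\<^esub>) \<approx> p"
proof -
  have "mul (dl \<one>\<^bsub>A\<^esub> \<one>\<^bsub>B\<^esub>) p \<approx> p \<and> mul p (dl \<one>\<^bsub>A\<^esub> \<one>\<^bsub>B\<^esub>) \<approx> p"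
    using assms
  proof (induction rule: C_induct)
    case (single a b i j z)
    have c: "a \<in> carrier A" "b \<in> carrier B" using single part_closed(1)[OF A] part_closed(1)[OF B] by auto
    show ?case
      using mul_homogeneous[OF part_one[OF A] part_one[OF B] single, of 1 z] 
        mul_homogeneous[OF single part_one[OF A] part_one[OF B], of z 1]
        c monoid.l_one[OF superalgebraD(4)[OF A]] monoid.r_one[OF superalgebraD(4)[OF A]]
        monoid.l_one[OF superalgebraD(4)[OF B]] monoid.r_one[OF superalgebraD(4)[OF B]]
      by simp
  next
    case (add p q)
    then show ?case by (simp add: mul_add cong_add)
  next
    case (cong p q)
    have "mul (dl \<one>\<^bsub>A\<^esub> \<one>\<^bsub>B\<^esub>) p \<approx> mul (dl \<one>\<^bsub>A\<^esub> \<one>\<^bsub>B\<^esub>) q" "mul p (dl \<one>\<^bsub>A\<^esub> \<one>\<^bsub>B\<^esub>) \<approx> mul q (dl \<one>\<^bsub>A\<^esub> \<one>\<^bsub>B\<^esub>)"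
      using mul_cong[OF cong_refl cong(3) unit_C cong(2)] mul_cong[OF cong(3) cong_refl cong(1) unit_C] by auto
    then show ?case using cong(4) cong_sym[OF cong(3)] cong_trans by blast
  qed
  then show "mul (dl \<one>\<^bsub>A\<^esub> \<one>\<^bsub>B\<^esub>) p \<approx> p" "mul p (dl \<one>\<^bsub>A\<^esub> \<one>\<^bsub>B\<^esub>) \<approx> p" by auto
qed

section \<open>Total parity on the tensor product\<close>

definition "hkeys k = {(a, b). \<exists>i j. a \<in> part A i \<and> b \<in> part B j \<and> k = (i \<noteq> j)}"

lemma pre_part: "part (pre_tensor A B) k = {p. Poly_Mapping.keys p \<subseteq> hkeys k}"
  unfolding pre_tensor_def hkeys_def by (auto 4 3)

lemma hkeys_sub: "hkeys k \<subseteq> carrier A \<times> carrier B"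
  using part_closed(1)[OF A] part_closed(1)[OF B] by (auto simp: hkeys_def)

text \<open>For the opposite parity the component is zero, which lies in both parts.\<close>

lemma hcomp_part': "a \<in> part A i \<Longrightarrow> hcomp A j a \<in> part A i" "b \<in> part B i \<Longrightarrow> hcomp B j b \<in> part B i"
  by (auto simp: hcomp_of_part[OF A] hcomp_of_part[OF B] part_closed(5)[OF A] part_closed(5)[OF B])

lemma mul_part:
  assumes "p \<in> part (pre_tensor A B) i" "q \<in> part (pre_tensor A B) j"
  shows "mul p q \<in> part (pre_tensor A B) (i \<noteq> j)"
proof -
  have tm: "tm x y \<in> {p. Poly_Mapping.keys p \<subseteq> hkeys (i \<noteq> j)}" if x: "x \<in> hkeys i" and y: "y \<in> hkeys j" for x y
  proof -
    obtain a b k l where x': "x = (a, b)" "a \<in> part A k" "b \<in> part B l" "i = (k \<noteq> l)"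
      using x by (auto simp: hkeys_def)
    obtain a' b' k' l' where y': "y = (a', b')" "a' \<in> part A k'" "b' \<in> part B l'" "j = (k' \<noteq> l')"
      using y by (auto simp: hkeys_def)
    have "(a \<otimes>\<^bsub>A\<^esub> hcomp A m a', hcomp B m' b \<otimes>\<^bsub>B\<^esub> b') \<in> hkeys (i \<noteq> j)" for m m'
      unfolding hkeys_def using x' y' superalgebraD(9)[OF A x'(2) hcomp_part'(1)[OF y'(2)]]
        superalgebraD(9)[OF B hcomp_part'(2)[OF x'(3)] y'(3)] by blast
    then show ?thesis
      unfolding tm_def x'(1) y'(1) by (intro sc.subspace_sum[OF subspace_keys]) auto
  qed
  show ?thesis
    unfolding mul_def pre_part
    by (intro lin_in_subspace[OF sc.vector_space_axioms subspace_keys] tm) (use assms in \<open>auto simp: pre_part\<close>)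
qed

text \<open>The component of total parity \<open>k\<close> of a pure tensor. The linear extension of
  \<open>diag False\<close> serves as the projection \<open>P\<close> of
  \<open>prequot\<close>.\<close>

definition diag :: "bool \<Rightarrow> 'a \<times> 'b \<Rightarrow> ('a \<times> 'b \<Rightarrow>\<^sub>0 complex)" where
  "diag k x = (\<Sum>i\<in>UNIV. dl (hcomp A i (fst x)) (hcomp B (i \<noteq> k) (snd x)))"

lemma diag_bil: "bil scale N (diag k)"
proof -
  note simps = diag_def sum_subtractf[symmetric] sc.scale_sum_right hcomp_add[OF A] hcomp_add[OF B]
    hcomp_smult[OF A] hcomp_smult[OF B] hcomp_carrier[OF A] hcomp_carrier[OF B]
  show ?thesis
    unfolding bil_def
    by (intro ballI conjI allI; simp add: simps diff_diff_eq)
      (intro sc.subspace_sum[OF subspace_N];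
        use single_add_left single_add_right single_scale_left[where z = 1] single_scale_right[where z = 1] in
          \<open>simp add: cong_def hcomp_carrier[OF A] hcomp_carrier[OF B] diff_diff_eq\<close>)+
qed

lemma diag_part: "x \<in> carrier A \<times> carrier B \<Longrightarrow> diag k x \<in> part (pre_tensor A B) k"
proof -
  assume x: "x \<in> carrier A \<times> carrier B"
  have "(hcomp A i (fst x), hcomp B (i \<noteq> k) (snd x)) \<in> hkeys k" for i
    unfolding hkeys_def using hcomp_part[OF A] hcomp_part[OF B] x by (cases k; cases i) force+
  then show ?thesis
    unfolding diag_def pre_part by (intro sc.subspace_sum[OF subspace_keys]) auto
qed

lemma diag_homogeneous:
  assumes "a \<in> part A i" "b \<in> part B j" 
  shows "diag k (a, b) \<approx> (if k = (i \<noteq> j) then dl a b else 0)"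
proof -
  have c: "a \<in> carrier A" "b \<in> carrier B" using assms part_closed(1)[OF A] part_closed(1)[OF B] by auto
  have "diag k (a, b) \<approx> (\<Sum>l\<in>UNIV. if l = i \<and> (l \<noteq> k) = j then dl a b else 0)"
    unfolding diag_def
    by (intro cong_sum) (use c A B single_zero_left single_zero_right in
      \<open>auto simp: hcomp_of_part[OF A assms(1)] hcomp_of_part[OF B assms(2)]\<close>)
  also have "\<dots> = (if k = (i \<noteq> j) then dl a b else 0)"
    by (cases i; cases j; cases k) (simp_all add: UNIV_bool)
  finally show ?thesis .
qed

lemma lin_cong: 
  assumes "\<And>x. x \<in> Poly_Mapping.keys p \<Longrightarrow> f x \<approx> g x"
  shows "lin scale f p \<approx> lin scale g p"
  unfolding lin_def using assms by (intro cong_sum cong_scale)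

lemma lin_id: "lin scale (\<lambda>x. Poly_Mapping.single x 1) p = p"
  by (simp add: lin_def sum_single_keys)

lemma lin_fun_add: "lin scale (\<lambda>x. f x + g x) p = lin scale f p + lin scale g p"
  by (simp add: lin_def sc.scale_right_distrib sum.distrib)

lemma prequot_tensor: "prequot (pre_tensor A B) N (lin scale (diag False))"
proof unfold_locales
  show "add (pre_tensor A B) = (+)" "zero (pre_tensor A B) = 0" "module.smult (pre_tensor A B) = scale" by simp_all
  show "sc.subspace (carrier (pre_tensor A B))" "sc.subspace N" "N \<subseteq> carrier (pre_tensor A B)"
    using subspace_C subspace_N N_C by simp_all
  show "\<one>\<^bsub>pre_tensor A B\<^esub> \<in> carrier (pre_tensor A B)" using unit_C by simp
  show "part (pre_tensor A B) i \<subseteq> carrier (pre_tensor A B)" for i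
    unfolding pre_part using hkeys_sub by auto
  show "sc.subspace (part (pre_tensor A B) i)" for i
    unfolding pre_part by (rule subspace_keys)
  fix p q r z
  assume p: "p \<in> carrier (pre_tensor A B)"
  then have p': "p \<in> C" by simp
  show "x \<in> N \<Longrightarrow> p \<otimes>\<^bsub>pre_tensor A B\<^esub> x \<in> N \<and> x \<otimes>\<^bsub>pre_tensor A B\<^esub> p \<in> N" for x
    using mul_absorb p' by (simp add: tensor_mult)
  show "\<one>\<^bsub>pre_tensor A B\<^esub> \<otimes>\<^bsub>pre_tensor A B\<^esub> p - p \<in> N \<and> p \<otimes>\<^bsub>pre_tensor A B\<^esub> \<one>\<^bsub>pre_tensor A B\<^esub> - p \<in> N"
    using mul_unit[OF p'] by (simp add: tensor_mult cong_def)
  \<comment> \<open>Modulo \<open>N\<close>, \<open>p\<close> is the sum of its components of even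
    and of odd total parity.\<close>
  have "p = lin scale (\<lambda>x. Poly_Mapping.single x 1) p" by (simp add: lin_id)
  also have "\<dots> \<approx> lin scale (\<lambda>x. diag False x + diag True x) p"
  proof (rule lin_cong)
    fix x assume "x \<in> Poly_Mapping.keys p"
    then have "fst x \<in> carrier A" "snd x \<in> carrier B" using p' by auto
    from single_decompose[OF this, of 1]
    show "Poly_Mapping.single x 1 \<approx> diag False x + diag True x"
      by (simp add: diag_def UNIV_bool ac_simps)
  qed
  finally have "p - lin scale (diag False) p - lin scale (diag True) p \<in> N"
    by (simp add: cong_def lin_fun_add algebra_simps)
  moreover have "lin scale (diag k) p \<in> part (pre_tensor A B) k" for k
    unfolding pre_part
    by (intro lin_in_subspace[OF sc.vector_space_axioms subspace_keys] diag_part[unfolded pre_part]) (use p' in auto)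
  ultimately show "lin scale (diag False) p \<in> part (pre_tensor A B) False \<and>
      (\<exists>c\<in>part (pre_tensor A B) True. p - lin scale (diag False) p - c \<in> N)" by blast
  assume q: "q \<in> carrier (pre_tensor A B)"
  then have q': "q \<in> C" by simp
  show "p \<otimes>\<^bsub>pre_tensor A B\<^esub> q \<in> carrier (pre_tensor A B)" using mul_C[OF p' q'] by (simp add: tensor_mult)
  show "scale z p \<otimes>\<^bsub>pre_tensor A B\<^esub> q = scale z (p \<otimes>\<^bsub>pre_tensor A B\<^esub> q) \<and>
      p \<otimes>\<^bsub>pre_tensor A B\<^esub> scale z q = scale z (p \<otimes>\<^bsub>pre_tensor A B\<^esub> q)"
    by (simp add: tensor_mult mul_scale)
  show "lin scale (diag False) (p - q) = lin scale (diag False) p - lin scale (diag False) q"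
    by (simp add: slin)
  assume r: "r \<in> carrier (pre_tensor A B)"
  then have r': "r \<in> C" by simp
  show "(p + q) \<otimes>\<^bsub>pre_tensor A B\<^esub> r = p \<otimes>\<^bsub>pre_tensor A B\<^esub> r + q \<otimes>\<^bsub>pre_tensor A B\<^esub> r \<and>
      r \<otimes>\<^bsub>pre_tensor A B\<^esub> (p + q) = r \<otimes>\<^bsub>pre_tensor A B\<^esub> p + r \<otimes>\<^bsub>pre_tensor A B\<^esub> q"
    by (simp add: tensor_mult mul_add)
  show "p \<otimes>\<^bsub>pre_tensor A B\<^esub> q \<otimes>\<^bsub>pre_tensor A B\<^esub> r - p \<otimes>\<^bsub>pre_tensor A B\<^esub> (q \<otimes>\<^bsub>pre_tensor A B\<^esub> r) \<in> N"
    using mul_assoc[OF p' q' r'] by (simp add: tensor_mult cong_def)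
next
  fix i j p q assume "p \<in> part (pre_tensor A B) i" "q \<in> part (pre_tensor A B) j"
  then show "p \<otimes>\<^bsub>pre_tensor A B\<^esub> q \<in> part (pre_tensor A B) (i \<noteq> j)"
    unfolding tensor_mult by (rule mul_part)
next
  fix x assume "x \<in> N"
  then show "lin scale (diag False) x \<in> N"
    by (rule lin_bil[OF sc.vector_space_axioms subspace_N diag_bil])
next
  have lin_homog: "lin scale (diag False) p \<approx> lin scale (\<lambda>x. if k then 0 else Poly_Mapping.single x 1) p"
    if "p \<in> part (pre_tensor A B) k" for p k
  proof (rule lin_cong)
    fix x assume "x \<in> Poly_Mapping.keys p"
    then have "x \<in> hkeys k" using that by (auto simp: pre_part)
    then obtain a b i j where x: "x = (a, b)" "a \<in> part A i" "b \<in> part B j" "k = (i \<noteq> j)"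
      by (auto simp: hkeys_def)
    show "diag False x \<approx> (if k then 0 else Poly_Mapping.single x 1)"
      using diag_homogeneous[OF x(2,3), of False] x by (cases i; cases j) simp_all
  qed
  fix p
  show "lin scale (diag False) p - p \<in> N" if "p \<in> part (pre_tensor A B) False"
    using lin_homog[OF that] by (simp add: cong_def lin_id)
  show "lin scale (diag False) p \<in> N" if "p \<in> part (pre_tensor A B) True"
    using lin_homog[OF that] by (simp add: cong_def lin_def)
qed

end

context tensor_pair
begin

interpretation TQ: prequot "pre_tensor A B" N "lin scale (diag False)"
  by (rule prequot_tensor)

abbreviation "T \<equiv> tensor A B"
abbreviation "pt \<equiv> pure_tensor A B"

lemma T_eq: "T = TQ.Q" by (simp add: tensor_def)

lemma pt_eq: "pt a b = TQ.coset (dl a b)" by (simp add: pure_tensor_def TQ.coset_def)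

lemma coset_single: "a \<in> carrier A \<Longrightarrow> b \<in> carrier B \<Longrightarrow>
    TQ.coset (Poly_Mapping.single (a, b) z) = z \<odot>\<^bsub>T\<^esub> pt a b"
  by (simp add: T_eq pt_eq TQ.Q_smult)

lemma superalgebra_tensor: "superalgebra T"
  unfolding T_eq by (rule TQ.superalgebra_Q)

lemma pt_in [simp]: "a \<in> carrier A \<Longrightarrow> b \<in> carrier B \<Longrightarrow> pt a b \<in> carrier T"
  by (simp add: T_eq pt_eq TQ.Q_carrier)

lemma pt_part: "a \<in> part A i \<Longrightarrow> b \<in> part B j \<Longrightarrow> pt a b \<in> part T (i \<noteq> j)"
  unfolding T_eq pt_eq TQ.Q_part by (rule imageI) (auto simp: pre_part hkeys_def)

lemma pt_one: "\<one>\<^bsub>T\<^esub> = pt \<one>\<^bsub>A\<^esub> \<one>\<^bsub>B\<^esub>"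
  by (simp add: T_eq pt_eq TQ.Q_one)

lemma pt_mult:
  assumes "a \<in> carrier A" "b \<in> part B j" "a' \<in> part A i'" "b' \<in> carrier B"
  shows "pt a b \<otimes>\<^bsub>T\<^esub> pt a' b' = (if j \<and> i' then -1 else 1) \<odot>\<^bsub>T\<^esub> pt (a \<otimes>\<^bsub>A\<^esub> a') (b \<otimes>\<^bsub>B\<^esub> b')"
proof -
  have c: "a' \<in> carrier A" "b \<in> carrier B" using assms part_closed(1)[OF A] part_closed(1)[OF B] by auto
  have "pt a b \<otimes>\<^bsub>T\<^esub> pt a' b' = TQ.coset (tm (a, b) (a', b'))"
    using c assms by (simp add: T_eq pt_eq TQ.Q_mult tensor_mult mul_single)
  also have "\<dots> = TQ.coset (Poly_Mapping.single (a \<otimes>\<^bsub>A\<^esub> a', b \<otimes>\<^bsub>B\<^esub> b') (if j \<and> i' then -1 else 1))"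
    using tm_inner_homogeneous[OF assms] by (simp add: TQ.coset_eq_iff cong_def)
  also have "\<dots> = (if j \<and> i' then -1 else 1) \<odot>\<^bsub>T\<^esub> pt (a \<otimes>\<^bsub>A\<^esub> a') (b \<otimes>\<^bsub>B\<^esub> b')"
    using c assms A B by (intro coset_single) auto
  finally show ?thesis .
qed

lemma pt_mult_even:
  assumes "a \<in> carrier A" "b \<in> part B j" "a' \<in> part A i'" "b' \<in> carrier B" "\<not> (j \<and> i')"
  shows "pt a b \<otimes>\<^bsub>T\<^esub> pt a' b' = pt (a \<otimes>\<^bsub>A\<^esub> a') (b \<otimes>\<^bsub>B\<^esub> b')"
proof -
  have c: "a' \<in> carrier A" "b \<in> carrier B" using assms part_closed(1)[OF A] part_closed(1)[OF B] by auto
  have z: "(if j \<and> i' then -1 else 1) = (1::complex)" using assms(5) by simp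
  show ?thesis
    unfolding pt_mult[OF assms(1-4)] z
    using c assms A B by (intro salg_smult(4)[OF superalgebra_tensor] pt_in) auto
qed

lemma pt_linear:
  "a \<in> carrier A \<Longrightarrow> a' \<in> carrier A \<Longrightarrow> b \<in> carrier B \<Longrightarrow> pt (a \<oplus>\<^bsub>A\<^esub> a') b = pt a b \<oplus>\<^bsub>T\<^esub> pt a' b"
  "a \<in> carrier A \<Longrightarrow> b \<in> carrier B \<Longrightarrow> b' \<in> carrier B \<Longrightarrow> pt a (b \<oplus>\<^bsub>B\<^esub> b') = pt a b \<oplus>\<^bsub>T\<^esub> pt a b'"
  "a \<in> carrier A \<Longrightarrow> b \<in> carrier B \<Longrightarrow> pt (z \<odot>\<^bsub>A\<^esub> a) b = z \<odot>\<^bsub>T\<^esub> pt a b"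
  "a \<in> carrier A \<Longrightarrow> b \<in> carrier B \<Longrightarrow> pt a (z \<odot>\<^bsub>B\<^esub> b) = z \<odot>\<^bsub>T\<^esub> pt a b"
  using single_add_left[of a a' b 1] single_add_right[of a b b' 1] single_scale_left[of a b z 1]
    single_scale_right[of a b z 1]
  by (simp_all add: T_eq pt_eq TQ.Q_add TQ.Q_smult TQ.coset_eq_iff cong_def)

lemma l_one_r_one: "a \<in> carrier A \<Longrightarrow> a \<otimes>\<^bsub>A\<^esub> \<one>\<^bsub>A\<^esub> = a" "a \<in> carrier A \<Longrightarrow> \<one>\<^bsub>A\<^esub> \<otimes>\<^bsub>A\<^esub> a = a"
  "b \<in> carrier B \<Longrightarrow> b \<otimes>\<^bsub>B\<^esub> \<one>\<^bsub>B\<^esub> = b" "b \<in> carrier B \<Longrightarrow> \<one>\<^bsub>B\<^esub> \<otimes>\<^bsub>B\<^esub> b = b"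
  using monoid.l_one[OF superalgebraD(4)[OF A]] monoid.r_one[OF superalgebraD(4)[OF A]]
    monoid.l_one[OF superalgebraD(4)[OF B]] monoid.r_one[OF superalgebraD(4)[OF B]] by auto

lemma one_closed: "\<one>\<^bsub>A\<^esub> \<in> carrier A" "\<one>\<^bsub>B\<^esub> \<in> carrier B"
  using A B by auto

text \<open>No sign arises because units are even. Statements about pure tensors are reduced in this
  way to the two embedded factors.\<close>

lemma pt_split: "a \<in> carrier A \<Longrightarrow> b \<in> carrier B \<Longrightarrow> pt a b = pt a \<one>\<^bsub>B\<^esub> \<otimes>\<^bsub>T\<^esub> pt \<one>\<^bsub>A\<^esub> b"
  using pt_mult_even[OF _ part_one[OF B] part_one[OF A], of a b] by (simp add: l_one_r_one)

lemma pt_swap: "a \<in> part A i \<Longrightarrow> b \<in> part B j \<Longrightarrow>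
    pt \<one>\<^bsub>A\<^esub> b \<otimes>\<^bsub>T\<^esub> pt a \<one>\<^bsub>B\<^esub> = (if j \<and> i then -1 else 1) \<odot>\<^bsub>T\<^esub> (pt a \<one>\<^bsub>B\<^esub> \<otimes>\<^bsub>T\<^esub> pt \<one>\<^bsub>A\<^esub> b)"
  using pt_mult[OF one_closed(1) _ _ one_closed(2), of b j a i] pt_split[of a b]
    part_closed(1)[OF A, of a i] part_closed(1)[OF B, of b j] by (simp add: l_one_r_one)

lemma inl_hom: "salg_hom A T (\<lambda>a. pt a \<one>\<^bsub>B\<^esub>)"
proof -
  have m: "pt (x \<otimes>\<^bsub>A\<^esub> y) \<one>\<^bsub>B\<^esub> = pt x \<one>\<^bsub>B\<^esub> \<otimes>\<^bsub>T\<^esub> pt y \<one>\<^bsub>B\<^esub>" if "x \<in> carrier A" "y \<in> carrier A" for x y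
  proof -
    note h = hcomp_carrier[OF A that(2)] hcomp_part[OF A that(2)]
    have hp: "pt (x \<otimes>\<^bsub>A\<^esub> hcomp A i y) \<one>\<^bsub>B\<^esub> = pt x \<one>\<^bsub>B\<^esub> \<otimes>\<^bsub>T\<^esub> pt (hcomp A i y) \<one>\<^bsub>B\<^esub>" for i
      using pt_mult_even[OF that(1) part_one[OF B] h(2) one_closed(2), of i] one_closed
      by (simp add: l_one_r_one)
    have y: "y = hcomp A False y \<oplus>\<^bsub>A\<^esub> hcomp A True y" using hcomp_decompose[OF A that(2), of False] by simp
    have "pt (x \<otimes>\<^bsub>A\<^esub> y) \<one>\<^bsub>B\<^esub> = pt (x \<otimes>\<^bsub>A\<^esub> hcomp A False y) \<one>\<^bsub>B\<^esub> \<oplus>\<^bsub>T\<^esub> pt (x \<otimes>\<^bsub>A\<^esub> hcomp A True y) \<one>\<^bsub>B\<^esub>"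
      by (subst y) (use h that A one_closed in \<open>simp add: salg_distrib[OF A] pt_linear\<close>)
    also have "\<dots> = pt x \<one>\<^bsub>B\<^esub> \<otimes>\<^bsub>T\<^esub> (pt (hcomp A False y) \<one>\<^bsub>B\<^esub> \<oplus>\<^bsub>T\<^esub> pt (hcomp A True y) \<one>\<^bsub>B\<^esub>)"
      unfolding hp using h that one_closed by (simp add: salg_distrib[OF superalgebra_tensor])
    also have "pt (hcomp A False y) \<one>\<^bsub>B\<^esub> \<oplus>\<^bsub>T\<^esub> pt (hcomp A True y) \<one>\<^bsub>B\<^esub> = pt y \<one>\<^bsub>B\<^esub>"
      by (subst (3) y) (use h one_closed in \<open>simp add: pt_linear\<close>)
    finally show ?thesis .
  qed
  show ?thesis
    unfolding salg_hom_def ring_hom_def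
    using m pt_linear one_closed pt_part[OF _ part_one[OF B]] by (auto simp: pt_one)
qed

lemma inr_hom: "salg_hom B T (\<lambda>b. pt \<one>\<^bsub>A\<^esub> b)"
proof -
  have m: "pt \<one>\<^bsub>A\<^esub> (x \<otimes>\<^bsub>B\<^esub> y) = pt \<one>\<^bsub>A\<^esub> x \<otimes>\<^bsub>T\<^esub> pt \<one>\<^bsub>A\<^esub> y" if "x \<in> carrier B" "y \<in> carrier B" for x y
  proof -
    note h = hcomp_carrier[OF B that(1)] hcomp_part[OF B that(1)]
    have hp: "pt \<one>\<^bsub>A\<^esub> (hcomp B i x \<otimes>\<^bsub>B\<^esub> y) = pt \<one>\<^bsub>A\<^esub> (hcomp B i x) \<otimes>\<^bsub>T\<^esub> pt \<one>\<^bsub>A\<^esub> y" for i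
      using pt_mult_even[OF one_closed(1) h(2) part_one[OF A] that(2), of i] one_closed
      by (simp add: l_one_r_one)
    have x: "x = hcomp B False x \<oplus>\<^bsub>B\<^esub> hcomp B True x" using hcomp_decompose[OF B that(1), of False] by simp
    have "pt \<one>\<^bsub>A\<^esub> (x \<otimes>\<^bsub>B\<^esub> y) = pt \<one>\<^bsub>A\<^esub> (hcomp B False x \<otimes>\<^bsub>B\<^esub> y) \<oplus>\<^bsub>T\<^esub> pt \<one>\<^bsub>A\<^esub> (hcomp B True x \<otimes>\<^bsub>B\<^esub> y)"
      by (subst x) (use h that B one_closed in \<open>simp add: salg_distrib[OF B] pt_linear\<close>)
    also have "\<dots> = (pt \<one>\<^bsub>A\<^esub> (hcomp B False x) \<oplus>\<^bsub>T\<^esub> pt \<one>\<^bsub>A\<^esub> (hcomp B True x)) \<otimes>\<^bsub>T\<^esub> pt \<one>\<^bsub>A\<^esub> y"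
      unfolding hp using h that one_closed by (simp add: salg_distrib[OF superalgebra_tensor])
    also have "pt \<one>\<^bsub>A\<^esub> (hcomp B False x) \<oplus>\<^bsub>T\<^esub> pt \<one>\<^bsub>A\<^esub> (hcomp B True x) = pt \<one>\<^bsub>A\<^esub> x"
      by (subst (3) x) (use h one_closed in \<open>simp add: pt_linear\<close>)
    finally show ?thesis .
  qed
  show ?thesis
    unfolding salg_hom_def ring_hom_def
    using m pt_linear one_closed pt_part[OF part_one[OF A]] by (auto simp: pt_one)
qed

lemma T_cases:
  assumes "x \<in> carrier T" obtains p where "p \<in> C" "x = TQ.coset p"
  using assms by (auto simp: T_eq TQ.Q_carrier)

text \<open>Pure tensors appear already factored through the two embedded algebras, so that the laws
  of a homomorphism apply to them directly.\<close>

lemma T_induct [consumes 1, case_names pure add]: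
  assumes x: "x \<in> carrier T"
    and pure: "\<And>a b z. a \<in> carrier A \<Longrightarrow> b \<in> carrier B \<Longrightarrow> Q (z \<odot>\<^bsub>T\<^esub> (pt a \<one>\<^bsub>B\<^esub> \<otimes>\<^bsub>T\<^esub> pt \<one>\<^bsub>A\<^esub> b))"
    and add: "\<And>x y. x \<in> carrier T \<Longrightarrow> y \<in> carrier T \<Longrightarrow> Q x \<Longrightarrow> Q y \<Longrightarrow> Q (x \<oplus>\<^bsub>T\<^esub> y)"
  shows "Q x"
proof -
  obtain p where p: "Poly_Mapping.keys p \<subseteq> carrier A \<times> carrier B" and x: "x = TQ.coset p"
    using x by (rule T_cases) auto
  have s: "Q (TQ.coset (Poly_Mapping.single (a, b) z))" if "a \<in> carrier A" "b \<in> carrier B" for a b z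
    using pure[OF that, of z] that by (simp add: coset_single pt_split[symmetric])
  from p have "Q (TQ.coset p)"
  proof (induction rule: poly_mapping_keys_induct)
    case (single k z)
    then show ?case using s by auto
  next
    case (add p q)
    then show ?case using assms(3)[of "TQ.coset p" "TQ.coset q"] by (simp add: T_eq TQ.Q_add)
  next
    case zero
    show ?case using s[OF one_closed, of 0] by simp
  qed
  with x show ?thesis by simp
qed

lemma tensor_hom_unique:
  assumes h: "salg_hom T R h" "salg_hom T R h'"
    and eq: "\<And>a. a \<in> carrier A \<Longrightarrow> h (pt a \<one>\<^bsub>B\<^esub>) = h' (pt a \<one>\<^bsub>B\<^esub>)"
      "\<And>b. b \<in> carrier B \<Longrightarrow> h (pt \<one>\<^bsub>A\<^esub> b) = h' (pt \<one>\<^bsub>A\<^esub> b)"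
    and x: "x \<in> carrier T"
  shows "h x = h' x"
  using x
proof (induction rule: T_induct)
  case (pure a b z)
  have "pt a \<one>\<^bsub>B\<^esub> \<in> carrier T" "pt \<one>\<^bsub>A\<^esub> b \<in> carrier T" using pure one_closed by simp_all
  then show ?case using pure eq superalgebra_tensor
    by (simp add: salg_homD[OF h(1)] salg_homD[OF h(2)])
next
  case (add x y)
  then show ?case by (simp add: salg_homD[OF h(1)] salg_homD[OF h(2)])
qed

text \<open>Universal property of the super tensor product. The map taking a pure tensor of
  \<open>a\<close> and \<open>b\<close> to \<open>f a\<close> times \<open>g b\<close> is bilinear,
  and supercommutation of the two images makes it multiplicative.\<close>

theorem tensor_hom_ex:
  fixes R :: "'r salg"
  assumes R: "superalgebra R" and f: "salg_hom A R f" and g: "salg_hom B R g"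
    and comm: "\<And>a b i j. a \<in> part A i \<Longrightarrow> b \<in> part B j \<Longrightarrow>
      g b \<otimes>\<^bsub>R\<^esub> f a = (if j \<and> i then -1 else 1) \<odot>\<^bsub>R\<^esub> (f a \<otimes>\<^bsub>R\<^esub> g b)"
  shows "\<exists>h. salg_hom T R h \<and> (\<forall>a\<in>carrier A. h (pt a \<one>\<^bsub>B\<^esub>) = f a) \<and> (\<forall>b\<in>carrier B. h (pt \<one>\<^bsub>A\<^esub> b) = g b)"
proof -
  define k where "k x = emb R (f (fst x)) * emb R (g (snd x))" for x
  define e where "e = emb R \<one>\<^bsub>R\<^esub>"
  define L where "L p = lin cscale k p" for p
  define \<phi> where "\<phi> p = Rep_prodalg (L p) R" for p
  note fc = salg_homD(1)[OF f] and gc = salg_homD(1)[OF g]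
  have one: "\<one>\<^bsub>R\<^esub> \<in> carrier R" using R by simp
  have bil: "bil cscale {0} k"
    using A B fc gc unfolding bil_def k_def
    by (simp add: salg_homD[OF f] salg_homD[OF g] emb_simps[OF R] algebra_simps)
  have kill: "L x = 0" if "x \<in> N" for x
    using lin_bil[OF vector_space_cscale cs.subspace_single_0 bil that] by (simp add: L_def)
  have L_single: "L (Poly_Mapping.single (a, b) z) = z *\<^sub>c (emb R (f a) * emb R (g b))" for a b z
    by (simp add: L_def k_def clin)
  have L_linear: "L (p + q) = L p + L q" "L (scale z p) = z *\<^sub>c L p" for p q z
    by (simp_all add: L_def clin)
  have L_cong: "L p = L q" if "p \<approx> q" for p q
    using kill[of "p - q"] that by (simp add: cong_def L_def clin)
  have swap: "emb R (g b) * emb R (f a) = (if j \<and> i then -1 else 1) *\<^sub>c (emb R (f a) * emb R (g b))"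
    if "a \<in> part A i" "b \<in> part B j" for a b i j
  proof -
    have c: "f a \<in> carrier R" "g b \<in> carrier R"
      using fc gc that part_closed(1)[OF A] part_closed(1)[OF B] by auto
    then show ?thesis using arg_cong[OF comm[OF that], of "emb R"] R by (simp add: emb_simps[OF R] del: if_split)
  qed
  have L_mult: "L (mul p q) = L p * L q" if "p \<in> C" "q \<in> C" for p q
    using that(1)
  proof (induction rule: C_induct)
    case p: (single a b i j z)
    show ?case
      using that(2)
    proof (induction rule: C_induct)
      case q: (single a' b' i' j' z')
      note c = part_closed(1)[OF A p(1)] part_closed(1)[OF B p(2)] part_closed(1)[OF A q(1)]
        part_closed(1)[OF B q(2)]
      have "L (mul (Poly_Mapping.single (a, b) z) (Poly_Mapping.single (a', b') z')) =
          (if j \<and> i' then - (z * z') else z * z') *\<^sub>c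
            (emb R (f a) * emb R (f a') * (emb R (g b) * emb R (g b')))"
        using c fc gc by (simp add: L_cong[OF mul_homogeneous[OF p q]] L_single salg_homD[OF f] salg_homD[OF g]
            emb_simps[OF R] del: if_split)
      \<comment> \<open>Supercommutation enters here: restoring the order of \<open>g b\<close> and
        \<open>f a'\<close> absorbs exactly the sign of the tensor multiplication.\<close>
      also have "\<dots> = (z * z') *\<^sub>c (emb R (f a) * (emb R (g b) * emb R (f a')) * emb R (g b'))"
        unfolding swap[OF q(1) p(2)] by (simp add: mult.assoc)
      finally show ?case by (simp add: L_single mult.assoc)
    next
      case (add q q')
      then show ?case by (simp add: mul_add L_linear distrib_left)
    next
      case (cong q q')
      have pC: "Poly_Mapping.single (a, b) z \<in> C"
        using part_closed(1)[OF A p(1)] part_closed(1)[OF B p(2)] by (rule C_single)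
      show ?case
        using cong(4) L_cong[OF cong(3)] L_cong[OF mul_cong[OF cong_refl cong(3) pC cong(2)]] by simp
    qed
  next
    case (add p p')
    then show ?case by (simp add: mul_add L_linear distrib_right)
  next
    case (cong p p')
    then show ?case using L_cong[OF cong(3)] L_cong[OF mul_cong[OF cong(3) cong_refl cong(1) that(2)]] by simp
  qed
  have "\<exists>h. salg_hom TQ.Q R h \<and> (\<forall>p\<in>carrier (pre_tensor A B). h (TQ.coset p) = \<phi> p)"
  proof (rule TQ.Q_hom_ex[OF R])
    fix p i assume "p \<in> part (pre_tensor A B) i"
    then have "Poly_Mapping.keys p \<subseteq> hkeys i" by (simp add: pre_part)
    then show "\<phi> p \<in> part R i"
    proof (induction rule: poly_mapping_keys_induct)
      case (single x z)
      then obtain a b i' j' where x: "x = (a, b)" "a \<in> part A i'" "b \<in> part B j'" "i = (i' \<noteq> j')"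
        by (auto simp: hkeys_def)
      have "f a \<otimes>\<^bsub>R\<^esub> g b \<in> part R i"
        unfolding x(4) by (rule superalgebraD(9)[OF R salg_homD(6)[OF f x(2)] salg_homD(6)[OF g x(3)]])
      then show ?case
        using fc gc part_closed(1)[OF A x(2)] part_closed(1)[OF B x(3)] R part_closed(4)[OF R]
        by (simp add: \<phi>_def L_single x(1) Rep_prodalg_ops)
    next
      case (add p q)
      then show ?case using R part_closed(2)[OF R] by (simp add: \<phi>_def L_linear Rep_prodalg_ops)
    next
      case zero
      show ?case using R part_closed(5)[OF R] by (simp add: \<phi>_def L_def clin Rep_prodalg_ops)
    qed
  next
    show "\<phi> \<one>\<^bsub>pre_tensor A B\<^esub> = \<one>\<^bsub>R\<^esub>"
      using R one by (simp add: \<phi>_def L_single salg_homD(4)[OF f] salg_homD(4)[OF g] emb_one)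
  qed (use R in \<open>simp_all add: \<phi>_def L_linear tensor_mult L_mult kill Rep_prodalg_ops\<close>)
  then obtain h where h: "salg_hom T R h" "\<And>p. p \<in> C \<Longrightarrow> h (TQ.coset p) = \<phi> p" by (auto simp: T_eq)
  have "h (pt a b) = f a \<otimes>\<^bsub>R\<^esub> g b" if "a \<in> carrier A" "b \<in> carrier B" for a b
    using h(2)[OF C_single[OF that, of 1]] fc[OF that(1)] gc[OF that(2)] R
    by (simp add: pt_eq \<phi>_def L_single Rep_prodalg_ops)
  then show ?thesis
    using h(1) one_closed salg_homD(4)[OF f] salg_homD(4)[OF g] fc gc
      monoid.l_one[OF superalgebraD(4)[OF R]] monoid.r_one[OF superalgebraD(4)[OF R]]
    by (intro exI[of _ h]) auto
qed

end

text \<open>\<open>id_tensor\<close> is a union over representatives, in which no algebraic law is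
  visible. It is identified with the homomorphism that the universal property yields.\<close>

lemma id_tensor_hom:
  assumes "tensor_pair A B" "tensor_pair A B'" and f: "salg_hom B B' f"
  shows "\<exists>h. salg_hom (tensor A B) (tensor A B') h \<and>
    (\<forall>x\<in>carrier (tensor A B). id_tensor A B' f x = h x) \<and>
    (\<forall>a\<in>carrier A. h (pure_tensor A B a \<one>\<^bsub>B\<^esub>) = pure_tensor A B' a \<one>\<^bsub>B'\<^esub>) \<and>
    (\<forall>b\<in>carrier B. h (pure_tensor A B \<one>\<^bsub>A\<^esub> b) = pure_tensor A B' \<one>\<^bsub>A\<^esub> (f b))"
proof -
  interpret t: tensor_pair A B by fact
  interpret t': tensor_pair A B' by fact
  interpret Q: prequot "pre_tensor A B" t.N "lin scale (t.diag False)" by (rule t.prequot_tensor)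
  interpret Q': prequot "pre_tensor A B'" t'.N "lin scale (t'.diag False)" by (rule t'.prequot_tensor)
  have "\<exists>h. salg_hom (tensor A B) (tensor A B') h \<and>
      (\<forall>a\<in>carrier A. h (t.pt a \<one>\<^bsub>B\<^esub>) = t'.pt a \<one>\<^bsub>B'\<^esub>) \<and> (\<forall>b\<in>carrier B. h (t.pt \<one>\<^bsub>A\<^esub> b) = t'.pt \<one>\<^bsub>A\<^esub> (f b))"
    by (rule t.tensor_hom_ex[OF t'.superalgebra_tensor t'.inl_hom salg_hom_comp[OF f t'.inr_hom]])
      (rule t'.pt_swap[OF _ salg_homD(6)[OF f]])
  then obtain h where h: "salg_hom (tensor A B) (tensor A B') h"
    "\<And>a. a \<in> carrier A \<Longrightarrow> h (t.pt a \<one>\<^bsub>B\<^esub>) = t'.pt a \<one>\<^bsub>B'\<^esub>"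
    "\<And>b. b \<in> carrier B \<Longrightarrow> h (t.pt \<one>\<^bsub>A\<^esub> b) = t'.pt \<one>\<^bsub>A\<^esub> (f b)" by blast
  define L where "L p = lin scale (\<lambda>(a, b). Poly_Mapping.single (a, f b) (1::complex)) p"
    for p :: "'a \<times> 'b \<Rightarrow>\<^sub>0 complex"
  have pure: "h (t.pt a b) = t'.pt a (f b)" if "a \<in> carrier A" "b \<in> carrier B" for a b
  proof -
    have "h (t.pt a b) = h (t.pt a \<one>\<^bsub>B\<^esub> \<otimes>\<^bsub>t.T\<^esub> t.pt \<one>\<^bsub>A\<^esub> b)" using t.pt_split[OF that] by simp
    also have "\<dots> = t'.pt a \<one>\<^bsub>B'\<^esub> \<otimes>\<^bsub>t'.T\<^esub> t'.pt \<one>\<^bsub>A\<^esub> (f b)"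
      using that t.one_closed by (simp add: salg_homD(3)[OF h(1)] h(2,3))
    also have "\<dots> = t'.pt a (f b)"
      using t'.pt_split[OF that(1) salg_homD(1)[OF f that(2)]] by simp
    finally show ?thesis .
  qed
  have hL: "h (Q.coset p) = Q'.coset (L p)" if "p \<in> t.C" for p
  proof -
    have "Poly_Mapping.keys p \<subseteq> carrier A \<times> carrier B" using that by simp
    then show ?thesis
    proof (induction rule: poly_mapping_keys_induct)
      case (single k z)
      then obtain a b where k: "k = (a, b)" "a \<in> carrier A" "b \<in> carrier B" by auto
      then show ?case using salg_homD(1)[OF f k(3)] t.one_closed pure[OF k(2,3)]
        by (simp add: t.coset_single salg_homD(5)[OF h(1)] t'.coset_single L_def slin)
    next
      case (add p q)
      then show ?case
        using salg_homD(2)[OF h(1), of "Q.coset p" "Q.coset q"] 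
        by (simp add: t.T_eq t'.T_eq Q.Q_add Q'.Q_add L_def slin)
    next
      case zero
      have "h (Q.coset 0) = h (0 \<odot>\<^bsub>t.T\<^esub> \<one>\<^bsub>t.T\<^esub>)"
        using salg_smult(6)[OF t.superalgebra_tensor, of "\<one>\<^bsub>t.T\<^esub>"] t.superalgebra_tensor
        by (simp add: t.T_eq Q.Q_zero)
      also have "\<dots> = 0 \<odot>\<^bsub>t'.T\<^esub> \<one>\<^bsub>t'.T\<^esub>"
        using t.superalgebra_tensor by (simp add: salg_homD[OF h(1)])
      also have "\<dots> = Q'.coset 0"
        using salg_smult(6)[OF t'.superalgebra_tensor, of "\<one>\<^bsub>t'.T\<^esub>"] t'.superalgebra_tensor
        by (simp add: t'.T_eq Q'.Q_zero)
      finally show ?case by (simp add: L_def slin)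
    qed
  qed
  have "id_tensor A B' f x = h x" if x: "x \<in> carrier (tensor A B)" for x
  proof -
    obtain p where p: "p \<in> t.C" "x = Q.coset p" using x by (rule t.T_cases)
    have "Q'.coset (L q) = h x" if "q \<in> x" for q
    proof -
      have "q \<in> t.C" using Q.coset_carrier[of p q] p that by simp
      moreover have "Q.coset q = x" using that p by (simp add: Q.coset_eq_iff Q.in_coset_iff)
      ultimately show ?thesis using hL by metis
    qed
    moreover have "p \<in> x" using p Q.I_ops(1) by (simp add: Q.in_coset_iff)
    moreover have "id_tensor A B' f x = (\<Union>q\<in>x. Q'.coset (L q))"
      by (simp add: id_tensor_def Q'.coset_def L_def lin_def case_prod_beta)
    ultimately show ?thesis by blast
  qed
  with h show ?thesis by blast
qed

section \<open>Coxeter presentations via descents\<close>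

text \<open>The number \<open>a s w\<close> is the value at \<open>w(\<alpha>\<^sub>s)\<close> of a dominant functional, so that its sign
  tells whether \<open>s\<close> is a descent of \<open>w\<close>.\<close>

locale descents =
  fixes W :: "'w set" and S :: "nat set" and act :: "'w \<Rightarrow> nat \<Rightarrow> 'w" and a :: "nat \<Rightarrow> 'w \<Rightarrow> int"
    and \<mu> :: "'w \<Rightarrow> nat" and w0 :: 'w
  assumes w0_in: "w0 \<in> W" and act_in: "\<And>w s. w \<in> W \<Longrightarrow> s \<in> S \<Longrightarrow> act w s \<in> W"
    and act_act: "\<And>w s. w \<in> W \<Longrightarrow> s \<in> S \<Longrightarrow> act (act w s) s = w"
    and a_act: "\<And>w s. w \<in> W \<Longrightarrow> s \<in> S \<Longrightarrow> a s (act w s) = - a s w"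
    and a_nz: "\<And>w s. w \<in> W \<Longrightarrow> s \<in> S \<Longrightarrow> a s w \<noteq> 0"
    and mu: "\<And>w s. w \<in> W \<Longrightarrow> s \<in> S \<Longrightarrow> a s w < 0 \<Longrightarrow> \<mu> (act w s) < \<mu> w"
    and dominant: "\<And>w. w \<in> W \<Longrightarrow> (\<And>s. s \<in> S \<Longrightarrow> a s w > 0) \<Longrightarrow> w = w0"
    and a_w0: "\<And>s. s \<in> S \<Longrightarrow> a s w0 > 0"
begin

text \<open>An element other than \<open>w0\<close> has a descent, and removing it lowers
  \<open>\<mu>\<close>; so all of \<open>W\<close> is reached from \<open>w0\<close> by the
  generators.\<close>

lemma W_induct [consumes 1, case_names base step]:
  assumes "w \<in> W" and base: "Q w0" and step: "\<And>w s. w \<in> W \<Longrightarrow> s \<in> S \<Longrightarrow> Q w \<Longrightarrow> Q (act w s)"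
  shows "Q w"
  using \<open>w \<in> W\<close>
proof (induction "\<mu> w" arbitrary: w rule: less_induct)
  case less
  show ?case
  proof (cases "\<forall>s\<in>S. a s w > 0")
    case True
    then show ?thesis using dominant less.prems base by metis
  next
    case False
    then obtain s where s: "s \<in> S" "a s w < 0" using a_nz[OF less.prems] by (metis linorder_neqE_linordered_idom)
    then have "Q (act w s)" using less mu act_in by blast
    then have "Q (act (act w s) s)" using step act_in less.prems s by blast
    then show ?thesis using act_act less.prems s by simp
  qed
qed

text \<open>The values express a reflection acting on the simple root of the other one: the
  coefficient of the added term is minus a Cartan integer, zero here and one in
  \<open>braid3\<close>. In \<open>braid4\<close> the two belongs to the short root, that of
  \<open>t\<close>.\<close>

definition commuting where "commuting s t \<longleftrightarrow> (\<forall>w\<in>W. a t (act w s) = a t w \<and> a s (act w t) = a s w \<and>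
    act (act w s) t = act (act w t) s)"

definition braid3 where "braid3 s t \<longleftrightarrow> (\<forall>w\<in>W. a t (act w s) = a s w + a t w \<and> a s (act w t) = a s w + a t w \<and>
    act (act (act w s) t) s = act (act (act w t) s) t)"

definition braid4 where "braid4 s t \<longleftrightarrow> (\<forall>w\<in>W. a t (act w s) = a s w + a t w \<and> a s (act w t) = a s w + 2 * a t w \<and>
    act (act (act (act w s) t) s) t = act (act (act (act w t) s) t) s)"

definition braid_relation :: "(nat \<Rightarrow> 'm :: semigroup_mult) \<Rightarrow> nat \<Rightarrow> nat \<Rightarrow> bool" where
  "braid_relation T s t \<longleftrightarrow>
     commuting s t \<and> T s * T t = T t * T s \<or>
     braid3 s t \<and> T s * T t * T s = T t * T s * T t \<or>
     braid4 s t \<and> T s * T t * T s * T t = T t * T s * T t * T s"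

text \<open>\<open>x\<close> is the product of the \<open>T s\<close> along a word for
  \<open>w\<close> obtained by stripping descents from the right, that is, along a reduced word.
  Different choices of descents may a priori give different \<open>x\<close>.\<close>

inductive rex :: "(nat \<Rightarrow> 'm :: semigroup_mult) \<Rightarrow> 'm \<Rightarrow> 'w \<Rightarrow> 'm \<Rightarrow> bool" for T e where
  base: "rex T e w0 e"
| step: "w \<in> W \<Longrightarrow> s \<in> S \<Longrightarrow> a s w < 0 \<Longrightarrow> rex T e (act w s) x \<Longrightarrow> rex T e w (x * T s)"

lemma rex_ex: "w \<in> W \<Longrightarrow> \<exists>x. rex T e w x"
proof (induction "\<mu> w" arbitrary: w rule: less_induct)
  case less
  show ?case
  proof (cases "\<forall>s\<in>S. a s w > 0")
    case True
    then show ?thesis using dominant less.prems rex.base by metis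
  next
    case False
    then obtain s where s: "s \<in> S" "a s w < 0" using a_nz[OF less.prems] by (metis linorder_neqE_linordered_idom)
    then show ?thesis using less mu act_in rex.step by metis
  qed
qed

text \<open>If \<open>s\<close> and \<open>t\<close> are both descents of \<open>w\<close>, an
  alternating word in them of full Coxeter length can be stripped from \<open>w\<close> in either
  order: each value met on the way is a nonnegative combination of the two negative numbers
  \<open>a s w\<close> and \<open>a t w\<close>. Both orders end at the same element, and the
  relation between \<open>T s\<close> and \<open>T t\<close> equates the products.\<close>

lemma rex_join:
  assumes br: "braid_relation T s t" and w: "w \<in> W" and st: "s \<in> S" "t \<in> S" "a s w < 0" "a t w < 0"
  shows "\<exists>x y. rex T e (act w s) x \<and> rex T e (act w t) y \<and> x * T s = y * T t"
proof -
  note cl = act_in[OF _ st(1)] act_in[OF _ st(2)]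
  note aa = a_act[OF _ st(1)] a_act[OF _ st(2)]
  from br consider
      (2) "commuting s t" "T s * T t = T t * T s"
    | (3) "braid3 s t" "T s * T t * T s = T t * T s * T t"
    | (4) "braid4 s t" "T s * T t * T s * T t = T t * T s * T t * T s"
    unfolding braid_relation_def by blast
  then show ?thesis
  proof cases
    case 2
    note r = 2(1)[unfolded commuting_def, rule_format]
    obtain z where z: "rex T e (act (act w s) t) z" using rex_ex cl w by blast
    have "rex T e (act w s) (z * T t)"
      by (rule rex.step[OF _ st(2) _ z]) (use r w cl st in simp_all)
    moreover have "rex T e (act w t) (z * T s)"
      by (rule rex.step[OF _ st(1)]) (use r w cl st z in simp_all)
    ultimately show ?thesis using 2(2) by (metis mult.assoc)
  next
    case 3
    note r = 3(1)[unfolded braid3_def, rule_format]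
    let ?u = "act (act (act w s) t) s"
    obtain z where z: "rex T e ?u z" using rex_ex[of ?u T e] cl w by auto
    have "rex T e (act (act w s) t) (z * T s)"
      by (rule rex.step[OF _ st(1) _ z]) (use r w cl st aa in simp_all)
    then have "rex T e (act w s) (z * T s * T t)"
      by (rule rex.step[OF _ st(2), rotated 2]) (use r w cl st in simp_all)
    moreover have "rex T e (act (act w t) s) (z * T t)"
      by (rule rex.step[OF _ st(2)]) (use r w cl st aa z in simp_all)
    then have "rex T e (act w t) (z * T t * T s)"
      by (rule rex.step[OF _ st(1), rotated 2]) (use r w cl st in simp_all)
    ultimately show ?thesis using 3(2) by (metis mult.assoc)
  next
    case 4
    note r = 4(1)[unfolded braid4_def, rule_format]
    let ?u = "act (act (act (act w s) t) s) t"
    obtain z where z: "rex T e ?u z" using rex_ex[of ?u T e] cl w by auto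
    have "rex T e (act (act (act w s) t) s) (z * T t)"
      by (rule rex.step[OF _ st(2) _ z]) (use r w cl st aa in simp_all)
    then have "rex T e (act (act w s) t) (z * T t * T s)"
      by (rule rex.step[OF _ st(1), rotated 2]) (use r w cl st aa in simp_all)
    then have "rex T e (act w s) (z * T t * T s * T t)"
      by (rule rex.step[OF _ st(2), rotated 2]) (use r w cl st aa in simp_all)
    moreover have "rex T e (act (act (act w t) s) t) (z * T s)"
      by (rule rex.step[OF _ st(1)]) (use r w cl st aa z in simp_all)
    then have "rex T e (act (act w t) s) (z * T s * T t)"
      by (rule rex.step[OF _ st(2), rotated 2]) (use r w cl st aa in simp_all)
    then have "rex T e (act w t) (z * T s * T t * T s)"
      by (rule rex.step[OF _ st(1), rotated 2]) (use r w cl st aa in simp_all)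
    ultimately show ?thesis using 4(2) by (metis mult.assoc)
  qed
qed

text \<open>Induction on \<open>\<mu>\<close>. Products with the same last letter agree by
  induction; for different last letters both are compared with the two products from
  \<open>rex_join\<close>, again by induction.\<close>

lemma rex_unique:
  assumes br: "\<And>s t. s \<in> S \<Longrightarrow> t \<in> S \<Longrightarrow> s \<noteq> t \<Longrightarrow> braid_relation T s t \<or> braid_relation T t s"
  shows "w \<in> W \<Longrightarrow> rex T e w x \<Longrightarrow> rex T e w y \<Longrightarrow> x = y"
proof (induction "\<mu> w" arbitrary: w x y rule: less_induct)
  case less
  show ?case
  proof (cases "w = w0")
    case True
    have "z = e" if "rex T e w z" for z
      using that
    proof cases
      case (step s x)
      then show ?thesis using a_w0[of s] True by simp
    qed
    then show ?thesis using less.prems by blast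
  next
    case False
    obtain s x' where x: "x = x' * T s" "s \<in> S" "a s w < 0" "rex T e (act w s) x'"
      using less.prems(2) False by (cases rule: rex.cases) blast+
    obtain t y' where y: "y = y' * T t" "t \<in> S" "a t w < 0" "rex T e (act w t) y'"
      using less.prems(3) False by (cases rule: rex.cases) blast+
    have IH: "z = z'" if "r \<in> S" "a r w < 0" "rex T e (act w r) z" "rex T e (act w r) z'" for r z z'
      using less.hyps[OF mu act_in] that less.prems(1) by blast
    show ?thesis
    proof (cases "s = t")
      case True
      then show ?thesis using IH x y by metis
    next
      case False
      obtain x'' y'' where "rex T e (act w s) x''" "rex T e (act w t) y''" "x'' * T s = y'' * T t"
        using br[OF x(2) y(2) False] rex_join[of T s t w e] rex_join[of T t s w e] x y less.prems(1) by metis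
      then show ?thesis using IH x y by metis
    qed
  qed
qed

text \<open>\<open>f w\<close> is the common value of the reduced words of \<open>w\<close>.
  Multiplying by a generator that is no descent lengthens a reduced word; multiplying by a descent
  removes a last letter, by \<open>T s * T s = e\<close>.\<close>

theorem coxeter_hom:
  assumes br: "\<And>s t. s \<in> S \<Longrightarrow> t \<in> S \<Longrightarrow> s \<noteq> t \<Longrightarrow> braid_relation T s t \<or> braid_relation T t s"
    and sq: "\<And>s. s \<in> S \<Longrightarrow> T s * T s = e" and unit: "\<And>s. s \<in> S \<Longrightarrow> T s * e = T s" "e * e = e"
  shows "\<exists>f. f w0 = e \<and> (\<forall>w\<in>W. f w * e = f w) \<and> (\<forall>w\<in>W. \<forall>s\<in>S. f (act w s) = f w * T s)"
proof -
  define f where "f w = (SOME x. rex T e w x)" for w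
  have f: "rex T e w (f w)" if "w \<in> W" for w
    unfolding f_def by (rule someI_ex[OF rex_ex[OF that]])
  have f_eq: "f w = x" if "w \<in> W" "rex T e w x" for w x
    using rex_unique[OF br] f that by blast
  have desc: "f w = f (act w s) * T s" if "w \<in> W" "s \<in> S" "a s w < 0" for w s
    using that by (intro f_eq rex.step f act_in)
  have f0: "f w0 = e" using f_eq[OF w0_in rex.base] .
  have unit': "f w * e = f w" if "w \<in> W" for w
    using f[OF that] that by cases (use unit in \<open>auto simp: mult.assoc\<close>)
  have "f (act w s) = f w * T s" if w: "w \<in> W" and s: "s \<in> S" for w s
  proof (cases "a s w < 0")
    case True
    then show ?thesis using desc[OF w s] sq[OF s] unit'[OF act_in[OF w s]] by (simp add: mult.assoc)
  next
    case False
    then have "a s (act w s) < 0" using a_act[OF w s] a_nz[OF w s] by simp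
    then show ?thesis using desc[OF act_in[OF w s] s] act_act[OF w s] by simp
  qed
  with f0 unit' show ?thesis by blast
qed

end

section \<open>The Weyl groups\<close>

lemma s_ref_apply:
  assumes "i \<ge> 1" "j \<ge> 1" "i \<noteq> j"
  shows "s_ref i j k = (if k = int i then int j else if k = int j then int i else
    if k = - int i then - int j else if k = - int j then - int i else k)"
  using assms by (auto simp: s_ref_def transpose_def)

lemma sbar_ref_apply:
  assumes "i \<ge> 1" "j \<ge> 1" "i \<noteq> j"
  shows "sbar_ref i j k = (if k = int i then - int j else if k = int j then - int i else
    if k = - int i then int j else if k = - int j then int i else k)"
  using assms by (auto simp: sbar_ref_def transpose_def)

lemma tau_ref_apply:
  "tau_ref i k = (if k = int i then - int i else if k = - int i then int i else k)"
  by (auto simp: tau_ref_def transpose_def)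

lemma signed_permsD:
  assumes "w \<in> signed_perms n"
  shows "w permutes {- int n..int n}" "w (- k) = - w k" "w 0 = 0" "inj w"
    "k \<in> {1..int n} \<Longrightarrow> w k \<noteq> 0 \<and> \<bar>w k\<bar> \<le> int n"
proof -
  show p: "w permutes {- int n..int n}" and m: "\<And>k. w (- k) = - w k"
    using assms by (auto simp: signed_perms_def)
  show z: "w 0 = 0" using m[of 0] by simp
  show i: "inj w" using p by (rule permutes_inj)
  show "k \<in> {1..int n} \<Longrightarrow> w k \<noteq> 0 \<and> \<bar>w k\<bar> \<le> int n"
    using permutes_in_image[OF p, of k] injD[OF i, of k 0] z by auto
qed

lemma signed_perms_comp: "w \<in> signed_perms n \<Longrightarrow> w' \<in> signed_perms n \<Longrightarrow> w \<circ> w' \<in> signed_perms n"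
  by (auto simp: signed_perms_def permutes_compose)

lemma signed_perms_inv: 
  assumes "w \<in> signed_perms n" shows "inv_into UNIV w \<in> signed_perms n"
proof -
  note w = signed_permsD[OF assms]
  have "inv_into UNIV w (- k) = - inv_into UNIV w k" for k
    using w(2)[of "inv_into UNIV w k"] permutes_inverses[OF w(1)] by metis
  then show ?thesis using permutes_inv[OF w(1)] by (simp add: signed_perms_def)
qed

text \<open>The character that counts sign changes modulo two. Written as a product of signs it is
  multiplicative by reindexing, which settles closure of type D under composition and
  inverses.\<close>

definition sg :: "nat \<Rightarrow> (int \<Rightarrow> int) \<Rightarrow> int" where "sg n w = (\<Prod>i\<in>{1..int n}. sgn (w i))"

lemma sg_card: 
  assumes "w \<in> signed_perms n"
  shows "sg n w = (-1) ^ card {i \<in> {1..int n}. w i < 0}"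
proof -
  have "sg n w = (\<Prod>i\<in>{1..int n}. if w i < 0 then -1 else 1)"
    unfolding sg_def using signed_permsD(5)[OF assms] by (intro prod.cong) (auto simp: sgn_if)
  also have "\<dots> = (\<Prod>i\<in>{i \<in> {1..int n}. w i < 0}. -1)"
    by (subst prod.inter_filter[symmetric]) auto
  finally show ?thesis by simp
qed

text \<open>The absolute values of \<open>w'\<close> permute \<open>{1..int n}\<close>, so after the
  sign of \<open>w' i\<close> is pulled out by oddness, the factor belonging to \<open>w\<close> may
  be reindexed.\<close>

lemma sg_comp:
  assumes w: "w \<in> signed_perms n" and w': "w' \<in> signed_perms n"
  shows "sg n (w \<circ> w') = sg n w * sg n w'"
proof -
  let ?A = "{1..int n}" and ?f = "\<lambda>i. \<bar>w' i\<bar>"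
  have inj: "inj_on ?f ?A"
  proof
    fix i j assume ij: "i \<in> ?A" "j \<in> ?A" "\<bar>w' i\<bar> = \<bar>w' j\<bar>"
    then have "w' i = w' j \<or> w' i = w' (- j)" using signed_permsD(2)[OF w', of j] by auto
    then show "i = j" using injD[OF signed_permsD(4)[OF w']] ij(1,2) by fastforce
  qed
  have sub: "?f ` ?A \<subseteq> ?A" using signed_permsD(5)[OF w'] by fastforce
  have bij: "bij_betw ?f ?A ?A" using endo_inj_surj[OF _ sub inj] inj by (simp add: bij_betw_def)
  have "sgn (w (w' i)) = sgn (w (?f i)) * sgn (w' i)" for i
    using signed_permsD(2)[OF w, of "w' i"] signed_permsD(3)[OF w] by (cases "w' i" "0 :: int" rule: linorder_cases) auto
  then have "sg n (w \<circ> w') = (\<Prod>i\<in>?A. sgn (w (?f i))) * sg n w'"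
    by (simp add: sg_def prod.distrib)
  also have "(\<Prod>i\<in>?A. sgn (w (?f i))) = sg n w"
    unfolding sg_def using prod.reindex_bij_betw[OF bij, of "\<lambda>k. sgn (w k)"] .
  finally show ?thesis .
qed

lemma weyl_sub: "weyl ty n \<subseteq> signed_perms n"
  by (cases ty) (auto simp: weyl_def)

lemma weylD_eq: "w \<in> weyl TypeD n \<longleftrightarrow> w \<in> signed_perms n \<and> sg n w = 1"
  by (auto simp: weyl_def sg_card minus_one_power_iff split: if_splits)

lemma weyl_comp: "w \<in> weyl ty n \<Longrightarrow> w' \<in> weyl ty n \<Longrightarrow> w \<circ> w' \<in> weyl ty n"
proof (cases ty)
  case TypeA
  assume "w \<in> weyl ty n" "w' \<in> weyl ty n"
  then have w: "w \<in> signed_perms n" "\<And>i. i \<in> {1..int n} \<Longrightarrow> w i > 0" 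
    and w': "w' \<in> signed_perms n" "\<And>i. i \<in> {1..int n} \<Longrightarrow> w' i > 0" using TypeA by (auto simp: weyl_def)
  have "w (w' i) > 0" if "i \<in> {1..int n}" for i
    using signed_permsD(5)[OF w'(1) that] w'(2)[OF that] by (intro w(2)) auto
  then show ?thesis using w w' TypeA by (auto simp: weyl_def signed_perms_comp)
qed (auto simp: weyl_def[of TypeB] weylD_eq signed_perms_comp sg_comp)

lemma id_weyl: "id \<in> weyl ty n"
proof -
  have "id \<in> signed_perms n" by (simp add: signed_perms_def permutes_id)
  moreover have "sg n id = 1" by (simp add: sg_def)
  ultimately show ?thesis by (cases ty) (auto simp: weyl_def[of TypeB] weyl_def[of TypeA] weylD_eq)
qed

lemma inv_comp_weyl: "w \<in> weyl ty n \<Longrightarrow> inv_into UNIV w \<circ> w = id \<and> w \<circ> inv_into UNIV w = id"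
  using signed_permsD(1)[of w n] weyl_sub permutes_inv_o by blast

lemma weyl_inv:
  assumes "w \<in> weyl ty n" shows "inv_into UNIV w \<in> weyl ty n"
proof -
  have w: "w \<in> signed_perms n" using assms weyl_sub by auto
  note i = signed_perms_inv[OF w]
  have c: "inv_into UNIV w \<circ> w = id" using inv_comp_weyl[OF assms] by simp
  show ?thesis
  proof (cases ty)
    case TypeA
    have "inv_into UNIV w k > 0" if k: "k \<in> {1..int n}" for k
    proof (rule ccontr)
      assume "\<not> ?thesis"
      moreover have "inv_into UNIV w k \<noteq> 0 \<and> \<bar>inv_into UNIV w k\<bar> \<le> int n" using signed_permsD(5)[OF i k] .
      \<comment> \<open>The negative of the inverse image would be a positive index that
        \<open>w\<close> sends to \<open>- k\<close>.\<close>
      ultimately have "- inv_into UNIV w k \<in> {1..int n}" by auto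
      then have "w (- inv_into UNIV w k) > 0" using assms TypeA by (auto simp: weyl_def)
      then show False using signed_permsD(2)[OF w] permutes_inverses(1)[OF signed_permsD(1)[OF w]] k by simp
    qed
    then show ?thesis using i TypeA by (simp add: weyl_def)
  next
    case TypeB
    then show ?thesis using i by (simp add: weyl_def)
  next
    case TypeD
    then have "sg n w = 1" using assms by (simp add: weylD_eq)
    moreover have "sg n (inv_into UNIV w) * sg n w = 1"
      using sg_comp[OF i w] by (simp add: c) (simp add: sg_def)
    ultimately show ?thesis using i TypeD by (simp add: weylD_eq)
  qed
qed

lemma s_ref_weyl:
  assumes "i \<in> {1..n}" "j \<in> {1..n}" "i \<noteq> j"
  shows "s_ref i j \<in> weyl ty n"
proof -
  note ap = s_ref_apply[of i j]
  have p: "s_ref i j permutes {- int n..int n}"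
    unfolding s_ref_def using assms by (intro permutes_compose permutes_swap_id) auto
  have "s_ref i j \<in> signed_perms n" using p assms by (auto simp: signed_perms_def ap)
  moreover have pos: "\<forall>k\<in>{1..int n}. s_ref i j k > 0" using assms by (auto simp: ap)
  moreover have "sg n (s_ref i j) = 1" unfolding sg_def using pos by (intro prod.neutral) auto
  ultimately show ?thesis by (cases ty) (auto simp: weyl_def[of TypeB] weyl_def[of TypeA] weylD_eq)
qed

lemma tau_ref_weyl:
  assumes "i \<in> {1..n}" shows "tau_ref i \<in> weyl TypeB n"
proof -
  have "tau_ref i permutes {- int n..int n}"
    unfolding tau_ref_def using assms by (intro permutes_swap_id) auto
  then show ?thesis by (auto simp: weyl_def signed_perms_def tau_ref_apply)
qed

lemma sbar_ref_weyl:
  assumes "i \<in> {1..n}" "j \<in> {1..n}" "i \<noteq> j" "ty \<noteq> TypeA"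
  shows "sbar_ref i j \<in> weyl ty n"
proof -
  note ap = sbar_ref_apply[of i j]
  have p: "sbar_ref i j permutes {- int n..int n}"
    unfolding sbar_ref_def using assms by (intro permutes_compose permutes_swap_id) auto
  then have s: "sbar_ref i j \<in> signed_perms n" using assms by (auto simp: signed_perms_def ap)
  moreover have "{k \<in> {1..int n}. sbar_ref i j k < 0} = {int i, int j}" using assms by (auto simp: ap)
  then have "sg n (sbar_ref i j) = 1" using assms by (simp add: sg_card[OF s])
  ultimately show ?thesis using assms(4) by (cases ty) (auto simp: weyl_def[of TypeB] weylD_eq)
qed

lemma simple_ref_weyl:
  assumes "admissible ty n" "s \<in> simple_index ty n"
  shows "simple_ref ty n s \<in> weyl ty n"
  using assms s_ref_weyl[of s n "s + 1" ty] tau_ref_weyl[of n n] sbar_ref_weyl[of "n - 1" n n ty]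
  by (cases ty) (auto simp: simple_ref_def simple_index_def)

text \<open>Value at \<open>e_k\<close> of the functional with coordinates
  \<open>n, n-1, ..., 1\<close>, extended to signed indices. Its values at the vectors
  \<open>e_k\<close> are distinct and nonzero, so it is regular and strictly dominant in types A, B
  and D at once.\<close>

definition height :: "nat \<Rightarrow> int \<Rightarrow> int" where
  "height n k = sgn k * (int n + 1 - \<bar>k\<bar>)"

lemma height_minus [simp]: "height n (- k) = - height n k"
  by (simp add: height_def)

lemma height_bound: "k \<noteq> 0 \<Longrightarrow> \<bar>k\<bar> \<le> int n \<Longrightarrow> 1 \<le> \<bar>height n k\<bar> \<and> \<bar>height n k\<bar> \<le> int n"
  by (auto simp: height_def abs_mult)

lemma height_inj: "k \<noteq> 0 \<Longrightarrow> \<bar>k\<bar> \<le> int n \<Longrightarrow> l \<noteq> 0 \<Longrightarrow> \<bar>l\<bar> \<le> int n \<Longrightarrow> height n k = height n l \<Longrightarrow> k = l"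
  by (auto simp: height_def sgn_if split: if_splits)

text \<open>This is \<open>height\<close> at the image under \<open>w\<close> of a simple root:
  \<open>e_s - e_{s+1}\<close> for \<open>s < n\<close>, and for \<open>s = n\<close> the root
  \<open>e_n\<close> in type B and \<open>e_{n-1} + e_n\<close> in type D.\<close>

definition descent :: "weyl_type \<Rightarrow> nat \<Rightarrow> nat \<Rightarrow> (int \<Rightarrow> int) \<Rightarrow> int" where
  "descent ty n s w = (if s < n then height n (w (int s)) - height n (w (int s + 1))
     else case ty of TypeB \<Rightarrow> height n (w (int n)) | _ \<Rightarrow> height n (w (int n - 1)) + height n (w (int n)))"

text \<open>The sum is the pairing of \<lambda> = (n, ..., 1) with w \<lambda>, which is largest at
  the identity. The cube of \<open>n\<close> is a crude upper bound for it and turns the difference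
  into a natural number.\<close>

definition defect :: "nat \<Rightarrow> (int \<Rightarrow> int) \<Rightarrow> nat" where
  "defect n w = nat (int n * int n * int n - (\<Sum>i\<in>{1..int n}. (int n + 1 - i) * height n (w i)))"

lemma sum_upd2:
  fixes f g :: "int \<Rightarrow> int"
  assumes "finite I" "p \<in> I" "q \<in> I" "p \<noteq> q" "\<And>i. i \<in> I \<Longrightarrow> i \<noteq> p \<Longrightarrow> i \<noteq> q \<Longrightarrow> f i = g i"
  shows "sum f I - sum g I = (f p - g p) + (f q - g q)"
proof -
  have "sum h I = h p + (h q + sum h (I - {p} - {q}))" for h :: "int \<Rightarrow> int"
    using assms by (simp add: sum.remove[of I p] sum.remove[of "I - {p}" q])
  moreover have "sum f (I - {p} - {q}) = sum g (I - {p} - {q})" using assms(5) by (intro sum.cong) auto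
  ultimately show ?thesis by simp
qed

lemma weighted_height_bound:
  assumes "w \<in> signed_perms n"
  shows "(\<Sum>i\<in>{1..int n}. (int n + 1 - i) * height n (w i)) \<le> int n * int n * int n"
proof -
  have "(\<Sum>i\<in>{1..int n}. (int n + 1 - i) * height n (w i)) \<le> (\<Sum>i\<in>{1..int n}. int n * int n)"
  proof (rule sum_mono)
    fix i assume i: "i \<in> {1..int n}"
    then have "\<bar>height n (w i)\<bar> \<le> int n" using signed_permsD(5)[OF assms i] height_bound by blast
    then show "(int n + 1 - i) * height n (w i) \<le> int n * int n"
      using i by (intro order.trans[OF mult_left_mono mult_right_mono]) auto
  qed
  then show ?thesis by simp
qed

text \<open>Replacing \<open>w\<close> by \<open>w\<close> times the reflection changes the pairing
  of \<lambda> = (n, ..., 1) with w \<lambda> by minus the descent value times the pairing of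
  \<lambda> with the simple coroot. The latter factor is 1 for \<open>s < n\<close>, 2 for the last
  reflection of type B and 3 for that of type D.\<close>

lemma defect_less:
  assumes ad: "admissible ty n" and w: "w \<in> weyl ty n" and s: "s \<in> simple_index ty n" and d: "descent ty n s w < 0"
  shows "defect n (w \<circ> simple_ref ty n s) < defect n w"
proof -
  have wp: "w \<in> signed_perms n" "w \<circ> simple_ref ty n s \<in> signed_perms n"
    using weyl_sub w weyl_comp[OF w simple_ref_weyl[OF ad s]] by auto
  define P where "P v = (\<Sum>i\<in>{1..int n}. (int n + 1 - i) * height n (v i))" for v :: "int \<Rightarrow> int"
  have "P (w \<circ> simple_ref ty n s) > P w"
  proof (cases "s < n")
    case True
    then have s1: "s \<ge> 1" using s by (cases ty) (auto simp: simple_index_def)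
    have "P (w \<circ> simple_ref ty n s) - P w = 
        height n (w (int s + 1)) - height n (w (int s))"
      unfolding P_def using True s1
      by (subst sum_upd2[where p = "int s" and q = "int s + 1"])
        (auto simp: simple_ref_def s_ref_apply algebra_simps)
    then show ?thesis using d True by (simp add: descent_def)
  next
    case False
    then have sn: "s = n" using s by (cases ty) (auto simp: simple_index_def)
    show ?thesis
    proof (cases ty)
      case TypeA
      then show ?thesis using s sn by (simp add: simple_index_def)
    next
      case TypeB
      then have n: "n \<ge> 2" using ad by simp
      have "P (w \<circ> simple_ref ty n s) - P w = - 2 * height n (w (int n))"
        unfolding P_def using n sn TypeB signed_permsD(2)[OF wp(1), of "int n"]
        \<comment> \<open>The index \<open>n - 1\<close> is a dummy: only the summand at
          \<open>n\<close> changes, while \<open>sum_upd2\<close> asks for two.\<close>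
        by (subst sum_upd2[where p = "int n" and q = "int n - 1"])
          (auto simp: simple_ref_def tau_ref_apply algebra_simps)
      then show ?thesis using d TypeB sn by (simp add: descent_def)
    next
      case TypeD
      then have n: "n \<ge> 4" using ad by simp
      have "P (w \<circ> simple_ref ty n s) - P w = - 3 * (height n (w (int n - 1)) + height n (w (int n)))"
        unfolding P_def using n sn TypeD signed_permsD(2)[OF wp(1), of "int n"] signed_permsD(2)[OF wp(1), of "int n - 1"]
        by (subst sum_upd2[where p = "int n" and q = "int n - 1"])
          (auto simp: simple_ref_def sbar_ref_apply of_nat_diff algebra_simps)
      then show ?thesis using d TypeD sn by (simp add: descent_def)
    qed
  qed
  moreover have "P (w \<circ> simple_ref ty n s) \<le> int n * int n * int n"
    unfolding P_def by (rule weighted_height_bound[OF wp(2)])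
  ultimately show ?thesis unfolding defect_def P_def by simp
qed

lemma signed_perm_eq_id:
  assumes w: "w \<in> signed_perms n" and eq: "\<And>i. i \<in> {1..int n} \<Longrightarrow> w i = i"
  shows "w = id"
proof
  fix k
  consider "k \<in> {1..int n}" | "- k \<in> {1..int n}" | "k = 0" | "k \<notin> {- int n..int n}" by force
  then show "w k = id k"
  proof cases
    case 2
    then show ?thesis using eq[OF 2] signed_permsD(2)[OF w, of k] by simp
  next
    case 4
    then show ?thesis using permutes_not_in[OF signed_permsD(1)[OF w] 4] by simp
  qed (use eq signed_permsD(3)[OF w] in auto)
qed

text \<open>The values \<open>h i\<close> are decreasing nonzero integers of absolute value at most
  \<open>n\<close>; if the last one is positive, they are squeezed to \<open>n, n-1, ..., 1\<close>.
  In type D a negative last value still leaves \<open>h (n - 1) \<ge> 2\<close>, so \<open>w\<close>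
  fixes the first \<open>n - 1\<close> indices and changes exactly one sign, which is
  excluded.\<close>

lemma dominant_weyl:
  assumes ad: "admissible ty n" and w: "w \<in> weyl ty n"
    and d: "\<And>s. s \<in> simple_index ty n \<Longrightarrow> descent ty n s w > 0"
  shows "w = id"
proof -
  have wp: "w \<in> signed_perms n" using w weyl_sub by auto
  have n: "n \<ge> 1" using ad by (cases ty) auto
  define h where "h i = height n (w (int i))" for i
  have hb: "1 \<le> \<bar>h i\<bar>" "\<bar>h i\<bar> \<le> int n" if "i \<in> {1..n}" for i
    using that signed_permsD(5)[OF wp, of "int i"] height_bound unfolding h_def by auto
  have dec: "h (Suc i) < h i" if "1 \<le> i" "i < n" for i
    using d[of i] that by (cases ty) (auto simp: simple_index_def descent_def h_def add.commute)
  have up: "h i \<le> int n + 1 - int i" if "i \<in> {1..n}" for i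
    using that
  proof (induction i)
    case (Suc i)
    then show ?case using dec[of i] hb[of "Suc i"] by (cases "i = 0") auto
  qed simp
  have low: "h i \<ge> int n + 1 - int i" if "i \<in> {1..m}" "m \<in> {1..n}" "h m \<ge> int n + 1 - int m" for i m
  proof -
    have "i \<le> m" "m \<le> n" "1 \<le> i" using that by auto
    then show ?thesis using that(3)
    proof (induction i rule: inc_induct)
      case (step k)
      then show ?case using dec[of k] by auto
    qed simp
  qed
  have wi: "w (int i) = int i" if "i \<in> {1..n}" "h i = int n + 1 - int i" for i
    using that height_inj[of "w (int i)" n "int i"] signed_permsD(5)[OF wp, of "int i"]
    by (simp add: h_def) (simp add: height_def)
  have all: "w = id" if "h n > 0"
  proof (rule signed_perm_eq_id[OF wp])
    fix k assume "k \<in> {1..int n}"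
    then obtain i where i: "k = int i" "i \<in> {1..n}" by (metis atLeastAtMost_iff nat_0_le nat_le_iff nat_mono zero_le_one order_trans int_nat_eq nat_1 nat_int One_nat_def)
    then show "w k = k" using wi[of i] up[of i] low[of i n] that n by simp
  qed
  show ?thesis
  proof (cases ty)
    case TypeA
    have "w (int n) > 0" using w TypeA n by (auto simp: weyl_def)
    then have "h n > 0" using signed_permsD(5)[OF wp, of "int n"] n by (simp add: h_def height_def)
    then show ?thesis by (rule all)
  next
    case TypeB
    then show ?thesis using d[of n] n by (intro all) (simp add: simple_index_def descent_def h_def)
  next
    case TypeD
    show ?thesis
    proof (rule all, rule ccontr)
      assume neg: "\<not> h n > 0"
      have n4: "n \<ge> 4" using ad TypeD by simp
      have "h (n - 1) + h n > 0"
        using d[of n] TypeD n4 by (simp add: simple_index_def descent_def h_def of_nat_diff)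
      then have "h (n - 1) \<ge> int n + 1 - int (n - 1)" using neg hb[of n] n4 by (auto simp: of_nat_diff)
      then have eq: "w (int i) = int i" if "i \<in> {1..n - 1}" for i
        using wi[of i] up[of i] low[of i "n - 1"] that n4 by force
      have wn: "w (int n) < 0"
        using neg hb[of n] n4 signed_permsD(5)[OF wp, of "int n"] by (auto simp: h_def height_def sgn_if split: if_splits)
      have "sgn (w k) = (if k = int n then -1 else 1)" if "k \<in> {1..int n}" for k
      proof (cases "k = int n")
        case False
        then have "nat k \<in> {1..n - 1}" "int (nat k) = k" using that by auto
        then show ?thesis using eq[of "nat k"] False that by simp
      qed (use wn in simp)
      then have "sg n w = (\<Prod>k\<in>{1..int n}. if k = int n then -1 else 1)"
        unfolding sg_def by (intro prod.cong) auto
      also have "\<dots> = -1" using n by (simp add: prod.delta)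
      finally show False using w TypeD by (simp add: weylD_eq)
    qed
  qed
qed

lemma simple_index_cases:
  assumes "admissible ty n" "s \<in> simple_index ty n"
  obtains "1 \<le> s" "s < n" | "s = n" "ty = TypeB" "n \<ge> 2" | "s = n" "ty = TypeD" "n \<ge> 4"
  using assms by (cases ty; cases "s < n"; auto simp: simple_index_def)

lemma simple_ref_involutive:
  assumes "admissible ty n" "s \<in> simple_index ty n"
  shows "simple_ref ty n s \<circ> simple_ref ty n s = id"
  using assms
  by (cases rule: simple_index_cases)
    (auto simp: fun_eq_iff simple_ref_def s_ref_apply tau_ref_apply sbar_ref_apply)

lemma descents_weyl:
  assumes ad: "admissible ty n"
  shows "descents (weyl ty n) (simple_index ty n) (\<lambda>w s. w \<circ> simple_ref ty n s) (descent ty n) (defect n) id"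
proof
  show "id \<in> weyl ty n" by (rule id_weyl)
  fix w s assume w: "w \<in> weyl ty n" and s: "s \<in> simple_index ty n"
  have wp: "w \<in> signed_perms n" using w weyl_sub by auto
  show "w \<circ> simple_ref ty n s \<in> weyl ty n" by (rule weyl_comp[OF w simple_ref_weyl[OF ad s]])
  show "w \<circ> simple_ref ty n s \<circ> simple_ref ty n s = w"
    using simple_ref_involutive[OF ad s] by (simp add: comp_assoc)
  show "descent ty n s (w \<circ> simple_ref ty n s) = - descent ty n s w"
    using ad s
  proof (cases rule: simple_index_cases)
    case 1
    then show ?thesis by (simp add: descent_def simple_ref_def s_ref_apply add.commute[of 1])
  next
    case 2
    then show ?thesis using signed_permsD(2)[OF wp, of "int n"]
      by (simp add: descent_def simple_ref_def tau_ref_apply)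
  next
    case 3
    then show ?thesis using signed_permsD(2)[OF wp, of "int n"] signed_permsD(2)[OF wp, of "int n - 1"]
      by (simp add: descent_def simple_ref_def sbar_ref_apply of_nat_diff)
  qed
  have nz: "height n (w k) \<noteq> 0" if "k \<in> {1..int n}" for k
    using signed_permsD(5)[OF wp that] height_bound by fastforce
  have inj: "height n (w k) \<noteq> height n (w l)" if "\<bar>k\<bar> \<in> {1..int n}" "\<bar>l\<bar> \<in> {1..int n}" "k \<noteq> l" for k l
  proof -
    have "w k \<noteq> 0 \<and> \<bar>w k\<bar> \<le> int n" "w l \<noteq> 0 \<and> \<bar>w l\<bar> \<le> int n"
      using signed_permsD(5)[OF wp that(1)] signed_permsD(5)[OF wp that(2)] signed_permsD(2)[OF wp, of k]
        signed_permsD(2)[OF wp, of l] by (auto simp: abs_if split: if_splits)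
    then show ?thesis using height_inj[of "w k" n "w l"] injD[OF signed_permsD(4)[OF wp], of k l] that(3) by auto
  qed
  show "descent ty n s w \<noteq> 0"
    using ad s
  proof (cases rule: simple_index_cases)
    case 1
    then show ?thesis using inj[of "int s" "int s + 1"] by (simp add: descent_def)
  next
    case 2
    then show ?thesis using nz[of "int n"] by (simp add: descent_def)
  next
    case 3
    then show ?thesis using inj[of "int n - 1" "- int n"] signed_permsD(2)[OF wp, of "int n"]
      by (simp add: descent_def)
  qed
  show "descent ty n s w < 0 \<Longrightarrow> defect n (w \<circ> simple_ref ty n s) < defect n w"
    by (rule defect_less[OF ad w s])
next
  fix w assume "w \<in> weyl ty n" "\<And>s. s \<in> simple_index ty n \<Longrightarrow> descent ty n s w > 0"
  then show "w = id" by (rule dominant_weyl[OF ad])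
next
  fix s assume "s \<in> simple_index ty n"
  with ad show "descent ty n s id > 0"
    by (cases rule: simple_index_cases) (auto simp: descent_def height_def)
qed

section \<open>Braid relations and extension of a family \<open>T\<close> to the Weyl group\<close>

definition weyl_braids :: "weyl_type \<Rightarrow> nat \<Rightarrow> (nat \<Rightarrow> 'm :: semigroup_mult) \<Rightarrow> bool" where
  "weyl_braids ty n T \<longleftrightarrow>
     (\<forall>s t. 1 \<le> s \<and> s + 1 < t \<and> t < n \<longrightarrow> T s * T t = T t * T s) \<and>
     (\<forall>s. 1 \<le> s \<and> s + 1 < n \<longrightarrow> T s * T (s + 1) * T s = T (s + 1) * T s * T (s + 1)) \<and>
     (ty = TypeB \<longrightarrow> (\<forall>s. 1 \<le> s \<and> s + 1 < n \<longrightarrow> T s * T n = T n * T s) \<and>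
        T (n - 1) * T n * T (n - 1) * T n = T n * T (n - 1) * T n * T (n - 1)) \<and>
     (ty = TypeD \<longrightarrow> (\<forall>s. 1 \<le> s \<and> s < n \<and> s \<noteq> n - 2 \<longrightarrow> T s * T n = T n * T s) \<and>
        T (n - 2) * T n * T (n - 2) = T n * T (n - 2) * T n)"

text \<open>Oddness reduces the comparison to one representative of each moved pair
  \<open>k\<close>, \<open>- k\<close>, which avoids a case explosion for nested
  reflections.\<close>

lemma odd_fun_eqI:
  fixes f g :: "int \<Rightarrow> int"
  assumes "\<And>k. f (- k) = - f k" "\<And>k. g (- k) = - g k" "\<And>k. k \<in> K \<Longrightarrow> f k = g k"
    "\<And>k. \<bar>k\<bar> \<notin> K \<Longrightarrow> f k = g k"
  shows "f k = g k"
proof (cases "\<bar>k\<bar> \<in> K")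
  case True
  then have "k \<in> K \<or> - k \<in> K" by (auto simp: abs_if split: if_splits)
  then show ?thesis using assms(3)[of k] assms(3)[of "- k"] assms(1,2) by auto
qed (rule assms(4))

text \<open>Attaches to each pair of simple reflections its Coxeter exponent together with its place
  in the diagram. In this form it serves both to extend a family \<open>T\<close> to the group and
  to read braid relations off the group.\<close>

lemma weyl_kind:
  assumes ad: "admissible ty n"
    and st: "s \<in> simple_index ty n" "t \<in> simple_index ty n" "s < t"
  shows "descents.commuting (weyl ty n) (\<lambda>w s. w \<circ> simple_ref ty n s) (descent ty n) s t \<and>
      (t < n \<and> s + 1 < t \<or> ty = TypeB \<and> t = n \<and> s + 1 < n \<or> ty = TypeD \<and> t = n \<and> s < n \<and> s \<noteq> n - 2) \<or>
    descents.braid3 (weyl ty n) (\<lambda>w s. w \<circ> simple_ref ty n s) (descent ty n) s t \<and>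
      (t = s + 1 \<and> t < n \<or> ty = TypeD \<and> t = n \<and> s = n - 2) \<or>
    descents.braid4 (weyl ty n) (\<lambda>w s. w \<circ> simple_ref ty n s) (descent ty n) s t \<and>
      (ty = TypeB \<and> t = n \<and> s = n - 1)"
proof -
  interpret descents "weyl ty n" "simple_index ty n" "\<lambda>w s. w \<circ> simple_ref ty n s" "descent ty n" "defect n" id
    by (rule descents_weyl[OF ad])
  have s1: "1 \<le> s" "s < n" using st ad by (cases ty; auto simp: simple_index_def)+
  have comm: "w \<circ> f \<circ> g = w \<circ> g \<circ> f" if "\<And>k. f (g k) = g (f k)" for w f g :: "int \<Rightarrow> int"
    using that by (auto simp: fun_eq_iff)
  have br: "w \<circ> f \<circ> g \<circ> f = w \<circ> g \<circ> f \<circ> g" if "\<And>k. f (g (f k)) = g (f (g k))" for w f g :: "int \<Rightarrow> int"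
    using that by (auto simp: fun_eq_iff)
  have br4: "w \<circ> f \<circ> g \<circ> f \<circ> g = w \<circ> g \<circ> f \<circ> g \<circ> f" if "\<And>k. f (g (f (g k))) = g (f (g (f k)))" for w f g :: "int \<Rightarrow> int"
    using that by (auto simp: fun_eq_iff)
  have sp: "w (- k) = - w k" if "w \<in> weyl ty n" for w k using that weyl_sub signed_permsD(2) by blast
  show ?thesis
    using ad st(2)
  proof (cases rule: simple_index_cases)
    case 1
    show ?thesis
    proof (cases "t = s + 1")
      case True
      have "braid3 s t"
        unfolding braid3_def
        by (intro ballI conjI br) (use True s1 1 in \<open>auto simp: add.commute[of 1] descent_def simple_ref_def s_ref_apply\<close>)
      then show ?thesis using True s1 1 by auto
    next
      case False
      have "commuting s t"
        unfolding commuting_def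
        by (intro ballI conjI comm) (use False s1 1 st(3) in \<open>auto simp: add.commute[of 1] descent_def simple_ref_def s_ref_apply\<close>)
      then show ?thesis using False s1 1 st(3) by auto
    qed
  next
    case 2
    show ?thesis
    proof (cases "s = n - 1")
      case True
      then have n: "n = s + 1" using s1 by simp
      have "braid4 s t"
        unfolding braid4_def
        by (intro ballI conjI br4; drule sp[of _ "int s + 1"];
          use n s1 2 in \<open>auto simp: add.commute[of 1] descent_def simple_ref_def s_ref_apply tau_ref_apply\<close>)
      then show ?thesis using True s1 2 by auto
    next
      case False
      have "commuting s t"
        unfolding commuting_def
        by (intro ballI conjI comm)
          (use False s1 2 in \<open>auto simp: add.commute[of 1] descent_def simple_ref_def s_ref_apply tau_ref_apply\<close>)
      then show ?thesis using False s1 2 by auto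
    qed
  next
    case 3
    show ?thesis
    proof (cases "s = n - 2")
      case True
      then have n: "n = s + 2" using s1 3 by simp
      have "braid3 s t"
        unfolding braid3_def
      proof (intro ballI conjI br)
        fix w k assume w: "w \<in> weyl ty n"
        have v: "simple_ref ty n s (int s) = int s + 1" "simple_ref ty n s (int s + 1) = int s"
          "simple_ref ty n s (int s + 2) = int s + 2" "simple_ref ty n t (int s) = int s"
          "simple_ref ty n t (int s + 1) = - (int s + 2)" "simple_ref ty n t (int s + 2) = - (int s + 1)"
          using n s1 3 by (auto simp: simple_ref_def s_ref_apply sbar_ref_apply)
        have d: "descent ty n t x = height n (x (int s + 1)) + height n (x (int s + 2))"
          "descent ty n s x = height n (x (int s)) - height n (x (int s + 1))" for x
          using n s1 3 by (auto simp: descent_def ac_simps)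
        show "descent ty n t (w \<circ> simple_ref ty n s) = descent ty n s w + descent ty n t w"
          "descent ty n s (w \<circ> simple_ref ty n t) = descent ty n s w + descent ty n t w"
          unfolding d comp_def v sp[OF w] by simp_all
      next
        fix k
        define f g where "f = simple_ref ty n s" and "g = simple_ref ty n t"
        have v: "f (int s) = int s + 1" "f (int s + 1) = int s" "f (int s + 2) = int s + 2"
          "g (int s) = int s" "g (int s + 1) = - (int s + 2)" "g (int s + 2) = - (int s + 1)"
          using n s1 3 by (auto simp: simple_ref_def s_ref_apply sbar_ref_apply f_def g_def)
        have m: "f (- k) = - f k" "g (- k) = - g k" for k
          using sp simple_ref_weyl[OF ad] st(1,2) by (auto simp: f_def g_def)
        have o: "f k = k" "g k = k" if "\<bar>k\<bar> \<notin> {int s, int s + 1, int s + 2}" for k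
          using n s1 3 that by (auto simp: simple_ref_def s_ref_apply sbar_ref_apply f_def g_def)
        have "f (g (f k)) = g (f (g k))"
          by (rule odd_fun_eqI[where K = "{int s, int s + 1, int s + 2}"])
            (simp_all only: m o not_False_eq_True, elim insertE emptyE, simp_all only: v m minus_minus)
        then show "simple_ref ty n s (simple_ref ty n t (simple_ref ty n s k)) =
            simple_ref ty n t (simple_ref ty n s (simple_ref ty n t k))"
          by (simp add: f_def g_def)
      qed
      then show ?thesis using True s1 3 by auto
    next
      case False
      have "commuting s t"
      proof -
        define p q a b where "p = int n - 1" and "q = int n" and "a = int s" and "b = int s + 1"
        define f g where "f = simple_ref ty n s" and "g = simple_ref ty n t"
        have m: "f (- k) = - f k" "g (- k) = - g k" for k
          using sp simple_ref_weyl[OF ad] st(1,2) by (auto simp: f_def g_def)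
        have g: "g p = - q" "g q = - p" "\<bar>k\<bar> \<notin> {p, q} \<Longrightarrow> g k = k" for k
          using 3 by (auto simp: simple_ref_def sbar_ref_apply of_nat_diff p_def q_def g_def)
        have f: "f a = b" "f b = a" "\<bar>k\<bar> \<notin> {a, b} \<Longrightarrow> f k = k" for k
          using s1 by (auto simp: simple_ref_def s_ref_apply a_def b_def f_def)
        have d: "descent ty n t x = height n (x p) + height n (x q)"
          "descent ty n s x = height n (x a) - height n (x b)" for x
          using s1 3 by (auto simp: descent_def p_def q_def a_def b_def ac_simps)
        \<comment> \<open>The pairs of coordinates moved by the two reflections are equal (for
          \<open>s = n - 1\<close>) or disjoint; in both cases the roots are orthogonal.\<close>
        have ab: "a = p \<and> b = q \<or> 0 < a \<and> a < b \<and> b < p \<and> p < q"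
          using False s1 3 by (auto simp: p_def q_def a_def b_def)
        have fg: "f p = p \<and> f q = q \<and> g a = a \<and> g b = b" if "\<not> (a = p \<and> b = q)"
          using ab that f(3)[of p] f(3)[of q] g(3)[of a] g(3)[of b] by simp
        have comm_fg: "f (g k) = g (f k)" for k
        proof (cases "a = p \<and> b = q")
          case True
          then have f': "f p = q" "f q = p" "\<bar>k\<bar> \<notin> {p, q} \<Longrightarrow> f k = k" for k using f by simp_all
          show ?thesis
            by (rule odd_fun_eqI[where K = "{p, q}"])
              (simp_all only: m f' g not_False_eq_True, elim insertE emptyE, simp_all only: f' g m minus_minus)
        next
          case False
          note fg = fg[OF False, THEN conjunct1] fg[OF False, THEN conjunct2, THEN conjunct1]
            fg[OF False, THEN conjunct2, THEN conjunct2, THEN conjunct1]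
            fg[OF False, THEN conjunct2, THEN conjunct2, THEN conjunct2]
          show ?thesis
          proof (rule odd_fun_eqI[where f = "\<lambda>k. f (g k)" and g = "\<lambda>k. g (f k)" and K = "{a, b, p, q}"])
            fix k assume "k \<in> {a, b, p, q}"
            then show "f (g k) = g (f k)"
              by (elim insertE emptyE) (simp_all only: fg f(1,2) g(1,2) m)
          next
            fix k assume "\<bar>k\<bar> \<notin> {a, b, p, q}"
            then have "f k = k" "g k = k" using f(3)[of k] g(3)[of k] by blast+
            then show "f (g k) = g (f k)" by simp
          qed (simp_all only: m)
        qed
        have "descent ty n t (w \<circ> f) = descent ty n t w" for w
        proof (cases "a = p \<and> b = q")
          case True
          then have "f p = q" "f q = p" using f(1,2) by simp_all
          then show ?thesis by (simp add: d)
        qed (use fg in \<open>simp add: d\<close>)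
        moreover have "descent ty n s (w \<circ> g) = descent ty n s w" if w: "w \<in> weyl ty n" for w
        proof (cases "a = p \<and> b = q")
          case True
          then have "g a = - b" "g b = - a" using g(1,2) by simp_all
          then show ?thesis by (simp add: d sp[OF w])
        qed (use fg in \<open>simp add: d\<close>)
        ultimately show ?thesis
          using comm_fg unfolding commuting_def f_def g_def by (intro ballI conjI comm) auto
      qed
      then show ?thesis using False s1 3 by auto
    qed
  qed
qed

lemma weyl_braid_relation:
  assumes ad: "admissible ty n" and T: "weyl_braids ty n T"
    and st: "s \<in> simple_index ty n" "t \<in> simple_index ty n" "s < t"
  shows "descents.braid_relation (weyl ty n) (\<lambda>w s. w \<circ> simple_ref ty n s) (descent ty n) T s t"
proof -
  interpret descents "weyl ty n" "simple_index ty n" "\<lambda>w s. w \<circ> simple_ref ty n s" "descent ty n" "defect n" id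
    by (rule descents_weyl[OF ad])
  have s1: "1 \<le> s" using st ad by (cases ty; auto simp: simple_index_def)
  have far: "T s * T t = T t * T s"
    if "t < n \<and> s + 1 < t \<or> ty = TypeB \<and> t = n \<and> s + 1 < n \<or> ty = TypeD \<and> t = n \<and> s < n \<and> s \<noteq> n - 2"
    using T s1 that unfolding weyl_braids_def by blast
  have three: "T s * T t * T s = T t * T s * T t"
    if "t = s + 1 \<and> t < n \<or> ty = TypeD \<and> t = n \<and> s = n - 2"
    using T s1 that unfolding weyl_braids_def by blast
  have four: "T s * T t * T s * T t = T t * T s * T t * T s" if "ty = TypeB \<and> t = n \<and> s = n - 1"
    using T that unfolding weyl_braids_def by blast
  show ?thesis
    using weyl_kind[OF ad st] far three four unfolding braid_relation_def by blast
qed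

lemma weyl_induct [consumes 2, case_names id step]:
  assumes "admissible ty n" "w \<in> weyl ty n" "Q id"
    "\<And>w s. w \<in> weyl ty n \<Longrightarrow> s \<in> simple_index ty n \<Longrightarrow> Q w \<Longrightarrow> Q (w \<circ> simple_ref ty n s)"
  shows "Q w"
  using descents.W_induct[OF descents_weyl[OF assms(1)] assms(2), of Q] assms(3,4) by blast

text \<open>For a simple right factor multiplicativity comes from \<open>coxeter_hom\<close>;
  induction on the right factor gives it in general.\<close>

theorem weyl_hom_ex:
  fixes T :: "nat \<Rightarrow> 'm :: semigroup_mult"
  assumes ad: "admissible ty n" and T: "weyl_braids ty n T"
    and sq: "\<And>s. s \<in> simple_index ty n \<Longrightarrow> T s * T s = e"
    and unit: "\<And>s. s \<in> simple_index ty n \<Longrightarrow> e * T s = T s" "\<And>s. s \<in> simple_index ty n \<Longrightarrow> T s * e = T s" "e * e = e"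
  shows "\<exists>f. f id = e \<and> (\<forall>w\<in>weyl ty n. \<forall>w'\<in>weyl ty n. f (w \<circ> w') = f w * f w') \<and>
    (\<forall>s\<in>simple_index ty n. f (simple_ref ty n s) = T s)"
proof -
  interpret descents "weyl ty n" "simple_index ty n" "\<lambda>w s. w \<circ> simple_ref ty n s" "descent ty n" "defect n" id
    by (rule descents_weyl[OF ad])
  have "\<exists>f. f id = e \<and> (\<forall>w\<in>weyl ty n. f w * e = f w) \<and>
      (\<forall>w\<in>weyl ty n. \<forall>s\<in>simple_index ty n. f (w \<circ> simple_ref ty n s) = f w * T s)"
    by (rule coxeter_hom) (use weyl_braid_relation[OF ad T] sq unit in \<open>auto simp: nat_neq_iff\<close>)
  then obtain f where f: "f id = e" "\<And>w. w \<in> weyl ty n \<Longrightarrow> f w * e = f w"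
    "\<And>w s. w \<in> weyl ty n \<Longrightarrow> s \<in> simple_index ty n \<Longrightarrow> f (w \<circ> simple_ref ty n s) = f w * T s" by blast
  have "f (w \<circ> w') = f w * f w'" if w: "w \<in> weyl ty n" and w': "w' \<in> weyl ty n" for w w'
    using ad w'
  proof (induction rule: weyl_induct)
    case id
    then show ?case by (simp only: comp_id f(1) f(2)[OF w])
  next
    case (step w' s)
    then show ?case using f(3)[OF weyl_comp[OF w step(1)] step(2)] f(3)[OF step(1,2)]
      by (simp only: comp_assoc mult.assoc)
  qed
  moreover have "f (simple_ref ty n s) = T s" if "s \<in> simple_index ty n" for s
    using f(3)[OF id_weyl that] f(1) unit(1)[OF that] by simp
  ultimately show ?thesis using f(1) by blast
qed

section \<open>The Clifford vectors of the simple reflections\<close>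

lemma anticomm_left: "x * y = - (y * x) \<Longrightarrow> x * (y * w) = - (y * (x * w))" for x y w :: "'a :: ring"
  by (metis mult.assoc mult_minus_left)

lemma sq_left: "x * x = e \<Longrightarrow> x * (x * w) = e * w" for x e w :: "'a :: ring"
  by (metis mult.assoc)

definition isq2 :: complex where "isq2 = 1 / complex_of_real (sqrt 2)"

lemma isq2_sq: "isq2 * isq2 = 1 / 2" "isq2 \<noteq> 0" "complex_of_real (sqrt 2) * isq2 = 1" "2 * isq2 = complex_of_real (sqrt 2)"
proof -
  have s: "complex_of_real (sqrt 2) * complex_of_real (sqrt 2) = 2"
    unfolding of_real_mult[symmetric] by simp
  have nz: "complex_of_real (sqrt 2) \<noteq> 0" by simp
  show "isq2 * isq2 = 1 / 2" by (simp add: isq2_def s)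
  show "isq2 \<noteq> 0" "complex_of_real (sqrt 2) * isq2 = 1" using nz by (simp_all add: isq2_def)
  show "2 * isq2 = complex_of_real (sqrt 2)" using s nz by (simp add: isq2_def field_simps)
qed

lemma half_twice: "(1 / 2) *\<^sub>c (x + x) = (x :: 'a :: calg)"
  by (simp add: cscale_add_right cscale_add_left[symmetric])

locale unit_vectors =
  fixes e p q :: "'a :: calg"
  assumes ee: "e * e = e" and ep: "e * p = p" "p * e = p" and eq: "e * q = q" "q * e = q"
    and pp: "p * p = e" and qq: "q * q = e" and qp: "q * p = - (p * q)"
begin

lemmas rules = ee ep eq pp qq qp anticomm_left[OF qp] sq_left[OF pp] sq_left[OF qq]

lemma unit_left: "e * (p * w) = p * w" "e * (q * w) = q * w"
  by (simp_all add: mult.assoc[symmetric] ep eq)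

lemmas vec_simps = rules unit_left mult.assoc algebra_simps

text \<open>For a unit vector \<open>b\<close> of a Clifford algebra, sending \<open>v\<close> to
  \<open>- b v b\<close> is the reflection along \<open>b\<close>. With \<open>b\<close> along
  \<open>p - q\<close> this exchanges \<open>p\<close> and \<open>q\<close>.\<close>

lemma reflection:
  defines "b \<equiv> isq2 *\<^sub>c (p - q)"
  shows "b * b = e" "b * p * b = - q" "b * q * b = - p"
proof -
  have h: "(1 / 2) *\<^sub>c x + (1 / 2) *\<^sub>c x = x" for x :: 'a
    using half_twice[of x] by (simp add: cscale_add_right)
  show "b * b = e" "b * p * b = - q" "b * q * b = - p"
    unfolding b_def by (simp_all add: vec_simps isq2_sq cscale_add_right cscale_diff_right h
      flip: cscale_add_left) 
qed

end


locale clifford_sys =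
  fixes e :: "'a :: calg" and c :: "nat \<Rightarrow> 'a" and ty :: weyl_type and n :: nat
  assumes ad: "admissible ty n"
    and ee: "e * e = e" and ec: "e * c i = c i" "c i * e = c i"
    and cc: "i \<in> {1..n} \<Longrightarrow> c i * c i = e"
    and canti: "i \<in> {1..n} \<Longrightarrow> j \<in> {1..n} \<Longrightarrow> i \<noteq> j \<Longrightarrow> c i * c j = - (c j * c i)"
begin

abbreviation "S \<equiv> simple_index ty n"
abbreviation "\<rho> \<equiv> simple_ref ty n"

definition cs :: "int \<Rightarrow> 'a" where "cs k = (if k > 0 then c (nat k) else - c (nat (- k)))"

definition b :: "nat \<Rightarrow> 'a" where
  "b s = (if s < n then isq2 *\<^sub>c (c s - c (s + 1))
     else case ty of TypeB \<Rightarrow> c n | _ \<Rightarrow> isq2 *\<^sub>c (c (n - 1) + c n))"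

lemma cs_unit: "e * cs k = cs k" "cs k * e = cs k"
  by (simp_all add: cs_def ec)

text \<open>The index zero is excluded because there the definition takes its default
  \<open>- c 0\<close>, which is not odd.\<close>

lemma cs_minus: "k \<noteq> 0 \<Longrightarrow> cs (- k) = - cs k"
  by (auto simp: cs_def)

lemma cs_cases:
  assumes "\<bar>k\<bar> \<in> {1..int n}"
  obtains i where "i \<in> {1..n}" "\<bar>k\<bar> = int i" "cs k = c i \<or> cs k = - c i"
proof
  show "nat \<bar>k\<bar> \<in> {1..n}" "\<bar>k\<bar> = int (nat \<bar>k\<bar>)" using assms by auto
  show "cs k = c (nat \<bar>k\<bar>) \<or> cs k = - c (nat \<bar>k\<bar>)" by (auto simp: cs_def abs_if)
qed

lemma cs_sq: "\<bar>k\<bar> \<in> {1..int n} \<Longrightarrow> cs k * cs k = e"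
  using cc by (elim cs_cases) auto

lemma cs_anti: "\<bar>k\<bar> \<in> {1..int n} \<Longrightarrow> \<bar>l\<bar> \<in> {1..int n} \<Longrightarrow> \<bar>k\<bar> \<noteq> \<bar>l\<bar> \<Longrightarrow> cs k * cs l = - (cs l * cs k)"
proof -
  assume k: "\<bar>k\<bar> \<in> {1..int n}" and l: "\<bar>l\<bar> \<in> {1..int n}" and kl: "\<bar>k\<bar> \<noteq> \<bar>l\<bar>"
  obtain i where i: "i \<in> {1..n}" "\<bar>k\<bar> = int i" "cs k = c i \<or> cs k = - c i" using k by (rule cs_cases)
  obtain j where j: "j \<in> {1..n}" "\<bar>l\<bar> = int j" "cs l = c j \<or> cs l = - c j" using l by (rule cs_cases)
  have "c i * c j = - (c j * c i)" using i(2) j(2) kl by (intro canti[OF i(1) j(1)]) auto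
  then show ?thesis using i(3) j(3) by auto
qed

lemma cs_int [simp]: "i \<ge> 1 \<Longrightarrow> cs (int i) = c i" "cs (int i + 1) = c (i + 1)"
  by (simp_all add: cs_def nat_add_distrib)

lemma b_less: "s < n \<Longrightarrow> b s = isq2 *\<^sub>c (c s - c (s + 1))"
  and b_last_B: "ty = TypeB \<Longrightarrow> b n = c n"
  and b_last_D: "ty = TypeD \<Longrightarrow> b n = isq2 *\<^sub>c (c (n - 1) + c n)"
  unfolding b_def by simp_all

text \<open>With signed indices \<open>e_{n-1} + e_n\<close> is the difference for the pair
  \<open>n-1\<close>, \<open>-n\<close>, so the last reflection of type D falls under
  \<open>pair\<close>; only the short root of type B is exceptional.\<close>

lemma b_cases:
  assumes "s \<in> S"
  obtains (pair) p q where "b s = isq2 *\<^sub>c (cs p - cs q)" "\<bar>p\<bar> \<in> {1..int n}" "\<bar>q\<bar> \<in> {1..int n}" "\<bar>p\<bar> \<noteq> \<bar>q\<bar>"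
      "\<rho> s p = q" "\<rho> s q = p" "\<And>k. \<bar>k\<bar> \<notin> {\<bar>p\<bar>, \<bar>q\<bar>} \<Longrightarrow> \<rho> s k = k"
    | (single) "ty = TypeB" "s = n" "b s = cs (int n)" "\<rho> s (int n) = - int n"
      "\<And>k. \<bar>k\<bar> \<noteq> int n \<Longrightarrow> \<rho> s k = k" "n \<ge> 2"
  using ad assms
proof (cases rule: simple_index_cases)
  case 1
  show ?thesis
    by (rule pair[of "int s" "int s + 1"])
      (use 1 in \<open>auto simp: b_less simple_ref_def s_ref_apply\<close>)
next
  case 2
  have "\<rho> s (int n) = - int n" "\<bar>k\<bar> \<noteq> int n \<Longrightarrow> \<rho> s k = k" for k
    using 2 by (auto simp: simple_ref_def tau_ref_apply)
  then show ?thesis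
    using 2(1,3) b_last_B[OF 2(2)] by (intro single 2(2)) simp_all
next
  case 3
  have "cs (int n - 1) = c (n - 1)" "cs (- int n) = - c n" using 3 by (auto simp: cs_def nat_diff_distrib)
  moreover have "\<rho> s (int n - 1) = - int n" "\<rho> s (- int n) = int n - 1"
    "\<bar>k\<bar> \<notin> {\<bar>int n - 1\<bar>, \<bar>- int n\<bar>} \<Longrightarrow> \<rho> s k = k" for k
    using 3 by (auto simp: simple_ref_def sbar_ref_apply of_nat_diff)
  ultimately show ?thesis
    using 3(1,3) b_last_D[OF 3(2)] by (intro pair[of "int n - 1" "- int n"]) simp_all
qed

lemma rho_minus: "s \<in> S \<Longrightarrow> \<rho> s (- k) = - \<rho> s k"
  using simple_ref_weyl[OF ad] weyl_sub signed_permsD(2) by blast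

lemma rho_range: "s \<in> S \<Longrightarrow> \<bar>k\<bar> \<in> {1..int n} \<Longrightarrow> \<bar>\<rho> s k\<bar> \<in> {1..int n}"
proof -
  assume s: "s \<in> S" and k: "\<bar>k\<bar> \<in> {1..int n}"
  have "\<rho> s \<in> signed_perms n" using simple_ref_weyl[OF ad s] weyl_sub by auto
  from signed_permsD(5)[OF this k] show ?thesis
    using rho_minus[OF s, of k] by (auto simp: abs_if split: if_splits)
qed

lemma rho_rho: "s \<in> S \<Longrightarrow> \<rho> s (\<rho> s k) = k"
  using simple_ref_involutive[OF ad] by (metis comp_apply id_apply)

lemma b_unit: "e * b s = b s" "b s * e = b s"
  by (auto simp: b_def ec algebra_simps split: weyl_type.splits)

lemma b_sq:
  assumes "s \<in> S" shows "b s * b s = e"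
  using assms
proof (cases rule: b_cases)
  case (pair p q)
  interpret unit_vectors e "cs p" "cs q"
    using pair cs_unit ee cs_sq cs_anti[of q p] by unfold_locales auto
  show ?thesis using reflection(1) pair by simp
next
  case single
  then show ?thesis using cs_sq[of "int n"] by simp
qed

text \<open>Conjugation by a unit vector is minus the reflection along it. For vectors orthogonal to
  \<open>b s\<close> this amounts to anticommuting with it, which is how they are treated
  here.\<close>

lemma b_reflect: 
  assumes s: "s \<in> S" and k: "\<bar>k\<bar> \<in> {1..int n}"
  shows "b s * cs k * b s = - cs (\<rho> s k)"
proof -
  have anti: "b s * cs k * b s = - cs k" if "b s * cs k = - (cs k * b s)"
    using that b_sq[OF s] by (simp add: mult.assoc cs_unit)
  show ?thesis
    using s
  proof (cases rule: b_cases)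
    case (pair p q)
    interpret unit_vectors e "cs p" "cs q"
      using pair cs_unit ee cs_sq cs_anti[of q p] by unfold_locales auto
    have nz: "p \<noteq> 0" "q \<noteq> 0" using pair by auto
    consider "k = p" | "k = q" | "k = - p" | "k = - q" | "\<bar>k\<bar> \<notin> {\<bar>p\<bar>, \<bar>q\<bar>}"
      by (auto simp: abs_eq_iff)
    then show ?thesis
    proof cases
      case 5
      then have "b s * cs k = - (cs k * b s)"
        unfolding pair(1) using cs_anti[OF pair(2) k] cs_anti[OF pair(3) k] by (simp add: algebra_simps)
      then show ?thesis using anti pair(7)[OF 5] by simp
    qed (use reflection pair nz rho_minus[OF s] cs_minus in simp_all)
  next
    case single
    consider "k = int n" | "k = - int n" | "\<bar>k\<bar> \<noteq> int n" by linarith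
    then show ?thesis
    proof cases
      case 3
      then show ?thesis using anti single cs_anti[of "int n" k] k by auto
    qed (use single cs_sq[of "int n"] cs_unit ec cs_minus[of "int n"] rho_minus[OF s, of "int n"] in simp_all)
  qed
qed

lemma b_cs: 
  assumes s: "s \<in> S" and k: "\<bar>k\<bar> \<in> {1..int n}"
  shows "b s * cs k = - (cs (\<rho> s k) * b s)"
proof -
  have "b s * cs k = b s * cs k * b s * b s"
    using b_sq[OF s] by (simp add: mult.assoc cs_unit)
  then show ?thesis using b_reflect[OF assms] by simp
qed

lemma b_anti:
  assumes "\<And>j. j \<in> {1..n} \<Longrightarrow> z * c j = - (c j * z)" and s: "s \<in> S"
  shows "z * b s = - (b s * z)"
proof -
  have z: "z * cs k = - (cs k * z)" if "\<bar>k\<bar> \<in> {1..int n}" for k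
    using that assms(1) by (elim cs_cases) auto
  show ?thesis
    using s
  proof (cases rule: b_cases)
    case (pair p q)
    show ?thesis unfolding pair(1) using z[OF pair(2)] z[OF pair(3)] by (simp add: algebra_simps)
  next
    case single
    show ?thesis unfolding single(3) using z[of "int n"] single(6) by simp
  qed
qed

lemma b_commute:
  assumes "\<And>j. j \<in> {1..n} \<Longrightarrow> z * c j = c j * z" and s: "s \<in> S"
  shows "z * b s = b s * z"
proof -
  have z: "z * cs k = cs k * z" if "\<bar>k\<bar> \<in> {1..int n}" for k
    using that assms(1) by (elim cs_cases) auto
  show ?thesis
    using s
  proof (cases rule: b_cases)
    case (pair p q)
    show ?thesis unfolding pair(1) using z[OF pair(2)] z[OF pair(3)] by (simp add: algebra_simps)
  next
    case single
    show ?thesis unfolding single(3) using z[of "int n"] single(6) by simp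
  qed
qed

lemma b_cancel: "s \<in> S \<Longrightarrow> e * z = z \<Longrightarrow> e * w = w \<Longrightarrow> b s * z = b s * w \<Longrightarrow> z = w"
  using b_sq by (metis mult.assoc)

lemma b_left: "e * (b s * w) = b s * w"
  by (simp add: b_unit mult.assoc[symmetric])

lemma b_cancel2:
  assumes "s \<in> S" "r \<in> S" "e * z = z" "e * w = w" "b s * (b r * z) = b s * (b r * w)"
  shows "z = w"
  using b_cancel[OF assms(2-4)] b_cancel[OF assms(1) b_left b_left assms(5)] by blast

text \<open>Orthogonal roots give anticommuting unit vectors. This is the sign that turns commuting
  reflections into elements \<open>t\<close> whose product has square minus the unit.\<close>

lemma b_far: "1 \<le> s \<Longrightarrow> s + 1 < r \<Longrightarrow> r < n \<Longrightarrow> b s * b r = - (b r * b s)"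
  using canti[of s r] canti[of s "r + 1"] canti[of "s + 1" r] canti[of "s + 1" "r + 1"]
  by (simp add: b_less algebra_simps)

lemma b_far_last_B:
  assumes "ty = TypeB" "1 \<le> s" "s + 1 < n" shows "b s * b n = - (b n * b s)"
  using assms(2,3) canti[of s n] canti[of "s + 1" n]
  by (simp add: b_less b_last_B[OF assms(1)] algebra_simps)

lemma b_far_last_D:
  assumes "ty = TypeD" "1 \<le> s" "s < n" "s \<noteq> n - 2" shows "b s * b n = - (b n * b s)"
\<comment> \<open>For \<open>s = n - 1\<close> the two vectors share both Clifford generators: up to
  scale they are \<open>c (n - 1) - c n\<close> and \<open>c (n - 1) + c n\<close>, which are still
  orthogonal.\<close>
proof (cases "s = n - 1")
  case True
  then show ?thesis
    using assms(2,3) canti[of "n - 1" n] cc[of n] cc[of "n - 1"]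
    by (simp add: b_less b_last_D[OF assms(1)] algebra_simps)
next
  case False
  then have "s + 1 < n - 1" using assms by linarith
  then show ?thesis
    using assms(2,3) canti[of s n] canti[of "s + 1" n] canti[of s "n - 1"] canti[of "s + 1" "n - 1"]
    by (simp add: b_less b_last_D[OF assms(1)] algebra_simps)
qed

lemma b_braid_gen:
  assumes "s \<in> S" "\<bar>p\<bar> \<in> {1..int n}" "\<bar>q\<bar> \<in> {1..int n}"
  shows "b s * (isq2 *\<^sub>c (cs p - cs q)) * b s = isq2 *\<^sub>c (cs (\<rho> s q) - cs (\<rho> s p))"
  using b_reflect[OF assms(1,2)] b_reflect[OF assms(1,3)] by (simp add: algebra_simps)

text \<open>Both sides are minus the unit vector along the sum of the two simple roots, so braid
  relations of length three acquire no sign.\<close>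

lemma b_braid:
  assumes s: "1 \<le> s" "s + 1 < n"
  shows "b s * b (s + 1) * b s = b (s + 1) * b s * b (s + 1)"
proof -
  have S: "s \<in> S" "s + 1 \<in> S" using s by (cases ty; simp add: simple_index_def)+
  have b: "b s = isq2 *\<^sub>c (cs (int s) - cs (int s + 1))" "b (s + 1) = isq2 *\<^sub>c (cs (int s + 1) - cs (int s + 2))"
    using s by (simp_all add: b_less cs_def nat_add_distrib)
  have r: "\<rho> s (int s + 1) = int s" "\<rho> s (int s + 2) = int s + 2" "\<rho> (s + 1) (int s) = int s" "\<rho> (s + 1) (int s + 1) = int s + 2"
    using s by (auto simp: simple_ref_def s_ref_apply)
  have "b s * b (s + 1) * b s = isq2 *\<^sub>c (cs (int s + 2) - cs (int s))"
    using b_braid_gen[OF S(1), of "int s + 1" "int s + 2"] s by (simp only: b(2) r) simp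
  moreover have "b (s + 1) * b s * b (s + 1) = isq2 *\<^sub>c (cs (int s + 2) - cs (int s))"
    using b_braid_gen[OF S(2), of "int s" "int s + 1"] s by (simp only: b(1) r) simp
  ultimately show ?thesis by simp
qed

lemma b_braid_D:
  assumes D: "ty = TypeD"
  shows "b (n - 2) * b n * b (n - 2) = b n * b (n - 2) * b n"
proof -
  have n: "n \<ge> 4" using ad D by simp
  have S: "n - 2 \<in> S" "n \<in> S" using n D by (simp_all add: simple_index_def)
  have b: "b (n - 2) = isq2 *\<^sub>c (cs (int n - 2) - cs (int n - 1))" "b n = isq2 *\<^sub>c (cs (int n - 1) - cs (- int n))"
    using n b_last_D[OF D] b_less[of "n - 2"] by (simp_all add: cs_def nat_diff_distrib Suc_diff_Suc numeral_2_eq_2)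
  have r: "\<rho> (n - 2) (int n - 1) = int n - 2" "\<rho> (n - 2) (- int n) = - int n" "\<rho> n (int n - 2) = int n - 2" 
    "\<rho> n (int n - 1) = - int n"
    using n D by (auto simp: simple_ref_def s_ref_apply sbar_ref_apply of_nat_diff)
  have "b (n - 2) * b n * b (n - 2) = isq2 *\<^sub>c (cs (- int n) - cs (int n - 2))"
    using b_braid_gen[OF S(1), of "int n - 1" "- int n"] n by (simp only: b(2) r) simp
  moreover have "b n * b (n - 2) * b n = isq2 *\<^sub>c (cs (- int n) - cs (int n - 2))"
    using b_braid_gen[OF S(2), of "int n - 2" "int n - 1"] n by (simp only: b(1) r) simp
  ultimately show ?thesis by simp
qed

text \<open>For \<open>p = c (n - 1)\<close> and \<open>q = c n\<close> the element \<open>x\<close>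
  is \<open>pq - e\<close> divided by sqrt 2, and its square is \<open>- pq\<close>. The rotation of
  order four thus lifts to an element of order eight.\<close>

lemma b_four:
  assumes B: "ty = TypeB"
  defines "x \<equiv> b (n - 1) * b n"
  shows "(x * x) * (x * x) = - e"
proof -
  have n: "n \<ge> 2" using ad B by simp
  define p q where "p = c (n - 1)" and "q = c n"
  interpret unit_vectors e p q
    using ee ec cc[of n] cc[of "n - 1"] canti[of n "n - 1"] n by unfold_locales (auto simp: p_def q_def)
  have x: "x = isq2 *\<^sub>c (p * q - e)"
  proof -
    have "b (n - 1) = isq2 *\<^sub>c (p - q)" "b n = q"
      using n b_less[of "n - 1"] b_last_B[OF B] by (simp_all add: p_def q_def)
    then show ?thesis unfolding x_def by (simp only:) (simp add: vec_simps)
  qed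
  have h: "(1 / 2) *\<^sub>c z + (1 / 2) *\<^sub>c z = z" for z :: 'a
    using half_twice[of z] by (simp add: cscale_add_right)
  have "x * x = - (p * q)"
    unfolding x using h[of "p * q"] by (simp add: vec_simps isq2_sq cscale_add_right cscale_diff_right)
  then show ?thesis by (simp add: vec_simps)
qed

end

locale spin_sys = clifford_sys +
  fixes \<iota> :: complex and t :: "nat \<Rightarrow> 'a"
  assumes iota: "\<iota> * \<iota> = -1"
    and et: "e * t s = t s" "t s * e = t s"
    and tc: "s \<in> S \<Longrightarrow> j \<in> {1..n} \<Longrightarrow> t s * c j = - (c j * t s)"
begin

definition T :: "nat \<Rightarrow> 'a" where "T s = (- \<iota>) *\<^sub>c (b s * t s)"

lemma tb: "s \<in> S \<Longrightarrow> r \<in> S \<Longrightarrow> t s * b r = - (b r * t s)"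
  using b_anti tc by blast

lemmas tb_left = anticomm_left[OF tb]

lemma T_unit: "e * T s = T s" "T s * e = T s"
  by (simp_all add: T_def mult.assoc et) (simp add: b_unit mult.assoc[symmetric])

lemma iota_nz: "\<iota> \<noteq> 0" using iota by auto

lemma unit_left: "e * (b s * w) = b s * w" "e * (t s * w) = t s * w"
  by (simp_all add: b_unit et mult.assoc[symmetric])

lemma t_eq: "s \<in> S \<Longrightarrow> t s = \<iota> *\<^sub>c (b s * T s)"
  by (simp add: T_def sq_left[OF b_sq] unit_left et iota)

text \<open>The two scalars \<open>- \<iota>\<close> contribute a factor -1, which cancels the sign
  from moving \<open>t s\<close> past \<open>b r\<close>. This is the purpose of the square root of
  -1 in the isomorphism.\<close>

lemma T_mult: "s \<in> S \<Longrightarrow> r \<in> S \<Longrightarrow> T s * T r = b s * b r * (t s * t r)"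
  by (simp add: T_def mult.assoc tb_left iota)

lemma T_sq: "s \<in> S \<Longrightarrow> T s * T s = t s * t s"
  by (simp add: T_mult b_sq unit_left mult.assoc)

lemma tt_b: "s \<in> S \<Longrightarrow> r \<in> S \<Longrightarrow> q \<in> S \<Longrightarrow> t s * t r * b q = b q * (t s * t r)"
  by (simp add: mult.assoc tb tb_left)

lemma T_mult3: "s \<in> S \<Longrightarrow> r \<in> S \<Longrightarrow> T s * T r * T s = (- \<iota>) *\<^sub>c (b s * b r * b s * (t s * t r * t s))"
proof -
  assume sr: "s \<in> S" "r \<in> S"
  have "T s * T r * T s = (- \<iota>) *\<^sub>c (b s * b r * (t s * t r * b s) * t s)"
    using sr by (simp add: T_mult) (simp add: T_def mult.assoc)
  then show ?thesis using sr by (simp add: tt_b) (simp add: mult.assoc)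
qed

lemma T_c: "s \<in> S \<Longrightarrow> \<bar>k\<bar> \<in> {1..int n} \<Longrightarrow> T s * cs k = cs (\<rho> s k) * T s"
proof -
  assume s: "s \<in> S" and k: "\<bar>k\<bar> \<in> {1..int n}"
  have t: "t s * cs k = - (cs k * t s)"
    using k tc[OF s] by (elim cs_cases) auto
  have "T s * cs k = (- \<iota>) *\<^sub>c (b s * (t s * cs k))" by (simp add: T_def mult.assoc)
  also have "\<dots> = \<iota> *\<^sub>c (b s * cs k * t s)" by (simp add: t mult.assoc)
  also have "\<dots> = cs (\<rho> s k) * T s" unfolding b_cs[OF s k] by (simp add: T_def mult.assoc)
  finally show ?thesis .
qed

text \<open>\<open>T s * T r\<close> is \<open>b s * b r\<close> times \<open>t s * t r\<close>, and
  the two \<open>b\<close> anticommute. So the \<open>T\<close> commute if and only if the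
  \<open>t\<close> anticommute, which for elements of square \<open>e\<close> means that their
  product has square \<open>- e\<close>.\<close>

lemma far_iff:
  assumes s: "s \<in> S" "r \<in> S" and sq: "t s * t s = e" "t r * t r = e" and b: "b s * b r = - (b r * b s)"
  shows "T s * T r = T r * T s \<longleftrightarrow> t s * t r * (t s * t r) = - e"
proof
  have bb: "b s * (b r * (b r * (b s * w))) = w" if "e * w = w" for w
    using s that by (simp add: sq_left[OF b_sq] unit_left)
  assume "T s * T r = T r * T s"
  then have "b s * b r * (t s * t r) = - (b s * b r * (t r * t s))"
    using s b by (simp add: T_mult)
  then have eq: "b s * (b r * (t s * t r)) = b s * (b r * (- (t r * t s)))" by (simp add: mult.assoc)
  have st: "t s * t r = - (t r * t s)"
    by (rule b_cancel2[OF s _ _ eq]) (simp_all add: unit_left)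
  have "t s * t r * (t s * t r) = t s * (t r * t s) * t r" by (simp add: mult.assoc)
  also have "t r * t s = - (t s * t r)" using st by simp
  finally show "t s * t r * (t s * t r) = - e"
    by (simp add: mult.assoc sq) (simp add: mult.assoc[symmetric] sq et)
next
  assume a: "t s * t r * (t s * t r) = - e"
  have "t r * t s = t s * (t s * t r * (t s * t r)) * t r"
    by (simp add: mult.assoc sq) (simp add: mult.assoc[symmetric] sq et)
  then have "t r * t s = - (t s * t r)" unfolding a by (simp add: et)
  then show "T s * T r = T r * T s" using s b by (simp add: T_mult)
qed

text \<open>Both sides carry the same scalar \<open>- \<iota>\<close> and the same product of the
  \<open>b\<close>; these can be cancelled, since \<open>\<iota>\<close> is nonzero and each
  \<open>b\<close> squares to \<open>e\<close>.\<close>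

lemma braid_iff:
  assumes s: "s \<in> S" "r \<in> S" and b: "b s * b r * b s = b r * b s * b r"
  shows "T s * T r * T s = T r * T s * T r \<longleftrightarrow> t s * t r * t s = t r * t s * t r"
proof
  assume "t s * t r * t s = t r * t s * t r"
  then show "T s * T r * T s = T r * T s * T r" using s b by (simp add: T_mult3)
next
  assume "T s * T r * T s = T r * T s * T r"
  then have "(- \<iota>) *\<^sub>c (b s * b r * b s * (t s * t r * t s)) = (- \<iota>) *\<^sub>c (b s * b r * b s * (t r * t s * t r))"
    by (simp only: T_mult3 s b)
  then have "b s * b r * b s * (t s * t r * t s) = b s * b r * b s * (t r * t s * t r)"
    using cscale_cancel[of "- \<iota>"] iota_nz by simp
  then have eq: "b s * (b r * (b s * (t s * t r * t s))) = b s * (b r * (b s * (t r * t s * t r)))"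
    by (simp only: mult.assoc)
  show "t s * t r * t s = t r * t s * t r"
    by (rule b_cancel[OF s(1) _ _ b_cancel2[OF s b_left b_left eq]])
      (simp_all add: unit_left mult.assoc)
qed

text \<open>The product \<open>t s * t r\<close> commutes with \<open>b s * b r\<close>, so the
  fourth power of \<open>T s * T r\<close> is the product of the two fourth powers, of which that of
  \<open>b s * b r\<close> is \<open>- e\<close>.\<close>

lemma four_iff:
  assumes s: "s \<in> S" "r \<in> S" and sq: "t s * t s = e" "t r * t r = e"
    and b: "b s * b r * (b s * b r) * (b s * b r * (b s * b r)) = - e"
  shows "T s * T r * T s * T r = T r * T s * T r * T s \<longleftrightarrow>
    t s * t r * (t s * t r) * (t s * t r * (t s * t r)) = - e"
proof -
  define x where "x = b s * b r"
  define z where "z = t s * t r"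
  have zb: "z * b q = b q * z" if "q \<in> S" for q using tt_b s that by (simp add: z_def)
  have zx: "z * x = x * z" "z * (x * w) = x * (z * w)" for w
    using s zb by (simp_all add: x_def mult.assoc[symmetric]) (simp_all add: mult.assoc zb)
  have Tx: "T s * T r = x * z" using s by (simp add: T_mult x_def z_def)
  have four: "T s * T r * (T s * T r) * (T s * T r * (T s * T r)) = - (z * z * (z * z))"
  proof -
    have "x * z * (x * z) * (x * z * (x * z)) = x * x * (x * x) * (z * z * (z * z))"
      by (simp add: mult.assoc zx)
    also have "\<dots> = - (e * (z * z * (z * z)))" using b by (simp add: x_def)
    also have "\<dots> = - (z * z * (z * z))" by (simp add: z_def unit_left mult.assoc)
    finally show ?thesis by (simp add: Tx)
  qed
  have Tsq: "T s * T s = e" "T r * T r = e" using s sq by (simp_all add: T_sq)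
  note Tl = sq_left[OF Tsq(1)] sq_left[OF Tsq(2)]
  have Tul: "e * (T q * w) = T q * w" for q w by (simp add: T_unit mult.assoc[symmetric])
  \<comment> \<open>The two alternating words of length four are inverse to each other, so their
    equality means that the alternating word of length eight is \<open>e\<close>.\<close>
  have inv: "T s * T r * T s * T r * (T r * T s * T r * T s) = e" "T r * T s * T r * T s * (T s * T r * T s * T r) = e"
    by (simp_all add: mult.assoc Tl Tul T_unit Tsq)
  have "T s * T r * T s * T r = T r * T s * T r * T s \<longleftrightarrow> T s * T r * (T s * T r) * (T s * T r * (T s * T r)) = e"
  proof
    assume "T s * T r * T s * T r = T r * T s * T r * T s"
    then show "T s * T r * (T s * T r) * (T s * T r * (T s * T r)) = e" using inv(1) by (simp add: mult.assoc)
  next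
    assume a: "T s * T r * (T s * T r) * (T s * T r * (T s * T r)) = e"
    have "T r * T s * T r * T s = T r * T s * T r * T s * (T s * T r * (T s * T r) * (T s * T r * (T s * T r)))"
      unfolding a by (simp add: mult.assoc T_unit)
    also have "\<dots> = T s * T r * T s * T r" by (simp add: mult.assoc Tl Tul T_unit Tsq)
    finally show "T s * T r * T s * T r = T r * T s * T r * T s" by simp
  qed
  also have "\<dots> \<longleftrightarrow> - (z * z * (z * z)) = e" by (simp only: four)
  also have "\<dots> \<longleftrightarrow> z * z * (z * z) = - e" by (metis minus_minus)
  finally show ?thesis by (simp only: z_def)
qed

end

section \<open>Recursions for the odd reflections\<close>

lemma t_down_Suc: "i \<le> j \<Longrightarrow> t_down j i = gt j * t_down (j - 1) i" if "j \<ge> 1"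
  using that by (simp add: t_down_def)

lemma t_up_Suc: "i \<le> j \<Longrightarrow> t_up i j = t_up i (j - 1) * gt j" if "j \<ge> 1"
  using that by (simp add: t_up_def)

lemma t_up_first: "i \<le> j \<Longrightarrow> t_up i j = gt i * t_up (Suc i) j"
  by (simp add: t_up_def upt_conv_Cons del: upt_Suc)

lemma t_down_last: "i \<le> j \<Longrightarrow> t_down j i = t_down j (Suc i) * gt i"
  by (simp add: t_down_def upt_conv_Cons del: upt_Suc)

lemma t_up_empty: "j < i \<Longrightarrow> t_up i j = 1" and t_down_empty: "j < i \<Longrightarrow> t_down j i = 1"
  by (simp_all add: t_up_def t_down_def)

lemma bracket_lt_base: "bracket_lt i (Suc i) = gt i"
  by (simp add: bracket_lt_def t_up_empty t_down_empty)

text \<open>The power of -1 in \<open>bracket_lt\<close> makes the passage from \<open>j\<close> to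
  \<open>j + 1\<close> the map sending \<open>z\<close> to \<open>- (t z t)\<close>, the same map by
  which \<open>refl_conj\<close> transports a reflection.\<close>

lemma bracket_lt_step:
  assumes "i < j" shows "bracket_lt i (Suc j) = - (gt j * bracket_lt i j * gt j)"
proof -
  have "(-1 :: gens free) ^ (Suc j - i - 1) = - ((-1) ^ (j - i - 1))"
    using assms by (simp add: Suc_diff_Suc power_Suc[symmetric] del: power_Suc) (metis Suc_diff_Suc power_Suc mult_minus1)
  moreover have "gt j * (-1) ^ k * x = (-1) ^ k * (gt j * x)" for k and x :: "gens free"
    by (cases "even k") auto
  ultimately show ?thesis
    using assms t_down_Suc[of j "i + 1"] t_up_Suc[of j "i + 1"]
    by (simp add: bracket_lt_def mult.assoc)
qed

lemma neg_power_swap: "x * ((-1) ^ k * y) = (-1) ^ k * (x * y)" for x y :: "gens free"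
  by (cases "even k") auto

text \<open>The recursions start at the root \<open>e_{n-1} + e_n\<close>. It is simple in type D;
  in type B it is the image of \<open>e_{n-1} - e_n\<close> under the last reflection, whence the
  conjugate of \<open>gt (n - 1)\<close>.\<close>

lemma bar_bracket_lt_base:
  assumes "n \<ge> 2"
  shows "bar_bracket_lt TypeD n (n - 1) n = gt n" "bar_bracket_lt TypeB n (n - 1) n = - (gt n * gt (n - 1) * gt n)"
  using assms by (simp_all add: bar_bracket_lt_def t_up_empty t_down_empty)

text \<open>All pairs are reached from \<open>(n - 1, n)\<close> by first lowering the first index
  (\<open>bar_bracket_lt_step1\<close>) and then, with that fixed, the second.\<close>

lemma bar_bracket_lt_step2:
  assumes "i < j" "j < n" shows "bar_bracket_lt ty n i j = - (gt j * bar_bracket_lt ty n i (Suc j) * gt j)"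
proof -
  have e: "(-1 :: gens free) ^ (Suc j - i) = - ((-1) ^ (j - i))" "(-1 :: gens free) ^ (j - i) = - ((-1) ^ (j - i - 1))"
    using assms by (simp_all add: Suc_diff_le) (metis Suc_diff_Suc power_Suc mult_minus1)
  have u: "t_up j (n - 1) = gt j * t_up (Suc j) (n - 1)" "t_down (n - 1) j = t_down (n - 1) (Suc j) * gt j"
    using assms by (auto intro!: t_up_first t_down_last)
  show ?thesis
    by (cases ty) (simp_all add: bar_bracket_lt_def u e neg_power_swap mult.assoc del: One_nat_def)
qed

lemma bar_bracket_lt_step1:
  assumes "Suc i < n" shows "bar_bracket_lt ty n i n = - (gt i * bar_bracket_lt ty n (Suc i) n * gt i)"
proof -
  have e: "(-1 :: gens free) ^ (n - i) = - ((-1) ^ (n - Suc i))" "(-1 :: gens free) ^ (n - Suc i) = - ((-1) ^ (n - Suc i - 1))"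
    using assms by (metis Suc_diff_Suc Suc_lessD power_Suc mult_minus1, metis Suc_diff_Suc diff_Suc_1 power_Suc mult_minus1)
  have u: "t_up i (n - 2) = gt i * t_up (Suc i) (n - 2)" "t_down (n - 2) i = t_down (n - 2) (Suc i) * gt i"
    using assms by (auto intro!: t_up_first t_down_last)
  have z: "t_up n (n - 1) = 1" "t_down (n - 1) n = 1" using assms by (simp_all add: t_up_empty t_down_empty)
  have d: "n - i - 1 = n - Suc i" by simp
  show ?thesis
    by (cases ty) (simp_all add: bar_bracket_lt_def u e z d neg_power_swap mult.assoc del: One_nat_def diff_Suc_1 diff_diff_left)
qed

lemma bar_single_base: "n \<ge> 1 \<Longrightarrow> bar_single n n = gt n"
  by (simp add: bar_single_def t_up_empty t_down_empty)

lemma bar_single_step: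
  assumes "i < n" shows "bar_single n i = - (gt i * bar_single n (Suc i) * gt i)"
proof -
  have e: "(-1 :: gens free) ^ (n - i) = - ((-1) ^ (n - Suc i))"
    using assms by (metis Suc_diff_Suc power_Suc mult_minus1)
  have u: "t_up i (n - 1) = gt i * t_up (Suc i) (n - 1)" "t_down (n - 1) i = t_down (n - 1) (Suc i) * gt i"
    using assms by (auto intro!: t_up_first t_down_last)
  show ?thesis
    by (simp add: bar_single_def u e neg_power_swap mult.assoc del: One_nat_def)
qed

section \<open>The spin Weyl group relations\<close>

lemma case_weyl_type_un: "(\<forall>r\<in>(case ty of TypeA \<Rightarrow> {} | TypeB \<Rightarrow> Y1 | TypeD \<Rightarrow> Y2). Q r) \<longleftrightarrow>
   (ty = TypeB \<longrightarrow> (\<forall>r\<in>Y1. Q r)) \<and> (ty = TypeD \<longrightarrow> (\<forall>r\<in>Y2. Q r))" for Y1 Y2 :: "'x set"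
  by (cases ty) auto

lemma ball_Collect1: "(\<forall>r\<in>{f i |i. P i}. Q r) \<longleftrightarrow> (\<forall>i. P i \<longrightarrow> Q (f i))"
  and ball_Collect2: "(\<forall>r\<in>{g i j |i j. R i j}. Q r) \<longleftrightarrow> (\<forall>i j. R i j \<longrightarrow> Q (g i j))"
  and ball_insert: "(\<forall>r\<in>insert x Y. Q r) \<longleftrightarrow> Q x \<and> (\<forall>r\<in>Y. Q r)" for Y :: "'x set"
  by auto

locale spin_ev = corner e a + spin_sys e "\<lambda>i. a (Gc i)" ty n \<iota> "\<lambda>s. a (Gt s)"
  for e :: "'a :: calg" and a :: "gens \<Rightarrow> 'a" and ty n \<iota>
begin

abbreviation "c i \<equiv> a (Gc i)"
abbreviation "t s \<equiv> a (Gt s)"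

lemma E_power2: "E (p ^ 2) = E p * E p"
  by (simp add: power2_eq_square)

lemma E_power4: "E (p ^ 4) = (E p * E p) * (E p * E p)"
  by (simp add: power4_eq_xxxx mult.assoc)

lemma simple_less: "1 \<le> s \<Longrightarrow> s < n \<Longrightarrow> s \<in> S"
  by (cases ty) (auto simp: simple_index_def)

lemma simple_last: "ty \<noteq> TypeA \<Longrightarrow> n \<in> S"
  using ad by (cases ty) (auto simp: simple_index_def)

lemma spin_rels_eq: "(\<forall>r\<in>spin_rels ty n. E r = 0) \<longleftrightarrow>
   (\<forall>s\<in>S. t s * t s = e) \<and>
   (\<forall>i. 1 \<le> i \<and> i + 1 < n \<longrightarrow> t i * t (i + 1) * t i = t (i + 1) * t i * t (i + 1)) \<and>
   (\<forall>i j. i \<in> {1..<n} \<and> j \<in> {1..<n} \<and> \<bar>int i - int j\<bar> > 1 \<longrightarrow> t i * t j * (t i * t j) = - e) \<and>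
   (ty = TypeB \<longrightarrow> (\<forall>i\<in>{1..n} - {n - 1, n}. t i * t n * (t i * t n) = - e) \<and>
      t (n - 1) * t n * (t (n - 1) * t n) * (t (n - 1) * t n * (t (n - 1) * t n)) = - e) \<and>
   (ty = TypeD \<longrightarrow> (\<forall>i\<in>{1..n} - {n - 2, n}. t i * t n * (t i * t n) = - e) \<and>
      t (n - 2) * t n * t (n - 2) = t n * t (n - 2) * t n)"
  unfolding spin_rels_def ball_Un case_weyl_type_un ball_Collect1 ball_Collect2 ball_insert Ball_def[of S]
    Ball_def[of "{1..n} - _"] E_diff E_add E_mult E_one E_gen E_power2 E_power4 eq_iff_diff_eq_0[symmetric]
    eq_neg_iff_add_eq_0[symmetric] ball_empty simp_thms conj_assoc
  \<comment> \<open>After the rewriting both sides of the equivalence are literally equal.\<close>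
  by (rule TrueI)

text \<open>This direction is needed in the tensor product, where the relations of the
  \<open>t\<close> are given and the group has to be constructed; the converse is needed in the
  Hecke-Clifford algebra, where the group is given.\<close>

lemma weyl_braids_of_spin_rels:
  assumes "\<forall>r\<in>spin_rels ty n. E r = 0"
  shows "weyl_braids ty n T" "\<And>s. s \<in> S \<Longrightarrow> T s * T s = e"
proof -
  note r = assms[unfolded spin_rels_eq]
  have sq: "t s * t s = e" if "s \<in> S" for s using r that by blast
  then show "\<And>s. s \<in> S \<Longrightarrow> T s * T s = e" using T_sq by simp
  have far: "T s * T r = T r * T s"
    if "s \<in> S" "r \<in> S" "b s * b r = - (b r * b s)" "t s * t r * (t s * t r) = - e" for s r
    using far_iff[OF that(1,2) sq[OF that(1)] sq[OF that(2)] that(3)] that(4) by blast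
  have "T s * T r = T r * T s" if "1 \<le> s" "s + 1 < r" "r < n" for s r
    using that r b_far[OF that] by (intro far simple_less) auto
  moreover have "T s * T (s + 1) * T s = T (s + 1) * T s * T (s + 1)" if "1 \<le> s" "s + 1 < n" for s
    using braid_iff[OF simple_less simple_less b_braid[OF that]] that r by simp
  moreover have "T s * T n = T n * T s" if "ty = TypeB" "1 \<le> s" "s + 1 < n" for s
    using that r b_far_last_B[OF that] by (intro far[OF simple_less simple_last]) auto
  moreover have "T (n - 1) * T n * T (n - 1) * T n = T n * T (n - 1) * T n * T (n - 1)" if "ty = TypeB"
  proof -
    have S: "n - 1 \<in> S" "n \<in> S"
      by (rule simple_less; use ad that in force) (rule simple_last; use that in simp)
    show ?thesis using four_iff[OF S sq[OF S(1)] sq[OF S(2)] b_four[OF that]] r that by blast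
  qed
  moreover have "T s * T n = T n * T s" if "ty = TypeD" "1 \<le> s" "s < n" "s \<noteq> n - 2" for s
    using that r b_far_last_D[OF that] by (intro far[OF simple_less simple_last]) auto
  moreover have "T (n - 2) * T n * T (n - 2) = T n * T (n - 2) * T n" if "ty = TypeD"
  proof -
    have S: "n - 2 \<in> S" "n \<in> S"
      by (rule simple_less; use ad that in force) (rule simple_last; use that in simp)
    show ?thesis using braid_iff[OF S b_braid_D[OF that]] r that by blast
  qed
  ultimately show "weyl_braids ty n T" unfolding weyl_braids_def by blast
qed

lemma spin_rels_of_weyl_braids:
  assumes br: "weyl_braids ty n T" and Tsq: "\<And>s. s \<in> S \<Longrightarrow> T s * T s = e"
  shows "\<forall>r\<in>spin_rels ty n. E r = 0"
proof -
  note w = br[unfolded weyl_braids_def]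
  have sq: "t s * t s = e" if "s \<in> S" for s using Tsq[OF that] T_sq[OF that] by simp
  have far: "t s * t r * (t s * t r) = - e"
    if "s \<in> S" "r \<in> S" "b s * b r = - (b r * b s)" "T s * T r = T r * T s" for s r
    using far_iff[OF that(1,2) sq[OF that(1)] sq[OF that(2)] that(3)] that(4) by blast
  have "t i * t j * (t i * t j) = - e" if "i \<in> {1..<n}" "j \<in> {1..<n}" and ij: "\<bar>int i - int j\<bar> > 1" for i j
  proof -
    consider "i + 1 < j" | "j + 1 < i" using ij by linarith
    then show ?thesis
    proof cases
      case 1
      then show ?thesis using that w b_far[of i j] by (intro far simple_less) auto
    next
      case 2
      then have "b i * b j = - (b j * b i)" using that b_far[of j i] by simp
      moreover have "T i * T j = T j * T i" using 2 that w by (metis atLeastLessThan_iff)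
      ultimately show ?thesis using that by (intro far simple_less) auto
    qed
  qed
  moreover have "t i * t (i + 1) * t i = t (i + 1) * t i * t (i + 1)" if "1 \<le> i" "i + 1 < n" for i
    using braid_iff[OF simple_less simple_less b_braid[OF that]] that w by simp
  moreover have "t i * t n * (t i * t n) = - e" if "ty = TypeB" "i \<in> {1..n} - {n - 1, n}" for i
  proof -
    have i: "1 \<le> i" "i + 1 < n" using that(2) by auto
    then show ?thesis using that(1) w b_far_last_B[OF that(1) i] by (intro far[OF simple_less simple_last]) auto
  qed
  moreover have "t (n - 1) * t n * (t (n - 1) * t n) * (t (n - 1) * t n * (t (n - 1) * t n)) = - e" if "ty = TypeB"
  proof -
    have S: "n - 1 \<in> S" "n \<in> S"
      by (rule simple_less; use ad that in force) (rule simple_last; use that in simp)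
    show ?thesis using four_iff[OF S sq[OF S(1)] sq[OF S(2)] b_four[OF that]] w that by blast
  qed
  moreover have "t i * t n * (t i * t n) = - e" if "ty = TypeD" "i \<in> {1..n} - {n - 2, n}" for i
  proof -
    have i: "1 \<le> i" "i < n" "i \<noteq> n - 2" using that(2) by auto
    then show ?thesis using that(1) w b_far_last_D[OF that(1) i] by (intro far[OF simple_less simple_last]) auto
  qed
  moreover have "t (n - 2) * t n * t (n - 2) = t n * t (n - 2) * t n" if "ty = TypeD"
  proof -
    have S: "n - 2 \<in> S" "n \<in> S"
      by (rule simple_less; use ad that in force) (rule simple_last; use that in simp)
    show ?thesis using braid_iff[OF S b_braid_D[OF that]] w that by blast
  qed
  ultimately show ?thesis unfolding spin_rels_eq using sq by blast
qed

end

text \<open>An assignment of values to the group elements as well as to the \<open>t\<close>,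
  compatible under the change of generators. The relators of both presentations can then be
  evaluated in one place.\<close>

locale weyl_ev = spin_ev +
  assumes om_id: "a (Gw id) = e"
    and om_mult: "w \<in> weyl ty n \<Longrightarrow> w' \<in> weyl ty n \<Longrightarrow> a (Gw (w \<circ> w')) = a (Gw w) * a (Gw w')"
    and om_simple: "s \<in> S \<Longrightarrow> a (Gw (\<rho> s)) = T s"
begin

abbreviation "om w \<equiv> a (Gw w)"

lemma rho_in: "s \<in> S \<Longrightarrow> \<rho> s \<in> weyl ty n"
  by (rule simple_ref_weyl[OF ad])

lemma om_T_sq: "s \<in> S \<Longrightarrow> T s * T s = e"
  using om_mult[OF rho_in rho_in, of s s] simple_ref_involutive[OF ad] om_simple om_id by simp

text \<open>Here the group multiplication is given. Each braid identity of the group, taken at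
  \<open>w = id\<close>, is carried over to the \<open>T\<close> by multiplicativity.\<close>

lemma om_braids: "weyl_braids ty n T"
proof -
  interpret descents "weyl ty n" S "\<lambda>w s. w \<circ> simple_ref ty n s" "descent ty n" "defect n" id
    by (rule descents_weyl[OF ad])
  have TT: "T s * T r = om (\<rho> s \<circ> \<rho> r)" if "s \<in> S" "r \<in> S" for s r
    using that by (simp add: om_mult rho_in om_simple)
  have two: "T s * T r = T r * T s" if "commuting s r" "s \<in> S" "r \<in> S" for s r
    using that(1)[unfolded commuting_def, rule_format, OF id_weyl] TT that by simp
  have three: "T s * T r * T s = T r * T s * T r" if "braid3 s r" "s \<in> S" "r \<in> S" for s r
  proof -
    have "om (\<rho> s \<circ> \<rho> r \<circ> \<rho> s) = om (\<rho> r \<circ> \<rho> s \<circ> \<rho> r)"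
      using that(1)[unfolded braid3_def, rule_format, OF id_weyl] by simp
    then show ?thesis using that by (simp add: om_mult rho_in weyl_comp om_simple)
  qed
  have four: "T s * T r * T s * T r = T r * T s * T r * T s" if "braid4 s r" "s \<in> S" "r \<in> S" for s r
  proof -
    have "om (\<rho> s \<circ> \<rho> r \<circ> \<rho> s \<circ> \<rho> r) = om (\<rho> r \<circ> \<rho> s \<circ> \<rho> r \<circ> \<rho> s)"
      using that(1)[unfolded braid4_def, rule_format, OF id_weyl] by simp
    then show ?thesis using that by (simp add: om_mult rho_in weyl_comp om_simple)
  qed
  have kind: "(s + 1 < r \<and> r < n \<longrightarrow> T s * T r = T r * T s) \<and>
     (r = s + 1 \<and> r < n \<longrightarrow> T s * T r * T s = T r * T s * T r)" if "1 \<le> s" "s < r" "r < n" for s r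
  proof -
    have S: "s \<in> S" "r \<in> S" using that by (auto intro: simple_less)
    show ?thesis using weyl_kind[OF ad S that(2)] two[OF _ S] three[OF _ S] that by auto
  qed
  have kindB: "(s + 1 < n \<longrightarrow> T s * T n = T n * T s) \<and>
     (s = n - 1 \<longrightarrow> T s * T n * T s * T n = T n * T s * T n * T s)" if "ty = TypeB" "1 \<le> s" "s < n" for s
  proof -
    have S: "s \<in> S" "n \<in> S"
      by (rule simple_less; use that in simp) (rule simple_last; use that in simp)
    show ?thesis using weyl_kind[OF ad S that(3)] two[OF _ S] four[OF _ S] that(1,3) by auto
  qed
  have kindD: "(s \<noteq> n - 2 \<longrightarrow> T s * T n = T n * T s) \<and>
     (s = n - 2 \<longrightarrow> T s * T n * T s = T n * T s * T n)" if "ty = TypeD" "1 \<le> s" "s < n" for s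
  proof -
    have S: "s \<in> S" "n \<in> S"
      by (rule simple_less; use that in simp) (rule simple_last; use that in simp)
    show ?thesis using weyl_kind[OF ad S that(3)] two[OF _ S] three[OF _ S] that(1,3) by auto
  qed
  have nB: "1 \<le> n - 1 \<and> n - 1 < n" if "ty = TypeB" using ad that by auto
  have nD: "1 \<le> n - 2 \<and> n - 2 < n" if "ty = TypeD" using ad that by auto
  show ?thesis
    unfolding weyl_braids_def
  proof (intro conjI allI impI)
    fix s r assume "1 \<le> s \<and> s + 1 < r \<and> r < n"
    then show "T s * T r = T r * T s" using kind[of s r] by simp
  next
    fix s assume "1 \<le> s \<and> s + 1 < n"
    then show "T s * T (s + 1) * T s = T (s + 1) * T s * T (s + 1)" using kind[of s "s + 1"] by simp
  next
    fix s assume "ty = TypeB" "1 \<le> s \<and> s + 1 < n"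
    then show "T s * T n = T n * T s" using kindB[of s] by simp
  next
    assume "ty = TypeB"
    then show "T (n - 1) * T n * T (n - 1) * T n = T n * T (n - 1) * T n * T (n - 1)"
      using kindB[of "n - 1"] nB by blast
  next
    fix s assume "ty = TypeD" "1 \<le> s \<and> s < n \<and> s \<noteq> n - 2"
    then show "T s * T n = T n * T s" using kindD[of s] by simp
  next
    assume "ty = TypeD"
    then show "T (n - 2) * T n * T (n - 2) = T n * T (n - 2) * T n"
      using kindD[of "n - 2"] nD by blast
  qed
qed

lemma om_spin_rels: "\<forall>r\<in>spin_rels ty n. E r = 0"
  by (rule spin_rels_of_weyl_braids[OF om_braids om_T_sq])

text \<open>What is left of oddness in an algebra without grading: anticommutation with the Clifford
  generators. It is exactly what moving past a vector requires.\<close>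

definition odd_elt :: "'a \<Rightarrow> bool" where
  "odd_elt z \<longleftrightarrow> e * z = z \<and> (\<forall>j\<in>{1..n}. z * c j = - (c j * z))"

lemma odd_elt_t: "s \<in> S \<Longrightarrow> odd_elt (t s)"
  using et tc by (simp add: odd_elt_def)

lemma odd_elt_conj: 
  assumes s: "s \<in> S" and z: "odd_elt z"
  shows "odd_elt (- (t s * z * t s))"
proof -
  have "t s * z * t s * c j = - (c j * (t s * z * t s))" if j: "j \<in> {1..n}" for j
  proof -
    have zj: "z * c j = - (c j * z)" using z j by (simp add: odd_elt_def)
    show ?thesis by (simp add: mult.assoc tc[OF s j] anticomm_left[OF tc[OF s j]] anticomm_left[OF zj])
  qed
  then show ?thesis by (simp add: odd_elt_def mult.assoc[symmetric] et)
qed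

text \<open>The shape "\<open>- \<iota>\<close> times vector times odd element" is stable under
  conjugation by a simple reflection: the vector undergoes minus conjugation by \<open>b s\<close>,
  which is a reflection, and the odd element minus conjugation by \<open>t s\<close>.\<close>

lemma om_conj:
  assumes s: "s \<in> S" and w: "w \<in> weyl ty n" and z: "odd_elt z" and g: "t s * g = - (g * t s)"
    and om: "om w = (- \<iota>) *\<^sub>c (g * z)"
  shows "om (\<rho> s \<circ> w \<circ> \<rho> s) = (- \<iota>) *\<^sub>c (- (b s * g * b s) * - (t s * z * t s))"
proof -
  have zb: "z * b s = - (b s * z)" using z s by (intro b_anti) (auto simp: odd_elt_def)
  have "om (\<rho> s \<circ> w \<circ> \<rho> s) = T s * om w * T s"
    using s w by (simp add: om_mult rho_in weyl_comp om_simple)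
  also have "\<dots> = (- \<iota> * (\<iota> * \<iota>)) *\<^sub>c (b s * t s * g * z * b s * t s)"
    by (simp add: om T_def mult.assoc)
  also have "b s * t s * g * z * b s * t s = - (b s * g * b s * (t s * z * t s))"
    by (simp add: mult.assoc anticomm_left[OF g] anticomm_left[OF zb] anticomm_left[OF tb[OF s s]])
  finally show ?thesis by (simp only: iota) simp
qed

lemma t_cs: "s \<in> S \<Longrightarrow> \<bar>k\<bar> \<in> {1..int n} \<Longrightarrow> t s * cs k = - (cs k * t s)"
  using tc by (elim cs_cases) auto

text \<open>A reflection in the root \<open>e\<^sub>p - e\<^sub>q\<close> (with \<open>e\<^sub>-\<^sub>k = - e\<^sub>k\<close>) corresponds to \<open>z\<close>.\<close>

definition refl :: "(int \<Rightarrow> int) \<Rightarrow> int \<Rightarrow> int \<Rightarrow> 'a \<Rightarrow> bool" where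
  "refl w p q z \<longleftrightarrow> w \<in> weyl ty n \<and> odd_elt z \<and> om w = (- \<iota>) *\<^sub>c (isq2 *\<^sub>c (cs p - cs q) * z)"

text \<open>Minus conjugation by \<open>b s\<close> moves the root vector by
  \<open>\<rho> s\<close>, so the data attached to a root are transported to its reflected
  root.\<close>

lemma refl_conj:
  assumes s: "s \<in> S" and r: "refl w p q z" and pq: "\<bar>p\<bar> \<in> {1..int n}" "\<bar>q\<bar> \<in> {1..int n}"
  shows "refl (\<rho> s \<circ> w \<circ> \<rho> s) (\<rho> s p) (\<rho> s q) (- (t s * z * t s))"
proof -
  have g: "t s * (isq2 *\<^sub>c (cs p - cs q)) = - (isq2 *\<^sub>c (cs p - cs q) * t s)"
    using t_cs[OF s pq(1)] t_cs[OF s pq(2)] by (simp add: algebra_simps)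
  have "- (b s * (isq2 *\<^sub>c (cs p - cs q)) * b s) = isq2 *\<^sub>c (cs (\<rho> s p) - cs (\<rho> s q))"
    unfolding b_braid_gen[OF s pq] by (simp add: cscale_diff_right)
  then show ?thesis
    using om_conj[OF s _ _ g] r odd_elt_conj[OF s] s by (simp add: refl_def weyl_comp rho_in del: mult_minus_right mult_minus_left)
qed

lemma refl_simple: "1 \<le> s \<Longrightarrow> s < n \<Longrightarrow> refl (s_ref s (Suc s)) (int s) (int s + 1) (t s)"
  using simple_less[of s] rho_in[of s] odd_elt_t[of s] om_simple[of s] b_less[of s]
  by (simp add: refl_def simple_ref_def T_def)

lemma refl_bracket_lt:
  assumes "1 \<le> i" "i < j" "j \<le> n"
  shows "refl (s_ref i j) (int i) (int j) (E (bracket_lt i j))"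
proof -
  have "Suc i \<le> j" using assms by simp
  then show ?thesis
    using assms(3)
  proof (induction j rule: dec_induct)
    case base
    then show ?case using refl_simple[of i] assms(1) by (simp add: bracket_lt_base add.commute)
  next
    case (step j)
    have j: "j \<in> S" using step assms(1) by (intro simple_less) auto
    have eq: "\<rho> j \<circ> s_ref i j \<circ> \<rho> j = s_ref i (Suc j)"
      using step assms(1) by (auto simp: fun_eq_iff simple_ref_def s_ref_apply)
    have v: "\<rho> j (int i) = int i" "\<rho> j (int j) = int (Suc j)"
      using step assms(1) by (auto simp: simple_ref_def s_ref_apply)
    show ?case
      using refl_conj[OF j step.IH] step assms(1)
      by (simp add: eq v bracket_lt_step mult.assoc)
  qed
qed

end

section \<open>Reflections with signed indices and the barred brackets\<close>

lemma s_ref_sym: "i \<ge> 1 \<Longrightarrow> j \<ge> 1 \<Longrightarrow> i \<noteq> j \<Longrightarrow> s_ref i j = s_ref j i"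
  by (auto simp: fun_eq_iff s_ref_apply)

lemma sbar_ref_sym: "i \<ge> 1 \<Longrightarrow> j \<ge> 1 \<Longrightarrow> i \<noteq> j \<Longrightarrow> sbar_ref i j = sbar_ref j i"
  by (auto simp: fun_eq_iff sbar_ref_apply)

text \<open>Reflection in \<open>e_p - e_q\<close> for signed indices: a negative \<open>q\<close>
  gives the barred reflections and \<open>q = - p\<close> the sign changes. Conjugation by an odd
  injection is then a mere substitution of indices.\<close>

definition root_refl :: "int \<Rightarrow> int \<Rightarrow> int \<Rightarrow> int" where
  "root_refl p q k = (if k = p then q else if k = q then p else if k = - p then - q else if k = - q then - p else k)"

lemma root_refl_conj:
  assumes inj: "inj f" and odd: "\<And>k. f (- k) = - f k"
  shows "root_refl (f p) (f q) (f k) = f (root_refl p q k)"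
proof -
  have "f k = - f l \<longleftrightarrow> k = - l" for k l using inj_eq[OF inj, of k "- l"] odd by simp
  then show ?thesis by (simp add: root_refl_def inj_eq[OF inj] odd)
qed

lemma s_ref_root: "i \<ge> 1 \<Longrightarrow> j \<ge> 1 \<Longrightarrow> i \<noteq> j \<Longrightarrow> s_ref i j = root_refl (int i) (int j)"
  and sbar_ref_root: "i \<ge> 1 \<Longrightarrow> j \<ge> 1 \<Longrightarrow> i \<noteq> j \<Longrightarrow> sbar_ref i j = root_refl (int i) (- int j)"
  and tau_ref_root: "tau_ref i = root_refl (int i) (- int i)"
  by (simp_all add: fun_eq_iff s_ref_apply sbar_ref_apply tau_ref_apply root_refl_def)

context weyl_ev
begin

lemma rho_root_refl: "s \<in> S \<Longrightarrow> \<rho> s \<circ> root_refl p q \<circ> \<rho> s = root_refl (\<rho> s p) (\<rho> s q)"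
proof
  fix k
  assume s: "s \<in> S"
  have "\<rho> s \<in> signed_perms n" using rho_in[OF s] weyl_sub by auto
  then have "root_refl (\<rho> s p) (\<rho> s q) (\<rho> s (\<rho> s k)) = \<rho> s (root_refl p q (\<rho> s k))"
    by (intro root_refl_conj signed_permsD)
  then show "(\<rho> s \<circ> root_refl p q \<circ> \<rho> s) k = root_refl (\<rho> s p) (\<rho> s q) k"
    by (simp add: rho_rho[OF s])
qed

lemma E_cst_mult: "E (cst z * p) = z *\<^sub>c E p"
  by simp

lemmas unfold_cst = weyl_type.case mult_minus_left E_uminus E_diff E_add E_cst_mult

lemma refl_bar_last:
  assumes "ty \<noteq> TypeA" "1 \<le> i" "i < n"
  shows "refl (sbar_ref i n) (int i) (- int n) (E (bar_bracket_lt ty n i n))"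
proof -
  have n: "n \<ge> 2" using assms by simp
  have base: "refl (sbar_ref (n - 1) n) (int (n - 1)) (- int n) (E (bar_bracket_lt ty n (n - 1) n))"
  proof (cases ty)
    case TypeA
    then show ?thesis using assms by simp
  next
    case TypeB
    have nS: "n \<in> S" using assms by (intro simple_last)
    have v: "\<rho> n (int (n - 1)) = int (n - 1)" "\<rho> n (int (n - 1) + 1) = - int n" "\<rho> n (int n) = - int n"
      using n TypeB by (auto simp: simple_ref_def tau_ref_apply)
    \<comment> \<open>In type B the root \<open>e_{n-1} + e_n\<close> is not simple, so already the
      base case is a conjugate.\<close>
    have eq: "\<rho> n \<circ> s_ref (n - 1) (Suc (n - 1)) \<circ> \<rho> n = sbar_ref (n - 1) n"
      using n s_ref_root[of "n - 1" n] sbar_ref_root[of "n - 1" n] rho_root_refl[OF nS, of "int (n - 1)" "int n"]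
      by (simp only: v) simp
    have "refl (s_ref (n - 1) (Suc (n - 1))) (int (n - 1)) (int (n - 1) + 1) (t (n - 1))"
      using n by (intro refl_simple) auto
    from refl_conj[OF nS this]
    have "refl (sbar_ref (n - 1) n) (int (n - 1)) (- int n) (- (t n * t (n - 1) * t n))"
      unfolding eq v using n by simp
    moreover have "E (bar_bracket_lt ty n (n - 1) n) = - (t n * t (n - 1) * t n)"
      using bar_bracket_lt_base(2)[OF n] TypeB by simp
    ultimately show ?thesis by simp
  next
    case TypeD
    have nS: "n \<in> S" using assms by (intro simple_last)
    have "\<rho> n = sbar_ref (n - 1) n" using TypeD by (simp add: simple_ref_def)
    moreover have "b n = isq2 *\<^sub>c (cs (int (n - 1)) - cs (- int n))"
    proof -
      have "cs (int (n - 1)) = c (n - 1)" "cs (- int n) = - c n" using n by (auto simp: cs_def simp del: of_nat_diff)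
      then show ?thesis using b_last_D[OF TypeD] by (simp only:) simp
    qed
    moreover have "E (bar_bracket_lt ty n (n - 1) n) = t n" using bar_bracket_lt_base(1)[OF n] TypeD by simp
    ultimately show ?thesis
      using rho_in[OF nS] odd_elt_t[OF nS] om_simple[OF nS] by (simp add: refl_def T_def)
  qed
  have "i \<le> n - 1" using assms by simp
  then show ?thesis
    using assms(2)
  proof (induction i rule: inc_induct)
    case base
    show ?case by (rule \<open>refl (sbar_ref (n - 1) n) _ _ _\<close>)
  next
    case (step i)
    have i: "i \<in> S" using step n by (intro simple_less) auto
    have v: "\<rho> i (int (Suc i)) = int i" "\<rho> i (- int n) = - int n"
      using step.hyps step.prems by (auto simp: simple_ref_def s_ref_apply)
    have eq: "\<rho> i \<circ> sbar_ref (Suc i) n \<circ> \<rho> i = sbar_ref i n"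
      using step.hyps step.prems rho_root_refl[OF i, of "int (Suc i)" "- int n"]
        sbar_ref_root[of "Suc i" n] sbar_ref_root[of i n] by (simp only: v)
    have "refl (sbar_ref (Suc i) n) (int (Suc i)) (- int n) (E (bar_bracket_lt ty n (Suc i) n))"
      using step by simp
    from refl_conj[OF i this] show ?case
      using step n unfolding eq v by (simp add: bar_bracket_lt_step1 mult.assoc)
  qed
qed

text \<open>Descends from \<open>j = n\<close>, where \<open>refl_bar_last\<close> applies, by
  conjugation with the reflections exchanging \<open>j\<close> and \<open>j + 1\<close>.\<close>

lemma refl_bar_lt:
  assumes "ty \<noteq> TypeA" "1 \<le> i" "i < j" "j \<le> n"
  shows "refl (sbar_ref i j) (int i) (- int j) (E (bar_bracket_lt ty n i j))"
  using assms(4,3)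
proof (induction j rule: inc_induct)
  case base
  then show ?case using refl_bar_last assms by simp
next
  case (step j)
  have j: "j \<in> S" using step by (intro simple_less) auto
  have v: "\<rho> j (int i) = int i" "\<rho> j (- int (Suc j)) = - int j"
    using step.hyps step.prems assms(2) by (auto simp: simple_ref_def s_ref_apply)
  have eq: "\<rho> j \<circ> sbar_ref i (Suc j) \<circ> \<rho> j = sbar_ref i j"
    using step.hyps step.prems assms(2) rho_root_refl[OF j, of "int i" "- int (Suc j)"]
      sbar_ref_root[of i "Suc j"] sbar_ref_root[of i j] by (simp only: v)
  have "refl (sbar_ref i (Suc j)) (int i) (- int (Suc j)) (E (bar_bracket_lt ty n i (Suc j)))"
    using step by simp
  from refl_conj[OF j this] show ?case
    using step assms(2) unfolding eq v by (simp add: bar_bracket_lt_step2 mult.assoc)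
qed

text \<open>For a short root the unit vector is \<open>c i\<close> itself, so the normalisation
  \<open>isq2\<close> does not occur. This accounts for the extra factor sqrt 2 in front of
  \<open>v\<close> in \<open>hc_diag\<close>.\<close>

lemma om_tau:
  assumes B: "ty = TypeB" and i: "1 \<le> i" "i \<le> n"
  shows "odd_elt (E (bar_single n i)) \<and> om (tau_ref i) = (- \<iota>) *\<^sub>c (cs (int i) * E (bar_single n i))"
  using i(2,1)
proof (induction i rule: inc_induct)
  case base
  have "n \<in> S" using B by (intro simple_last) simp
  moreover have "\<rho> n = tau_ref n" using B by (simp add: simple_ref_def)
  ultimately show ?case
    using om_simple[of n] odd_elt_t[of n] base b_last_B[OF B] by (simp add: bar_single_base T_def)
next
  case (step i)
  have iS: "i \<in> S" using step by (intro simple_less) auto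
  have v: "\<rho> i (int (Suc i)) = int i" "\<rho> i (- int (Suc i)) = - int i"
    using step.hyps step.prems by (auto simp: simple_ref_def s_ref_apply)
  have eq: "\<rho> i \<circ> tau_ref (Suc i) \<circ> \<rho> i = tau_ref i"
    unfolding tau_ref_root rho_root_refl[OF iS] v ..
  have k: "\<bar>int (Suc i)\<bar> \<in> {1..int n}" using step by simp
  have w: "tau_ref (Suc i) \<in> weyl ty n" using tau_ref_weyl[of "Suc i" n] B step by simp
  have IH: "odd_elt (E (bar_single n (Suc i)))"
    "om (tau_ref (Suc i)) = (- \<iota>) *\<^sub>c (cs (int (Suc i)) * E (bar_single n (Suc i)))" using step by auto
  have z: "E (bar_single n i) = - (t i * E (bar_single n (Suc i)) * t i)"
    using step by (simp add: bar_single_step)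
  show ?case
    using om_conj[OF iS w IH(1) t_cs[OF iS k] IH(2)] odd_elt_conj[OF iS IH(1)]
    unfolding eq b_reflect[OF iS k] v z by simp
qed

text \<open>The factors \<open>1 + c_j c_i\<close> and \<open>1 - c_j c_i\<close> of the commutators
  collapse the root vectors to multiples of \<open>c i\<close>. The 2 against the normalisation
  \<open>isq2\<close> leaves sqrt 2, hence the constant \<open>r\<close>.\<close>

lemma pair_sum:
  assumes "i \<in> {1..n}" "j \<in> {1..n}" "i \<noteq> j"
  shows "(e + c j * c i) * (c i - c j) = 2 *\<^sub>c c i" "(e - c j * c i) * (c i + c j) = 2 *\<^sub>c c i"
proof -
  have two: "2 *\<^sub>c z = z + z" for z :: 'a
    using cscale_add_left[of 1 1 z] by simp
  interpret unit_vectors e "c i" "c j"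
    using assms ee ec cc[of i] cc[of j] canti[of j i] by unfold_locales auto
  show "(e + c j * c i) * (c i - c j) = 2 *\<^sub>c c i" "(e - c j * c i) * (c i + c j) = 2 *\<^sub>c c i"
    by (simp_all add: vec_simps two)
qed

abbreviation "r \<equiv> complex_of_real (sqrt 2) * \<iota>"

lemma r_nz: "r \<noteq> 0" using iota_nz by simp

lemma om_s:
  assumes "i \<in> {1..n}" "j \<in> {1..n}" "i \<noteq> j"
  shows "(e + c j * c i) * om (s_ref i j) = (- r) *\<^sub>c (c i * E (bracket i j))"
proof -
  have "om (s_ref i j) = (- \<iota>) *\<^sub>c (isq2 *\<^sub>c (c i - c j) * E (bracket i j))"
  proof (cases "i < j")
    case True
    then show ?thesis using refl_bracket_lt[of i j] assms by (simp add: refl_def bracket_def)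
  next
    \<comment> \<open>Both the root vector and \<open>bracket\<close> change sign when the indices
      are exchanged.\<close>
    case False
    then have "j < i" using assms by simp
    then show ?thesis using refl_bracket_lt[of j i] assms s_ref_sym[of i j]
      by (simp add: refl_def bracket_def algebra_simps)
  qed
  then have "(e + c j * c i) * om (s_ref i j) = (- \<iota> * isq2) *\<^sub>c ((e + c j * c i) * (c i - c j) * E (bracket i j))"
    by (simp add: mult.assoc)
  then show ?thesis unfolding pair_sum[OF assms] using isq2_sq(4) by (simp add: mult.commute mult.left_commute)
qed

lemma om_sbar:
  assumes "ty \<noteq> TypeA" "i \<in> {1..n}" "j \<in> {1..n}" "i \<noteq> j"
  shows "(e - c j * c i) * om (sbar_ref i j) = (- r) *\<^sub>c (c i * E (bar_bracket ty n i j))"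
proof -
  have m: "cs (- int k) = - c k" if "k \<ge> 1" for k using that by (simp add: cs_def)
  have "om (sbar_ref i j) = (- \<iota>) *\<^sub>c (isq2 *\<^sub>c (c i + c j) * E (bar_bracket ty n i j))"
  proof (cases "i < j")
    case True
    then show ?thesis using refl_bar_lt[of i j] assms by (simp add: refl_def bar_bracket_def m)
  next
    case False
    then have "j < i" using assms by simp
    then show ?thesis using refl_bar_lt[of j i] assms sbar_ref_sym[of i j]
      by (simp add: refl_def bar_bracket_def m add.commute)
  qed
  then have "(e - c j * c i) * om (sbar_ref i j) = (- \<iota> * isq2) *\<^sub>c ((e - c j * c i) * (c i + c j) * E (bar_bracket ty n i j))"
    by (simp add: mult.assoc)
  then show ?thesis unfolding pair_sum[OF assms(2-4)] using isq2_sq(4) by (simp add: mult.commute mult.left_commute)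
qed

lemma E_offdiag:
  assumes "i \<in> {1..n}" "j \<in> {1..n}" "i \<noteq> j"
  shows "E (hc_offdiag ty u j i) = r *\<^sub>c (c i * E (hm_offdiag ty n u i j))"
proof (cases "ty = TypeA")
  case True
  then show ?thesis
    using om_s[OF assms] s_ref_sym[of i j] assms
    unfolding True hc_offdiag_def hm_offdiag_def unfold_cst by (simp add: mult.commute)
next
  case False
  have "E (hc_offdiag ty u j i) = u *\<^sub>c ((e + c j * c i) * om (s_ref i j) - (e - c j * c i) * om (sbar_ref i j))"
    using False unfolding hc_offdiag_def by (cases ty; simp only: unfold_cst; simp)
  moreover have "E (hm_offdiag ty n u i j) = u *\<^sub>c (E (bar_bracket ty n i j) - E (bracket i j))"
    using False unfolding hm_offdiag_def by (cases ty; simp only: unfold_cst; simp add: cscale_diff_right)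
  ultimately show ?thesis
    by (simp only: om_s[OF assms] om_sbar[OF False assms])
      (simp add: cscale_diff_right right_diff_distrib mult.commute mult.left_commute)
qed

lemma E_diag:
  assumes i: "i \<in> {1..n}"
  shows "E (hc_diag ty n u v i) = r *\<^sub>c (c i * E (hm_diag ty n u v i))"
proof -
  have s: "(e + c k * c i) * om (s_ref k i) = (- r) *\<^sub>c (c i * E (bracket i k))" if "k \<in> {1..n} - {i}" for k
    using om_s[OF i, of k] s_ref_sym[of i k] that i by simp
  have sb: "(e - c k * c i) * om (sbar_ref k i) = (- r) *\<^sub>c (c i * E (bar_bracket ty n i k))"
    if "k \<in> {1..n} - {i}" "ty \<noteq> TypeA" for k
    using om_sbar[OF that(2) i, of k] sbar_ref_sym[of i k] that i by simp
  note lin = cscale_sum_right sum_distrib_left sum_distrib_right mult.assoc[symmetric]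
  show ?thesis
  proof (cases ty)
    case TypeA
    have "E (hc_diag ty n u v i) = (- u) *\<^sub>c (\<Sum>k\<in>{1..n} - {i}. (e + c k * c i) * om (s_ref k i))"
      unfolding TypeA hc_diag_def unfold_cst by simp
    also have "\<dots> = r *\<^sub>c (c i * (u *\<^sub>c (\<Sum>k\<in>{1..n} - {i}. E (bracket i k))))"
      by (simp add: s cscale_sum_right sum_distrib_left sum_negf mult.commute)
    finally show ?thesis unfolding TypeA hm_diag_def unfold_cst by simp
  next
    case TypeD
    then have nA: "ty \<noteq> TypeA" by simp
    have "E (hc_diag ty n u v i) = (- u) *\<^sub>c (\<Sum>k\<in>{1..n} - {i}. (e + c k * c i) * om (s_ref k i) + (e - c k * c i) * om (sbar_ref k i))"
      unfolding TypeD hc_diag_def unfold_cst by simp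
    also have "\<dots> = r *\<^sub>c (c i * (u *\<^sub>c (\<Sum>k\<in>{1..n} - {i}. E (bracket i k) + E (bar_bracket ty n i k))))"
      by (simp add: s sb[OF _ nA] cscale_sum_right sum_distrib_left distrib_left cscale_add_right
          cscale_diff_right sum_negf sum_subtractf sum.distrib mult.commute mult.left_commute)
    finally show ?thesis unfolding TypeD hm_diag_def unfold_cst by simp
  next
    case TypeB
    then have nA: "ty \<noteq> TypeA" by simp
    have tau: "om (tau_ref i) = (- \<iota>) *\<^sub>c (c i * E (bar_single n i))"
      using om_tau[OF TypeB, of i] i by simp
    have "E (hc_diag ty n u v i) = (- u) *\<^sub>c (\<Sum>k\<in>{1..n} - {i}. (e + c k * c i) * om (s_ref k i) + (e - c k * c i) * om (sbar_ref k i))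
        - (complex_of_real (sqrt 2) * v) *\<^sub>c om (tau_ref i)"
      unfolding TypeB hc_diag_def unfold_cst by simp
    also have "\<dots> = r *\<^sub>c (c i * (u *\<^sub>c (\<Sum>k\<in>{1..n} - {i}. E (bracket i k) + E (bar_bracket ty n i k)) + v *\<^sub>c E (bar_single n i)))"
      by (simp add: s sb[OF _ nA] tau cscale_sum_right sum_distrib_left distrib_left cscale_add_right
          cscale_diff_right sum_negf sum_subtractf sum.distrib mult.commute mult.left_commute)
    finally show ?thesis unfolding TypeB hm_diag_def unfold_cst by simp
  qed
qed

end

section \<open>The relations of the rational double affine algebras\<close>

context weyl_ev
begin

lemma a_unit: "e * a g = a g" "a g * e = a g"
  using E_unit[of "gen g"] by simp_all

lemma a_unit_left: "e * (a g * z) = a g * z"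
  by (simp add: a_unit mult.assoc[symmetric])

lemma t_sq: "s \<in> S \<Longrightarrow> t s * t s = e"
  using om_T_sq T_sq by simp

lemma clifford_rels_vanish: "\<forall>r\<in>clifford_rels n. E r = 0"
proof -
  have "c i * c j + c j * c i = 0" if "i \<in> {1..n} \<and> j \<in> {1..n} \<and> i \<noteq> j" for i j
    using canti[of i j] that by simp
  then show ?thesis
    unfolding clifford_rels_def ball_Un ball_Collect1 ball_Collect2 E_diff E_add E_mult E_gen E_one
    using cc by simp
qed

lemma weyl_rels_vanish: "\<forall>r\<in>weyl_rels ty n. E r = 0"
  unfolding weyl_rels_def ball_Un ball_Collect2 ball_insert E_diff E_mult E_gen E_one
  using om_id om_mult by simp

definition fs :: "(nat \<Rightarrow> gens) \<Rightarrow> int \<Rightarrow> 'a" where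
  "fs G k = (if k > 0 then a (G (nat k)) else - a (G (nat (- k))))"

lemma E_signed: "E (signed (\<lambda>i. gen (G i)) k) = fs G k"
  by (simp add: signed_def fs_def)

lemma fs_unit: "e * fs G k = fs G k" "fs G k * e = fs G k"
  by (simp_all add: fs_def a_unit)

lemma fs_minus: "k \<noteq> 0 \<Longrightarrow> fs G (- k) = - fs G k"
  by (auto simp: fs_def)

lemma fs_int: "i \<ge> 1 \<Longrightarrow> fs G (int i) = a (G i)"
  by (simp add: fs_def)

text \<open>One direction specialises to simple reflections, which are their own inverses. The other
  is an induction over the group, for which the family has to be extended to signed indices.\<close>

lemma conj_rels_iff:
  "(\<forall>r\<in>conj_rels ty n (\<lambda>i. gen (G i)). E r = 0) \<longleftrightarrow>
   (\<forall>s\<in>S. \<forall>i\<in>{1..n}. T s * a (G i) = fs G (\<rho> s (int i)) * T s)"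
proof -
  have eq: "(\<forall>r\<in>conj_rels ty n (\<lambda>i. gen (G i)). E r = 0) \<longleftrightarrow>
    (\<forall>w i. w \<in> weyl ty n \<and> i \<in> {1..n} \<longrightarrow> om w * a (G i) * om (inv_into UNIV w) = fs G (w (int i)))"
    unfolding conj_rels_def ball_Collect2 E_diff E_mult E_gen E_signed by simp
  show ?thesis
    unfolding eq
  proof (intro iffI allI impI ballI; (elim conjE)?)
    fix s i assume h: "\<forall>w i. w \<in> weyl ty n \<and> i \<in> {1..n} \<longrightarrow> om w * a (G i) * om (inv_into UNIV w) = fs G (w (int i))"
      and s: "s \<in> S" and i: "i \<in> {1..n}"
    have "inv_into UNIV (\<rho> s) = \<rho> s"
      using simple_ref_involutive[OF ad s] by (intro inv_unique_comp)
    then have "T s * a (G i) * T s = fs G (\<rho> s (int i))"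
      using h rho_in[OF s] i om_simple[OF s] by fastforce
    then have "T s * a (G i) * T s * T s = fs G (\<rho> s (int i)) * T s" by simp
    then show "T s * a (G i) = fs G (\<rho> s (int i)) * T s"
      using om_T_sq[OF s] by (simp add: mult.assoc a_unit)
  next
    fix w i assume h: "\<forall>s\<in>S. \<forall>i\<in>{1..n}. T s * a (G i) = fs G (\<rho> s (int i)) * T s"
      and w: "w \<in> weyl ty n" and i: "i \<in> {1..n}"
    have T: "T s * fs G k = fs G (\<rho> s k) * T s" if s: "s \<in> S" and k: "\<bar>k\<bar> \<in> {1..int n}" for s k
    proof -
      define j where "j = nat \<bar>k\<bar>"
      have j: "j \<in> {1..n}" "\<bar>int j\<bar> \<in> {1..int n}" and kj: "k = int j \<or> k = - int j" using k by (auto simp: j_def)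
      have p: "T s * fs G (int j) = fs G (\<rho> s (int j)) * T s"
        using h s j(1) fs_int[of j G] by simp
      have "\<rho> s (int j) \<noteq> 0" using rho_range[OF s j(2)] by auto
      then have "fs G (\<rho> s (- int j)) = - fs G (\<rho> s (int j))" "fs G (- int j) = - fs G (int j)"
        using fs_minus[of "\<rho> s (int j)" G] fs_minus[of "int j" G] rho_minus[OF s, of "int j"] j(1) by simp_all
      then show ?thesis using kj p by auto
    qed
    have "\<forall>k. \<bar>k\<bar> \<in> {1..int n} \<longrightarrow> om w * fs G k = fs G (w k) * om w"
      using ad w
    proof (induction rule: weyl_induct)
      case id
      then show ?case by (simp add: om_id[unfolded id_def] fs_unit id_def)
    next
      case (step w s)
      show ?case
      proof (intro allI impI)
        fix k assume k: "\<bar>k\<bar> \<in> {1..int n}"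
        have "om (w \<circ> \<rho> s) * fs G k = om w * (T s * fs G k)"
          using om_mult[OF step(1) rho_in[OF step(2)]] om_simple[OF step(2)] by (simp add: mult.assoc)
        also have "\<dots> = om w * fs G (\<rho> s k) * T s" by (simp add: T[OF step(2) k] mult.assoc)
        also have "\<dots> = fs G (w (\<rho> s k)) * (om w * T s)"
          using step(3) rho_range[OF step(2) k] by (simp add: mult.assoc)
        finally show "om (w \<circ> \<rho> s) * fs G k = fs G ((w \<circ> \<rho> s) k) * om (w \<circ> \<rho> s)"
          using om_mult[OF step(1) rho_in[OF step(2)]] om_simple[OF step(2)] by simp
      qed
    qed
    from this[rule_format, of "int i"] have "om w * a (G i) = fs G (w (int i)) * om w"
      using i fs_int[of i G] by simp
    then have "om w * a (G i) * om (inv_into UNIV w) = fs G (w (int i)) * om (w \<circ> inv_into UNIV w)"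
      using om_mult[OF w weyl_inv[OF w]] by (simp add: mult.assoc)
    then show "om w * a (G i) * om (inv_into UNIV w) = fs G (w (int i))"
      using inv_comp_weyl[OF w] om_id fs_unit by simp
  qed
qed

lemma conj_c_vanish: "\<forall>r\<in>conj_rels ty n (\<lambda>i. gen (Gc i)). E r = 0"
proof -
  have "fs Gc k = cs k" for k by (simp add: fs_def cs_def)
  then show ?thesis unfolding conj_rels_iff using T_c[of _ "int _"] by (auto simp: cs_int)
qed

text \<open>The relations between the \<open>t\<^sub>s\<close> and a family \<open>f\<close>, where the sign \<open>\<epsilon>\<close> is \<open>1\<close> for \<open>y\<close> and
  \<open>-1\<close> for \<open>\<xi>\<close>.\<close>

definition twisted :: "(nat \<Rightarrow> 'a) \<Rightarrow> complex \<Rightarrow> bool" where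
  "twisted f \<epsilon> \<longleftrightarrow> (\<forall>s\<in>S. \<forall>i\<in>{1..n}.
     t s * f i = (if \<rho> s (int i) > 0 then \<epsilon> else -1) *\<^sub>c (f (nat \<bar>\<rho> s (int i)\<bar>) * t s))"

text \<open>The presentation lists only one of the two indices exchanged by a reflection. A change
  of sign gives -1 for both families: for \<open>y\<close> it is the sign of the reflection, while
  for \<open>xi\<close> the signs coming from \<open>c\<close> and \<open>x\<close> cancel and the
  sign of two odd elements is left.\<close>

lemma twisted_iff:
  assumes eps: "\<epsilon> * \<epsilon> = 1" and fu: "\<And>i. e * f i = f i" "\<And>i. f i * e = f i"
  shows "twisted f \<epsilon> \<longleftrightarrow>
    (\<forall>i. i \<in> {1..<n} \<longrightarrow> t i * f i = \<epsilon> *\<^sub>c (f (i + 1) * t i)) \<and>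
    (\<forall>i j. i \<in> {1..<n} \<and> j \<in> {1..n} - {i, i + 1} \<longrightarrow> t i * f j = \<epsilon> *\<^sub>c (f j * t i)) \<and>
    (ty = TypeB \<longrightarrow> t n * f n = - (f n * t n) \<and> (\<forall>j. j \<in> {1..n} - {n} \<longrightarrow> t n * f j = \<epsilon> *\<^sub>c (f j * t n))) \<and>
    (ty = TypeD \<longrightarrow> t n * f n = - (f (n - 1) * t n) \<and>
       (\<forall>j. j \<in> {1..n} - {n - 1, n} \<longrightarrow> t n * f j = \<epsilon> *\<^sub>c (f j * t n)))" (is "_ \<longleftrightarrow> ?R")
proof
  have v1: "\<rho> i (int i) = int (i + 1)" "\<rho> i (int (i + 1)) = int i" "k \<notin> {i, i + 1} \<Longrightarrow> k \<ge> 1 \<Longrightarrow> \<rho> i (int k) = int k"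
    if "i \<in> {1..<n}" for i k using that by (auto simp: simple_ref_def s_ref_apply)
  have vB: "\<rho> n (int n) = - int n" "k \<noteq> n \<Longrightarrow> k \<ge> 1 \<Longrightarrow> \<rho> n (int k) = int k" if "ty = TypeB" for k
    using that by (auto simp: simple_ref_def tau_ref_apply)
  have vD: "\<rho> n (int n) = - int (n - 1)" "\<rho> n (int (n - 1)) = - int n"
    "k \<notin> {n - 1, n} \<Longrightarrow> k \<ge> 1 \<Longrightarrow> \<rho> n (int k) = int k" if "ty = TypeD" for k
  proof -
    have "n \<ge> 4" using ad that by simp
    then show "\<rho> n (int n) = - int (n - 1)" "\<rho> n (int (n - 1)) = - int n"
      "k \<notin> {n - 1, n} \<Longrightarrow> k \<ge> 1 \<Longrightarrow> \<rho> n (int k) = int k"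
      using that by (auto simp: simple_ref_def sbar_ref_apply)
  qed
  {
    assume "twisted f \<epsilon>"
    then have tw: "t s * f i = (if \<rho> s (int i) > 0 then \<epsilon> else -1) *\<^sub>c (f (nat \<bar>\<rho> s (int i)\<bar>) * t s)"
      if "s \<in> S" "i \<in> {1..n}" for s i using that by (auto simp: twisted_def)
    have n1: "n \<ge> 1" using ad by (cases ty) auto
    have "t i * f i = \<epsilon> *\<^sub>c (f (i + 1) * t i)" if "i \<in> {1..<n}" for i
      using tw[of i i] v1[OF that] that simple_less[of i] by (simp only: v1[OF that]) (simp add: nat_add_distrib)
    moreover have "t i * f j = \<epsilon> *\<^sub>c (f j * t i)" if "i \<in> {1..<n}" "j \<in> {1..n} - {i, i + 1}" for i j
    proof -
      have "\<rho> i (int j) = int j" using v1(3)[OF that(1), of j] that(2) by auto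
      then show ?thesis using tw[of i j] that simple_less[of i] by simp
    qed
    moreover have "t n * f n = - (f n * t n) \<and> (\<forall>j. j \<in> {1..n} - {n} \<longrightarrow> t n * f j = \<epsilon> *\<^sub>c (f j * t n))" if B: "ty = TypeB"
    proof -
      have nS: "n \<in> S" by (rule simple_last) (use B in simp)
      have "\<rho> n (int j) = int j" if "j \<in> {1..n} - {n}" for j using vB(2)[OF B, of j] that by auto
      then show ?thesis using tw[OF nS] vB(1)[OF B] n1 by auto
    qed
    moreover have "t n * f n = - (f (n - 1) * t n) \<and> (\<forall>j. j \<in> {1..n} - {n - 1, n} \<longrightarrow> t n * f j = \<epsilon> *\<^sub>c (f j * t n))"
      if D: "ty = TypeD"
    proof -
      have nS: "n \<in> S" by (rule simple_last) (use D in simp)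
      have "\<rho> n (int j) = int j" if "j \<in> {1..n} - {n - 1, n}" for j using vD(3)[OF D, of j] that by auto
      moreover have "t n * f n = - (f (n - 1) * t n)"
        using tw[OF nS, of n] n1 unfolding vD(1)[OF D] by (simp add: nat_diff_distrib)
      ultimately show ?thesis using tw[OF nS] by auto
    qed
    ultimately show ?R by blast
  }
  assume R: ?R
  note R1 = R[THEN conjunct1, rule_format] and R2 = R[THEN conjunct2, THEN conjunct1, rule_format, OF conjI]
  have RB: "t n * f n = - (f n * t n)" "\<And>j. j \<in> {1..n} - {n} \<Longrightarrow> t n * f j = \<epsilon> *\<^sub>c (f j * t n)" if "ty = TypeB"
    using R[THEN conjunct2, THEN conjunct2, THEN conjunct1, rule_format, OF that] by blast+
  have RD: "t n * f n = - (f (n - 1) * t n)" "\<And>j. j \<in> {1..n} - {n - 1, n} \<Longrightarrow> t n * f j = \<epsilon> *\<^sub>c (f j * t n)" if "ty = TypeD"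
    using R[THEN conjunct2, THEN conjunct2, THEN conjunct2, rule_format, OF that] by blast+
  \<comment> \<open>Multiplying the relation at \<open>i\<close> by \<open>t s\<close> on both sides
    gives the one at the other exchanged index, as \<open>t s\<close> squares to \<open>e\<close>
    and the scalar to one.\<close>
  have flip: "t s * f j = z *\<^sub>c (f i * t s)" if s: "s \<in> S" and ij: "t s * f i = z *\<^sub>c (f j * t s)" and z: "z * z = 1" for s i j z
  proof -
    have "z *\<^sub>c (t s * (t s * f i) * t s) = z *\<^sub>c (t s * (z *\<^sub>c (f j * t s)) * t s)" by (simp add: ij)
    then have "z *\<^sub>c (t s * t s * f i * t s) = t s * f j * (t s * t s)" by (simp add: mult.assoc z)
    then show ?thesis by (simp add: t_sq[OF s] fu mult.assoc)
  qed
  show "twisted f \<epsilon>"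
    unfolding twisted_def
  proof (intro ballI)
    fix s i assume s: "s \<in> S" and i: "i \<in> {1..n}"
    show "t s * f i = (if \<rho> s (int i) > 0 then \<epsilon> else -1) *\<^sub>c (f (nat \<bar>\<rho> s (int i)\<bar>) * t s)"
      using ad s
    proof (cases rule: simple_index_cases)
      case 1
      then have s': "s \<in> {1..<n}" by simp
      consider "i = s" | "i = s + 1" | "i \<notin> {s, s + 1}" by blast
      then show ?thesis
      proof cases
        case 1
        then show ?thesis using R1[OF s'] v1(1)[OF s'] by (simp add: nat_add_distrib)
      next
        case 2
        have "t s * f (s + 1) = \<epsilon> *\<^sub>c (f s * t s)" by (rule flip[OF s R1[OF s'] eps])
        then show ?thesis using 2 unfolding 2 v1(2)[OF s'] using s' by simp
      next
        case 3
        then have "t s * f i = \<epsilon> *\<^sub>c (f i * t s)" using i by (intro R2[OF s']) blast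
        then show ?thesis using v1(3)[OF s' 3] i by simp
      qed
    next
      case 2
      show ?thesis
      proof (cases "i = n")
        case True
        then show ?thesis using RB(1)[OF 2(2)] vB(1)[OF 2(2)] 2(1) by simp
      next
        case False
        then have "t n * f i = \<epsilon> *\<^sub>c (f i * t n)" using i by (intro RB(2)[OF 2(2)]) blast
        then show ?thesis using vB(2)[OF 2(2) False] i 2(1) by simp
      qed
    next
      case 3
      have tn: "t n * f n = (-1) *\<^sub>c (f (n - 1) * t n)" using RD(1)[OF 3(2)] by simp
      consider "i = n" | "i = n - 1" | "i \<notin> {n - 1, n}" by blast
      then show ?thesis
      proof cases
        case 1
        then show ?thesis using tn 3(3) unfolding 3(1) 1 vD(1)[OF 3(2)] by (simp add: nat_diff_distrib)
      next
        case 2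
        have "t n * f (n - 1) = (-1) *\<^sub>c (f n * t n)" using s 3(1) by (intro flip[OF _ tn]) simp_all
        then show ?thesis unfolding 3(1) 2 vD(2)[OF 3(2)] by simp
      next
        case i3: 3
        then have "t n * f i = \<epsilon> *\<^sub>c (f i * t n)" using i by (intro RD(2)[OF 3(2)]) blast
        then show ?thesis using vD(3)[OF 3(2) i3] i 3(1) by simp
      qed
    qed
  qed
qed

end

section \<open>The relators that involve x, y and xi\<close>

locale daha_ev = weyl_ev +
  assumes yc: "i \<in> {1..n} \<Longrightarrow> j \<in> {1..n} \<Longrightarrow> a (Gy i) * c j = c j * a (Gy i)"
    and xic: "i \<in> {1..n} \<Longrightarrow> j \<in> {1..n} \<Longrightarrow> a (Gxi i) * c j = - (c j * a (Gxi i))"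
    and x_eq: "i \<in> {1..n} \<Longrightarrow> a (Gx i) = (complex_of_real (sqrt 2) * \<iota>) *\<^sub>c (c i * a (Gxi i))"
begin

abbreviation "y i \<equiv> a (Gy i)"
abbreviation "xi i \<equiv> a (Gxi i)"
abbreviation "x i \<equiv> a (Gx i)"

lemma c_left_cancel:
  assumes "i \<in> {1..n}" "e * z = z" "e * w = w"
  shows "c i * z = c i * w \<longleftrightarrow> z = w"
  using sq_left[OF cc[OF assms(1)], of z] sq_left[OF cc[OF assms(1)], of w] assms(2,3) by metis

lemma x_left_cancel:
  assumes "i \<in> {1..n}" "e * z = z" "e * w = w"
  shows "r *\<^sub>c (c i * z) = r *\<^sub>c (c i * w) \<longleftrightarrow> z = w"
  using c_left_cancel[OF assms] cscale_cancel[OF r_nz] by simp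

lemma rho_nat:
  assumes "s \<in> S" "i \<in> {1..n}"
  shows "nat \<bar>\<rho> s (int i)\<bar> \<in> {1..n}" "\<bar>\<rho> s (int i)\<bar> \<in> {1..int n}" "\<rho> s (int i) \<noteq> 0"
  using rho_range[OF assms(1), of "int i"] assms(2) by auto

text \<open>\<open>y\<close> commutes with the Clifford generators, so on both sides the vector
  \<open>b s\<close> inside \<open>T s\<close> can be moved to the left and cancelled.\<close>

lemma Ty_iff: "(\<forall>s\<in>S. \<forall>i\<in>{1..n}. T s * y i = fs Gy (\<rho> s (int i)) * T s) \<longleftrightarrow> twisted y 1"
  unfolding twisted_def
proof (intro ball_cong refl)
  fix s i assume s: "s \<in> S" and i: "i \<in> {1..n}"
  define j where "j = nat \<bar>\<rho> s (int i)\<bar>"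
  define \<epsilon> :: complex where "\<epsilon> = (if \<rho> s (int i) > 0 then 1 else -1)"
  have j: "j \<in> {1..n}" using rho_nat(1)[OF s i] by (simp add: j_def)
  have f: "fs Gy (\<rho> s (int i)) = \<epsilon> *\<^sub>c y j"
    using rho_nat(3)[OF s i] by (auto simp: fs_def \<epsilon>_def j_def)
  have yb: "y j * b s = b s * y j" by (rule b_commute[OF _ s]) (use yc j in auto)
  have "T s * y i = (- \<iota>) *\<^sub>c (b s * (t s * y i))" by (simp add: T_def mult.assoc)
  moreover have "fs Gy (\<rho> s (int i)) * T s = (- \<iota>) *\<^sub>c (b s * (\<epsilon> *\<^sub>c (y j * t s)))"
  proof -
    have "fs Gy (\<rho> s (int i)) * T s = (- \<iota> * \<epsilon>) *\<^sub>c (y j * b s * t s)"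
      by (simp add: f T_def mult.assoc mult.commute)
    then show ?thesis unfolding yb by (simp add: mult.assoc)
  qed
  moreover have "(- \<iota>) *\<^sub>c (b s * (t s * y i)) = (- \<iota>) *\<^sub>c (b s * (\<epsilon> *\<^sub>c (y j * t s))) \<longleftrightarrow>
      t s * y i = \<epsilon> *\<^sub>c (y j * t s)"
  proof -
    have "(- \<iota>) *\<^sub>c (b s * (t s * y i)) = (- \<iota>) *\<^sub>c (b s * (\<epsilon> *\<^sub>c (y j * t s))) \<longleftrightarrow>
        b s * (t s * y i) = b s * (\<epsilon> *\<^sub>c (y j * t s))"
      by (rule cscale_cancel) (simp add: iota_nz)
    then show ?thesis
      using b_cancel[OF s, of "t s * y i" "\<epsilon> *\<^sub>c (y j * t s)"] by (auto simp: a_unit_left)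
  qed
  ultimately show "(T s * y i = fs Gy (\<rho> s (int i)) * T s) \<longleftrightarrow>
      (t s * y i = (if 0 < \<rho> s (int i) then 1 else - 1) *\<^sub>c (y (nat \<bar>\<rho> s (int i)\<bar>) * t s))"
    unfolding \<epsilon>_def j_def by simp
qed

text \<open>The sign of \<open>\<rho> s\<close> at \<open>i\<close> is absorbed by the signed
  Clifford element \<open>cs k\<close>, which is a common left factor of both sides, as is
  \<open>b s\<close>. Moving \<open>xi\<close> past \<open>b s\<close> leaves the constant sign
  -1.\<close>

lemma Tx_iff: "(\<forall>s\<in>S. \<forall>i\<in>{1..n}. T s * x i = fs Gx (\<rho> s (int i)) * T s) \<longleftrightarrow> twisted xi (-1)"
  unfolding twisted_def if_cancel
proof (intro ball_cong refl)
  fix s i assume s: "s \<in> S" and i: "i \<in> {1..n}"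
  define k where "k = \<rho> s (int i)"
  define j where "j = nat \<bar>k\<bar>"
  have j: "j \<in> {1..n}" and k: "\<bar>k\<bar> \<in> {1..int n}" "k \<noteq> 0" using rho_nat[OF s i] by (simp_all add: j_def k_def)
  have f: "fs Gx k = r *\<^sub>c (cs k * xi j)"
    using k x_eq[OF j] by (auto simp: fs_def cs_def j_def)
  have xb: "xi j * b s = - (b s * xi j)" by (rule b_anti[OF _ s]) (use xic j in auto)
  have ci: "c i = cs (int i)" "\<bar>int i\<bar> \<in> {1..int n}" using i by (simp_all add: cs_int)
  have "T s * x i = r *\<^sub>c (T s * cs (int i) * xi i)" by (simp add: x_eq[OF i] ci mult.assoc)
  also have "\<dots> = r *\<^sub>c (cs k * T s * xi i)" unfolding T_c[OF s ci(2)] k_def ..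
  also have "\<dots> = (- \<iota> * r) *\<^sub>c (cs k * (b s * (t s * xi i)))" by (simp add: T_def mult.assoc mult.commute mult.left_commute)
  finally have L: "T s * x i = (- \<iota> * r) *\<^sub>c (cs k * (b s * (t s * xi i)))" .
  have "fs Gx k * T s = (- \<iota> * r) *\<^sub>c (cs k * (xi j * b s) * t s)"
    by (simp add: f T_def mult.assoc mult.commute mult.left_commute)
  also have "\<dots> = (- \<iota> * r) *\<^sub>c (cs k * (b s * (- (xi j * t s))))"
    unfolding xb by (simp add: mult.assoc)
  finally have R: "fs Gx k * T s = (- \<iota> * r) *\<^sub>c (cs k * (b s * (- (xi j * t s))))" .
  have csc: "z = w" if "cs k * (b s * z) = cs k * (b s * w)" "e * z = z" "e * w = w" for z w
  proof -
    have "cs k * (cs k * (b s * z)) = cs k * (cs k * (b s * w))" using that(1) by simp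
    then have "b s * z = b s * w" using cs_sq[OF k(1)] by (simp add: mult.assoc[symmetric] b_unit)
    then show ?thesis using b_cancel[OF s] that(2,3) by blast
  qed
  have "T s * x i = fs Gx k * T s \<longleftrightarrow> cs k * (b s * (t s * xi i)) = cs k * (b s * (- (xi j * t s)))"
    unfolding L R by (rule cscale_cancel) (use iota_nz r_nz in simp)
  also have "\<dots> \<longleftrightarrow> t s * xi i = - (xi j * t s)"
    using csc[of "t s * xi i" "- (xi j * t s)"] by (auto simp: a_unit_left)
  finally show "(T s * x i = fs Gx (\<rho> s (int i)) * T s) \<longleftrightarrow>
      (t s * xi i = - 1 *\<^sub>c (xi (nat \<bar>\<rho> s (int i)\<bar>) * t s))"
    unfolding k_def[symmetric] j_def[symmetric] by simp
qed

text \<open>Reordering the two Clifford generators costs one sign, so commuting \<open>x\<close>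
  correspond to anticommuting \<open>xi\<close>.\<close>

lemma xx_iff:
  assumes "i \<in> {1..n}" "j \<in> {1..n}" "i \<noteq> j"
  shows "x i * x j = x j * x i \<longleftrightarrow> xi i * xi j = - (xi j * xi i)"
proof -
  have m: "x k * x l = (- (r * r)) *\<^sub>c (c k * (c l * (xi k * xi l)))" if "k \<in> {1..n}" "l \<in> {1..n}" for k l
    using that by (simp add: x_eq mult.assoc anticomm_left[OF xic])
  have "c j * (c i * (xi j * xi i)) = c i * (c j * (- (xi j * xi i)))"
    using anticomm_left[OF canti[OF assms(2,1)]] assms(3) by simp
  moreover have "x i * x j = x j * x i \<longleftrightarrow> c i * (c j * (xi i * xi j)) = c j * (c i * (xi j * xi i))"
    unfolding m[OF assms(1,2)] m[OF assms(2,1)] by (rule cscale_cancel) (use r_nz in simp)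
  ultimately have "x i * x j = x j * x i \<longleftrightarrow> c i * (c j * (xi i * xi j)) = c i * (c j * (- (xi j * xi i)))"
    by simp
  also have "\<dots> \<longleftrightarrow> xi i * xi j = - (xi j * xi i)"
    using c_left_cancel[OF assms(1), of "c j * (xi i * xi j)" "c j * (- (xi j * xi i))"]
      c_left_cancel[OF assms(2), of "xi i * xi j" "- (xi j * xi i)"] by (simp add: a_unit_left)
  finally show ?thesis .
qed

text \<open>As \<open>y\<close> commutes with \<open>c i\<close>, the commutator with
  \<open>x i\<close> is \<open>r\<close> times \<open>c i\<close> times the commutator with
  \<open>xi i\<close>, and this left factor can be cancelled.\<close>

lemma commutator_iff:
  assumes i: "i \<in> {1..n}" "j \<in> {1..n}" and p: "E p = r *\<^sub>c (c i * E q)"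
  shows "E (commutator (gy j) (gx i) - p) = 0 \<longleftrightarrow> E (commutator (gy j) (gxi i) - q) = 0"
proof -
  have "y j * x i = r *\<^sub>c (y j * c i * xi i)" by (simp add: x_eq[OF i(1)] mult.assoc)
  then have "y j * x i = r *\<^sub>c (c i * (y j * xi i))" unfolding yc[OF i(2,1)] by (simp add: mult.assoc)
  moreover have "x i * y j = r *\<^sub>c (c i * (xi i * y j))" by (simp add: x_eq[OF i(1)] mult.assoc)
  ultimately have "y j * x i - x i * y j = r *\<^sub>c (c i * (y j * xi i - xi i * y j))"
    by (simp add: right_diff_distrib cscale_diff_right)
  then have "y j * x i - x i * y j = E p \<longleftrightarrow> y j * xi i - xi i * y j = E q"
    unfolding p using x_left_cancel[OF i(1), of "y j * xi i - xi i * y j" "E q"]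
    by (simp add: a_unit_left right_diff_distrib)
  then show ?thesis by (simp add: commutator_def)
qed

lemma twisted_rels: "twisted f \<epsilon> \<longleftrightarrow>
    (\<forall>i. i \<in> {1..<n} \<longrightarrow> t i * f i - \<epsilon> *\<^sub>c (f (i + 1) * t i) = 0) \<and>
    (\<forall>i j. i \<in> {1..<n} \<and> j \<in> {1..n} - {i, i + 1} \<longrightarrow> t i * f j - \<epsilon> *\<^sub>c (f j * t i) = 0) \<and>
    (ty = TypeB \<longrightarrow> t n * f n + f n * t n = 0 \<and> (\<forall>j. j \<in> {1..n} - {n} \<longrightarrow> t n * f j - \<epsilon> *\<^sub>c (f j * t n) = 0)) \<and>
    (ty = TypeD \<longrightarrow> t n * f n + f (n - 1) * t n = 0 \<and>
       (\<forall>j. j \<in> {1..n} - {n - 1, n} \<longrightarrow> t n * f j - \<epsilon> *\<^sub>c (f j * t n) = 0))"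
  if "\<epsilon> * \<epsilon> = 1" "\<And>i. e * f i = f i" "\<And>i. f i * e = f i"
  unfolding twisted_iff[OF that] eq_iff_diff_eq_0[symmetric] eq_neg_iff_add_eq_0[symmetric] by (rule refl)

lemma spin_hecke_rels: "(\<forall>r\<in>snd (spin_hecke ty n u v). E r = 0) \<longleftrightarrow>
   (\<forall>i j. i \<in> {1..n} \<and> j \<in> {1..n} \<longrightarrow> y i * y j = y j * y i) \<and>
   (\<forall>i j. i \<in> {1..n} \<and> j \<in> {1..n} \<and> i \<noteq> j \<longrightarrow> xi i * xi j = - (xi j * xi i)) \<and>
   twisted y 1 \<and> twisted xi (-1) \<and>
   (\<forall>i j. i \<in> {1..n} \<and> j \<in> {1..n} \<and> i \<noteq> j \<longrightarrow> E (commutator (gy j) (gxi i) - hm_offdiag ty n u i j) = 0) \<and>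
   (\<forall>i. i \<in> {1..n} \<longrightarrow> E (commutator (gy i) (gxi i) - hm_diag ty n u v i) = 0)"
proof -
  have one: "(1::complex) * 1 = 1" "(-1::complex) * -1 = 1" by simp_all
  have m1: "z - (-1) *\<^sub>c w = z + w" for z w :: 'a by simp
  show ?thesis
    unfolding twisted_rels[OF one(1) a_unit] twisted_rels[OF one(2) a_unit] cscale_one m1
      spin_hecke_def snd_conv ball_Un case_weyl_type_un ball_Collect1 ball_Collect2 ball_insert ball_empty simp_thms
      E_diff E_add E_mult E_gen eq_iff_diff_eq_0[of "y _ * _"] eq_neg_iff_add_eq_0[of "xi _ * _"]
    by (insert om_spin_rels, cases ty; simp only: simp_thms weyl_type.distinct; intro iffI conjI; (elim conjE)?; assumption)
qed

text \<open>The relators not listed vanish in the locale already: those of the Clifford algebra and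
  of the group and, \<open>x i\<close> being a multiple of \<open>c i * xi i\<close>, those between
  \<open>x\<close> or \<open>y\<close> and the Clifford generators.\<close>

lemma hecke_rels: "(\<forall>r\<in>snd (hecke_clifford ty n u v). E r = 0) \<longleftrightarrow>
   (\<forall>i j. i \<in> {1..n} \<and> j \<in> {1..n} \<longrightarrow> y i * y j = y j * y i) \<and>
   (\<forall>i j. i \<in> {1..n} \<and> j \<in> {1..n} \<and> i \<noteq> j \<longrightarrow> x i * x j = x j * x i) \<and>
   (\<forall>s\<in>S. \<forall>i\<in>{1..n}. T s * y i = fs Gy (\<rho> s (int i)) * T s) \<and>
   (\<forall>s\<in>S. \<forall>i\<in>{1..n}. T s * x i = fs Gx (\<rho> s (int i)) * T s) \<and>
   (\<forall>i j. i \<in> {1..n} \<and> j \<in> {1..n} \<and> i \<noteq> j \<longrightarrow> E (commutator (gy j) (gx i) - hc_offdiag ty u j i) = 0) \<and>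
   (\<forall>i. i \<in> {1..n} \<longrightarrow> E (commutator (gy i) (gx i) - hc_diag ty n u v i) = 0)"
proof -
  have xc: "x i * c i + c i * x i = 0" if "i \<in> {1..n}" for i
  proof -
    have "c i * xi i * c i = - (c i * (c i * xi i))" using xic[OF that that] by (simp add: mult.assoc)
    then show ?thesis by (simp add: x_eq[OF that])
  qed
  have xc': "x i * c j = c j * x i" if "i \<in> {1..n} \<and> j \<in> {1..n} \<and> i \<noteq> j" for i j
  proof -
    have "c i * xi i * c j = - (c i * (c j * xi i))" using xic[of i j] that by (simp add: mult.assoc)
    also have "\<dots> = c j * (c i * xi i)" using anticomm_left[OF canti[of i j]] that by simp
    finally show ?thesis using that by (simp add: x_eq)
  qed
  have xx: "(\<forall>i j. i \<in> {1..n} \<and> j \<in> {1..n} \<longrightarrow> x i * x j = x j * x i) \<longleftrightarrow>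
    (\<forall>i j. i \<in> {1..n} \<and> j \<in> {1..n} \<and> i \<noteq> j \<longrightarrow> x i * x j = x j * x i)" by auto
  have xcA: "\<forall>i. i \<in> {1..n} \<longrightarrow> x i * c i + c i * x i = 0" using xc by blast
  have xcA': "\<forall>i j. i \<in> {1..n} \<and> j \<in> {1..n} \<and> i \<noteq> j \<longrightarrow> x i * c j = c j * x i" using xc' by blast
  have ycA: "\<forall>i j. i \<in> {1..n} \<and> j \<in> {1..n} \<longrightarrow> y i * c j = c j * y i" using yc by blast
  show ?thesis
    unfolding hecke_clifford_def snd_conv ball_Un conj_rels_iff ball_Collect1 ball_Collect2
      E_diff[of "_ * _"] E_add[of "_ * _"] E_mult E_gen eq_iff_diff_eq_0[symmetric] xx
    by (insert clifford_rels_vanish weyl_rels_vanish conj_c_vanish[unfolded conj_rels_iff] xcA xcA' ycA,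
        intro iffI conjI; (elim conjE)?; assumption)
qed

theorem daha_rels_iff:
  "(\<forall>r\<in>snd (hecke_clifford ty n u v). E r = 0) \<longleftrightarrow> (\<forall>r\<in>snd (spin_hecke ty n u v). E r = 0)"
proof -
  have off: "E (commutator (gy j) (gx i) - hc_offdiag ty u j i) = 0 \<longleftrightarrow>
      E (commutator (gy j) (gxi i) - hm_offdiag ty n u i j) = 0"
    if "i \<in> {1..n}" "j \<in> {1..n}" "i \<noteq> j" for i j
    using that by (intro commutator_iff E_offdiag) auto
  have diag: "E (commutator (gy i) (gx i) - hc_diag ty n u v i) = 0 \<longleftrightarrow>
      E (commutator (gy i) (gxi i) - hm_diag ty n u v i) = 0" if "i \<in> {1..n}" for i
    using that by (intro commutator_iff E_diag) auto
  have xxA: "(\<forall>i j. i \<in> {1..n} \<and> j \<in> {1..n} \<and> i \<noteq> j \<longrightarrow> x i * x j = x j * x i) \<longleftrightarrow>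
      (\<forall>i j. i \<in> {1..n} \<and> j \<in> {1..n} \<and> i \<noteq> j \<longrightarrow> xi i * xi j = - (xi j * xi i))"
    using xx_iff by blast
  have offA: "(\<forall>i j. i \<in> {1..n} \<and> j \<in> {1..n} \<and> i \<noteq> j \<longrightarrow> E (commutator (gy j) (gx i) - hc_offdiag ty u j i) = 0) \<longleftrightarrow>
      (\<forall>i j. i \<in> {1..n} \<and> j \<in> {1..n} \<and> i \<noteq> j \<longrightarrow> E (commutator (gy j) (gxi i) - hm_offdiag ty n u i j) = 0)"
    using off by blast
  have diagA: "(\<forall>i. i \<in> {1..n} \<longrightarrow> E (commutator (gy i) (gx i) - hc_diag ty n u v i) = 0) \<longleftrightarrow>
      (\<forall>i. i \<in> {1..n} \<longrightarrow> E (commutator (gy i) (gxi i) - hm_diag ty n u v i) = 0)"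
    using diag by blast
  show ?thesis
    unfolding hecke_rels spin_hecke_rels Ty_iff Tx_iff xxA offA diagA ..
qed

end

section \<open>Homogeneity of the presentations\<close>

lemma part_rules:
  "p \<in> part (F G) i \<Longrightarrow> q \<in> part (F G) j \<Longrightarrow> i = j \<Longrightarrow> p + q \<in> part (F G) i"
  "p \<in> part (F G) i \<Longrightarrow> q \<in> part (F G) j \<Longrightarrow> i = j \<Longrightarrow> p - q \<in> part (F G) i"
  "p \<in> part (F G) i \<Longrightarrow> - p \<in> part (F G) i"
  "1 \<in> part (F G) False" "cst z \<in> part (F G) False"
  "g \<in> G \<Longrightarrow> gen g \<in> part (F G) (odd_gen g)"
  by (simp_all add: free_part_closed)

lemma part_power: "p \<in> part (F G) False \<Longrightarrow> p ^ m \<in> part (F G) False"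
proof (induction m)
  case (Suc m)
  then show ?case using free_part_mult[of p G False "p ^ m" False] by simp
qed (simp add: part_rules)

lemma cst_part: "p \<in> part (F G) i \<Longrightarrow> cst z * p \<in> part (F G) i"
  using free_part_closed(5)[of p G i z] by (simp add: scale_eq_cst)

context
  fixes ty :: weyl_type and n :: nat and G :: "gens set"
  assumes ad: "admissible ty n" and G: "Gt ` simple_index ty n \<subseteq> G"
begin

lemma gt_part: "s \<in> simple_index ty n \<Longrightarrow> gt s \<in> part (F G) True"
  using part_rules(6)[of "Gt s" G] G by auto

text \<open>An odd element between two odd ones is odd, so oddness of the brackets follows their
  recursions.\<close>

lemma gt_part_conj:
  assumes "s \<in> simple_index ty n" "p \<in> part (F G) True"
  shows "- (gt s * p * gt s) \<in> part (F G) True"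
  using part_rules(3)[OF free_part_mult[OF free_part_mult[OF gt_part[OF assms(1)] assms(2)] gt_part[OF assms(1)]]] by simp

lemma simple_index_less: "1 \<le> s \<Longrightarrow> s < n \<Longrightarrow> s \<in> simple_index ty n"
  by (cases ty) (auto simp: simple_index_def)

lemma bracket_lt_part:
  assumes "1 \<le> i" "i < j" "j \<le> n" shows "bracket_lt i j \<in> part (F G) True"
proof -
  from assms(2) have "Suc i \<le> j" by simp
  then show ?thesis using assms(3)
  proof (induction j rule: dec_induct)
    case base
    then show ?case using assms gt_part[of i] simple_index_less[of i] by (simp add: bracket_lt_base)
  next
    case (step m)
    then show ?case
      using assms gt_part_conj[of m] simple_index_less[of m] by (simp add: bracket_lt_step)
  qed
qed

lemma bracket_part: "i \<in> {1..n} \<Longrightarrow> j \<in> {1..n} \<Longrightarrow> i \<noteq> j \<Longrightarrow> bracket i j \<in> part (F G) True"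
  using bracket_lt_part[of i j] bracket_lt_part[of j i] part_rules(3)[of "bracket_lt j i" G True] by (auto simp: bracket_def)

lemma bar_bracket_last_part:
  assumes "ty \<noteq> TypeA" "1 \<le> i" "i < n" shows "bar_bracket_lt ty n i n \<in> part (F G) True"
proof -
  have "i \<le> n - 1" using assms by simp
  then show ?thesis using assms(2)
  proof (induction i rule: inc_induct)
    case base
    have n: "n \<in> simple_index ty n" "n \<ge> 2" using ad assms(1) by (cases ty; simp add: simple_index_def)+
    show ?case
    proof (cases ty)
      case TypeB
      show ?thesis
        unfolding TypeB bar_bracket_lt_base(2)[OF n(2)]
        using gt_part_conj[OF n(1) gt_part[OF simple_index_less[of "n - 1"]]] n(2) by simp
    next
      case TypeD
      show ?thesis unfolding TypeD bar_bracket_lt_base(1)[OF n(2)] using gt_part[OF n(1)] by simp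
    qed (use assms in simp)
  next
    case (step m)
    then show ?case
      using gt_part_conj[of m] simple_index_less[of m] by (simp add: bar_bracket_lt_step1)
  qed
qed

lemma bar_bracket_lt_part:
  assumes "ty \<noteq> TypeA" "1 \<le> i" "i < j" "j \<le> n" shows "bar_bracket_lt ty n i j \<in> part (F G) True"
  using assms(4,3)
proof (induction j rule: inc_induct)
  case base
  then show ?case using assms bar_bracket_last_part by simp
next
  case (step m)
  then show ?case
    using assms gt_part_conj[of m] simple_index_less[of m] by (simp add: bar_bracket_lt_step2)
qed

lemma bar_bracket_part: "ty \<noteq> TypeA \<Longrightarrow> i \<in> {1..n} \<Longrightarrow> j \<in> {1..n} \<Longrightarrow> i \<noteq> j \<Longrightarrow> bar_bracket ty n i j \<in> part (F G) True"
  using bar_bracket_lt_part[of i j] bar_bracket_lt_part[of j i]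
  by (cases "i < j") (auto simp: bar_bracket_def min_def max_def)

lemma bar_single_part:
  assumes "ty \<noteq> TypeA" "1 \<le> i" "i \<le> n" shows "bar_single n i \<in> part (F G) True"
  using assms(3,2)
proof (induction i rule: inc_induct)
  case base
  then show ?case using assms(1) gt_part[of n] by (cases ty) (simp_all add: bar_single_base simple_index_def)
next
  case (step m)
  then show ?case
    using gt_part_conj[of m] simple_index_less[of m] by (simp add: bar_single_step)
qed

lemma hm_offdiag_part:
  assumes "i \<in> {1..n}" "j \<in> {1..n}" "i \<noteq> j" shows "hm_offdiag ty n u i j \<in> part (F G) True"
  using assms bracket_part[of i j] bar_bracket_part[of i j] free_part_closed(3)[OF cst_part cst_part]
    cst_part[of "- bracket i j" G True u]
  by (cases ty) (auto simp: hm_offdiag_def intro!: free_part_closed(2,4) cst_part)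

lemma hm_diag_part:
  assumes "i \<in> {1..n}" shows "hm_diag ty n u v i \<in> part (F G) True"
proof -
  have k: "bracket i k \<in> part (F G) True" "ty \<noteq> TypeA \<Longrightarrow> bar_bracket ty n i k \<in> part (F G) True"
    if "k \<in> {1..n} - {i}" for k using that assms bracket_part[of i k] bar_bracket_part[of i k] by auto
  have "(\<Sum>k\<in>{1..n} - {i}. bracket i k) \<in> part (F G) True"
    by (intro free_part_closed(6) k)
  moreover have "(\<Sum>k\<in>{1..n} - {i}. bracket i k + bar_bracket ty n i k) \<in> part (F G) True" if "ty \<noteq> TypeA"
    using that by (intro free_part_closed(2,6) k)
  moreover have "bar_single n i \<in> part (F G) True" if "ty \<noteq> TypeA" using that assms bar_single_part by simp
  ultimately show ?thesis
    unfolding hm_diag_def by (cases ty) (auto intro!: free_part_closed(2) cst_part)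
qed

lemma spin_rels_part: "r \<in> spin_rels ty n \<Longrightarrow> \<exists>i. r \<in> part (F G) i"
proof -
  have l: "gt i \<in> part (F G) True" if "i \<in> {1..<n}" for i
    using gt_part simple_index_less that by simp
  have tn: "gt n \<in> part (F G) True" if "ty \<noteq> TypeA"
    using that ad gt_part[of n] by (cases ty) (auto simp: simple_index_def)
  have rels: "p * p - 1 \<in> part (F G) False" if "p \<in> part (F G) True" for p
    using free_part_mult[OF that that] by (auto intro!: free_part_closed(3,7))
  have rels2: "(p * q) ^ m + 1 \<in> part (F G) False" "p * q * p - q * p * q \<in> part (F G) True"
    if "p \<in> part (F G) True" "q \<in> part (F G) True" for p q m
  proof -
    have e: "p * q \<in> part (F G) False" "q * p \<in> part (F G) False"
      using free_part_mult[OF that] free_part_mult[OF that(2,1)] by auto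
    have "p * q * p \<in> part (F G) True" "q * p * q \<in> part (F G) True"
      using free_part_mult[OF e(1) that(1)] free_part_mult[OF e(2) that(2)] by auto
    with e show "(p * q) ^ m + 1 \<in> part (F G) False" "p * q * p - q * p * q \<in> part (F G) True"
      by (auto intro!: free_part_closed(2,3,7) part_power)
  qed
  have n: "ty = TypeB \<Longrightarrow> n \<ge> 2" "ty = TypeD \<Longrightarrow> n \<ge> 4" using ad by auto
  have sq: "\<forall>i. i \<in> simple_index ty n \<longrightarrow> (\<exists>k. gt i * gt i - 1 \<in> part (F G) k)"
    using rels gt_part by blast
  have braid: "\<exists>k. gt i * gt (i + 1) * gt i - gt (i + 1) * gt i * gt (i + 1) \<in> part (F G) k"
    if "1 \<le> i \<and> i + 1 < n" for i
    using rels2(2)[OF l[of i] l[of "i + 1"]] that by auto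
  have far: "\<exists>k. (gt i * gt j) ^ 2 + 1 \<in> part (F G) k" if "i \<in> {1..<n} \<and> j \<in> {1..<n} \<and> \<bar>int i - int j\<bar> > 1" for i j
    using rels2(1)[OF l[of i] l[of j]] that by blast
  have last: "\<exists>k. (gt i * gt n) ^ m + 1 \<in> part (F G) k" if "ty \<noteq> TypeA" "i \<in> {1..<n}" for i m
    using rels2(1)[OF l[of i] tn] that by blast
  have lastB: "\<exists>k. (gt i * gt n) ^ 2 + 1 \<in> part (F G) k" if "ty = TypeB" "i \<in> {1..n} - {n - 1, n}" for i
    using that by (intro last) auto
  have lastD: "\<exists>k. (gt i * gt n) ^ 2 + 1 \<in> part (F G) k" if "ty = TypeD" "i \<in> {1..n} - {n - 2, n}" for i
    using that by (intro last) auto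
  have four: "\<exists>k. (gt (n - 1) * gt n) ^ 4 + 1 \<in> part (F G) k" if "ty = TypeB"
    using that n by (intro last) auto
  have braidD: "\<exists>k. gt (n - 2) * gt n * gt (n - 2) - gt n * gt (n - 2) * gt n \<in> part (F G) k" if "ty = TypeD"
  proof -
    have "n - 2 \<in> {1..<n}" using n(2)[OF that] by auto
    then show ?thesis using rels2(2)[OF l[of "n - 2"] tn] that by blast
  qed
  have "\<forall>r\<in>spin_rels ty n. \<exists>i. r \<in> part (F G) i"
    unfolding spin_rels_def ball_Un case_weyl_type_un ball_Collect1 ball_Collect2 ball_insert
    by (intro conjI allI impI ballI; (erule emptyE)?;
        rule sq[rule_format] braid far lastB lastD four braidD; assumption)
  then show "r \<in> spin_rels ty n \<Longrightarrow> \<exists>i. r \<in> part (F G) i" by blast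
qed

end

section \<open>Homogeneity of each of the presentations\<close>

lemma homogeneous_spin_weyl: "admissible ty n \<Longrightarrow> homogeneous_pres (spin_weyl ty n)"
  unfolding homogeneous_pres_def spin_weyl_def using spin_rels_part by auto

lemma homogeneous_spin_hecke:
  assumes ad: "admissible ty n" shows "homogeneous_pres (spin_hecke ty n u v)"
proof -
  define G where "G = Gxi ` {1..n} \<union> Gy ` {1..n} \<union> Gt ` simple_index ty n"
  have G: "Gt ` simple_index ty n \<subseteq> G" by (auto simp: G_def)
  have tt: "gt i \<in> part (F G) True" if "i \<in> {1..<n}" for i
    using gt_part[OF ad G] simple_index_less[OF ad G] that by auto
  have tn: "gt n \<in> part (F G) True" if "ty \<noteq> TypeA"
    using that ad gt_part[OF ad G, of n] by (cases ty) (auto simp: simple_index_def)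
  have y: "gy i \<in> part (F G) False" if "i \<in> {1..n}" for i using part_rules(6)[of "Gy i" G] that by (auto simp: G_def)
  have x: "gxi i \<in> part (F G) True" if "i \<in> {1..n}" for i using part_rules(6)[of "Gxi i" G] that by (auto simp: G_def)
  have "\<exists>i. r \<in> part (F G) i" if "r \<in> snd (spin_hecke ty n u v)" for r
  proof -
    have n1: "n - 1 \<in> {1..n} \<and> n \<in> {1..n}" if "ty \<noteq> TypeA" using ad that by (cases ty) auto
    have ni: "i \<in> {1..<n} \<Longrightarrow> i + 1 \<in> {1..n} \<and> i \<in> {1..n}" for i by auto
    have com: "p * q - q' * p' \<in> part (F G) (i \<noteq> j)" "p * q + q' * p' \<in> part (F G) (i \<noteq> j)"
      if "p \<in> part (F G) i" "p' \<in> part (F G) i" "q \<in> part (F G) j" "q' \<in> part (F G) j" for p q p' q' i j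
      using free_part_closed(2,3) free_part_mult[OF that(1,3)] free_part_mult[OF that(4,2)] by (cases i; cases j; auto)+
    have A: "\<forall>r\<in>spin_rels ty n. \<exists>i. r \<in> part (F G) i" using spin_rels_part[OF ad G] by blast
    have off: "commutator (gy j) (gxi i) - hm_offdiag ty n u i j \<in> part (F G) True"
      if "i \<in> {1..n} \<and> j \<in> {1..n} \<and> i \<noteq> j" for i j
      using that free_part_closed(3)[OF _ hm_offdiag_part[OF ad G, of i j u]] com(1)[OF y[of j] y[of j] x[of i] x[of i]]
      by (auto simp: commutator_def)
    have dia: "commutator (gy i) (gxi i) - hm_diag ty n u v i \<in> part (F G) True" if "i \<in> {1..n}" for i
      using that free_part_closed(3)[OF _ hm_diag_part[OF ad G, of i u v]] com(1)[OF y[of i] y[of i] x[of i] x[of i]]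
      by (auto simp: commutator_def)
    have "\<forall>r\<in>snd (spin_hecke ty n u v). \<exists>i. r \<in> part (F G) i"
      unfolding spin_hecke_def snd_conv ball_Un case_weyl_type_un ball_Collect1 ball_Collect2 ball_insert
      by (insert n1, intro conjI allI impI ballI; (elim conjE)?;
          ((rule exI, (rule off dia | (rule com, (rule y x tt tn, (auto)[1])+)); auto; fail)
           | (rule A[rule_format], assumption) | simp; fail))
    then show ?thesis using that by blast
  qed
  then show ?thesis by (simp add: homogeneous_pres_def spin_hecke_def G_def)
qed

lemma conj_rels_part:
  assumes W: "Gw ` weyl ty n \<subseteq> G" and f: "\<And>i. i \<in> {1..n} \<Longrightarrow> f i \<in> part (F G) k"
    and r: "r \<in> conj_rels ty n f"
  shows "r \<in> part (F G) k"
proof -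
  obtain w i where w: "w \<in> weyl ty n" and i: "i \<in> {1..n}"
    and req: "r = gw w * f i * gw (inv_into UNIV w) - signed f (w (int i))"
    using r by (auto simp: conj_rels_def)
  have gw: "gw w' \<in> part (F G) False" if "w' \<in> weyl ty n" for w'
    using part_rules(6)[of "Gw w'" G] W that by auto
  \<comment> \<open>At zero \<open>signed\<close> would take its default \<open>- f 0\<close>, whose
    index lies outside the range of generators.\<close>
  have "w (int i) \<noteq> 0 \<and> \<bar>w (int i)\<bar> \<le> int n"
    using signed_permsD(5)[of w n "int i"] w i weyl_sub by force
  then have "signed f (w (int i)) \<in> part (F G) k"
    by (auto simp: signed_def intro!: free_part_closed(4) f)
  moreover have "gw w * f i * gw (inv_into UNIV w) \<in> part (F G) k"
    using free_part_mult[OF free_part_mult[OF gw[OF w] f[OF i]] gw[OF weyl_inv[OF w]]] by simp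
  ultimately show ?thesis unfolding req by (rule free_part_closed(3)[rotated])
qed

lemma weyl_rels_part:
  assumes W: "Gw ` weyl ty n \<subseteq> G" and r: "r \<in> weyl_rels ty n"
  shows "r \<in> part (F G) False"
proof -
  have gw: "gw w \<in> part (F G) False" if "w \<in> weyl ty n" for w
    using part_rules(6)[of "Gw w" G] W that by auto
  show ?thesis
    using r gw[OF id_weyl] free_part_mult[OF gw gw] gw[OF weyl_comp]
    unfolding weyl_rels_def by (auto intro!: free_part_closed(3,7))
qed

lemma clifford_rels_part:
  assumes C: "Gc ` {1..n} \<subseteq> G" and r: "r \<in> clifford_rels n"
  shows "r \<in> part (F G) False"
proof -
  have c: "gc i \<in> part (F G) True" if "i \<in> {1..n}" for i
    using part_rules(6)[of "Gc i" G] subsetD[OF C imageI[OF that]] by simp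
  have "gc i * gc j \<in> part (F G) False" if "i \<in> {1..n}" "j \<in> {1..n}" for i j
    using free_part_mult[OF c c] that by simp
  then show ?thesis
    using r unfolding clifford_rels_def by (auto intro!: free_part_closed(2,3,7))
qed

lemma homogeneous_clifford: "homogeneous_pres (clifford n)"
  unfolding homogeneous_pres_def clifford_def using clifford_rels_part by auto

lemma homogeneous_clifford_weyl: "homogeneous_pres (clifford_weyl ty n)"
proof -
  define G where "G = Gc ` {1..n} \<union> Gw ` weyl ty n"
  have "gc i \<in> part (F G) True" if "i \<in> {1..n}" for i
    using part_rules(6)[of "Gc i" G] that by (auto simp: G_def)
  then have "\<exists>i. r \<in> part (F G) i" if "r \<in> snd (clifford_weyl ty n)" for r
    using that clifford_rels_part[of n G r] weyl_rels_part[of ty n G r] conj_rels_part[of ty n G gc True r]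
    unfolding clifford_weyl_def by (auto simp: G_def)
  then show ?thesis by (simp add: homogeneous_pres_def clifford_weyl_def G_def)
qed

lemma homogeneous_hecke_clifford:
  assumes ad: "admissible ty n" shows "homogeneous_pres (hecke_clifford ty n u v)"
proof -
  define G where "G = Gx ` {1..n} \<union> Gy ` {1..n} \<union> Gc ` {1..n} \<union> Gw ` weyl ty n"
  have W: "Gw ` weyl ty n \<subseteq> G" and C: "Gc ` {1..n} \<subseteq> G" by (auto simp: G_def)
  have y: "gy i \<in> part (F G) False" and x: "gx i \<in> part (F G) False" and c: "gc i \<in> part (F G) True"
    if "i \<in> {1..n}" for i
    using part_rules(6)[of "Gy i" G] part_rules(6)[of "Gx i" G] part_rules(6)[of "Gc i" G] that by (auto simp: G_def)
  have w: "gw w \<in> part (F G) False" if "w \<in> weyl ty n" for w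
    using part_rules(6)[of "Gw w" G] that by (auto simp: G_def)
  have com: "p * q - q * p \<in> part (F G) (i \<noteq> j)" "p * q + q * p \<in> part (F G) (i \<noteq> j)"
    if "p \<in> part (F G) i" "q \<in> part (F G) j" for p q i j
    using free_part_closed(2,3) free_part_mult[OF that] free_part_mult[OF that(2,1)] by (cases i; cases j; auto)+
  have cc: "1 + gc j * gc i \<in> part (F G) False" "1 - gc j * gc i \<in> part (F G) False"
    if "i \<in> {1..n}" "j \<in> {1..n}" for i j
    using free_part_mult[OF c c] that by (auto intro!: free_part_closed(2,3,7))
  have even: "p * q \<in> part (F G) False" if "p \<in> part (F G) False" "q \<in> part (F G) False" for p q
    using free_part_mult[OF that] by simp
  have s: "(1 + gc j * gc i) * gw (s_ref j i) \<in> part (F G) False"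
    "(1 + gc j * gc i) * gw (s_ref i j) \<in> part (F G) False"
    "ty \<noteq> TypeA \<Longrightarrow> (1 - gc j * gc i) * gw (sbar_ref i j) \<in> part (F G) False"
    "ty \<noteq> TypeA \<Longrightarrow> (1 - gc j * gc i) * gw (sbar_ref j i) \<in> part (F G) False"
    if "i \<in> {1..n}" "j \<in> {1..n}" "i \<noteq> j" for i j
    using that by (auto intro!: even cc w s_ref_weyl sbar_ref_weyl)
  have off: "hc_offdiag ty u j i \<in> part (F G) False" if "i \<in> {1..n}" "j \<in> {1..n}" "i \<noteq> j" for i j
    using s[OF that] unfolding hc_offdiag_def by (cases ty) (auto intro!: cst_part free_part_closed(3))
  have dia: "hc_diag ty n u v i \<in> part (F G) False" if i: "i \<in> {1..n}" for i
  proof -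
    have "(\<Sum>k\<in>{1..n} - {i}. (1 + gc k * gc i) * gw (s_ref k i)) \<in> part (F G) False"
      using i by (intro free_part_closed(6) s) auto
    moreover have "(\<Sum>k\<in>{1..n} - {i}. (1 + gc k * gc i) * gw (s_ref k i) + (1 - gc k * gc i) * gw (sbar_ref k i)) \<in> part (F G) False"
      if "ty \<noteq> TypeA" using i that by (intro free_part_closed(6) free_part_closed(2) s) auto
    moreover have "gw (tau_ref i) \<in> part (F G) False" if "ty = TypeB" using i that tau_ref_weyl by (intro w) simp
    ultimately show ?thesis
      unfolding hc_diag_def mult_minus_left by (cases ty) (auto intro!: free_part_closed(3,4) cst_part)
  qed
  have offr: "\<exists>k. commutator (gy j) (gx i) - hc_offdiag ty u j i \<in> part (F G) k"
    if "i \<in> {1..n} \<and> j \<in> {1..n} \<and> i \<noteq> j" for i j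
  proof -
    have "gy j * gx i - gx i * gy j \<in> part (F G) False" using that com(1)[OF y[of j] x[of i]] by simp
    from free_part_closed(3)[OF this off[of i j]] show ?thesis using that by (auto simp: commutator_def)
  qed
  have diar: "\<exists>k. commutator (gy i) (gx i) - hc_diag ty n u v i \<in> part (F G) k" if "i \<in> {1..n}" for i
  proof -
    have "gy i * gx i - gx i * gy i \<in> part (F G) False" using that com(1)[OF y[of i] x[of i]] by simp
    from free_part_closed(3)[OF this dia[OF that]] show ?thesis by (auto simp: commutator_def)
  qed
  have rels: "r \<in> clifford_rels n \<Longrightarrow> \<exists>k. r \<in> part (F G) k" "r \<in> weyl_rels ty n \<Longrightarrow> \<exists>k. r \<in> part (F G) k"
    "r \<in> conj_rels ty n gx \<Longrightarrow> \<exists>k. r \<in> part (F G) k" "r \<in> conj_rels ty n gy \<Longrightarrow> \<exists>k. r \<in> part (F G) k"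
    "r \<in> conj_rels ty n gc \<Longrightarrow> \<exists>k. r \<in> part (F G) k" for r
    by (rule exI, rule clifford_rels_part[OF C] weyl_rels_part[OF W] conj_rels_part[OF W x] conj_rels_part[OF W y]
      conj_rels_part[OF W c]; assumption)+
  have coms: "i \<in> {1..n} \<and> j \<in> {1..n} \<Longrightarrow> \<exists>k. gx i * gx j - gx j * gx i \<in> part (F G) k"
    "i \<in> {1..n} \<and> j \<in> {1..n} \<Longrightarrow> \<exists>k. gy i * gy j - gy j * gy i \<in> part (F G) k"
    "i \<in> {1..n} \<and> j \<in> {1..n} \<Longrightarrow> \<exists>k. gy i * gc j - gc j * gy i \<in> part (F G) k"
    "i \<in> {1..n} \<Longrightarrow> \<exists>k. gx i * gc i + gc i * gx i \<in> part (F G) k"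
    "i \<in> {1..n} \<and> j \<in> {1..n} \<and> i \<noteq> j \<Longrightarrow> \<exists>k. gx i * gc j - gc j * gx i \<in> part (F G) k" for i j
    by ((elim conjE)?, rule exI, rule com, (rule x y c; assumption)+)+
  have "\<forall>r\<in>snd (hecke_clifford ty n u v). \<exists>i. r \<in> part (F G) i"
    unfolding hecke_clifford_def snd_conv ball_Un ball_Collect1 ball_Collect2
    by (intro conjI allI impI ballI)
       (rule rels, assumption | rule coms, assumption | rule offr, assumption | rule diar, assumption)+
  then show ?thesis by (simp add: homogeneous_pres_def hecke_clifford_def G_def)
qed

section \<open>Evaluation of presentations\<close>

lemma ev_cong:
  assumes "p \<in> free_carrier G" "\<And>g. g \<in> G \<Longrightarrow> a g = a' g"
  shows "ev e a p = ev e a' p"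
proof -
  have "foldr (\<lambda>g x. a g * x) w e = foldr (\<lambda>g x. a' g * x) w e" if "w \<in> Poly_Mapping.keys p" for w
  proof -
    have "set w \<subseteq> G" using assms(1) that by (auto simp: free_carrier_def)
    then show ?thesis using assms(2) by (intro foldr_cong) (auto dest!: subsetD)
  qed
  then show ?thesis unfolding ev_def lin_def by (intro sum.cong) auto
qed

lemma corner_emb:
  assumes R: "superalgebra R" and a: "\<And>g. a g \<in> emb R ` carrier R"
  shows "corner (emb R \<one>\<^bsub>R\<^esub>) a"
proof
  show "emb R \<one>\<^bsub>R\<^esub> * emb R \<one>\<^bsub>R\<^esub> = emb R \<one>\<^bsub>R\<^esub>"
    by (rule emb_one(1)[OF R salg_closed(7)[OF R]])
  show "emb R \<one>\<^bsub>R\<^esub> * a g = a g" "a g * emb R \<one>\<^bsub>R\<^esub> = a g" for g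
  proof -
    obtain x where "x \<in> carrier R" "a g = emb R x" using a[of g] by blast
    then show "emb R \<one>\<^bsub>R\<^esub> * a g = a g" "a g * emb R \<one>\<^bsub>R\<^esub> = a g" using emb_one[OF R, of x] by simp_all
  qed
qed

lemma emb_part_closed:
  assumes R: "superalgebra R"
  shows "0 \<in> emb R ` part R i"
    "x \<in> emb R ` part R i \<Longrightarrow> y \<in> emb R ` part R i \<Longrightarrow> x + y \<in> emb R ` part R i"
    "x \<in> emb R ` part R i \<Longrightarrow> y \<in> emb R ` part R i \<Longrightarrow> x - y \<in> emb R ` part R i"
    "x \<in> emb R ` part R i \<Longrightarrow> z *\<^sub>c x \<in> emb R ` part R i"
    "x \<in> emb R ` part R i \<Longrightarrow> y \<in> emb R ` part R j \<Longrightarrow> x * y \<in> emb R ` part R (i \<noteq> j)"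
    "emb R \<one>\<^bsub>R\<^esub> \<in> emb R ` part R False"
    "emb R ` part R i \<subseteq> emb R ` carrier R"
proof -
  note p = part_closed[OF R] and e = emb_simps[OF R]
  show "0 \<in> emb R ` part R i" using e(4) p(5) image_eqI[of 0 "emb R" "\<zero>\<^bsub>R\<^esub>"] by simp
  show "x + y \<in> emb R ` part R i" if xy: "x \<in> emb R ` part R i" "y \<in> emb R ` part R i"
  proof -
    obtain a b where ab: "a \<in> part R i" "b \<in> part R i" "x = emb R a" "y = emb R b" using xy by blast
    then have "x + y = emb R (a \<oplus>\<^bsub>R\<^esub> b)" using e(1)[OF p(1) p(1)] by simp
    then show ?thesis using p(2)[OF ab(1,2)] by (rule image_eqI)
  qed
  show "x - y \<in> emb R ` part R i" if xy: "x \<in> emb R ` part R i" "y \<in> emb R ` part R i"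
  proof -
    obtain a b where ab: "a \<in> part R i" "b \<in> part R i" "x = emb R a" "y = emb R b" using xy by blast
    then have "x - y = emb R (a \<ominus>\<^bsub>R\<^esub> b)" using e(5)[OF p(1) p(1)] by simp
    then show ?thesis using p(3)[OF ab(1,2)] by (rule image_eqI)
  qed
  show "z *\<^sub>c x \<in> emb R ` part R i" if x: "x \<in> emb R ` part R i"
  proof -
    obtain a where a: "a \<in> part R i" "x = emb R a" using x by blast
    then have "z *\<^sub>c x = emb R (z \<odot>\<^bsub>R\<^esub> a)" using e(3)[OF p(1)] by simp
    then show ?thesis using p(4)[OF a(1)] by (rule image_eqI)
  qed
  show "x * y \<in> emb R ` part R (i \<noteq> j)" if xy: "x \<in> emb R ` part R i" "y \<in> emb R ` part R j"
  proof -
    obtain a b where ab: "a \<in> part R i" "b \<in> part R j" "x = emb R a" "y = emb R b" using xy by blast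
    then have "x * y = emb R (a \<otimes>\<^bsub>R\<^esub> b)" using e(2)[OF p(1) p(1)] by simp
    then show ?thesis using superalgebraD(9)[OF R ab(1,2)] by (rule image_eqI)
  qed
  show "emb R \<one>\<^bsub>R\<^esub> \<in> emb R ` part R False" using part_one[OF R] by blast
  show "emb R ` part R i \<subseteq> emb R ` carrier R" using p(1) by blast
qed

text \<open>In contrast to \<open>alg_hom_ev\<close>, the assignment may also give values to
  generators outside \<open>P\<close>, so that a single one can serve two presentations.\<close>

lemma hom_ev:
  assumes P: "homogeneous_pres P" and R: "superalgebra R" and h: "salg_hom (alg P) R h"
    and a: "\<And>g. g \<in> fst P \<Longrightarrow> a g = emb R (h (cls P (gen g)))" and p: "p \<in> free_carrier (fst P)"
  shows "emb R (h (cls P p)) = ev (emb R \<one>\<^bsub>R\<^esub>) a p"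
  using alg_hom_ev[OF P R h p] ev_cong[OF p, of a "hat R (fst P) (\<lambda>g. h (cls P (gen g)))"] a by (simp add: hat_def)

lemma hom_rels:
  assumes P: "homogeneous_pres P" and R: "superalgebra R" and h: "salg_hom (alg P) R h"
    and a: "\<And>g. g \<in> fst P \<Longrightarrow> a g = emb R (h (cls P (gen g)))" and r: "r \<in> snd P"
  shows "ev (emb R \<one>\<^bsub>R\<^esub>) a r = 0"
proof -
  have "h (cls P r) = \<zero>\<^bsub>R\<^esub>"
  proof -
    have Z: "\<zero>\<^bsub>alg P\<^esub> \<in> carrier (alg P)" using salg_closed(6)[OF superalgebra_alg[OF P]] .
    have "h \<zero>\<^bsub>alg P\<^esub> = h (0 \<odot>\<^bsub>alg P\<^esub> \<zero>\<^bsub>alg P\<^esub>)" using salg_smult(5)[OF superalgebra_alg[OF P]] by simp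
    also have "\<dots> = \<zero>\<^bsub>R\<^esub>" using salg_homD(5)[OF h Z] salg_smult(6)[OF R salg_homD(1)[OF h Z]] by simp
    finally show ?thesis using cls_rel[OF P r] by simp
  qed
  then show ?thesis
    using hom_ev[OF P R h a, of r] rels_carrier[OF P] r emb_simps(4)[OF R] by auto
qed

lemma hom_ex:
  assumes P: "homogeneous_pres P" and R: "superalgebra R"
    and a: "\<And>g. g \<in> fst P \<Longrightarrow> a g \<in> emb R ` part R (odd_gen g)"
    and rels: "\<And>r. r \<in> snd P \<Longrightarrow> ev (emb R \<one>\<^bsub>R\<^esub>) a r = 0"
  shows "\<exists>h. salg_hom (alg P) R h \<and> (\<forall>g\<in>fst P. a g = emb R (h (cls P (gen g))))"
proof -
  define b where "b g = (SOME x. x \<in> part R (odd_gen g) \<and> a g = emb R x)" for g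
  have b: "b g \<in> part R (odd_gen g)" "a g = emb R (b g)" if "g \<in> fst P" for g
    using someI_ex[of "\<lambda>x. x \<in> part R (odd_gen g) \<and> a g = emb R x"] a[OF that] by (auto simp: b_def)
  have "ev (emb R \<one>\<^bsub>R\<^esub>) (hat R (fst P) b) r = 0" if "r \<in> snd P" for r
    using ev_cong[of r "fst P" "hat R (fst P) b" a "emb R \<one>\<^bsub>R\<^esub>"] b rels[OF that] rels_carrier[OF P] that by (auto simp: hat_def)
  then show ?thesis using alg_hom_ex[OF P R, of b] b by force
qed

text \<open>Supercommutation spreads from generators to words by moving one letter at a time, with
  parities adding up, and to homogeneous polynomials by linearity. It supplies the hypothesis of
  \<open>tensor_hom_ex\<close>.\<close>

lemma ev_supercommute:
  fixes a :: "gens \<Rightarrow> 'a :: calg"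
  assumes cor: "corner e a" and comm: "\<And>g h. g \<in> G \<Longrightarrow> h \<in> H \<Longrightarrow>
      a h * a g = (if odd_gen h \<and> odd_gen g then -1 else 1) *\<^sub>c (a g * a h)"
    and p: "p \<in> part (F G) i" and q: "q \<in> part (F H) j"
  shows "ev e a q * ev e a p = (if j \<and> i then -1 else 1) *\<^sub>c (ev e a p * ev e a q)"
proof -
  interpret corner e a by (rule cor)
  define W where "W w = foldr (\<lambda>g x. a g * x) w e" for w
  have W: "W [] = e" "W (g # w) = a g * W w" for g w by (simp_all add: W_def)
  have eW: "e * W w = W w" "W w * e = W w" for w
  proof -
    show "e * W w = W w" unfolding W_def by (rule word_unit)
    show "W w * e = W w" by (induction w) (simp_all add: W e_idem mult.assoc)
  qed
  have g1: "a h * W w = (if odd_gen h \<and> wpar w then -1 else 1) *\<^sub>c (W w * a h)"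
    if "h \<in> H" "set w \<subseteq> G" for h w
    using that(2)
  proof (induction w)
    case Nil
    then show ?case by (simp add: W wpar_def unit_left unit_right)
  next
    case (Cons g w)
    have "a h * (a g * W w) = (if odd_gen h \<and> odd_gen g then -1 else 1) *\<^sub>c (a g * (a h * W w))"
      using comm[of g h] that(1) Cons.prems by (simp add: mult.assoc[symmetric])
    also have "\<dots> = (if odd_gen h \<and> odd_gen g then -1 else 1) *\<^sub>c
        ((if odd_gen h \<and> wpar w then -1 else 1) *\<^sub>c (a g * W w * a h))"
      using Cons by (simp add: mult.assoc)
    finally show ?case using wpar_append[of "[g]" w] by (auto simp: W mult.assoc wpar_def)
  qed
  have g2: "W v * W w = (if wpar v \<and> wpar w then -1 else 1) *\<^sub>c (W w * W v)"
    if "set v \<subseteq> H" "set w \<subseteq> G" for v w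
    using that(1)
  proof (induction v)
    case Nil
    then show ?case using eW by (simp add: W wpar_def)
  next
    case (Cons h v)
    have "a h * (W v * W w) = (if wpar v \<and> wpar w then -1 else 1) *\<^sub>c (a h * W w * W v)"
      using Cons by (simp add: mult.assoc)
    also have "\<dots> = (if wpar v \<and> wpar w then -1 else 1) *\<^sub>c
        ((if odd_gen h \<and> wpar w then -1 else 1) *\<^sub>c (W w * (a h * W v)))"
      using g1[of h w] Cons.prems that(2) by (simp add: mult.assoc)
    finally show ?case by (auto simp: W mult.assoc wpar_def)
  qed
  have p': "Poly_Mapping.keys p \<subseteq> {w. set w \<subseteq> G \<and> wpar w = i}"
    and q': "Poly_Mapping.keys q \<subseteq> {w. set w \<subseteq> H \<and> wpar w = j}" using p q by (simp_all add: free_part)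
  have sg: "E (Poly_Mapping.single v y) * E p = (if j \<and> i then -1 else 1) *\<^sub>c (E p * E (Poly_Mapping.single v y))"
    if v: "set v \<subseteq> H \<and> wpar v = j" for v y
    using p'
  proof (induction p rule: poly_mapping_keys_induct)
    case (single w z)
    then show ?case using g2[of v w] v by (simp add: E_single W_def[symmetric] mult.commute)
  next
    case (add p q)
    then show ?case by (simp add: distrib_left distrib_right cscale_add_right)
  qed simp
  from q' show ?thesis
  proof (induction q rule: poly_mapping_keys_induct)
    case (single v y)
    then show ?case using sg[of v y] by simp
  next
    case (add p q)
    then show ?case by (simp add: distrib_left distrib_right cscale_add_right)
  qed simp
qed

text \<open>The presentation has a generator for every group element, but its multiplication table
  reduces them to the simple reflections.\<close>

lemma hom_weyl_eq:
  assumes ad: "admissible ty n" and P: "homogeneous_pres P" and R: "superalgebra R"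
    and sub: "Gw ` weyl ty n \<subseteq> fst P" "weyl_rels ty n \<subseteq> snd P"
    and h: "salg_hom (alg P) R h" "salg_hom (alg P) R h'"
    and eq: "\<And>s. s \<in> simple_index ty n \<Longrightarrow>
      h (cls P (gw (simple_ref ty n s))) = h' (cls P (gw (simple_ref ty n s)))"
    and w: "w \<in> weyl ty n"
  shows "h (cls P (gw w)) = h' (cls P (gw w))"
  using ad w
proof (induction rule: weyl_induct)
  case id
  have "cls P (gw id) = \<one>\<^bsub>alg P\<^esub>"
  proof -
    have "gw id - 1 \<in> rel_ideal P" using sub(2) rels_subset[OF P] by (auto simp: weyl_rels_def)
    then show ?thesis using cls_eq_iff[OF P] cls_ops(1)[OF P] by simp
  qed
  then show ?case using salg_homD(4)[OF h(1)] salg_homD(4)[OF h(2)] by (simp add: id_def)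
next
  case (step w s)
  have s: "simple_ref ty n s \<in> weyl ty n" by (rule simple_ref_weyl[OF ad step(2)])
  have g: "gw v \<in> free_carrier (fst P)" if "v \<in> weyl ty n" for v using sub(1) that by auto
  have "gw w * gw (simple_ref ty n s) - gw (w \<circ> simple_ref ty n s) \<in> rel_ideal P"
    using sub(2) rels_subset[OF P] step(1) s unfolding weyl_rels_def by blast
  then have e: "cls P (gw (w \<circ> simple_ref ty n s)) = cls P (gw w) \<otimes>\<^bsub>alg P\<^esub> cls P (gw (simple_ref ty n s))"
    unfolding cls_ops(4)[OF P g[OF step(1)] g[OF s]] cls_eq_iff[OF P, symmetric] by (rule sym)
  have c: "cls P (gw w) \<in> carrier (alg P)" "cls P (gw (simple_ref ty n s)) \<in> carrier (alg P)"
    using g[OF step(1)] g[OF s] cls_in[OF P] by simp_all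
  show ?case unfolding e salg_homD(3)[OF h(1) c] salg_homD(3)[OF h(2) c] using step(3) eq[OF step(2)] by simp
qed

section \<open>The two algebras as images of each other\<close>

text \<open>\<open>Z\<close> carries along a property closed under products. In the application it
  is membership in the even part, which the new values need in order to define a graded
  homomorphism.\<close>

lemma weyl_ev_ex:
  fixes e :: "'a :: calg"
  assumes sp: "spin_ev e a ty n \<iota>" and rels: "\<forall>r\<in>spin_rels ty n. ev e a r = 0"
    and Z: "Z e" "\<And>x y. Z x \<Longrightarrow> Z y \<Longrightarrow> Z (x * y)"
      "\<And>s. s \<in> simple_index ty n \<Longrightarrow> Z (spin_sys.T (\<lambda>i. a (Gc i)) ty n \<iota> (\<lambda>s. a (Gt s)) s)"
  shows "\<exists>f. weyl_ev e (\<lambda>g. case g of Gw w \<Rightarrow> f w | _ \<Rightarrow> a g) ty n \<iota> \<and> (\<forall>w. Z (f w))"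
proof -
  interpret A: spin_ev e a ty n \<iota> by (rule sp)
  note br = A.weyl_braids_of_spin_rels[OF rels]
  obtain f where f: "f id = e" "\<And>w w'. w \<in> weyl ty n \<Longrightarrow> w' \<in> weyl ty n \<Longrightarrow> f (w \<circ> w') = f w * f w'"
    "\<And>s. s \<in> A.S \<Longrightarrow> f (A.\<rho> s) = A.T s"
    using weyl_hom_ex[OF A.ad br A.T_unit A.e_idem] by blast
  \<comment> \<open>Outside the group the default is \<open>e\<close>, which satisfies both the unit
    laws and \<open>Z\<close>.\<close>
  define f' where "f' w = (if w \<in> weyl ty n then f w else e)" for w
  have fe: "e * f w = f w" "f w * e = f w" if "w \<in> weyl ty n" for w
    using f(1) f(2)[OF id_weyl that] f(2)[OF that id_weyl] by simp_all
  have fe': "e * f' w = f' w" "f' w * e = f' w" for w by (simp_all add: f'_def fe A.e_idem)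
  have rho: "A.\<rho> s \<in> weyl ty n" if "s \<in> A.S" for s by (rule simple_ref_weyl[OF A.ad that])
  have Zf: "Z (f w)" if "w \<in> weyl ty n" for w
    using A.ad that
  proof (induction rule: weyl_induct)
    case (step w s)
    then show ?case using f(2)[OF step(1) rho[OF step(2)]] f(3)[OF step(2)] Z(2)[OF step(3) Z(3)[OF step(2)]] by (simp add: o_def)
  qed (use f(1) Z(1) in \<open>simp add: id_def\<close>)
  have fm: "f' id = e" "w \<in> weyl ty n \<Longrightarrow> w' \<in> weyl ty n \<Longrightarrow> f' (w \<circ> w') = f' w * f' w'"
    "s \<in> A.S \<Longrightarrow> f' (A.\<rho> s) = A.T s" for w w' s
    using f(1) f(2)[of w w'] f(3)[of s] rho[of s] weyl_comp[of w ty n w'] by (simp_all add: f'_def id_weyl)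
  have "weyl_ev e (\<lambda>g. case g of Gw w \<Rightarrow> f' w | _ \<Rightarrow> a g) ty n \<iota>"
  proof (unfold_locales, unfold gens.case)
    show "e * (case g of Gw w \<Rightarrow> f' w | _ \<Rightarrow> a g) = (case g of Gw w \<Rightarrow> f' w | _ \<Rightarrow> a g)" for g
      by (cases g) (simp_all only: gens.case fe' corner.unit_left[OF A.corner_axioms])
    show "(case g of Gw w \<Rightarrow> f' w | _ \<Rightarrow> a g) * e = (case g of Gw w \<Rightarrow> f' w | _ \<Rightarrow> a g)" for g
      by (cases g) (simp_all only: gens.case fe' corner.unit_right[OF A.corner_axioms])
  qed (fact A.e_idem A.ad A.ec A.cc A.canti A.iota A.et A.tc fm)+
  moreover have "\<forall>w. Z (f' w)" using Zf Z(1) by (simp add: f'_def)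
  ultimately show ?thesis by blast
qed

text \<open>\<open>None\<close> stands for the finite-dimensional pair, \<open>Some (u, v)\<close> for the double affine one.\<close>

definition clifford_side :: "weyl_type \<Rightarrow> nat \<Rightarrow> (complex \<times> complex) option \<Rightarrow> pres" where
  "clifford_side ty n P = (case P of None \<Rightarrow> clifford_weyl ty n | Some (u, v) \<Rightarrow> hecke_clifford ty n u v)"

definition spin_side :: "weyl_type \<Rightarrow> nat \<Rightarrow> (complex \<times> complex) option \<Rightarrow> pres" where
  "spin_side ty n P = (case P of None \<Rightarrow> spin_weyl ty n | Some (u, v) \<Rightarrow> spin_hecke ty n u v)"

text \<open>Empty for the finite pair, so that x, y and xi drop out and one proof treats both
  pairs.\<close>

definition affine_index :: "nat \<Rightarrow> (complex \<times> complex) option \<Rightarrow> nat set" where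
  "affine_index n P = (case P of None \<Rightarrow> {} | Some _ \<Rightarrow> {1..n})"

lemma affine_index_sub: "i \<in> affine_index n P \<Longrightarrow> i \<in> {1..n}"
  by (auto simp: affine_index_def split: option.splits)

lemma fst_sides:
  "fst (clifford_side ty n P) = Gx ` affine_index n P \<union> Gy ` affine_index n P \<union> Gc ` {1..n} \<union> Gw ` weyl ty n"
  "fst (spin_side ty n P) = Gxi ` affine_index n P \<union> Gy ` affine_index n P \<union> Gt ` simple_index ty n"
  by (auto simp: clifford_side_def spin_side_def affine_index_def clifford_weyl_def hecke_clifford_def
      spin_weyl_def spin_hecke_def split: option.splits)

lemma snd_sides:
  "clifford_rels n \<subseteq> snd (clifford_side ty n P)" "weyl_rels ty n \<subseteq> snd (clifford_side ty n P)"
  "conj_rels ty n gc \<subseteq> snd (clifford_side ty n P)" "spin_rels ty n \<subseteq> snd (spin_side ty n P)"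
  "i \<in> affine_index n P \<Longrightarrow> j \<in> {1..n} \<Longrightarrow> gy i * gc j - gc j * gy i \<in> snd (clifford_side ty n P)"
  "i \<in> affine_index n P \<Longrightarrow> gx i * gc i + gc i * gx i \<in> snd (clifford_side ty n P)"
  "i \<in> affine_index n P \<Longrightarrow> j \<in> {1..n} \<Longrightarrow> i \<noteq> j \<Longrightarrow> gx i * gc j - gc j * gx i \<in> snd (clifford_side ty n P)"
proof -
  consider "P = None" | u v where "P = Some (u, v)" by (cases P) auto
  note cases = this
  show "clifford_rels n \<subseteq> snd (clifford_side ty n P)" "weyl_rels ty n \<subseteq> snd (clifford_side ty n P)"
    "conj_rels ty n gc \<subseteq> snd (clifford_side ty n P)" "spin_rels ty n \<subseteq> snd (spin_side ty n P)"
    using cases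
    by (cases; simp only: clifford_side_def spin_side_def option.case prod.case clifford_weyl_def hecke_clifford_def
        spin_weyl_def spin_hecke_def snd_conv; blast)+
  assume i: "i \<in> affine_index n P"
  obtain u v where P: "P = Some (u, v)" using cases i by cases (simp_all add: affine_index_def)
  have i': "i \<in> {1..n}" by (rule affine_index_sub[OF i])
  show "gx i * gc i + gc i * gx i \<in> snd (clifford_side ty n P)"
    unfolding P clifford_side_def option.case prod.case hecke_clifford_def snd_conv using i' by blast
  assume j: "j \<in> {1..n}"
  show "gy i * gc j - gc j * gy i \<in> snd (clifford_side ty n P)"
    unfolding P clifford_side_def option.case prod.case hecke_clifford_def snd_conv using i' j by blast
  assume ij: "i \<noteq> j"
  show "gx i * gc j - gc j * gx i \<in> snd (clifford_side ty n P)"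
    unfolding P clifford_side_def option.case prod.case hecke_clifford_def snd_conv using i' j ij by blast
qed

lemma homogeneous_sides:
  assumes "admissible ty n"
  shows "homogeneous_pres (clifford_side ty n P)" "homogeneous_pres (spin_side ty n P)"
  using assms homogeneous_clifford_weyl homogeneous_hecke_clifford homogeneous_spin_weyl homogeneous_spin_hecke
  by (auto simp: clifford_side_def spin_side_def split: option.splits)

text \<open>For the finite pair the relators of both sides vanish outright in
  \<open>weyl_ev\<close>; the affine pair is \<open>daha_rels_iff\<close>.\<close>

lemma side_rels_iff:
  assumes "weyl_ev e a ty n \<iota>"
    and "\<And>i j. i \<in> affine_index n P \<Longrightarrow> j \<in> {1..n} \<Longrightarrow> a (Gy i) * a (Gc j) = a (Gc j) * a (Gy i)"
    and "\<And>i j. i \<in> affine_index n P \<Longrightarrow> j \<in> {1..n} \<Longrightarrow> a (Gxi i) * a (Gc j) = - (a (Gc j) * a (Gxi i))"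
    and "\<And>i. i \<in> affine_index n P \<Longrightarrow> a (Gx i) = (complex_of_real (sqrt 2) * \<iota>) *\<^sub>c (a (Gc i) * a (Gxi i))"
  shows "(\<forall>r\<in>snd (clifford_side ty n P). ev e a r = 0) \<longleftrightarrow> (\<forall>r\<in>snd (spin_side ty n P). ev e a r = 0)"
proof (cases P)
  case None
  interpret weyl_ev e a ty n \<iota> by (rule assms(1))
  show ?thesis
    using None om_spin_rels clifford_rels_vanish weyl_rels_vanish conj_c_vanish
    by (simp add: clifford_side_def spin_side_def clifford_weyl_def spin_weyl_def ball_Un)
next
  case (Some uv)
  interpret weyl_ev e a ty n \<iota> by (rule assms(1))
  interpret daha_ev e a ty n \<iota>
    using assms(2-) Some by unfold_locales (auto simp: affine_index_def)
  show ?thesis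
    using daha_rels_iff Some by (cases uv) (simp add: clifford_side_def spin_side_def)
qed

lemma E_beta:
  assumes "spin_ev e a ty n \<iota>" "s \<in> simple_index ty n"
  shows "ev e a (beta ty n s) = clifford_sys.b (\<lambda>i. a (Gc i)) ty n s"
proof -
  interpret spin_ev e a ty n \<iota> by (rule assms(1))
  show ?thesis
    unfolding beta_def b_def isq2_def[symmetric] scale_eq_cst[symmetric]
    by (auto split: weyl_type.splits)
qed

section \<open>The mutually inverse homomorphisms for a pair of presentations\<close>

locale side_pair =
  fixes ty :: weyl_type and n :: nat and \<iota> :: complex and P :: "(complex \<times> complex) option"
  assumes ad: "admissible ty n" and iota: "\<iota> * \<iota> = -1"
begin

abbreviation "Cl \<equiv> clifford n"
abbreviation "Hp \<equiv> clifford_side ty n P"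
abbreviation "Sp \<equiv> spin_side ty n P"
abbreviation "J \<equiv> affine_index n P"
abbreviation "r \<equiv> complex_of_real (sqrt 2) * \<iota>"
abbreviation "\<rho> \<equiv> simple_ref ty n"

sublocale tensor_pair "alg Cl" "alg Sp"
  using superalgebra_alg homogeneous_clifford homogeneous_sides[OF ad] by unfold_locales auto

lemmas homog = homogeneous_clifford homogeneous_sides[OF ad]

lemma superalgebra_Hp: "superalgebra (alg Hp)"
  by (rule superalgebra_alg[OF homog(2)])

lemma fst_Cl: "fst Cl = Gc ` {1..n}" and snd_Cl: "snd Cl = clifford_rels n"
  by (simp_all add: clifford_def)

abbreviation "iC p \<equiv> pt (cls Cl p) \<one>\<^bsub>alg Sp\<^esub>"
abbreviation "iS q \<equiv> pt \<one>\<^bsub>alg Cl\<^esub> (cls Sp q)"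

lemma gen_parts:
  "i \<in> {1..n} \<Longrightarrow> cls Cl (gc i) \<in> part (alg Cl) True"
  "s \<in> simple_index ty n \<Longrightarrow> cls Sp (gt s) \<in> part (alg Sp) True"
  "i \<in> J \<Longrightarrow> cls Sp (gxi i) \<in> part (alg Sp) True"
  "i \<in> J \<Longrightarrow> cls Sp (gy i) \<in> part (alg Sp) False"
  unfolding alg_part[OF homog(1)] alg_part[OF homog(3)]
  using part_rules(6)[of "Gc i" "fst Cl"] part_rules(6)[of "Gt s" "fst Sp"] part_rules(6)[of "Gxi i" "fst Sp"]
    part_rules(6)[of "Gy i" "fst Sp"]
  by (auto simp: fst_Cl fst_sides)

lemma beta_carrier: "s \<in> simple_index ty n \<Longrightarrow> beta ty n s \<in> part (F (Gc ` {1..n})) True"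
proof -
  define G where "G = Gc ` {1..n}"
  have c: "gc i \<in> part (F G) True" if "i \<in> {1..n}" for i
    using part_rules(6)[of "Gc i" G] that by (simp add: G_def)
  assume "s \<in> simple_index ty n"
  with ad have "beta ty n s \<in> part (F G) True"
    by (cases rule: simple_index_cases) (auto simp: beta_def intro!: cst_part free_part_closed(2,3) c)
  then show ?thesis by (simp only: G_def)
qed

lemma sub_Cl: "fst Cl \<subseteq> fst Hp" "snd Cl \<subseteq> snd Hp"
  using snd_sides(1) by (auto simp: fst_Cl snd_Cl fst_sides)

lemma beta_free: "s \<in> simple_index ty n \<Longrightarrow> beta ty n s \<in> free_carrier (fst Hp)"
  using beta_carrier[of s] free_part_sub[of "fst Cl" True] free_carrier_mono[OF sub_Cl(1)] unfolding fst_Cl by blast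

lemma hom_iC: "salg_hom (alg Cl) T (\<lambda>x. pt x \<one>\<^bsub>alg Sp\<^esub>)" and hom_iS: "salg_hom (alg Sp) T (\<lambda>x. pt \<one>\<^bsub>alg Cl\<^esub> x)"
  by (rule inl_hom inr_hom)+

lemma iC_part: "i \<in> {1..n} \<Longrightarrow> iC (gc i) \<in> part T True"
  using salg_homD(6)[OF hom_iC gen_parts(1)] .

lemma iS_part:
  "s \<in> simple_index ty n \<Longrightarrow> iS (gt s) \<in> part T True"
  "i \<in> J \<Longrightarrow> iS (gxi i) \<in> part T True" "i \<in> J \<Longrightarrow> iS (gy i) \<in> part T False"
  using salg_homD(6)[OF hom_iS] gen_parts by blast+

lemma Cn_elt_split:
  "p \<in> free_carrier (fst Cl) \<Longrightarrow> q \<in> free_carrier (fst Sp) \<Longrightarrow> pt (cls Cl p) (cls Sp q) = iC p \<otimes>\<^bsub>T\<^esub> iS q"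
  using pt_split cls_in[OF homog(1)] cls_in[OF homog(3)] by blast

text \<open>Values are first given to the generators of the two tensor factors, where the spin
  relators hold; the simple reflections then extend to the group, and \<open>side_rels_iff\<close>
  yields the relators of the other side. The last two claims evaluate \<open>\<Phi>\<close> at the
  expressions for \<open>t\<close> and \<open>xi\<close>, as needed for the composite with
  \<open>\<Psi>\<close>.\<close>

lemma Phi_ex: "\<exists>\<Phi>. salg_hom (alg Hp) T \<Phi> \<and>
    (\<forall>i\<in>{1..n}. \<Phi> (cls Hp (gc i)) = iC (gc i)) \<and>
    (\<forall>s\<in>simple_index ty n. \<Phi> (cls Hp (gw (\<rho> s))) = (- \<iota>) \<odot>\<^bsub>T\<^esub> pt (cls Cl (beta ty n s)) (cls Sp (gt s))) \<and>
    (\<forall>i\<in>J. \<Phi> (cls Hp (gy i)) = iS (gy i)) \<and>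
    (\<forall>i\<in>J. \<Phi> (cls Hp (gx i)) = r \<odot>\<^bsub>T\<^esub> pt (cls Cl (gc i)) (cls Sp (gxi i))) \<and>
    (\<forall>s\<in>simple_index ty n. \<Phi> (cls Hp (cst \<iota> * beta ty n s * gw (\<rho> s))) = iS (gt s)) \<and>
    (\<forall>i\<in>J. \<Phi> (cls Hp (cst (1 / r) * gc i * gx i)) = iS (gxi i))"
proof -
  note sT = superalgebra_tensor
  define e where "e = emb T \<one>\<^bsub>T\<^esub>"
  \<comment> \<open>Zero outside the index ranges keeps the unit laws and the parity condition valid
    for every generator. Group elements get provisional zeros, as their values depend on the
    \<open>t\<close>.\<close>
  define a0 where "a0 g = (case g of
      Gc i \<Rightarrow> if i \<in> {1..n} then emb T (iC (gc i)) else 0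
    | Gt s \<Rightarrow> if s \<in> simple_index ty n then emb T (iS (gt s)) else 0
    | Gxi i \<Rightarrow> if i \<in> J then emb T (iS (gxi i)) else 0
    | Gy i \<Rightarrow> if i \<in> J then emb T (iS (gy i)) else 0
    | Gx i \<Rightarrow> if i \<in> J then r *\<^sub>c (emb T (iC (gc i)) * emb T (iS (gxi i))) else 0
    | Gw w \<Rightarrow> 0)" for g
  have a0_simps: "a0 (Gc i) = (if i \<in> {1..n} then emb T (iC (gc i)) else 0)"
    "a0 (Gt i) = (if i \<in> simple_index ty n then emb T (iS (gt i)) else 0)"
    "a0 (Gxi i) = (if i \<in> J then emb T (iS (gxi i)) else 0)"
    "a0 (Gy i) = (if i \<in> J then emb T (iS (gy i)) else 0)"
    "a0 (Gx i) = (if i \<in> J then r *\<^sub>c (emb T (iC (gc i)) * emb T (iS (gxi i))) else 0)"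
    "a0 (Gw w) = 0" for i w by (simp_all add: a0_def)
  note ep = emb_part_closed[OF sT]
  have a0_part: "a0 g \<in> emb T ` part T (odd_gen g)" for g
  proof (cases g)
    case (Gx i)
    show ?thesis
    proof (cases "i \<in> J")
      case True
      have "emb T (iC (gc i)) * emb T (iS (gxi i)) \<in> emb T ` part T (True \<noteq> True)"
        by (intro ep(5) imageI iC_part iS_part True affine_index_sub[OF True])
      then show ?thesis using True ep(4) by (simp add: Gx a0_simps)
    qed (simp add: Gx a0_simps ep(1))
  qed (auto simp: a0_simps ep(1) intro!: imageI iC_part iS_part)
  have a0_carrier: "a0 g \<in> emb T ` carrier T" for g using a0_part ep(7) by blast
  have cor: "corner e a0" unfolding e_def by (rule corner_emb[OF sT a0_carrier])
  have a0_Cl: "a0 g = emb T (pt (cls Cl (gen g)) \<one>\<^bsub>alg Sp\<^esub>)" if "g \<in> fst Cl" for g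
    using that by (auto simp: fst_Cl a0_simps)
  have a0_Sp: "a0 g = emb T (pt \<one>\<^bsub>alg Cl\<^esub> (cls Sp (gen g)))" if "g \<in> fst Sp" for g
    using that by (auto simp: fst_sides a0_simps)
  have evC: "emb T (iC p) = ev e a0 p" if "p \<in> free_carrier (fst Cl)" for p
    unfolding e_def by (rule hom_ev[OF homog(1) sT hom_iC a0_Cl that])
  have relC: "ev e a0 q = 0" if "q \<in> clifford_rels n" for q
    unfolding e_def using that by (intro hom_rels[OF homog(1) sT hom_iC a0_Cl]) (simp_all add: snd_Cl)
  have relS: "ev e a0 q = 0" if "q \<in> snd Sp" for q
    unfolding e_def by (rule hom_rels[OF homog(3) sT hom_iS a0_Sp that])
  interpret A0: corner e a0 by (rule cor)
  have swap: "emb T (pt \<one>\<^bsub>alg Cl\<^esub> b) * emb T (pt a \<one>\<^bsub>alg Sp\<^esub>) =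
      (if j \<and> i then -1 else 1) *\<^sub>c (emb T (pt a \<one>\<^bsub>alg Sp\<^esub>) * emb T (pt \<one>\<^bsub>alg Cl\<^esub> b))"
    if a: "a \<in> part (alg Cl) i" and b: "b \<in> part (alg Sp) j" for a b i j
  proof -
    have c: "pt \<one>\<^bsub>alg Cl\<^esub> b \<in> carrier T" "pt a \<one>\<^bsub>alg Sp\<^esub> \<in> carrier T"
      using part_closed(1)[OF sT] salg_homD(6)[OF hom_iS b] salg_homD(6)[OF hom_iC a] by auto
    then have "emb T (pt \<one>\<^bsub>alg Cl\<^esub> b \<otimes>\<^bsub>T\<^esub> pt a \<one>\<^bsub>alg Sp\<^esub>) =
        emb T ((if j \<and> i then -1 else 1) \<odot>\<^bsub>T\<^esub> (pt a \<one>\<^bsub>alg Sp\<^esub> \<otimes>\<^bsub>T\<^esub> pt \<one>\<^bsub>alg Cl\<^esub> b))"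
      using pt_swap[OF a b] by simp
    then show ?thesis using c salg_closed(2)[OF sT] by (simp only: emb_simps[OF sT])
  qed
  have sp: "spin_ev e a0 ty n \<iota>"
  proof unfold_locales
    show "a0 (Gc i) * a0 (Gc i) = e" if "i \<in> {1..n}" for i
    proof -
      have "ev e a0 (gc i * gc i - 1) = 0" using that by (intro relC) (auto simp: clifford_rels_def)
      then show ?thesis by simp
    qed
    show "a0 (Gc i) * a0 (Gc j) = - (a0 (Gc j) * a0 (Gc i))" if "i \<in> {1..n}" "j \<in> {1..n}" "i \<noteq> j" for i j
    proof -
      have "ev e a0 (gc i * gc j + gc j * gc i) = 0" using that by (intro relC) (auto simp: clifford_rels_def)
      then show ?thesis by (simp add: eq_neg_iff_add_eq_0)
    qed
    show "a0 (Gt s) * a0 (Gc j) = - (a0 (Gc j) * a0 (Gt s))" if "s \<in> simple_index ty n" "j \<in> {1..n}" for s j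
      using swap[OF gen_parts(1)[OF that(2)] gen_parts(2)[OF that(1)]] that by (simp add: a0_simps)
  qed (use ad iota A0.e_idem A0.unit_left A0.unit_right in auto)
  interpret B0: spin_ev e a0 ty n \<iota> by (rule sp)
  have b_eq: "B0.b s = emb T (iC (beta ty n s))" if "s \<in> simple_index ty n" for s
  proof -
    have "beta ty n s \<in> free_carrier (fst Cl)" using beta_carrier[OF that] free_part_sub unfolding fst_Cl by blast
    then show ?thesis using evC E_beta[OF sp that] by simp
  qed
  have T_part: "B0.T s \<in> emb T ` part T False" if s: "s \<in> simple_index ty n" for s
  proof -
    have "cls Cl (beta ty n s) \<in> part (alg Cl) True"
      unfolding alg_part[OF homog(1)] fst_Cl using beta_carrier[OF s] by blast
    then have "B0.b s \<in> emb T ` part T True" unfolding b_eq[OF s] using salg_homD(6)[OF hom_iC] by blast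
    then have "B0.b s * B0.t s \<in> emb T ` part T (True \<noteq> True)" using a0_part[of "Gt s"] by (intro ep(5)) simp_all
    from ep(4)[OF this, of "- \<iota>"] show ?thesis unfolding B0.T_def by simp
  qed
  obtain f where f: "weyl_ev e (\<lambda>g. case g of Gw w \<Rightarrow> f w | _ \<Rightarrow> a0 g) ty n \<iota>" "\<And>w. f w \<in> emb T ` part T False"
  proof -
    have "\<forall>q\<in>spin_rels ty n. ev e a0 q = 0" using relS snd_sides(4) by blast
    then show ?thesis
      using weyl_ev_ex[OF sp, of "\<lambda>x. x \<in> emb T ` part T False"] ep(5)[of _ False _ False] ep(6) T_part that
      unfolding e_def by auto
  qed
  \<comment> \<open>Only the values of group elements are replaced; the spin relators do not contain
    these and keep their values.\<close>
  define a where "a g = (case g of Gw w \<Rightarrow> f w | _ \<Rightarrow> a0 g)" for g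
  have a_simps: "a (Gc i) = a0 (Gc i)" "a (Gt i) = a0 (Gt i)" "a (Gx i) = a0 (Gx i)" "a (Gy i) = a0 (Gy i)"
    "a (Gxi i) = a0 (Gxi i)" "a (Gw w) = f w" for i w by (simp_all add: a_def)
  have aw: "weyl_ev e a ty n \<iota>" using f(1) by (simp add: a_def[abs_def])
  interpret A: weyl_ev e a ty n \<iota> by (rule aw)
  have "ev e a q = 0" if "q \<in> snd Sp" for q
  proof -
    have "ev e a q = ev e a0 q"
    proof (rule ev_cong)
      show "q \<in> free_carrier (fst Sp)" using rels_carrier[OF homog(3)] that by blast
      show "a g = a0 g" if "g \<in> fst Sp" for g using that by (auto simp: fst_sides a_simps)
    qed
    then show ?thesis using relS[OF that] by simp
  qed
  then have "\<forall>q\<in>snd Sp. ev e a q = 0" by blast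
  moreover have "(\<forall>q\<in>snd Hp. ev e a q = 0) \<longleftrightarrow> (\<forall>q\<in>snd Sp. ev e a q = 0)"
  proof (rule side_rels_iff[OF aw])
    fix i j assume i: "i \<in> J" and j: "j \<in> {1..n}"
    show "a (Gy i) * a (Gc j) = a (Gc j) * a (Gy i)" "a (Gxi i) * a (Gc j) = - (a (Gc j) * a (Gxi i))"
      using swap[OF gen_parts(1)[OF j] gen_parts(4)[OF i]] swap[OF gen_parts(1)[OF j] gen_parts(3)[OF i]] i j
      by (simp_all add: a_simps a0_simps)
  next
    fix i assume i: "i \<in> J"
    then show "a (Gx i) = r *\<^sub>c (a (Gc i) * a (Gxi i))"
      using affine_index_sub[OF i] by (simp add: a_simps a0_simps)
  qed
  ultimately have relH: "ev e a q = 0" if "q \<in> snd Hp" for q using that by blast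
  have a_part: "a g \<in> emb T ` part T (odd_gen g)" for g
    using a0_part[of g] f(2) by (cases g) (simp_all add: a_simps)
  obtain \<Phi> where \<Phi>: "salg_hom (alg Hp) T \<Phi>" "\<And>g. g \<in> fst Hp \<Longrightarrow> a g = emb T (\<Phi> (cls Hp (gen g)))"
    using hom_ex[OF homog(2) sT a_part relH[unfolded e_def]] by blast
  have in_T: "\<Phi> (cls Hp (gen g)) \<in> carrier T" if "g \<in> fst Hp" for g
    using salg_homD(1)[OF \<Phi>(1)] cls_in[OF homog(2)] that by simp
  have eqI: "\<Phi> (cls Hp (gen g)) = x" if "g \<in> fst Hp" "x \<in> carrier T" "a g = emb T x" for g x
    using emb_inject[OF sT in_T[OF that(1)] that(2)] \<Phi>(2)[OF that(1)] that(3) by simp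
  have iCc: "iC p \<in> carrier T" if "p \<in> free_carrier (fst Cl)" for p
    using salg_homD(1)[OF hom_iC cls_in[OF homog(1) that]] .
  have iSc: "iS p \<in> carrier T" if "p \<in> free_carrier (fst Sp)" for p
    using salg_homD(1)[OF hom_iS cls_in[OF homog(3) that]] .
  have "\<Phi> (cls Hp (gc i)) = iC (gc i)" if "i \<in> {1..n}" for i
    using that by (intro eqI iCc) (auto simp: fst_sides fst_Cl a_simps a0_simps)
  moreover have "\<Phi> (cls Hp (gy i)) = iS (gy i)" if "i \<in> J" for i
    using that by (intro eqI iSc) (auto simp: fst_sides a_simps a0_simps)
  moreover have "\<Phi> (cls Hp (gx i)) = r \<odot>\<^bsub>T\<^esub> pt (cls Cl (gc i)) (cls Sp (gxi i))" if i: "i \<in> J" for i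
  proof -
    have m: "gc i \<in> free_carrier (fst Cl)" "gxi i \<in> free_carrier (fst Sp)" "Gx i \<in> fst Hp"
      using i affine_index_sub[OF i] by (auto simp: fst_sides fst_Cl)
    show ?thesis
      unfolding Cn_elt_split[OF m(1,2)]
      using i iCc[OF m(1)] iSc[OF m(2)] salg_closed(2)[OF sT]
      by (intro eqI m salg_closed(2,4)[OF sT]) (simp_all only: a_simps a0_simps emb_simps[OF sT] if_True)
  qed
  moreover have "\<Phi> (cls Hp (gw (\<rho> s))) = (- \<iota>) \<odot>\<^bsub>T\<^esub> pt (cls Cl (beta ty n s)) (cls Sp (gt s))"
    if s: "s \<in> simple_index ty n" for s
  proof -
    have m: "beta ty n s \<in> free_carrier (fst Cl)" "gt s \<in> free_carrier (fst Sp)" "Gw (\<rho> s) \<in> fst Hp"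
      using beta_carrier[OF s] free_part_sub s simple_ref_weyl[OF ad s] unfolding fst_Cl by (auto simp: fst_sides)
    have "a (Gw (\<rho> s)) = A.T s" by (rule A.om_simple[OF s])
    also have "\<dots> = B0.T s" by (simp add: A.T_def B0.T_def A.b_def B0.b_def a_simps)
    also have "\<dots> = (- \<iota>) *\<^sub>c (emb T (iC (beta ty n s)) * emb T (iS (gt s)))"
      unfolding B0.T_def b_eq[OF s] using s by (simp add: a0_simps)
    finally have "a (Gw (\<rho> s)) = emb T ((- \<iota>) \<odot>\<^bsub>T\<^esub> (iC (beta ty n s) \<otimes>\<^bsub>T\<^esub> iS (gt s)))"
      using iCc[OF m(1)] iSc[OF m(2)] salg_closed(2)[OF sT] by (simp only: emb_simps[OF sT])
    then show ?thesis
      unfolding Cn_elt_split[OF m(1,2)]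
      using iCc[OF m(1)] iSc[OF m(2)] by (intro eqI m salg_closed(2,4)[OF sT])
  qed
  moreover have "\<Phi> (cls Hp (cst \<iota> * beta ty n s * gw (\<rho> s))) = iS (gt s)" if s: "s \<in> simple_index ty n" for s
  proof -
    have b: "beta ty n s \<in> free_carrier (fst Hp)" "Gw (\<rho> s) \<in> fst Hp" "gt s \<in> free_carrier (fst Sp)"
      using beta_free[OF s] simple_ref_weyl[OF ad s] s by (auto simp: fst_sides)
    have "emb T (\<Phi> (cls Hp (cst \<iota> * beta ty n s * gw (\<rho> s)))) = ev e a (cst \<iota> * beta ty n s * gw (\<rho> s))"
      unfolding e_def using b by (intro hom_ev[OF homog(2) sT \<Phi>]) simp_all
    also have "\<dots> = \<iota> *\<^sub>c (A.b s * A.T s)"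
      using A.om_simple[OF s] E_beta[OF A.spin_ev_axioms s] A.b_unit by simp
    also have "\<dots> = emb T (iS (gt s))" using A.t_eq[OF s] s by (simp add: a_simps a0_simps)
    finally show ?thesis
      using b salg_homD(1)[OF \<Phi>(1) cls_in[OF homog(2)]] iSc[OF b(3)] by (simp add: emb_inject[OF sT])
  qed
  moreover have "\<Phi> (cls Hp (cst (1 / r) * gc i * gx i)) = iS (gxi i)" if i: "i \<in> J" for i
  proof -
    have b: "gc i \<in> free_carrier (fst Hp)" "gx i \<in> free_carrier (fst Hp)" "gxi i \<in> free_carrier (fst Sp)"
      using i affine_index_sub[OF i] by (auto simp: fst_sides)
    have rnz: "r \<noteq> 0" using iota by auto
    have "emb T (\<Phi> (cls Hp (cst (1 / r) * gc i * gx i))) = ev e a (cst (1 / r) * gc i * gx i)"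
      unfolding e_def using b by (intro hom_ev[OF homog(2) sT \<Phi>]) simp_all
    also have "\<dots> = (1 / r) *\<^sub>c (A.c i * a (Gx i))" by (simp add: A.a_unit A.a_unit_left mult.assoc)
    also have "a (Gx i) = r *\<^sub>c (A.c i * a (Gxi i))"
      using i affine_index_sub[OF i] by (simp add: a_simps a0_simps)
    also have "(1 / r) *\<^sub>c (A.c i * (r *\<^sub>c (A.c i * a (Gxi i)))) = a (Gxi i)"
      using sq_left[OF A.cc[OF affine_index_sub[OF i]], of "a (Gxi i)"] rnz by (simp add: A.a_unit A.a_unit_left)
    also have "\<dots> = emb T (iS (gxi i))" using i by (simp add: a_simps a0_simps)
    finally show ?thesis
      using b salg_homD(1)[OF \<Phi>(1) cls_in[OF homog(2)]] iSc[OF b(3)] by (simp add: emb_inject[OF sT])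
  qed
  ultimately show ?thesis using \<Phi>(1) by blast
qed

text \<open>The roles are exchanged: c, x, y and the group are given, and \<open>t\<close> and
  \<open>xi\<close> are defined from them. The last two claims recover the reflections and
  \<open>x\<close>, as needed for the composite with \<open>\<Phi>\<close>.\<close>

lemma Psi_ex: "\<exists>\<Psi>. salg_hom T (alg Hp) \<Psi> \<and>
    (\<forall>x\<in>carrier (alg Cl). \<Psi> (pt x \<one>\<^bsub>alg Sp\<^esub>) = canon Hp x) \<and>
    (\<forall>s\<in>simple_index ty n. \<Psi> (iS (gt s)) = cls Hp (cst \<iota> * beta ty n s * gw (\<rho> s))) \<and>
    (\<forall>i\<in>J. \<Psi> (iS (gy i)) = cls Hp (gy i)) \<and>
    (\<forall>i\<in>J. \<Psi> (iS (gxi i)) = cls Hp (cst (1 / r) * gc i * gx i)) \<and>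
    (\<forall>s\<in>simple_index ty n. (- \<iota>) \<odot>\<^bsub>alg Hp\<^esub> (cls Hp (beta ty n s) \<otimes>\<^bsub>alg Hp\<^esub>
       cls Hp (cst \<iota> * beta ty n s * gw (\<rho> s))) = cls Hp (gw (\<rho> s))) \<and>
    (\<forall>i\<in>J. r \<odot>\<^bsub>alg Hp\<^esub> (cls Hp (gc i) \<otimes>\<^bsub>alg Hp\<^esub> cls Hp (cst (1 / r) * gc i * gx i)) = cls Hp (gx i))"
proof -
  define R where "R = alg Hp"
  have sR: "superalgebra R" unfolding R_def by (rule superalgebra_Hp)
  have rnz: "r \<noteq> 0" using iota by auto
  define e where "e = emb R \<one>\<^bsub>R\<^esub>"
  define a0 where "a0 g = (if g \<in> fst Hp then emb R (cls Hp (gen g)) else 0)" for g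
  define b0 where "b0 = clifford_sys.b (\<lambda>i. a0 (Gc i)) ty n"
  define a where "a g = (case g of
      Gt s \<Rightarrow> if s \<in> simple_index ty n then \<iota> *\<^sub>c (b0 s * a0 (Gw (\<rho> s))) else 0
    | Gxi i \<Rightarrow> if i \<in> J then (1 / r) *\<^sub>c (a0 (Gc i) * a0 (Gx i)) else 0
    | _ \<Rightarrow> a0 g)" for g
  have a_simps: "a (Gc i) = a0 (Gc i)" "a (Gx i) = a0 (Gx i)" "a (Gy i) = a0 (Gy i)" "a (Gw w) = a0 (Gw w)"
    "a (Gt i) = (if i \<in> simple_index ty n then \<iota> *\<^sub>c (b0 i * a0 (Gw (\<rho> i))) else 0)"
    "a (Gxi i) = (if i \<in> J then (1 / r) *\<^sub>c (a0 (Gc i) * a0 (Gx i)) else 0)" for i w by (simp_all add: a_def)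
  note ep = emb_part_closed[OF sR]
  have gen_part: "cls Hp (gen g) \<in> part R (odd_gen g)" if "g \<in> fst Hp" for g
    unfolding R_def alg_part[OF homog(2)] using part_rules(6)[OF that] by blast
  have a0_part: "a0 g \<in> emb R ` part R (odd_gen g)" for g
    using gen_part[of g] ep(1) by (auto simp: a0_def)
  have cor0: "corner e a0" unfolding e_def using a0_part ep(7) by (intro corner_emb[OF sR]) blast
  have id: "salg_hom (alg Hp) R (\<lambda>x. x)" unfolding R_def by (rule salg_hom_id)
  have rel0: "ev e a0 q = 0" if "q \<in> snd Hp" for q
    unfolding e_def by (rule hom_rels[OF homog(2) sR id _ that]) (simp add: a0_def)
  interpret A0: corner e a0 by (rule cor0)
  have c_sq: "a0 (Gc i) * a0 (Gc i) = e" if "i \<in> {1..n}" for i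
  proof -
    have "ev e a0 (gc i * gc i - 1) = 0" using that snd_sides(1) by (intro rel0) (force simp: clifford_rels_def)
    then show ?thesis by simp
  qed
  have c_anti: "a0 (Gc i) * a0 (Gc j) = - (a0 (Gc j) * a0 (Gc i))" if "i \<in> {1..n}" "j \<in> {1..n}" "i \<noteq> j" for i j
  proof -
    have "gc i * gc j + gc j * gc i \<in> clifford_rels n" using that unfolding clifford_rels_def by blast
    then have "ev e a0 (gc i * gc j + gc j * gc i) = 0" using snd_sides(1) by (intro rel0) blast
    then show ?thesis by (simp add: eq_neg_iff_add_eq_0)
  qed
  interpret K: clifford_sys e "\<lambda>i. a0 (Gc i)" ty n
    by unfold_locales (rule ad A0.e_idem A0.unit_left A0.unit_right c_sq c_anti; assumption)+
  have om: "a0 (Gw id) = e" "w \<in> weyl ty n \<Longrightarrow> w' \<in> weyl ty n \<Longrightarrow> a0 (Gw (w \<circ> w')) = a0 (Gw w) * a0 (Gw w')" for w w'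
  proof -
    have "gw id - 1 \<in> weyl_rels ty n" unfolding weyl_rels_def by blast
    then have "ev e a0 (gw id - 1) = 0" using snd_sides(2) by (intro rel0) blast
    then show "a0 (Gw id) = e" by simp
    assume "w \<in> weyl ty n" "w' \<in> weyl ty n"
    then have "gw w * gw w' - gw (w \<circ> w') \<in> weyl_rels ty n" unfolding weyl_rels_def by blast
    then have "ev e a0 (gw w * gw w' - gw (w \<circ> w')) = 0" using snd_sides(2) by (intro rel0) blast
    then show "a0 (Gw (w \<circ> w')) = a0 (Gw w) * a0 (Gw w')" by simp
  qed
  \<comment> \<open>The conjugation relator of a simple reflection, multiplied by that reflection
    from the right, becomes a rule for moving a Clifford generator past it.\<close>
  have om_c: "a0 (Gw (\<rho> s)) * a0 (Gc j) = K.cs (\<rho> s (int j)) * a0 (Gw (\<rho> s))"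
    if s: "s \<in> simple_index ty n" and j: "j \<in> {1..n}" for s j
  proof -
    note w = simple_ref_weyl[OF ad s] and inv = simple_ref_involutive[OF ad s]
    have "inv_into UNIV (\<rho> s) = \<rho> s" using inv by (intro inv_unique_comp)
    then have "gw (\<rho> s) * gc j * gw (\<rho> s) - signed gc (\<rho> s (int j)) \<in> conj_rels ty n gc"
      using w j unfolding conj_rels_def by force
    then have "ev e a0 (gw (\<rho> s) * gc j * gw (\<rho> s) - signed gc (\<rho> s (int j))) = 0"
      using snd_sides(3) by (intro rel0) blast
    moreover have "ev e a0 (signed gc k) = K.cs k" for k by (simp add: signed_def K.cs_def)
    ultimately have "a0 (Gw (\<rho> s)) * a0 (Gc j) * a0 (Gw (\<rho> s)) = K.cs (\<rho> s (int j))" by simp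
    then have "a0 (Gw (\<rho> s)) * a0 (Gc j) * (a0 (Gw (\<rho> s)) * a0 (Gw (\<rho> s))) = K.cs (\<rho> s (int j)) * a0 (Gw (\<rho> s))"
      by (simp add: mult.assoc[symmetric])
    moreover have "a0 (Gw (\<rho> s)) * a0 (Gw (\<rho> s)) = e" using om(2)[OF w w] inv om(1) by simp
    ultimately show ?thesis by (simp add: mult.assoc A0.unit_right)
  qed
  have sp: "spin_ev e a ty n \<iota>"
  proof unfold_locales
    show "e * e = e" by (rule A0.e_idem)
    show "e * a g = a g" "a g * e = a g" for g
      using A0.unit_left A0.unit_right K.b_unit
      by (cases g; simp add: a_simps mult.assoc[symmetric] b0_def; simp add: mult.assoc)+
    then show "e * a (Gt s) = a (Gt s)" "a (Gt s) * e = a (Gt s)" "e * a (Gc s) = a (Gc s)" "a (Gc s) * e = a (Gc s)" for s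
      by blast+
    show "admissible ty n" by (rule ad)
    show "\<iota> * \<iota> = -1" by (rule iota)
    show "a (Gc i) * a (Gc i) = e" if "i \<in> {1..n}" for i using c_sq[OF that] by (simp add: a_simps)
    show "a (Gc i) * a (Gc j) = - (a (Gc j) * a (Gc i))" if "i \<in> {1..n}" "j \<in> {1..n}" "i \<noteq> j" for i j
      unfolding a_simps using that by (rule c_anti)
    show "a (Gt s) * a (Gc j) = - (a (Gc j) * a (Gt s))" if s: "s \<in> simple_index ty n" and j: "j \<in> {1..n}" for s j
    proof -
      have j': "\<bar>int j\<bar> \<in> {1..int n}" "K.cs (int j) = a0 (Gc j)" using j by simp_all
      have "K.b s * K.cs (\<rho> s (int j)) = - (K.cs (int j) * K.b s)"
        using K.b_cs[OF s K.rho_range[OF s j'(1)]] K.rho_rho[OF s] by simp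
      then have "K.b s * (a0 (Gw (\<rho> s)) * a0 (Gc j)) = - (a0 (Gc j) * (K.b s * a0 (Gw (\<rho> s))))"
        unfolding om_c[OF s j] j'(2) by (simp add: mult.assoc[symmetric])
      then show ?thesis using s by (simp add: a_simps b0_def mult.assoc)
    qed
  qed
  interpret B: spin_ev e a ty n \<iota> by (rule sp)
  have b0: "b0 s = B.b s" for s by (simp add: b0_def K.b_def B.b_def a_simps)
  have a_Gt: "a (Gt s) = \<iota> *\<^sub>c (B.b s * a0 (Gw (\<rho> s)))" if "s \<in> simple_index ty n" for s
    using that by (simp add: a_simps(5) b0)
  \<comment> \<open>Substituting the definition of \<open>t\<close> into \<open>T\<close> returns
    the reflection, since \<open>b s\<close> squares to \<open>e\<close> and the scalars multiply to
    \<open>- \<iota> * \<iota> = 1\<close>.\<close>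
  have T_om: "B.T s = a0 (Gw (\<rho> s))" if s: "s \<in> simple_index ty n" for s
  proof -
    have "B.b s * (B.b s * a0 (Gw (\<rho> s))) = a0 (Gw (\<rho> s))"
      using sq_left[OF B.b_sq[OF s]] by (simp add: A0.unit_left)
    then show ?thesis unfolding B.T_def a_Gt[OF s] using iota by simp
  qed
  have aw: "weyl_ev e a ty n \<iota>"
  proof unfold_locales
    show "a (Gw id) = e" unfolding a_simps by (rule om(1))
    show "a (Gw (w \<circ> w')) = a (Gw w) * a (Gw w')" if "w \<in> weyl ty n" "w' \<in> weyl ty n" for w w'
      unfolding a_simps using that by (rule om(2))
    show "a (Gw (\<rho> s)) = B.T s" if "s \<in> simple_index ty n" for s using T_om[OF that] by (simp add: a_simps)
  qed
  interpret A: weyl_ev e a ty n \<iota> by (rule aw)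
  have a_H: "a g = emb R (cls Hp (gen g))" if "g \<in> fst Hp" for g
    using that by (cases g) (auto simp: a_simps a0_def fst_sides)
  have evH: "emb R (cls Hp p) = ev e a p" if "p \<in> free_carrier (fst Hp)" for p
    unfolding e_def by (rule hom_ev[OF homog(2) sR id a_H that])
  have relH: "ev e a q = 0" if "q \<in> snd Hp" for q
    unfolding e_def by (rule hom_rels[OF homog(2) sR id a_H that])
  have yc: "a (Gy i) * a (Gc j) = a (Gc j) * a (Gy i)" if "i \<in> J" "j \<in> {1..n}" for i j
    using relH[OF snd_sides(5)[OF that]] by simp
  have xic: "a (Gxi i) * a (Gc j) = - (a (Gc j) * a (Gxi i))" if i: "i \<in> J" and j: "j \<in> {1..n}" for i j
  proof -
    have "B.c i * (a (Gx i) * B.c j) = - (B.c j * (B.c i * a (Gx i)))"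
    proof (cases "i = j")
      case True
      have "a (Gx i) * B.c i = - (B.c i * a (Gx i))"
        using relH[OF snd_sides(6)[OF i]] by (simp add: eq_neg_iff_add_eq_0)
      then show ?thesis using True by simp
    next
      case False
      have "a (Gx i) * B.c j = B.c j * a (Gx i)" using relH[OF snd_sides(7)[OF i j False]] by simp
      then show ?thesis using anticomm_left[OF B.canti[OF affine_index_sub[OF i] j False]] by simp
    qed
    then show ?thesis using i by (simp add: a_simps mult.assoc)
  qed
  have x_eq: "a (Gx i) = r *\<^sub>c (a (Gc i) * a (Gxi i))" if i: "i \<in> J" for i
    using sq_left[OF B.cc[OF affine_index_sub[OF i]], of "a (Gx i)"] rnz i A.a_unit(1)[of "Gx i"]
    by (simp add: a_simps)
  have relS: "ev e a q = 0" if "q \<in> snd Sp" for q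
    using side_rels_iff[OF aw yc xic x_eq] relH that by blast
  have b_eq: "B.b s = emb R (cls Hp (beta ty n s))" if s: "s \<in> simple_index ty n" for s
    using evH[OF beta_free[OF s]] E_beta[OF sp s] by simp
  have mono: "part (F G) i \<subseteq> part (F G') i" if "G \<subseteq> G'" for G G' i
    using that by (auto simp: free_part)
  have a_part: "a g \<in> emb R ` part R (odd_gen g)" if g: "g \<in> fst Sp" for g
  proof (cases g)
    case (Gt s)
    then have s: "s \<in> simple_index ty n" using g by (auto simp: fst_sides)
    have "beta ty n s \<in> part (F (fst Hp)) True" using beta_carrier[OF s] mono[OF sub_Cl(1)] unfolding fst_Cl by blast
    then have "B.b s \<in> emb R ` part R True" unfolding b_eq[OF s] R_def alg_part[OF homog(2)] by blast
    then have "B.b s * a0 (Gw (\<rho> s)) \<in> emb R ` part R (True \<noteq> False)"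
      using a0_part[of "Gw (\<rho> s)"] by (intro ep(5)) simp_all
    from ep(4)[OF this, of \<iota>] show ?thesis using s by (simp add: Gt a_simps b0)
  next
    case (Gxi i)
    have "a0 (Gc i) * a0 (Gx i) \<in> emb R ` part R (True \<noteq> False)"
      using a0_part[of "Gc i"] a0_part[of "Gx i"] by (intro ep(5)) simp_all
    from ep(4)[OF this, of "1 / r"] show ?thesis using g by (auto simp: Gxi a_simps fst_sides)
  qed (use a0_part[of g] in \<open>simp_all add: a_simps\<close>)
  obtain h where h: "salg_hom (alg Sp) R h" "\<And>g. g \<in> fst Sp \<Longrightarrow> a g = emb R (h (cls Sp (gen g)))"
    using hom_ex[OF homog(3) sR a_part relS[unfolded e_def]] by blast
  have f: "salg_hom (alg Cl) R (canon Hp)" unfolding R_def by (rule canon_hom[OF homog(2,1) sub_Cl])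
  have fcls: "canon Hp (cls Cl p) = cls Hp p" for p by (rule canon_cls[OF homog(2,1) sub_Cl])
  have fa: "a g = emb R (canon Hp (cls Cl (gen g)))" if "g \<in> fst Cl" for g
    unfolding fcls using that sub_Cl(1) by (intro a_H) blast
  \<comment> \<open>The first factor is generated by the \<open>c j\<close>; these anticommute with
    the odd \<open>t\<close> and \<open>xi\<close> and commute with the even
    \<open>y\<close>.\<close>
  have comm: "a g' * a g = (if odd_gen g' \<and> odd_gen g then -1 else 1) *\<^sub>c (a g * a g')"
    if g: "g \<in> fst Cl" "g' \<in> fst Sp" for g g'
  proof -
    obtain j where j: "g = Gc j" "j \<in> {1..n}" using g(1) unfolding fst_Cl by blast
    show ?thesis
      using g(2) j(2) B.tc[of _ j] xic[of _ j] yc[of _ j] unfolding j(1) fst_sides by auto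
  qed
  obtain \<Psi> where \<Psi>: "salg_hom T R \<Psi>" "\<And>x. x \<in> carrier (alg Cl) \<Longrightarrow> \<Psi> (pt x \<one>\<^bsub>alg Sp\<^esub>) = canon Hp x"
    "\<And>x. x \<in> carrier (alg Sp) \<Longrightarrow> \<Psi> (pt \<one>\<^bsub>alg Cl\<^esub> x) = h x"
  proof -
    have "h y \<otimes>\<^bsub>R\<^esub> canon Hp x = (if j \<and> i then -1 else 1) \<odot>\<^bsub>R\<^esub> (canon Hp x \<otimes>\<^bsub>R\<^esub> h y)"
      if x: "x \<in> part (alg Cl) i" and y: "y \<in> part (alg Sp) j" for x y i j
    proof -
      obtain p q where p: "p \<in> part (F (fst Cl)) i" "x = cls Cl p" and q: "q \<in> part (F (fst Sp)) j" "y = cls Sp q"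
        using x y unfolding alg_part[OF homog(1)] alg_part[OF homog(3)] by blast
      have ex: "emb R (canon Hp x) = ev e a p" unfolding p(2) e_def
        using p(1) free_part_sub by (intro hom_ev[OF homog(1) sR f fa]) blast+
      have ey: "emb R (h y) = ev e a q" unfolding q(2) e_def
        using q(1) free_part_sub by (intro hom_ev[OF homog(3) sR h]) blast+
      have c: "h y \<in> carrier R" "canon Hp x \<in> carrier R"
        using part_closed(1)[OF sR] salg_homD(6)[OF h(1) y] salg_homD(6)[OF f x] by auto
      have "emb R (h y) * emb R (canon Hp x) = (if j \<and> i then -1 else 1) *\<^sub>c (emb R (canon Hp x) * emb R (h y))"
        unfolding ex ey by (rule ev_supercommute[OF B.corner_axioms comm p(1) q(1)])
      then have "emb R (h y \<otimes>\<^bsub>R\<^esub> canon Hp x) = emb R ((if j \<and> i then -1 else 1) \<odot>\<^bsub>R\<^esub> (canon Hp x \<otimes>\<^bsub>R\<^esub> h y))"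
        using c salg_closed(2)[OF sR] by (simp only: emb_simps[OF sR])
      then show ?thesis using c salg_closed(2,4)[OF sR] by (simp only: emb_inject[OF sR])
    qed
    then show ?thesis using tensor_hom_ex[OF sR f h(1)] that by blast
  qed
  have eqI: "x = y" if "x \<in> carrier R" "y \<in> carrier R" "emb R x = emb R y" for x y
    using emb_inject[OF sR that(1,2)] that(3) by simp
  have cc: "cls Hp p \<in> carrier R" if "p \<in> free_carrier (fst Hp)" for p
    unfolding R_def by (rule cls_in[OF homog(2) that])
  have hc: "h (cls Sp p) \<in> carrier R" if "p \<in> free_carrier (fst Sp)" for p
    by (rule salg_homD(1)[OF h(1) cls_in[OF homog(3) that]])
  have m: "cst \<iota> * beta ty n s * gw (\<rho> s) \<in> free_carrier (fst Hp)" "beta ty n s \<in> free_carrier (fst Hp)"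
    "gw (\<rho> s) \<in> free_carrier (fst Hp)" "gt s \<in> free_carrier (fst Sp)"
    if s: "s \<in> simple_index ty n" for s
    using beta_free[OF s] simple_ref_weyl[OF ad s] s by (auto simp: fst_sides)
  have mx: "cst (1 / r) * gc i * gx i \<in> free_carrier (fst Hp)" "gc i \<in> free_carrier (fst Hp)"
    "gx i \<in> free_carrier (fst Hp)" "gxi i \<in> free_carrier (fst Sp)" "gy i \<in> free_carrier (fst Sp)"
    "gy i \<in> free_carrier (fst Hp)" if i: "i \<in> J" for i
    using i affine_index_sub[OF i] by (auto simp: fst_sides)
  have ev_t: "emb R (cls Hp (cst \<iota> * beta ty n s * gw (\<rho> s))) = \<iota> *\<^sub>c (B.b s * a0 (Gw (\<rho> s)))" if s: "s \<in> simple_index ty n" for s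
    unfolding evH[OF m(1)[OF s]] using E_beta[OF sp s] B.b_unit by (simp add: a_simps)
  have ev_x: "emb R (cls Hp (cst (1 / r) * gc i * gx i)) = (1 / r) *\<^sub>c (a0 (Gc i) * a0 (Gx i))" if i: "i \<in> J" for i
    unfolding evH[OF mx(1)[OF i]] by (simp add: a_simps A0.unit_left)
  have "\<Psi> (iS (gt s)) = cls Hp (cst \<iota> * beta ty n s * gw (\<rho> s))" if s: "s \<in> simple_index ty n" for s
    unfolding \<Psi>(3)[OF cls_in[OF homog(3) m(4)[OF s]]]
  proof (rule eqI[OF hc[OF m(4)[OF s]] cc[OF m(1)[OF s]]])
    have "a (Gt s) = emb R (h (cls Sp (gt s)))" using s by (intro h(2)) (auto simp: fst_sides)
    then show "emb R (h (cls Sp (gt s))) = emb R (cls Hp (cst \<iota> * beta ty n s * gw (\<rho> s)))"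
      unfolding ev_t[OF s] using s by (simp add: a_simps b0)
  qed
  moreover have "\<Psi> (iS (gy i)) = cls Hp (gy i)" if i: "i \<in> J" for i
    unfolding \<Psi>(3)[OF cls_in[OF homog(3) mx(5)[OF i]]]
  proof (rule eqI[OF hc[OF mx(5)[OF i]] cc[OF mx(6)[OF i]]])
    show "emb R (h (cls Sp (gy i))) = emb R (cls Hp (gy i))"
      using h(2)[of "Gy i"] a_H[of "Gy i"] i by (simp add: fst_sides)
  qed
  moreover have "\<Psi> (iS (gxi i)) = cls Hp (cst (1 / r) * gc i * gx i)" if i: "i \<in> J" for i
    unfolding \<Psi>(3)[OF cls_in[OF homog(3) mx(4)[OF i]]]
  proof (rule eqI[OF hc[OF mx(4)[OF i]] cc[OF mx(1)[OF i]]])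
    have "a (Gxi i) = emb R (h (cls Sp (gxi i)))" using i by (intro h(2)) (auto simp: fst_sides)
    then show "emb R (h (cls Sp (gxi i))) = emb R (cls Hp (cst (1 / r) * gc i * gx i))"
      unfolding ev_x[OF i] using i by (simp add: a_simps)
  qed
  moreover have "(- \<iota>) \<odot>\<^bsub>R\<^esub> (cls Hp (beta ty n s) \<otimes>\<^bsub>R\<^esub> cls Hp (cst \<iota> * beta ty n s * gw (\<rho> s))) = cls Hp (gw (\<rho> s))"
    if s: "s \<in> simple_index ty n" for s
  proof (rule eqI)
    note c = cc[OF m(1)[OF s]] cc[OF m(2)[OF s]]
    show "(- \<iota>) \<odot>\<^bsub>R\<^esub> (cls Hp (beta ty n s) \<otimes>\<^bsub>R\<^esub> cls Hp (cst \<iota> * beta ty n s * gw (\<rho> s))) \<in> carrier R"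
      by (intro salg_closed(2,4)[OF sR] c)
    show "cls Hp (gw (\<rho> s)) \<in> carrier R" by (rule cc[OF m(3)[OF s]])
    have "emb R ((- \<iota>) \<odot>\<^bsub>R\<^esub> (cls Hp (beta ty n s) \<otimes>\<^bsub>R\<^esub> cls Hp (cst \<iota> * beta ty n s * gw (\<rho> s)))) =
      (- \<iota>) *\<^sub>c (B.b s * (\<iota> *\<^sub>c (B.b s * a0 (Gw (\<rho> s)))))"
      unfolding emb_simps(3)[OF sR salg_closed(2)[OF sR c(2,1)]] emb_simps(2)[OF sR c(2,1)] ev_t[OF s] b_eq[OF s] ..
    also have "\<dots> = B.T s" unfolding B.T_def a_Gt[OF s] ..
    also have "\<dots> = emb R (cls Hp (gw (\<rho> s)))" unfolding T_om[OF s] using m(3)[OF s] by (simp add: a0_def)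
    finally show "emb R ((- \<iota>) \<odot>\<^bsub>R\<^esub> (cls Hp (beta ty n s) \<otimes>\<^bsub>R\<^esub> cls Hp (cst \<iota> * beta ty n s * gw (\<rho> s)))) =
      emb R (cls Hp (gw (\<rho> s)))" .
  qed
  moreover have "r \<odot>\<^bsub>R\<^esub> (cls Hp (gc i) \<otimes>\<^bsub>R\<^esub> cls Hp (cst (1 / r) * gc i * gx i)) = cls Hp (gx i)" if i: "i \<in> J" for i
  proof (rule eqI)
    note c = cc[OF mx(1)[OF i]] cc[OF mx(2)[OF i]]
    show "r \<odot>\<^bsub>R\<^esub> (cls Hp (gc i) \<otimes>\<^bsub>R\<^esub> cls Hp (cst (1 / r) * gc i * gx i)) \<in> carrier R"
      by (intro salg_closed(2,4)[OF sR] c)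
    show "cls Hp (gx i) \<in> carrier R" by (rule cc[OF mx(3)[OF i]])
    have ci: "emb R (cls Hp (gc i)) = a (Gc i)" and xi: "emb R (cls Hp (gx i)) = a (Gx i)"
      using mx(2,3)[OF i] a_H by simp_all
    show "emb R (r \<odot>\<^bsub>R\<^esub> (cls Hp (gc i) \<otimes>\<^bsub>R\<^esub> cls Hp (cst (1 / r) * gc i * gx i))) = emb R (cls Hp (gx i))"
      unfolding emb_simps(3)[OF sR salg_closed(2)[OF sR c(2,1)]] emb_simps(2)[OF sR c(2,1)] ev_x[OF i] ci xi x_eq[OF i]
      using i by (simp add: a_simps)
  qed
  ultimately show ?thesis using \<Psi>(1,2) unfolding R_def by blast
qed

text \<open>Both composites are compared with the identity on generators. On the Clifford side the
  group elements are reduced to simple reflections; on the tensor product the two factors are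
  treated separately.\<close>

theorem pair_isos: "\<exists>\<Phi> \<Psi>. salg_hom (alg Hp) T \<Phi> \<and> salg_hom T (alg Hp) \<Psi> \<and> inverse_maps (alg Hp) T \<Phi> \<Psi> \<and>
    (\<forall>x\<in>carrier (alg Cl). \<Phi> (canon Hp x) = pt x \<one>\<^bsub>alg Sp\<^esub> \<and> \<Psi> (pt x \<one>\<^bsub>alg Sp\<^esub>) = canon Hp x) \<and>
    (\<forall>s\<in>simple_index ty n.
       \<Phi> (cls Hp (gw (\<rho> s))) = (- \<iota>) \<odot>\<^bsub>T\<^esub> pt (cls Cl (beta ty n s)) (cls Sp (gt s)) \<and>
       \<Psi> (iS (gt s)) = cls Hp (cst \<iota> * beta ty n s * gw (\<rho> s))) \<and>
    (\<forall>i\<in>J. \<Phi> (cls Hp (gy i)) = iS (gy i) \<and> \<Psi> (iS (gy i)) = cls Hp (gy i) \<and>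
       \<Phi> (cls Hp (gx i)) = r \<odot>\<^bsub>T\<^esub> pt (cls Cl (gc i)) (cls Sp (gxi i)) \<and>
       \<Psi> (iS (gxi i)) = cls Hp (cst (1 / r) * gc i * gx i))"
proof -
  obtain \<Phi> where h\<Phi>: "salg_hom (alg Hp) T \<Phi>"
    and \<Phi>c0: "\<forall>i\<in>{1..n}. \<Phi> (cls Hp (gc i)) = iC (gc i)"
    and \<Phi>w0: "\<forall>s\<in>simple_index ty n. \<Phi> (cls Hp (gw (\<rho> s))) = (- \<iota>) \<odot>\<^bsub>T\<^esub> pt (cls Cl (beta ty n s)) (cls Sp (gt s))"
    and \<Phi>y0: "\<forall>i\<in>J. \<Phi> (cls Hp (gy i)) = iS (gy i)"
    and \<Phi>x0: "\<forall>i\<in>J. \<Phi> (cls Hp (gx i)) = r \<odot>\<^bsub>T\<^esub> pt (cls Cl (gc i)) (cls Sp (gxi i))"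
    and \<Phi>t0: "\<forall>s\<in>simple_index ty n. \<Phi> (cls Hp (cst \<iota> * beta ty n s * gw (\<rho> s))) = iS (gt s)"
    and \<Phi>xi0: "\<forall>i\<in>J. \<Phi> (cls Hp (cst (1 / r) * gc i * gx i)) = iS (gxi i)"
    using Phi_ex by blast
  obtain \<Psi> where h\<Psi>: "salg_hom T (alg Hp) \<Psi>"
    and \<Psi>C0: "\<forall>x\<in>carrier (alg Cl). \<Psi> (pt x \<one>\<^bsub>alg Sp\<^esub>) = canon Hp x"
    and \<Psi>t0: "\<forall>s\<in>simple_index ty n. \<Psi> (iS (gt s)) = cls Hp (cst \<iota> * beta ty n s * gw (\<rho> s))"
    and \<Psi>y0: "\<forall>i\<in>J. \<Psi> (iS (gy i)) = cls Hp (gy i)"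
    and \<Psi>xi0: "\<forall>i\<in>J. \<Psi> (iS (gxi i)) = cls Hp (cst (1 / r) * gc i * gx i)"
    and Hw0: "\<forall>s\<in>simple_index ty n. (- \<iota>) \<odot>\<^bsub>alg Hp\<^esub> (cls Hp (beta ty n s) \<otimes>\<^bsub>alg Hp\<^esub>
       cls Hp (cst \<iota> * beta ty n s * gw (\<rho> s))) = cls Hp (gw (\<rho> s))"
    and Hx0: "\<forall>i\<in>J. r \<odot>\<^bsub>alg Hp\<^esub> (cls Hp (gc i) \<otimes>\<^bsub>alg Hp\<^esub> cls Hp (cst (1 / r) * gc i * gx i)) = cls Hp (gx i)"
    using Psi_ex by blast
  note \<Phi>c = \<Phi>c0[rule_format]
  note \<Phi>w = \<Phi>w0[rule_format]
  note \<Phi>y = \<Phi>y0[rule_format]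
  note \<Phi>x = \<Phi>x0[rule_format]
  note \<Phi>t = \<Phi>t0[rule_format]
  note \<Phi>xi = \<Phi>xi0[rule_format]
  note \<Psi>C = \<Psi>C0[rule_format]
  note \<Psi>t = \<Psi>t0[rule_format]
  note \<Psi>y = \<Psi>y0[rule_format]
  note \<Psi>xi = \<Psi>xi0[rule_format]
  note Hw = Hw0[rule_format]
  note Hx = Hx0[rule_format]
  note sT = superalgebra_tensor
  have fcls: "canon Hp (cls Cl p) = cls Hp p" for p by (rule canon_cls[OF homog(2,1) sub_Cl])
  have f: "salg_hom (alg Cl) (alg Hp) (canon Hp)" by (rule canon_hom[OF homog(2,1) sub_Cl])
  have \<Phi>C: "\<Phi> (canon Hp x) = pt x \<one>\<^bsub>alg Sp\<^esub>" if "x \<in> carrier (alg Cl)" for x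
    by (rule alg_hom_unique[OF homog(1) sT salg_hom_comp[OF f h\<Phi>] hom_iC _ that]) (auto simp: fst_Cl fcls \<Phi>c)
  have \<Psi>Cn: "\<Psi> (z \<odot>\<^bsub>T\<^esub> pt (cls Cl p) (cls Sp q)) = z \<odot>\<^bsub>alg Hp\<^esub> (cls Hp p \<otimes>\<^bsub>alg Hp\<^esub> \<Psi> (iS q))"
    if p: "p \<in> free_carrier (fst Cl)" and q: "q \<in> free_carrier (fst Sp)" for z p q
  proof -
    note c = salg_homD(1)[OF hom_iC cls_in[OF homog(1) p]] salg_homD(1)[OF hom_iS cls_in[OF homog(3) q]]
    show ?thesis
      unfolding Cn_elt_split[OF p q] salg_homD(5)[OF h\<Psi> salg_closed(2)[OF sT c]] salg_homD(3)[OF h\<Psi> c]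
        \<Psi>C[OF cls_in[OF homog(1) p]] fcls ..
  qed
  have beta_Cl: "beta ty n s \<in> free_carrier (fst Cl)" if "s \<in> simple_index ty n" for s
    using beta_carrier[OF that] free_part_sub unfolding fst_Cl by blast
  have w1: "\<Psi> (\<Phi> (cls Hp (gw (\<rho> s)))) = cls Hp (gw (\<rho> s))" if s: "s \<in> simple_index ty n" for s
    unfolding \<Phi>w[OF s] using s by (subst \<Psi>Cn[OF beta_Cl[OF s]]) (auto simp: fst_sides \<Psi>t Hw)
  note comp1 = salg_hom_comp[OF h\<Phi> h\<Psi>] and comp2 = salg_hom_comp[OF h\<Psi> h\<Phi>]
  have inv1: "\<Psi> (\<Phi> x) = x" if "x \<in> carrier (alg Hp)" for x
  proof (rule alg_hom_unique[OF homog(2) superalgebra_Hp comp1 salg_hom_id _ that])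
    fix g assume g: "g \<in> fst Hp"
    show "\<Psi> (\<Phi> (cls Hp (gen g))) = cls Hp (gen g)"
    proof (cases g)
      case (Gx i)
      then have i: "i \<in> J" using g by (auto simp: fst_sides)
      have m: "gc i \<in> free_carrier (fst Cl)" "gxi i \<in> free_carrier (fst Sp)"
        using i affine_index_sub[OF i] by (auto simp: fst_sides fst_Cl)
      show ?thesis unfolding Gx \<Phi>x[OF i] \<Psi>Cn[OF m] \<Psi>xi[OF i] by (rule Hx[OF i])
    next
      case (Gy i)
      then show ?thesis using g \<Phi>y \<Psi>y by (auto simp: fst_sides)
    next
      case (Gc i)
      then have i: "i \<in> {1..n}" using g by (auto simp: fst_sides)
      show ?thesis unfolding Gc \<Phi>c[OF i] using i by (subst \<Psi>C) (auto simp: fcls fst_Cl intro!: cls_in[OF homog(1)])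
    next
      case (Gw w)
      then have w: "w \<in> weyl ty n" using g by (auto simp: fst_sides)
      show ?thesis
        unfolding Gw by (rule hom_weyl_eq[OF ad homog(2) superalgebra_Hp _ snd_sides(2) comp1 salg_hom_id w1 w])
          (auto simp: fst_sides)
    qed (use g in \<open>auto simp: fst_sides\<close>)
  qed
  have inv2: "\<Phi> (\<Psi> x) = x" if "x \<in> carrier T" for x
  proof (rule tensor_hom_unique[OF comp2 salg_hom_id _ _ that])
    show "\<Phi> (\<Psi> (pt x \<one>\<^bsub>alg Sp\<^esub>)) = pt x \<one>\<^bsub>alg Sp\<^esub>" if "x \<in> carrier (alg Cl)" for x
      using \<Psi>C[OF that] \<Phi>C[OF that] by simp
    show "\<Phi> (\<Psi> (pt \<one>\<^bsub>alg Cl\<^esub> x)) = pt \<one>\<^bsub>alg Cl\<^esub> x" if "x \<in> carrier (alg Sp)" for x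
      by (rule alg_hom_unique[OF homog(3) sT salg_hom_comp[OF hom_iS comp2] hom_iS _ that])
         (auto simp: fst_sides \<Psi>t \<Psi>y \<Psi>xi \<Phi>t \<Phi>y \<Phi>xi)
  qed
  have "inverse_maps (alg Hp) T \<Phi> \<Psi>" using inv1 inv2 by (simp add: inverse_maps_def)
  with h\<Phi> h\<Psi> \<Phi>C \<Psi>C \<Phi>w \<Psi>t \<Phi>y \<Psi>y \<Phi>x \<Psi>xi show ?thesis by blast
qed

end

text \<open>The finite and the affine pair are two instances of the same construction. The extension
  statements are then equalities of two homomorphisms out of a finite algebra, which only have to
  agree on its generators.\<close>

theorem theorem5p5:
  fixes ty :: weyl_type and n :: nat and u v \<iota> :: complex
  assumes "admissible ty n" and "\<iota> ^ 2 = -1"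
  shows "\<exists>\<Phi>0 \<Psi>0 \<Phi> \<Psi>.
    let H0 = clifford_weyl ty n; S0 = spin_weyl ty n; T0 = Cn_tensor n S0;
        H = hecke_clifford ty n u v; S = spin_hecke ty n u v; T = Cn_tensor n S;
        r = complex_of_real (sqrt 2) * \<iota>
    in
      finite_isos ty n \<iota> \<Phi>0 \<Psi>0 \<and>
      superalgebra_iso (alg H) T \<Phi> \<and>
      (\<forall>z\<in>carrier (alg H0). \<Phi> (canon H z) = Cn_canon n S (\<Phi>0 z)) \<and>
      (\<forall>i\<in>{1..n}. \<Phi> (cls H (gy i)) = Cn_elt n S 1 (gy i)) \<and>
      (\<forall>i\<in>{1..n}. \<Phi> (cls H (gx i)) = r \<odot>\<^bsub>T\<^esub> Cn_elt n S (gc i) (gxi i)) \<and>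
      (\<forall>i\<in>simple_index ty n. \<Phi> (cls H (gw (simple_ref ty n i)))
         = (- \<iota>) \<odot>\<^bsub>T\<^esub> Cn_elt n S (beta ty n i) (gt i)) \<and>
      (\<forall>i\<in>{1..n}. \<Phi> (cls H (gc i)) = Cn_elt n S (gc i) 1) \<and>
      superalgebra_iso T (alg H) \<Psi> \<and>
      inverse_maps (alg H) T \<Phi> \<Psi> \<and>
      (\<forall>z\<in>carrier T0. \<Psi> (Cn_canon n S z) = canon H (\<Psi>0 z)) \<and>
      (\<forall>i\<in>{1..n}. \<Psi> (Cn_elt n S 1 (gy i)) = cls H (gy i)) \<and>
      (\<forall>i\<in>{1..n}. \<Psi> (Cn_elt n S 1 (gxi i)) = cls H (cst (1 / r) * gc i * gx i)) \<and>
      (\<forall>i\<in>simple_index ty n. \<Psi> (Cn_elt n S 1 (gt i))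
         = cls H (cst \<iota> * beta ty n i * gw (simple_ref ty n i))) \<and>
      (\<forall>i\<in>{1..n}. \<Psi> (Cn_elt n S (gc i) 1) = cls H (gc i))"
proof -
  have iota: "\<iota> * \<iota> = -1" using assms(2) by (simp add: power2_eq_square)
  interpret fin: side_pair ty n \<iota> None by unfold_locales (rule assms(1) iota)+
  interpret aff: side_pair ty n \<iota> "Some (u, v)" by unfold_locales (rule assms(1) iota)+
  define H0 where "H0 = clifford_side ty n None"
  define S0 where "S0 = spin_side ty n None"
  define H where "H = clifford_side ty n (Some (u, v))"
  define S where "S = spin_side ty n (Some (u, v))"
  define C where "C = clifford n"
  define T0 where "T0 = tensor (alg C) (alg S0)"
  define T where "T = tensor (alg C) (alg S)"
  define pt0 where "pt0 = pure_tensor (alg C) (alg S0)"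
  define pt where "pt = pure_tensor (alg C) (alg S)"
  note defs = H0_def S0_def H_def S_def C_def T0_def T_def pt0_def pt_def
  have J: "affine_index n (Some (u, v)) = {1..n}" by (simp add: affine_index_def)
  obtain \<Phi>0 \<Psi>0 where h0: "salg_hom (alg H0) T0 \<Phi>0" "salg_hom T0 (alg H0) \<Psi>0" and inv0: "inverse_maps (alg H0) T0 \<Phi>0 \<Psi>0"
    and C0: "\<forall>x\<in>carrier (alg C). \<Phi>0 (canon H0 x) = pt0 x \<one>\<^bsub>alg S0\<^esub> \<and> \<Psi>0 (pt0 x \<one>\<^bsub>alg S0\<^esub>) = canon H0 x"
    and W0: "\<forall>s\<in>simple_index ty n.
       \<Phi>0 (cls H0 (gw (simple_ref ty n s))) = (- \<iota>) \<odot>\<^bsub>T0\<^esub> pt0 (cls C (beta ty n s)) (cls S0 (gt s)) \<and>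
       \<Psi>0 (pt0 \<one>\<^bsub>alg C\<^esub> (cls S0 (gt s))) = cls H0 (cst \<iota> * beta ty n s * gw (simple_ref ty n s))"
    using fin.pair_isos unfolding defs by blast
  obtain \<Phi> \<Psi> where h: "salg_hom (alg H) T \<Phi>" "salg_hom T (alg H) \<Psi>" and inv: "inverse_maps (alg H) T \<Phi> \<Psi>"
    and CC: "\<forall>x\<in>carrier (alg C). \<Phi> (canon H x) = pt x \<one>\<^bsub>alg S\<^esub> \<and> \<Psi> (pt x \<one>\<^bsub>alg S\<^esub>) = canon H x"
    and W: "\<forall>s\<in>simple_index ty n.
       \<Phi> (cls H (gw (simple_ref ty n s))) = (- \<iota>) \<odot>\<^bsub>T\<^esub> pt (cls C (beta ty n s)) (cls S (gt s)) \<and>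
       \<Psi> (pt \<one>\<^bsub>alg C\<^esub> (cls S (gt s))) = cls H (cst \<iota> * beta ty n s * gw (simple_ref ty n s))"
    and XY: "\<forall>i\<in>{1..n}. \<Phi> (cls H (gy i)) = pt \<one>\<^bsub>alg C\<^esub> (cls S (gy i)) \<and> \<Psi> (pt \<one>\<^bsub>alg C\<^esub> (cls S (gy i))) = cls H (gy i) \<and>
       \<Phi> (cls H (gx i)) = (complex_of_real (sqrt 2) * \<iota>) \<odot>\<^bsub>T\<^esub> pt (cls C (gc i)) (cls S (gxi i)) \<and>
       \<Psi> (pt \<one>\<^bsub>alg C\<^esub> (cls S (gxi i))) = cls H (cst (1 / (complex_of_real (sqrt 2) * \<iota>)) * gc i * gx i)"
    using aff.pair_isos unfolding defs J by blast
  have hom: "homogeneous_pres C" "homogeneous_pres H0" "homogeneous_pres S0" "homogeneous_pres H" "homogeneous_pres S"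
    using fin.homog aff.homog by (simp_all add: defs)
  have tp0: "tensor_pair (alg C) (alg S0)" and tp: "tensor_pair (alg C) (alg S)"
    using fin.tensor_pair_axioms aff.tensor_pair_axioms by (simp_all add: defs)
  have sA: "superalgebra (alg H0)" "superalgebra (alg H)" "superalgebra T0" "superalgebra T"
    using superalgebra_alg hom(2,4) fin.superalgebra_tensor aff.superalgebra_tensor unfolding defs by blast+
  have subH: "fst H0 \<subseteq> fst H" "snd H0 \<subseteq> snd H" and subS: "fst S0 \<subseteq> fst S" "snd S0 \<subseteq> snd S"
    unfolding defs clifford_side_def spin_side_def option.case prod.case clifford_weyl_def hecke_clifford_def
      spin_weyl_def spin_hecke_def fst_conv snd_conv by blast+
  have subC0: "fst C \<subseteq> fst H0" "snd C \<subseteq> snd H0" and subC: "fst C \<subseteq> fst H" "snd C \<subseteq> snd H"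
    using fin.sub_Cl aff.sub_Cl unfolding defs by blast+
  note cH = canon_cls[OF hom(4,2) subH] and cS = canon_cls[OF hom(5,3) subS]
    and cC = canon_cls[OF hom(4,1) subC] and cC0 = canon_cls[OF hom(2,1) subC0]
  note hH = canon_hom[OF hom(4,2) subH] and hS = canon_hom[OF hom(5,3) subS]
  obtain k where k: "salg_hom T0 T k" "\<forall>x\<in>carrier T0. id_tensor (alg C) (alg S) (canon S) x = k x"
    "\<forall>x\<in>carrier (alg C). k (pt0 x \<one>\<^bsub>alg S0\<^esub>) = pt x \<one>\<^bsub>alg S\<^esub>"
    "\<forall>x\<in>carrier (alg S0). k (pt0 \<one>\<^bsub>alg C\<^esub> x) = pt \<one>\<^bsub>alg C\<^esub> (canon S x)"
    using id_tensor_hom[OF tp0 tp hS] unfolding T0_def T_def pt0_def pt_def by blast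
  have one: "\<one>\<^bsub>alg C\<^esub> = cls C 1" "\<one>\<^bsub>alg S\<^esub> = cls S 1" "\<one>\<^bsub>alg S0\<^esub> = cls S0 1"
    using cls_ops(1) hom by blast+
  have gc: "cls C (gc i) \<in> carrier (alg C)" if "i \<in> {1..n}" for i
    using that by (intro cls_in[OF hom(1)]) (simp add: C_def clifford_def)
  have \<Phi>c: "\<Phi> (cls H (gc i)) = pt (cls C (gc i)) \<one>\<^bsub>alg S\<^esub>" "\<Psi> (pt (cls C (gc i)) \<one>\<^bsub>alg S\<^esub>) = cls H (gc i)"
    if "i \<in> {1..n}" for i using CC[rule_format, OF gc[OF that]] by (simp_all add: cC)
  have \<Phi>0c: "\<Phi>0 (cls H0 (gc i)) = pt0 (cls C (gc i)) \<one>\<^bsub>alg S0\<^esub>"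
    if "i \<in> {1..n}" for i using C0[rule_format, OF gc[OF that]] by (simp add: cC0)
  \<comment> \<open>On a simple reflection both routes give \<open>- \<iota>\<close> times the
    tensor of \<open>beta\<close> and \<open>t\<close>; other group elements will follow from
    \<open>hom_weyl_eq\<close>.\<close>
  have simple: "k (\<Phi>0 (cls H0 (gw (simple_ref ty n s)))) = \<Phi> (cls H (gw (simple_ref ty n s)))"
    if s: "s \<in> simple_index ty n" for s
  proof -
    have c: "cls C (beta ty n s) \<in> carrier (alg C)" "cls S0 (gt s) \<in> carrier (alg S0)" "cls S (gt s) \<in> carrier (alg S)"
    proof -
      show "cls C (beta ty n s) \<in> carrier (alg C)"
        using fin.beta_carrier[OF s] free_part_sub unfolding C_def fin.fst_Cl[symmetric]
        by (intro cls_in[OF hom(1), unfolded C_def]) blast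
      show "cls S0 (gt s) \<in> carrier (alg S0)" "cls S (gt s) \<in> carrier (alg S)"
        using s by (auto simp: S0_def S_def fst_sides intro!: cls_in hom[unfolded defs])
    qed
    note p = tensor_pair.inl_hom[OF tp0, folded T0_def pt0_def] tensor_pair.inr_hom[OF tp0, folded T0_def pt0_def]
    note p' = salg_homD(1)[OF p(1) c(1)] salg_homD(1)[OF p(2) c(2)]
    have "pt0 (cls C (beta ty n s)) (cls S0 (gt s)) = pt0 (cls C (beta ty n s)) \<one>\<^bsub>alg S0\<^esub> \<otimes>\<^bsub>T0\<^esub> pt0 \<one>\<^bsub>alg C\<^esub> (cls S0 (gt s))"
      using tensor_pair.pt_split[OF tp0 c(1,2)] by (simp add: pt0_def T0_def)
    then have "k (\<Phi>0 (cls H0 (gw (simple_ref ty n s)))) = (- \<iota>) \<odot>\<^bsub>T\<^esub>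
        (pt (cls C (beta ty n s)) \<one>\<^bsub>alg S\<^esub> \<otimes>\<^bsub>T\<^esub> pt \<one>\<^bsub>alg C\<^esub> (cls S (gt s)))"
      using W0[rule_format, OF s] salg_homD(5)[OF k(1) salg_closed(2)[OF sA(3) p'], of "- \<iota>"]
        salg_homD(3)[OF k(1) p'] k(3)[rule_format, OF c(1)] k(4)[rule_format, OF c(2)] by (simp add: cS)
    also have "\<dots> = \<Phi> (cls H (gw (simple_ref ty n s)))"
      using W[rule_format, OF s] tensor_pair.pt_split[OF tp c(1,3)] by (simp add: pt_def T_def)
    finally show ?thesis .
  qed
  note c1 = salg_hom_comp[OF h0(1) k(1)] and c2 = salg_hom_comp[OF hH h(1)]
  note c3 = salg_hom_comp[OF k(1) h(2)] and c4 = salg_hom_comp[OF h0(2) hH]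
  have ext1: "\<Phi> (canon H z) = id_tensor (alg C) (alg S) (canon S) (\<Phi>0 z)" if z: "z \<in> carrier (alg H0)" for z
  proof -
    have "k (\<Phi>0 z) = \<Phi> (canon H z)"
    proof (rule alg_hom_unique[OF hom(2) sA(4) c1 c2 _ z])
      fix g assume "g \<in> fst H0"
      then consider i where "g = Gc i" "i \<in> {1..n}" | w where "g = Gw w" "w \<in> weyl ty n"
        unfolding H0_def fst_sides by (auto simp: affine_index_def)
      then show "k (\<Phi>0 (cls H0 (gen g))) = \<Phi> (canon H (cls H0 (gen g)))"
      proof cases
        case 1
        then show ?thesis using \<Phi>0c \<Phi>c(1) k(3) gc by (simp add: cH)
      next
        case 2
        have G: "Gw ` weyl ty n \<subseteq> fst H0" "weyl_rels ty n \<subseteq> snd H0"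
          unfolding H0_def fst_sides using snd_sides(2) by auto
        show ?thesis
          unfolding 2(1) by (rule hom_weyl_eq[OF assms(1) hom(2) sA(4) G c1 c2 _ 2(2)]) (simp add: cH simple)
      qed
    qed
    then show ?thesis using k(2) salg_homD(1)[OF h0(1) z] by simp
  qed
  have ext2: "\<Psi> (id_tensor (alg C) (alg S) (canon S) z) = canon H (\<Psi>0 z)" if z: "z \<in> carrier T0" for z
  proof -
    have "\<Psi> (k z) = canon H (\<Psi>0 z)"
    proof (rule tensor_pair.tensor_hom_unique[OF tp0 c3[unfolded T0_def] c4[unfolded T0_def] _ _ z[unfolded T0_def], folded pt0_def])
      fix x assume x: "x \<in> carrier (alg C)"
      then obtain p where "x = cls C p" unfolding alg_carrier[OF hom(1)] by blast
      then show "\<Psi> (k (pt0 x \<one>\<^bsub>alg S0\<^esub>)) = canon H (\<Psi>0 (pt0 x \<one>\<^bsub>alg S0\<^esub>))"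
        using k(3) C0 CC x by (simp add: cC cC0 cH)
    next
      fix x assume x: "x \<in> carrier (alg S0)"
      note i = tensor_pair.inr_hom[OF tp0, folded T0_def pt0_def]
      show "\<Psi> (k (pt0 \<one>\<^bsub>alg C\<^esub> x)) = canon H (\<Psi>0 (pt0 \<one>\<^bsub>alg C\<^esub> x))"
      proof (rule alg_hom_unique[OF hom(3) sA(2) salg_hom_comp[OF i c3] salg_hom_comp[OF i c4] _ x])
        fix g assume g: "g \<in> fst S0"
        then obtain s where s: "g = Gt s" "s \<in> simple_index ty n"
          unfolding S0_def fst_sides by (auto simp: affine_index_def)
        have "cls S0 (gt s) \<in> carrier (alg S0)" using g s by (intro cls_in[OF hom(3)]) simp
        then show "\<Psi> (k (pt0 \<one>\<^bsub>alg C\<^esub> (cls S0 (gen g)))) = canon H (\<Psi>0 (pt0 \<one>\<^bsub>alg C\<^esub> (cls S0 (gen g))))"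
          using k(4) W0 W s by (simp add: cS cH)
      qed
    qed
    then show ?thesis using k(2) z by simp
  qed
  note iso0 = superalgebra_iso_of_inverse[OF sA(1,3) h0 inv0] and iso = superalgebra_iso_of_inverse[OF sA(2,4) h inv]
  have eqs: "H0 = clifford_weyl ty n" "S0 = spin_weyl ty n" "H = hecke_clifford ty n u v" "S = spin_hecke ty n u v"
    by (simp_all add: defs clifford_side_def spin_side_def)
  have fin: "finite_isos ty n \<iota> \<Phi>0 \<Psi>0"
    unfolding finite_isos_def Let_def eqs[symmetric] C_def[symmetric] T0_def[symmetric] pt0_def[symmetric] one(1)[symmetric]
    using iso0 inv0 C0 W0 by blast
  show ?thesis
    unfolding Let_def eqs[symmetric] C_def[symmetric] T0_def[symmetric] T_def[symmetric] pt_def[symmetric] one(1,2)[symmetric]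
    using fin iso inv ext1 ext2 XY W \<Phi>c by (intro exI[of _ \<Phi>0] exI[of _ \<Psi>0] exI[of _ \<Phi>] exI[of _ \<Psi>]) blast
qed

end
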